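(* Let $f$ be a meromorphic quasi-modular form of weight $k$ and depth $p$ with component functions $f_0=f,f_1,\dots,f_p$ (set $f_r=0$ for $r>p$). Then: (i) $\Lambda(f,s)$ extends to a meromorphic function of $s\in\mathbb C$ satisfying $$\Lambda(f,s)=\sum_{r=0}^{p}i^{k-r}\Lambda(f_{r},k-r-s).$$ (ii) $\Lambda(f,s)$ has only possibly simple poles, either at $s=0$ or at integers $s$ with $k-p\le s\le k$, and the residue at an integer $n$ is $$\operatorname{Res}_{s=n}\Lambda(f,s)=\begin{cases}-a_f(0)+a_{f_k}(0)& n=0,\\ i^n a_{f_{k-n}}(0) & n\ne0,\ k-p\le n\le k.\end{cases}$$ (iii) For every $0\le m\le p$, $$\Lambda(f_m,s)=\sum_{r=0}^{p-m}i^{k-2m-r}\binom{m+r}{r}\Lambda(f_{m+r},k-2m-r-s).$$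
   Context: $\mathcal H$ is the upper half-plane, $q=e^{2\pi i\tau}$, $(f|_k\gamma)(\tau)=(c\tau+d)^{-k}f(\frac{a\tau+b}{c\tau+d})$. A meromorphic quasi-modular form of weight $k\in\mathbb Z$ is a meromorphic $f$ on $\mathcal H$ with functions $f_0,\dots,f_p$ (component functions), each meromorphic on $\mathcal H$ and meromorphic at infinity (having a Fourier expansion $\sum_{n\ge -n_0}a(n)q^n$), such that $(f|_k\gamma)(\tau)=\sum_{r=0}^p f_r(\tau)(c/(c\tau+d))^r$ for all $\gamma=\begin{pmatrix}a&b\\c&d\end{pmatrix}\in SL_2(\mathbb Z)$; depth $p$ means $f_p\neq0$. Each $f_r$ is itself a meromorphic quasi-modular form of weight $k-2r$. For a function $g$ meromorphic at infinity, $a_g(0)$ denotes the constant term of its Fourier expansion. Regularized integrals: for $g$ analytic with at most linear exponential growth for large $t$, $\int_{t_0}^{\infty,*}g(t)dt$ is the value at $w=0$ of the analytic continuation of $w\mapsto\int_{t_0}^\infty e^{-wt}g(t)dt$ (defined for $\operatorname{Re}w$ large); $\int_0^{t_0,*}g(t)dt:=\int_{1/t_0}^{\infty,*}t^{-2}g(1/t)dt$. If $g$ is meromorphic near $[a,b]$ with a single pole $c\in(a,b)$, $\int_a^{b,*}g(t)dt$ is the constant term at $s=0$ of the Laurent expansion of the meromorphic continuation of $s\mapsto\int_a^b|t-c|^sg(t)dt$. For $g$ with finitely many poles in $(0,\infty)$, $\int_0^{\infty,*}g(t)dt$ is obtained by splitting $(0,\infty)$ into $(0,a_1),(a_1,a_2),\dots,(a_n,\infty)$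 with all poles in the inner intervals, each containing exactly one pole, and summing the regularized integrals above. The complete $L$-function of $f$ is $\Lambda(f,s)=\int_0^{\infty,*}f(it)t^{s-1}dt$. *)

theory Defs
  imports "HOL-Complex_Analysis.Complex_Analysis"
begin

section \<open>Meromorphic quasi-modular forms\<close>

abbreviation upper_half_plane :: "complex set" where
  "upper_half_plane \<equiv> {\<tau>. Im \<tau> > 0}"

definition slash :: "int \<Rightarrow> int \<Rightarrow> int \<Rightarrow> int \<Rightarrow> int \<Rightarrow> (complex \<Rightarrow> complex) \<Rightarrow> complex \<Rightarrow> complex" where
  "slash k a b c d f \<tau> =
     (of_int c * \<tau> + of_int d) powi (-k) * f ((of_int a * \<tau> + of_int b) / (of_int c * \<tau> + of_int d))"

definition has_fourier_expansion :: "(complex \<Rightarrow> complex) \<Rightarrow> (int \<Rightarrow> complex) \<Rightarrow> bool" where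
  "has_fourier_expansion f a \<longleftrightarrow>
     (\<exists>N::int. \<exists>T::real. (\<forall>n < - N. a n = 0) \<and>
        (\<forall>\<tau>. Im \<tau> > T \<longrightarrow>
           ((\<lambda>n. a n * exp (2 * of_real pi * \<i> * of_int n * \<tau>)) has_sum f \<tau>) {- N..}))"

definition meromorphic_at_infinity :: "(complex \<Rightarrow> complex) \<Rightarrow> bool" where
  "meromorphic_at_infinity f \<longleftrightarrow> (\<exists>a. has_fourier_expansion f a)"

definition fourier_coeff :: "(complex \<Rightarrow> complex) \<Rightarrow> int \<Rightarrow> complex" where
  "fourier_coeff f = (THE a. has_fourier_expansion f a)"

text \<open>
  A meromorphic function is represented by its normalised representative (removable
  singularities removed, value 0 at the poles), so that \<open>fs p \<noteq> 0\<close> can be tested pointwise.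
  The transformation law is an identity of meromorphic functions, hence required away from the
  poles of the functions involved.
\<close>
definition mero_quasi_modular ::
  "int \<Rightarrow> nat \<Rightarrow> (complex \<Rightarrow> complex) \<Rightarrow> (nat \<Rightarrow> complex \<Rightarrow> complex) \<Rightarrow> bool" where
  "mero_quasi_modular k p f fs \<longleftrightarrow>
     f nicely_meromorphic_on upper_half_plane \<and>
     (\<forall>r\<le>p. fs r nicely_meromorphic_on upper_half_plane \<and> meromorphic_at_infinity (fs r)) \<and>
     (\<forall>a b c d \<tau>. a * d - b * c = 1 \<longrightarrow> Im \<tau> > 0 \<longrightarrow>
        \<not> is_pole f ((of_int a * \<tau> + of_int b) / (of_int c * \<tau> + of_int d)) \<longrightarrow>
        (\<forall>r\<le>p. \<not> is_pole (fs r) \<tau>) \<longrightarrow>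
        slash k a b c d f \<tau> =
          (\<Sum>r\<le>p. fs r \<tau> * (of_int c / (of_int c * \<tau> + of_int d)) ^ r)) \<and>
     (\<exists>\<tau>\<in>upper_half_plane. fs p \<tau> \<noteq> 0)"

text \<open>The components \<open>f\<^sub>j\<close>, extended by 0 to all indices \<open>j\<close> outside \<open>{0..p}\<close>.\<close>
definition component :: "nat \<Rightarrow> (nat \<Rightarrow> complex \<Rightarrow> complex) \<Rightarrow> int \<Rightarrow> complex \<Rightarrow> complex" where
  "component p fs j = (if 0 \<le> j \<and> j \<le> int p then fs (nat j) else (\<lambda>_. 0))"


section \<open>Regularized integrals\<close>

text \<open>
  Regularization at infinity: \<open>v\<close> is the value at \<open>w = 0\<close> of the analytic continuation of
  \<open>w \<mapsto> \<integral>\<^bsub>t0\<^esub>\<^bsup>\<infinity>\<^esup> exp (-w t) g t dt\<close>.  If \<open>g\<close> grows exponentially, e.g.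
  \<open>g t = exp (2 pi n t) t powr (s-1)\<close>, the continuation is multivalued: it has branch points on
  the real axis, here at \<open>w = 2 pi n\<close>.  It is therefore taken along the upper (\<open>\<sigma> = 1\<close>) or the
  lower (\<open>\<sigma> = -1\<close>) half plane; \<open>\<sigma> = 1\<close> gives the principal branch of the incomplete Gamma
  function \<open>\<Gamma>(s, -2 pi n t0)\<close>.  The value at 0 is the boundary value from that half plane
  (the limit matters if \<open>w = 0\<close> is itself a branch point).
\<close>
definition has_reg_integral_inf :: "real \<Rightarrow> (real \<Rightarrow> complex) \<Rightarrow> real \<Rightarrow> complex \<Rightarrow> bool" where
  "has_reg_integral_inf \<sigma> g t0 v \<longleftrightarrow>
     (\<exists>C F. F holomorphic_on {w. Re w > C \<or> \<sigma> * Im w > 0} \<and>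
        (\<forall>w. Re w > C \<longrightarrow>
           (\<lambda>t. exp (- w * of_real t) * g t) absolutely_integrable_on {t0..} \<and>
           F w = integral {t0..} (\<lambda>t. exp (- w * of_real t) * g t)) \<and>
        (F \<longlongrightarrow> v) (at 0 within {w. \<sigma> * Im w > 0}))"

definition has_reg_integral_zero :: "real \<Rightarrow> (real \<Rightarrow> complex) \<Rightarrow> real \<Rightarrow> complex \<Rightarrow> bool" where
  "has_reg_integral_zero \<sigma> g t0 v \<longleftrightarrow>
     has_reg_integral_inf \<sigma> (\<lambda>t. g (1 / t) / of_real (t\<^sup>2)) (1 / t0) v"

definition has_reg_integral_pole ::
  "(real \<Rightarrow> complex) \<Rightarrow> real \<Rightarrow> real \<Rightarrow> real \<Rightarrow> complex \<Rightarrow> bool" where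
  "has_reg_integral_pole g a b c v \<longleftrightarrow>
     (\<exists>G L C. G meromorphic_on UNIV \<and>
        (\<forall>z. Re z > C \<longrightarrow>
           (\<lambda>t. of_real \<bar>t - c\<bar> powr z * g t) absolutely_integrable_on {a..b} \<and>
           G z = integral {a..b} (\<lambda>t. of_real \<bar>t - c\<bar> powr z * g t)) \<and>
        G has_laurent_expansion L \<and> fls_nth L 0 = v)"


section \<open>The complete L-function\<close>

definition mellin_integrand :: "(complex \<Rightarrow> complex) \<Rightarrow> complex \<Rightarrow> real \<Rightarrow> complex" where
  "mellin_integrand f s t = f (\<i> * of_real t) * of_real t powr (s - 1)"

text \<open>
  \<open>(0, a 0), (a 0, a 1), \<dots>, (a n, \<infinity>)\<close> is a splitting of \<open>(0, \<infinity>)\<close>; the poles of \<open>t \<mapsto> f (i t)\<close>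
  are exactly \<open>c 0, \<dots>, c (n-1)\<close>, with \<open>c j\<close> in \<open>(a j, a (j+1))\<close>.
\<close>
definition admissible_splitting ::
  "(complex \<Rightarrow> complex) \<Rightarrow> nat \<Rightarrow> (nat \<Rightarrow> real) \<Rightarrow> (nat \<Rightarrow> real) \<Rightarrow> bool" where
  "admissible_splitting f n a c \<longleftrightarrow>
     0 < a 0 \<and> (\<forall>j<n. a j < c j \<and> c j < a (Suc j)) \<and>
     {t. 0 < t \<and> is_pole f (\<i> * of_real t)} = c ` {..<n}"

text \<open>\<open>F\<close> is a meromorphic extension of the partial function with graph \<open>R\<close>.\<close>
definition meromorphically_extends ::
  "(complex \<Rightarrow> complex) \<Rightarrow> (complex \<Rightarrow> complex \<Rightarrow> bool) \<Rightarrow> bool" where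
  "meromorphically_extends F R \<longleftrightarrow>
     F nicely_meromorphic_on UNIV \<and> (\<forall>s v. R s v \<longrightarrow> \<not> is_pole F s \<and> F s = v)"

text \<open>
  \<open>\<Lambda>\<close> is the (meromorphically extended) complete L-function
  \<open>s \<mapsto> \<integral>\<^bsub>0\<^esub>\<^bsup>\<infinity>,*\<^esup> f (i t) t powr (s-1) dt\<close>.  If the constant Fourier coefficients do not
  vanish, the regularized integral at infinity exists only on a left half plane
  (\<open>w = 0\<close> is then a singularity of the form \<open>w powr (-s)\<close>) and the one at 0 only on a right
  half plane, in general without a common point.  So the two end pieces are
  extended in \<open>s\<close> separately and then added to the middle pieces, which exist for every \<open>s\<close>.
  The result has to be the same for all admissible splittings.
\<close>
definition is_complete_L :: "real \<Rightarrow> (complex \<Rightarrow> complex) \<Rightarrow> (complex \<Rightarrow> complex) \<Rightarrow> bool" where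
  "is_complete_L \<sigma> f \<Lambda> \<longleftrightarrow>
     \<Lambda> nicely_meromorphic_on UNIV \<and>
     (\<exists>n a c. admissible_splitting f n a c) \<and>
     (\<forall>n a c. admissible_splitting f n a c \<longrightarrow>
        (\<exists>I0 Iinf M.
           meromorphically_extends I0
             (\<lambda>s. has_reg_integral_zero \<sigma> (mellin_integrand f s) (a 0)) \<and>
           (\<exists>C. \<forall>s. Re s > C \<longrightarrow>
              (\<exists>v. has_reg_integral_zero \<sigma> (mellin_integrand f s) (a 0) v)) \<and>
           meromorphically_extends Iinf
             (\<lambda>s. has_reg_integral_inf \<sigma> (mellin_integrand f s) (a n)) \<and>
           (\<exists>C. \<forall>s. Re s < C \<longrightarrow>
              (\<exists>v. has_reg_integral_inf \<sigma> (mellin_integrand f s) (a n) v)) \<and>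
           (\<forall>j<n. \<forall>s. has_reg_integral_pole (mellin_integrand f s)
                         (a j) (a (Suc j)) (c j) (M j s)) \<and>
           \<Lambda> = remove_sings (\<lambda>s. I0 s + (\<Sum>j<n. M j s) + Iinf s)))"

definition complete_L :: "real \<Rightarrow> (complex \<Rightarrow> complex) \<Rightarrow> complex \<Rightarrow> complex" where
  "complete_L \<sigma> f = (THE \<Lambda>. is_complete_L \<sigma> f \<Lambda>)"

end

theory Submission
  imports Defs "HOL-Real_Asymp.Real_Asymp"
begin

text \<open>
  On \<open>{T..}\<close> a component \<open>f\<^sub>r (i t)\<close> is a finite sum of exponentials, a constant \<open>a\<^sub>r\<close> and an exponentially
  decaying rest.  Turning the ray of integration by a right angle continues the Laplace integrals,
  and at \<open>w = 0\<close> everything except the constant yields an entire function of \<open>s\<close>, while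
  the constant contributes \<open>- a\<^sub>r T\<^sup>s / s\<close>; call the sum \<open>K\<^sub>r s\<close>.  Across a pole the regularized integral
  is a principal value.  In the coordinate \<open>t = exp x\<close> it is the mean of the integrals just above
  and just below the real axis; hence it is entire in \<open>s\<close>, additive in the interval
  and compatible with \<open>x \<mapsto> - x\<close>.  The transformation under \<open>S\<close>,
  \<open>f\<^sub>m (i / t) = (\<Sum>l. c m l * t powi (k - 2 m - l) * f\<^sub>m\<^sub>+\<^sub>l (i t))\<close>, carries the end at 0 to infinity, so that
  \<open>\<Lambda> (f\<^sub>m, s) = PV\<^sub>m s + K\<^sub>m s + (\<Sum>l. c m l * K\<^sub>m\<^sub>+\<^sub>l (k - 2 m - l - s))\<close> with \<open>PV\<^sub>m\<close> the principal value over
  \<open>[1/T, T]\<close>.  Reflection maps \<open>PV\<^sub>m\<close> to the corresponding combination of the \<open>PV\<^sub>m\<^sub>+\<^sub>l\<close>,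
  and the tails are interchanged because applying \<open>S\<close> twice is trivial (an alternating sum
  of binomial coefficients, using that \<open>k\<close> is even).  The poles are those of the terms \<open>T\<^sup>s / s\<close>.
\<close>

section \<open>Laplace integrals along rotated rays\<close>

text \<open>\<open>is_complete_L\<close> asks for more than a formula on a half-plane of s: the
  extension must also be finite and correct at every further s where the limit in
  \<open>has_reg_integral_inf\<close> happens to exist. At the end 0 the constant terms of several
  components meet, with different powers of t, so it has to be excluded that their divergences at w
  = 0 cancel. The tool is the dilation of w, under which an incomplete Gamma function is homogeneous
  up to an integral over a bounded interval: comparing a convergent combination at w and at 2 w
  removes one exponent at a time. These limits are taken in the quadrant Re w > 0, \<sigma> Im w >
  0, where the Laplace integral itself converges and equals the rotated one. The logarithmic
  coordinate is chosen because of the inversion. The finite part defined by |t - c|^z is tied to the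
  coordinate t, and for poles of higher order its behaviour under t -> 1 / t is not visible. The
  mean over the two sides depends on contours only, and in x = ln t the inversion maps horizontal
  lines to horizontal lines and exchanges the sides.\<close>

lemma holomorphic_integral_exp_kernel:
  fixes b g :: "real \<Rightarrow> complex"
  assumes b: "continuous_on {\<alpha>..\<beta>} b" and g: "continuous_on {\<alpha>..\<beta>} g"
  shows "(\<lambda>s. integral {\<alpha>..\<beta>} (\<lambda>t. exp (s * b t) * g t)) holomorphic_on U"
proof -
  have "(\<lambda>s. integral (cbox \<alpha> \<beta>) (\<lambda>t. exp (s * b t) * g t)) holomorphic_on UNIV"
  proof (rule leibniz_rule_holomorphic[where fx = "\<lambda>s t. exp (s * b t) * b t * g t"])
    show "((\<lambda>x. exp (x * b t) * g t) has_field_derivative exp (x * b t) * b t * g t) (at x within UNIV)" for x t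
      by (auto intro!: derivative_eq_intros)
    show "(\<lambda>t. exp (x * b t) * g t) integrable_on cbox \<alpha> \<beta>" for x
      by (rule integrable_continuous) (use b g in \<open>auto intro!: continuous_intros\<close>)
    have b': "continuous_on (UNIV \<times> cbox \<alpha> \<beta>) (\<lambda>x. b (snd x))"
      if "continuous_on {\<alpha>..\<beta>} b" for b :: "real \<Rightarrow> complex"
      by (rule continuous_on_compose2[OF that]) (auto intro!: continuous_intros)
    show "continuous_on (UNIV \<times> cbox \<alpha> \<beta>) (\<lambda>(x, t). exp (x * b t) * b t * g t)"
      unfolding case_prod_unfold by (intro continuous_intros b'[OF b] b'[OF g])
  qed auto
  then show ?thesis by (auto intro: holomorphic_on_subset)
qed

lemma absolutely_integrable_on_Ici_bound:
  fixes f :: "real \<Rightarrow> complex"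
  assumes "continuous_on {T..} f" "m integrable_on {T..}" "\<And>t. t \<ge> T \<Longrightarrow> norm (f t) \<le> m t"
  shows "f absolutely_integrable_on {T..}"
  by (rule measurable_bounded_by_integrable_imp_absolutely_integrable[where g = m])
     (use assms in \<open>auto intro!: continuous_imp_measurable_on_sets_lebesgue\<close>)

lemma integral_Ici_split:
  fixes f :: "real \<Rightarrow> 'b::euclidean_space"
  assumes "f absolutely_integrable_on {T..}" "T \<le> R"
  shows "integral {T..} f = integral {T..R} f + integral {R..} f"
proof -
  have u: "{T..} = {T..R} \<union> {R..}" using assms by auto
  have "f absolutely_integrable_on {T..R}" "f absolutely_integrable_on {R..}"
    using assms by (auto intro: set_integrable_subset)
  moreover have "negligible ({T..R} \<inter> {R..})"
    by (rule negligible_subset[of "{R}"]) auto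
  ultimately show ?thesis
    unfolding u by (intro integral_Un) (auto intro: set_lebesgue_integral_eq_integral)
qed

lemma integral_Ici_tendsto:
  fixes f :: "real \<Rightarrow> 'b::euclidean_space"
  assumes f: "f absolutely_integrable_on {T..}"
  shows "(\<lambda>n. integral {T..T + real n} f) \<longlonglongrightarrow> integral {T..} f"
proof -
  let ?g = "\<lambda>n t. if t \<in> {T..T + real n} then f t else 0"
  have "(\<lambda>n. integral {T..} (?g n)) \<longlonglongrightarrow> integral {T..} f"
  proof (rule dominated_convergence)
    show "(\<lambda>t. norm (f t)) integrable_on {T..}"
      using f unfolding absolutely_integrable_on_def by auto
    show "?g n integrable_on {T..}" for n
    proof -
      have "f integrable_on {T..T + real n}"
        by (rule set_lebesgue_integral_eq_integral(1)[OF set_integrable_subset[OF f]]) auto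
      then show ?thesis
        by (subst integrable_restrict_Int) (simp add: Int_absorb2 Int_commute)
    qed
    show "(\<lambda>n. ?g n x) \<longlonglongrightarrow> f x" if "x \<in> {T..}" for x
    proof (rule tendsto_eventually)
      have "eventually (\<lambda>n. real n \<ge> x - T) sequentially" by real_asymp
      then show "\<forall>\<^sub>F n in sequentially. ?g n x = f x"
        by eventually_elim (use that in auto)
    qed
  qed auto
  moreover have "integral {T..} (?g n) = integral {T..T + real n} f" for n
    by (subst integral_restrict_Int) (simp add: Int_absorb2 Int_commute)
  ultimately show ?thesis by simp
qed

text \<open>The kernel exp (s * b t) covers Laplace transforms (b t = - t) and Mellin transforms (b
  t = ln t), on the real axis as well as on a rotated ray. The majorant m may depend on the disc:
  the truncated integrals are holomorphic and converge uniformly on the disc at the rate at which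
  the tails of m vanish.\<close>

lemma holomorphic_integral_exp_kernel_Ici:
  fixes b g :: "real \<Rightarrow> complex"
  assumes U: "open U" and b: "continuous_on {T..} b" and g: "continuous_on {T..} g"
    and dom: "\<And>s. s \<in> U \<Longrightarrow> \<exists>d>0. \<exists>m. cball s d \<subseteq> U \<and> m integrable_on {T..} \<and>
                 (\<forall>z\<in>cball s d. \<forall>t\<ge>T. norm (exp (z * b t) * g t) \<le> m t)"
  shows "(\<lambda>s. integral {T..} (\<lambda>t. exp (s * b t) * g t)) holomorphic_on U"
    and "\<And>s. s \<in> U \<Longrightarrow> (\<lambda>t. exp (s * b t) * g t) absolutely_integrable_on {T..}"
proof -
  have ai: "(\<lambda>t. exp (z * b t) * g t) absolutely_integrable_on {T..}"
    if "m integrable_on {T..}" "\<forall>t\<ge>T. norm (exp (z * b t) * g t) \<le> m t" for z m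
    by (rule absolutely_integrable_on_Ici_bound[where m = m])
       (use that b g in \<open>auto intro!: continuous_intros\<close>)
  show "(\<lambda>t. exp (s * b t) * g t) absolutely_integrable_on {T..}" if "s \<in> U" for s
  proof -
    from dom[OF that] obtain d m where "d > 0" "m integrable_on {T..}"
      "\<forall>z\<in>cball s d. \<forall>t\<ge>T. norm (exp (z * b t) * g t) \<le> m t" by blast
    then show ?thesis by (intro ai[of m]) auto
  qed
  show "(\<lambda>s. integral {T..} (\<lambda>t. exp (s * b t) * g t)) holomorphic_on U"
  proof (rule holomorphic_uniform_sequence[OF U])
    show "(\<lambda>s. integral {T..T + real n} (\<lambda>t. exp (s * b t) * g t)) holomorphic_on U" for n
      by (rule holomorphic_integral_exp_kernel) (use b g in \<open>auto intro: continuous_on_subset\<close>)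
    fix s assume "s \<in> U"
    then obtain d m where d: "d > 0" "cball s d \<subseteq> U" and m: "m integrable_on {T..}"
      and le: "\<And>z t. z \<in> cball s d \<Longrightarrow> t \<ge> T \<Longrightarrow> norm (exp (z * b t) * g t) \<le> m t"
      using dom[of s] by blast
    have m0: "m t \<ge> 0" if "t \<ge> T" for t
      by (rule order_trans[OF norm_ge_zero le[of s t]]) (use d that in auto)
    have mai: "m absolutely_integrable_on {T..}"
      by (rule nonnegative_absolutely_integrable_1) (use m m0 in auto)
    have tail: "(\<lambda>n. integral {T..} m - integral {T..T + real n} m) \<longlonglongrightarrow> 0"
      using tendsto_diff[OF tendsto_const[of "integral {T..} m"] integral_Ici_tendsto[OF mai]] by simp
    have "uniform_limit (cball s d) (\<lambda>n s. integral {T..T + real n} (\<lambda>t. exp (s * b t) * g t))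
        (\<lambda>s. integral {T..} (\<lambda>t. exp (s * b t) * g t)) sequentially"
    proof (rule uniform_limitI)
      fix e :: real assume "e > 0"
      from order_tendstoD(2)[OF tail this]
      show "\<forall>\<^sub>F n in sequentially. \<forall>x\<in>cball s d. dist (integral {T..T + real n} (\<lambda>t. exp (x * b t) * g t))
          (integral {T..} (\<lambda>t. exp (x * b t) * g t)) < e"
      proof eventually_elim
        case (elim n)
        show ?case
        proof
          fix z assume z: "z \<in> cball s d"
          let ?f = "\<lambda>t. exp (z * b t) * g t" and ?R = "T + real n"
          have fai: "?f absolutely_integrable_on {T..}"
            by (rule ai[OF m]) (use le z in auto)
          have "norm (integral {?R..} ?f) \<le> integral {?R..} m"
            by (rule integral_norm_bound_integral)
               (use le z in \<open>auto intro!: set_lebesgue_integral_eq_integral(1)[OF set_integrable_subset[OF fai]]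
                   set_lebesgue_integral_eq_integral(1)[OF set_integrable_subset[OF mai]]\<close>)
          also have "\<dots> = integral {T..} m - integral {T..?R} m"
            using integral_Ici_split[OF mai, of ?R] by simp
          also note elim
          finally show "dist (integral {T..?R} ?f) (integral {T..} ?f) < e"
            using integral_Ici_split[OF fai, of ?R] by (simp add: dist_norm norm_minus_commute)
        qed
      qed
    qed
    then show "\<exists>d>0. cball s d \<subseteq> U \<and> uniform_limit (cball s d) (\<lambda>n s. integral {T..T + real n} (\<lambda>t. exp (s * b t) * g t))
        (\<lambda>s. integral {T..} (\<lambda>t. exp (s * b t) * g t)) sequentially"
      using d by blast
  qed
qed

lemma integral_complex_primitive:
  fixes \<Phi> q :: "complex \<Rightarrow> complex"
  assumes "\<alpha> \<le> \<beta>"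
    and "\<And>t. \<alpha> \<le> t \<Longrightarrow> t \<le> \<beta> \<Longrightarrow> (\<Phi> has_field_derivative q (p + of_real t * d)) (at (p + of_real t * d))"
  shows "((\<lambda>t. d * q (p + of_real t * d)) has_integral (\<Phi> (p + of_real \<beta> * d) - \<Phi> (p + of_real \<alpha> * d))) {\<alpha>..\<beta>}"
proof (rule fundamental_theorem_of_calculus[OF assms(1)])
  fix t assume "t \<in> {\<alpha>..\<beta>}"
  then have D: "(\<Phi> has_field_derivative q (p + of_real t * d)) (at (p + of_real t * d))"
    using assms(2) by auto
  have "((\<lambda>t. p + of_real t * d) has_vector_derivative d) (at t within {\<alpha>..\<beta>})"
    by (auto intro!: derivative_eq_intros simp: scaleR_conv_of_real)
  from field_vector_diff_chain_within[OF this has_field_derivative_at_within[OF D]]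
  show "((\<lambda>t. \<Phi> (p + of_real t * d)) has_vector_derivative d * q (p + of_real t * d)) (at t within {\<alpha>..\<beta>})"
    by (simp add: o_def)
qed

text \<open>Cauchy's theorem for a quarter turn. The hypothesis \<open>bd\<close> allows growth of
  rate B in the real direction but only of arbitrarily small rate in the imaginary direction. On the
  ray T + u * \<rho> the modulus of exp (- w z) decays like exp (- \<sigma> Im w u), which wins as
  soon as \<sigma> Im w > 0, whatever Re w is.\<close>

lemma laplace_rotation:
  fixes h :: "complex \<Rightarrow> complex" and \<sigma> T T' B :: real
  assumes \<sigma>: "\<sigma> = 1 \<or> \<sigma> = -1" and hol: "h holomorphic_on {z. Re z > T'}" and T: "T' < T" "0 \<le> T"
    and bd: "\<And>\<epsilon>. \<epsilon> > 0 \<Longrightarrow> \<exists>M. \<forall>z. Re z \<ge> T \<longrightarrow> norm (h z) \<le> M * exp ((B + \<epsilon>) * Re z + \<epsilon> * \<bar>Im z\<bar>)"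
  defines "\<rho> \<equiv> - \<i> * of_real \<sigma>"
  shows laplace_holomorphic:
      "(\<lambda>w. integral {T..} (\<lambda>t. exp (- w * of_real t) * h (of_real t))) holomorphic_on {w. Re w > B}"
    and laplace_integrable: "\<And>w. Re w > B \<Longrightarrow> (\<lambda>t. exp (- w * of_real t) * h (of_real t)) absolutely_integrable_on {T..}"
    and laplace_rotated_holomorphic:
      "(\<lambda>w. \<rho> * integral {0..} (\<lambda>u. exp (- w * (of_real T + of_real u * \<rho>)) * h (of_real T + of_real u * \<rho>))) holomorphic_on {w. \<sigma> * Im w > 0}"
    and laplace_rotated_integrable:
      "\<And>w. \<sigma> * Im w > 0 \<Longrightarrow> (\<lambda>u. exp (- w * (of_real T + of_real u * \<rho>)) * h (of_real T + of_real u * \<rho>)) absolutely_integrable_on {0..}"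
    and laplace_rotated_eq: "\<And>w. Re w > B \<Longrightarrow> \<sigma> * Im w > 0 \<Longrightarrow>
       \<rho> * integral {0..} (\<lambda>u. exp (- w * (of_real T + of_real u * \<rho>)) * h (of_real T + of_real u * \<rho>)) =
       integral {T..} (\<lambda>t. exp (- w * of_real t) * h (of_real t))"
proof -
  have \<sigma>2: "\<sigma> * \<sigma> = 1" "\<bar>\<sigma>\<bar> = 1" using \<sigma> by auto
  have \<rho>[simp]: "Re \<rho> = 0" "Im \<rho> = - \<sigma>" by (auto simp: \<rho>_def)
  have conth: "continuous_on {z. Re z > T'} h"
    using hol by (rule holomorphic_on_imp_continuous_on)
  have c1: "continuous_on {T..} (\<lambda>t. h (of_real t))"
    by (rule continuous_on_compose2[OF conth]) (use T in \<open>auto intro!: continuous_intros\<close>)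
  have c2: "continuous_on {0..} (\<lambda>u. h (of_real T + of_real u * \<rho>))"
    by (rule continuous_on_compose2[OF conth]) (use T in \<open>auto intro!: continuous_intros\<close>)
  have open1: "open {w. Re w > B}" by (rule open_halfspace_Re_gt)
  have open2: "open {w. \<sigma> * Im w > 0}"
    by (intro open_Collect_less continuous_intros)
  have dom1: "\<exists>d>0. \<exists>m. cball s d \<subseteq> {w. Re w > B} \<and> m integrable_on {T..} \<and>
                 (\<forall>z\<in>cball s d. \<forall>t\<ge>T. norm (exp (z * (- of_real t)) * h (of_real t)) \<le> m t)"
    if "s \<in> {w. Re w > B}" for s
  proof -
    \<comment> \<open>Of the margin 4 d, one d pays for the radius of the disc and one for the
      \<epsilon> in \<open>bd\<close>; the majorant decays at the remaining rate 2 d.\<close>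
    define d where "d = (Re s - B) / 4"
    have d: "d > 0" and sB: "Re s = B + 4 * d" using that unfolding d_def by (auto simp: field_simps)
    from bd[OF d] obtain M where M: "\<And>z. Re z \<ge> T \<Longrightarrow> norm (h z) \<le> M * exp ((B + d) * Re z + d * \<bar>Im z\<bar>)" by blast
    have *: "Re z \<ge> Re s - d" if "z \<in> cball s d" for z
      using that complex_Re_le_cmod[of "s - z"] by (auto simp: dist_norm)
    show ?thesis
    proof (intro exI[of _ d] conjI exI[of _ "\<lambda>t. M * exp (- (2 * d) * t)"] ballI allI impI)
      show "cball s d \<subseteq> {w. Re w > B}"
      proof
        fix z assume "z \<in> cball s d"
        from *[OF this] show "z \<in> {w. Re w > B}" using d sB by simp
      qed
      show "(\<lambda>t. M * exp (- (2 * d) * t)) integrable_on {T..}"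
        using integrable_on_exp_minus_to_infinity[of "2 * d"] d by (intro integrable_on_mult_right) auto
      fix z t assume z: "z \<in> cball s d" and t: "T \<le> t"
      have "norm (exp (z * (- of_real t)) * h (of_real t)) \<le> exp (- (Re z * t)) * (M * exp ((B + d) * t))"
        unfolding norm_mult using M[of "of_real t"] t by (intro mult_mono) auto
      also have "\<dots> \<le> exp (- ((B + 3 * d) * t)) * (M * exp ((B + d) * t))"
      proof (rule mult_right_mono)
        have "(B + 3 * d) * t \<le> Re z * t" using *[OF z] sB t T by (intro mult_right_mono) auto
        then show "exp (- (Re z * t)) \<le> exp (- ((B + 3 * d) * t))" by simp
        show "0 \<le> M * exp ((B + d) * t)"
          using order_trans[OF norm_ge_zero M[of "of_real t"]] t by simp
      qed
      also have "\<dots> = M * exp (- (2 * d) * t)"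
        by (simp add: algebra_simps flip: exp_add)
      finally show "norm (exp (z * (- of_real t)) * h (of_real t)) \<le> M * exp (- (2 * d) * t)" .
    qed (use d in auto)
  qed
  have dom2: "\<exists>d>0. \<exists>m. cball s d \<subseteq> {w. \<sigma> * Im w > 0} \<and> m integrable_on {0..} \<and>
                 (\<forall>z\<in>cball s d. \<forall>t\<ge>0. norm (exp (z * (- (of_real T + of_real t * \<rho>))) * h (of_real T + of_real t * \<rho>)) \<le> m t)"
    if "s \<in> {w. \<sigma> * Im w > 0}" for s
  proof -
    define d where "d = \<sigma> * Im s / 4"
    have d: "d > 0" and sB: "\<sigma> * Im s = 4 * d" using that unfolding d_def by (auto simp: field_simps)
    from bd[OF d] obtain M where M: "\<And>z. Re z \<ge> T \<Longrightarrow> norm (h z) \<le> M * exp ((B + d) * Re z + d * \<bar>Im z\<bar>)" by blast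
    have *: "\<sigma> * Im z \<ge> 3 * d" "- Re z \<le> cmod s + d" if "z \<in> cball s d" for z
    proof -
      have "\<sigma> * (Im s - Im z) \<le> \<bar>\<sigma> * (Im s - Im z)\<bar>" by linarith
      also have "\<dots> \<le> d" using that abs_Im_le_cmod[of "s - z"] by (auto simp: dist_norm abs_mult \<sigma>2)
      finally show "\<sigma> * Im z \<ge> 3 * d" using sB by (simp add: algebra_simps)
      have "- Re z \<le> cmod z" using abs_Re_le_cmod[of z] by linarith
      also have "\<dots> \<le> cmod s + d" using that norm_triangle_ineq2[of z s] by (auto simp: dist_norm norm_minus_commute)
      finally show "- Re z \<le> cmod s + d" .
    qed
    show ?thesis
    proof (intro exI[of _ d] conjI exI[of _ "\<lambda>t. (exp (T * (cmod s + d)) * (M * exp ((B + d) * T))) * exp (- (2 * d) * t)"] ballI allI impI)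
      show "cball s d \<subseteq> {w. \<sigma> * Im w > 0}"
      proof
        fix z assume "z \<in> cball s d"
        from *(1)[OF this] show "z \<in> {w. \<sigma> * Im w > 0}" using d sB by simp
      qed
      show "(\<lambda>t. (exp (T * (cmod s + d)) * (M * exp ((B + d) * T))) * exp (- (2 * d) * t)) integrable_on {0..}"
        using integrable_on_exp_minus_to_infinity[of "2 * d"] d by (intro integrable_on_mult_right) auto
      fix z and t :: real assume z: "z \<in> cball s d" and t: "0 \<le> t"
      let ?z = "of_real T + of_real t * \<rho>"
      have "norm (exp (z * (- ?z)) * h ?z) \<le> exp (- (Re z * T) - \<sigma> * Im z * t) * (M * exp ((B + d) * T + d * t))"
        unfolding norm_mult
      proof (rule mult_mono)
        show "norm (exp (z * (- ?z))) \<le> exp (- (Re z * T) - \<sigma> * Im z * t)"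
          by (simp add: algebra_simps)
        show "norm (h ?z) \<le> M * exp ((B + d) * T + d * t)"
          using M[of ?z] t by (simp add: abs_mult \<sigma>2)
      qed auto
      also have "\<dots> \<le> exp (T * (cmod s + d) - 3 * d * t) * (M * exp ((B + d) * T + d * t))"
      proof (rule mult_right_mono)
        have "3 * d * t \<le> \<sigma> * Im z * t" using *[OF z] t by (intro mult_right_mono) auto
        moreover have "- Re z * T \<le> (cmod s + d) * T" using *[OF z] T by (intro mult_right_mono) auto
        ultimately show "exp (- (Re z * T) - \<sigma> * Im z * t) \<le> exp (T * (cmod s + d) - 3 * d * t)"
          by (simp add: algebra_simps)
        show "0 \<le> M * exp ((B + d) * T + d * t)"
          using order_trans[OF norm_ge_zero M[of ?z]] t by (simp add: abs_mult \<sigma>2)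
      qed
      also have "\<dots> = (exp (T * (cmod s + d)) * (M * exp ((B + d) * T))) * exp (- (2 * d) * t)"
        by (simp add: algebra_simps flip: exp_add)
      finally show "norm (exp (z * (- ?z)) * h ?z) \<le> (exp (T * (cmod s + d)) * (M * exp ((B + d) * T))) * exp (- (2 * d) * t)" .
    qed (use d in auto)
  qed
  have b1: "continuous_on {T..} (\<lambda>t. - complex_of_real t)" by (intro continuous_intros)
  have b2: "continuous_on {0..} (\<lambda>u. - (of_real T + of_real u * \<rho>))" by (intro continuous_intros)
  note L1 = holomorphic_integral_exp_kernel_Ici[OF open1 b1 c1 dom1]
  note L2 = holomorphic_integral_exp_kernel_Ici[OF open2 b2 c2 dom2]
  show H1: "(\<lambda>w. integral {T..} (\<lambda>t. exp (- w * of_real t) * h (of_real t))) holomorphic_on {w. Re w > B}"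
    using L1(1) by simp
  show I1: "(\<lambda>t. exp (- w * of_real t) * h (of_real t)) absolutely_integrable_on {T..}" if "Re w > B" for w
    using L1(2)[of w] that by simp
  show H2: "(\<lambda>w. \<rho> * integral {0..} (\<lambda>u. exp (- w * (of_real T + of_real u * \<rho>)) * h (of_real T + of_real u * \<rho>))) holomorphic_on {w. \<sigma> * Im w > 0}"
    using L2(1) unfolding mult_minus_right mult_minus_left by (intro holomorphic_intros)
  show I2: "(\<lambda>u. exp (- w * (of_real T + of_real u * \<rho>)) * h (of_real T + of_real u * \<rho>)) absolutely_integrable_on {0..}"
    if "\<sigma> * Im w > 0" for w
    using L2(2)[of w] that unfolding mult_minus_right mult_minus_left by blast
  show "\<rho> * integral {0..} (\<lambda>u. exp (- w * (of_real T + of_real u * \<rho>)) * h (of_real T + of_real u * \<rho>)) =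
       integral {T..} (\<lambda>t. exp (- w * of_real t) * h (of_real t))"
    if w: "Re w > B" "\<sigma> * Im w > 0" for w
  proof -
    \<comment> \<open>q has a primitive on the half-plane, so the truncated integrals along the two
      rays differ by its increment between the ends T + n and T + n * \<rho>. This increment is
      estimated along the segment joining the ends, whose length is at most 2 n.\<close>
    define q where "q = (\<lambda>z. exp (- w * z) * h z)"
    have "q holomorphic_on {z. Re z > T'}"
      unfolding q_def by (intro holomorphic_intros hol)
    from holomorphic_convex_primitive'[OF convex_halfspace_Re_gt open_halfspace_Re_gt this]
    obtain \<Phi> where \<Phi>: "\<And>x. Re x > T' \<Longrightarrow> (\<Phi> has_field_derivative q x) (at x within {z. Re z > T'})"
      by auto
    have \<Phi>': "(\<Phi> has_field_derivative q x) (at x)" if "Re x > T'" for x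
      using \<Phi>[OF that] that open_halfspace_Re_gt[of T'] by (simp add: at_within_open[of x "{z. Re z > T'}"])
    have A: "integral {T..T + real n} (\<lambda>t. q (of_real t)) = \<Phi> (of_real T + of_nat n) - \<Phi> T" for n
      using integral_complex_primitive[of T "T + real n" \<Phi> q 0 1] \<Phi>' T
      by (intro integral_unique) (auto simp: add.commute)
    have B: "\<rho> * integral {0..0 + real n} (\<lambda>u. q (of_real T + of_real u * \<rho>)) = \<Phi> (of_real T + of_nat n * \<rho>) - \<Phi> T" for n
    proof -
      have "((\<lambda>u. \<rho> * q (of_real T + of_real u * \<rho>)) has_integral \<Phi> (of_real T + of_nat n * \<rho>) - \<Phi> T) {0..0 + real n}"
        using integral_complex_primitive[of 0 "0 + real n" \<Phi> q "of_real T" \<rho>] \<Phi>' T by auto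
      from integral_unique[OF this] show ?thesis by simp
    qed
    \<comment> \<open>A point of the segment has moved by (1 - v) n in the real and by v n in the
      imaginary direction; with this \<kappa> both displacements gain decay at rate at least
      \<kappa>, so together the factor exp (- \<kappa> n).\<close>
    define \<kappa> where "\<kappa> = min (Re w - B) (\<sigma> * Im w) / 2"
    have \<kappa>: "\<kappa> > 0" "Re w - B - \<kappa> \<ge> \<kappa>" "\<sigma> * Im w - \<kappa> \<ge> \<kappa>"
      using w by (auto simp: \<kappa>_def min_def field_simps)
    from bd[OF \<kappa>(1)] obtain M where M: "\<And>z. Re z \<ge> T \<Longrightarrow> norm (h z) \<le> M * exp ((B + \<kappa>) * Re z + \<kappa> * \<bar>Im z\<bar>)" by blast
    have M0: "M \<ge> 0" using order_trans[OF norm_ge_zero M[of "of_real T"]] by (simp add: zero_le_mult_iff)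
    define K where "K = M * exp (- ((Re w - B - \<kappa>) * T))"
    have bound: "norm (\<Phi> (of_real T + of_nat n) - \<Phi> (of_real T + of_nat n * \<rho>)) \<le> K * exp (- (\<kappa> * real n)) * (2 * real n)" for n
    proof -
      let ?S = "closed_segment (of_real T + of_nat n) (of_real T + of_nat n * \<rho>)"
      have S: "\<exists>v. 0 \<le> v \<and> v \<le> 1 \<and> Re z = T + (1 - v) * real n \<and> Im z = - \<sigma> * v * real n" if z: "z \<in> ?S" for z
      proof -
        obtain v where v: "0 \<le> v" "v \<le> 1"
          and z': "z = (1 - v) *\<^sub>R (of_real T + of_nat n) + v *\<^sub>R (of_real T + of_nat n * \<rho>)"
          using z by (auto simp: in_segment)
        have "Re z = T + (1 - v) * real n" "Im z = - \<sigma> * v * real n"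
          unfolding z' by (simp_all add: algebra_simps)
        then show ?thesis using v by blast
      qed
      have "norm (\<Phi> (of_real T + of_nat n) - \<Phi> (of_real T + of_nat n * \<rho>)) \<le> K * exp (- (\<kappa> * real n)) * norm ((of_real T + of_nat n) - (of_real T + of_nat n * \<rho>))"
      proof (rule field_differentiable_bound[where S = ?S and f' = q])
        fix z assume "z \<in> ?S"
        from S[OF this] obtain v where v: "0 \<le> v" "v \<le> 1" "Re z = T + (1 - v) * real n" "Im z = - \<sigma> * v * real n"
          by blast
        have rz: "Re z \<ge> T" using v by simp
        show "(\<Phi> has_field_derivative q z) (at z within ?S)"
          by (rule has_field_derivative_at_within[OF \<Phi>']) (use rz T in auto)
        have "norm (q z) \<le> exp (- (Re w * Re z) + Im w * Im z) * (M * exp ((B + \<kappa>) * Re z + \<kappa> * \<bar>Im z\<bar>))"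
          unfolding q_def norm_mult using M[OF rz] by (intro mult_mono) auto
        also have "\<dots> = M * exp (- (Re w - B - \<kappa>) * Re z + (Im w * Im z + \<kappa> * \<bar>Im z\<bar>))"
          by (simp add: algebra_simps flip: exp_add)
        also have "Im w * Im z + \<kappa> * \<bar>Im z\<bar> = - (\<sigma> * Im w - \<kappa>) * (v * real n)"
          using v by (simp add: abs_mult \<sigma>2 algebra_simps)
        also have "M * exp (- (Re w - B - \<kappa>) * Re z + - (\<sigma> * Im w - \<kappa>) * (v * real n)) \<le>
            M * exp (- ((Re w - B - \<kappa>) * T) + - (\<kappa> * real n))"
        proof -
          have "\<kappa> * ((1 - v) * real n) \<le> (Re w - B - \<kappa>) * ((1 - v) * real n)"
            using \<kappa> v by (intro mult_right_mono) auto
          moreover have "\<kappa> * (v * real n) \<le> (\<sigma> * Im w - \<kappa>) * (v * real n)"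
            using \<kappa> v by (intro mult_right_mono) auto
          ultimately have "- (Re w - B - \<kappa>) * Re z + - (\<sigma> * Im w - \<kappa>) * (v * real n) \<le> - ((Re w - B - \<kappa>) * T) + - (\<kappa> * real n)"
            unfolding v(3) by (simp add: algebra_simps)
          then show ?thesis using M0 by (intro mult_left_mono) auto
        qed
        also have "\<dots> = K * exp (- (\<kappa> * real n))" by (simp only: K_def exp_add mult.assoc)
        finally show "norm (q z) \<le> K * exp (- (\<kappa> * real n))" .
      qed auto
      also have "norm ((of_real T + of_nat n) - (of_real T + of_nat n * \<rho>)) \<le> 2 * real n"
      proof -
        have "norm ((of_real T + of_nat n) - (of_real T + of_nat n * \<rho>)) = norm (of_nat n - of_nat n * \<rho>)" by simp
        also have "\<dots> \<le> norm (of_nat n :: complex) + norm (of_nat n * \<rho>)" by (rule norm_triangle_ineq4)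
        also have "\<dots> = 2 * real n" by (simp add: norm_mult \<rho>_def \<sigma>2)
        finally show ?thesis .
      qed
      finally show ?thesis using M0 by (simp add: K_def mult_left_mono)
    qed
    have "(\<lambda>n. K * exp (- (\<kappa> * real n)) * (2 * real n)) \<longlonglongrightarrow> 0"
      using \<kappa>(1) by real_asymp
    then have "(\<lambda>n. \<Phi> (of_real T + of_nat n) - \<Phi> (of_real T + of_nat n * \<rho>)) \<longlonglongrightarrow> 0"
      by (rule Lim_null_comparison[rotated]) (use bound in auto)
    moreover have "(\<lambda>n. (\<Phi> (of_real T + of_nat n) - \<Phi> T) - (\<Phi> (of_real T + of_nat n * \<rho>) - \<Phi> T)) \<longlonglongrightarrow>
        integral {T..} (\<lambda>t. q (of_real t)) - \<rho> * integral {0..} (\<lambda>u. q (of_real T + of_real u * \<rho>))"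
      unfolding A[symmetric] B[symmetric]
      by (intro tendsto_intros integral_Ici_tendsto) (use I1 I2 w in \<open>auto simp: q_def\<close>)
    ultimately have "integral {T..} (\<lambda>t. q (of_real t)) - \<rho> * integral {0..} (\<lambda>u. q (of_real T + of_real u * \<rho>)) = 0"
      by (intro LIMSEQ_unique[of _ _ 0]) auto
    then show ?thesis by (simp add: q_def)
  qed
qed

definition rotated_laplace :: "real \<Rightarrow> real \<Rightarrow> (complex \<Rightarrow> complex) \<Rightarrow> complex \<Rightarrow> complex" where
  "rotated_laplace \<sigma> T h w =
     (- \<i> * of_real \<sigma>) * integral {0..} (\<lambda>u. exp (- w * (of_real T + of_real u * (- \<i> * of_real \<sigma>))) *
        h (of_real T + of_real u * (- \<i> * of_real \<sigma>)))"

text \<open>The two integrals agree on the overlap of the half-planes, so they glue to one function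
  on the domain that \<open>has_reg_integral_inf\<close> prescribes.\<close>

lemma laplace_continuation:
  fixes h :: "complex \<Rightarrow> complex" and \<sigma> T T' B :: real
  assumes \<sigma>: "\<sigma> = 1 \<or> \<sigma> = -1" and hol: "h holomorphic_on {z. Re z > T'}" and T: "T' < T" "0 \<le> T"
    and bd: "\<And>\<epsilon>. \<epsilon> > 0 \<Longrightarrow> \<exists>M. \<forall>z. Re z \<ge> T \<longrightarrow> norm (h z) \<le> M * exp ((B + \<epsilon>) * Re z + \<epsilon> * \<bar>Im z\<bar>)"
  shows "\<exists>F. F holomorphic_on {w. Re w > B \<or> \<sigma> * Im w > 0} \<and>
     (\<forall>w. Re w > B \<longrightarrow> (\<lambda>t. exp (- w * of_real t) * h (of_real t)) absolutely_integrable_on {T..} \<and>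
            F w = integral {T..} (\<lambda>t. exp (- w * of_real t) * h (of_real t))) \<and>
     (\<forall>w. \<sigma> * Im w > 0 \<longrightarrow> F w = rotated_laplace \<sigma> T h w)"
proof -
  note L = laplace_rotation[OF \<sigma> hol T bd, folded rotated_laplace_def]
  let ?A = "{w. Re w > B}" and ?C = "{w. \<sigma> * Im w > 0}"
  let ?F = "\<lambda>w. if w \<in> ?A then integral {T..} (\<lambda>t. exp (- w * of_real t) * h (of_real t)) else rotated_laplace \<sigma> T h w"
  have "?F holomorphic_on ?A \<union> ?C"
  proof (rule holomorphic_on_If_Un)
    show "(\<lambda>w. integral {T..} (\<lambda>t. exp (- w * of_real t) * h (of_real t))) holomorphic_on ?A" by (rule L(1))
    show "rotated_laplace \<sigma> T h holomorphic_on ?C" using L(3) by simp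
    show "open ?A" by (rule open_halfspace_Re_gt)
    show "open ?C" by (intro open_Collect_less continuous_intros)
  qed (use L(5) in auto)
  moreover have "?A \<union> ?C = {w. Re w > B \<or> \<sigma> * Im w > 0}" by auto
  ultimately show ?thesis
    using L(2,5) by (intro exI[of _ ?F]) auto
qed

section \<open>Growth of complex powers on a right half-plane\<close>

lemma norm_powr_le:
  assumes "z \<noteq> 0"
  shows "norm (z powr a) \<le> exp (Re a * ln (norm z) + \<bar>Im a\<bar> * pi)"
proof -
  have "\<bar>Im (Ln z)\<bar> \<le> pi" using assms Im_Ln_le_pi mpi_less_Im_Ln by (smt (verit))
  then have "\<bar>Im a * Im (Ln z)\<bar> \<le> \<bar>Im a\<bar> * pi" unfolding abs_mult by (intro mult_left_mono) auto
  then have "- (Im a * Im (Ln z)) \<le> \<bar>Im a\<bar> * pi" by linarith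
  then show ?thesis using assms by (simp add: powr_def)
qed

text \<open>The logarithm grows more slowly than any linear function. The exponent may have either
  sign, so ln |z| is bounded above through \<open>ln_le_minus_one\<close> and below through ln T;
  the argument of z contributes only a constant factor.\<close>

lemma norm_powr_subexponential:
  fixes a :: complex
  assumes "T > 0" "\<epsilon> > 0"
  shows "\<exists>M. \<forall>z. Re z \<ge> T \<longrightarrow> norm (z powr a) \<le> M * exp (\<epsilon> * Re z + \<epsilon> * \<bar>Im z\<bar>)"
proof -
  \<comment> \<open>Chosen so that |Re a| \<delta> is at most \<epsilon>; the summand 1 takes care
    of Re a = 0.\<close>
  define \<delta> where "\<delta> = \<epsilon> / (\<bar>Re a\<bar> + 1)"
  have \<delta>: "\<delta> > 0" "\<bar>Re a\<bar> * \<delta> \<le> \<epsilon>"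
    using assms by (auto simp: \<delta>_def field_simps)
  define K where "K = \<bar>ln \<delta>\<bar> + \<bar>ln T\<bar>"
  show ?thesis
  proof (intro exI[of _ "exp (\<bar>Re a\<bar> * K + \<bar>Im a\<bar> * pi)"] allI impI)
    fix z assume z: "Re z \<ge> T"
    have nz: "norm z \<ge> T" "z \<noteq> 0" using z complex_Re_le_cmod[of z] assms by auto
    have "ln (\<delta> * norm z) \<le> \<delta> * norm z - 1" using nz \<delta> by (intro ln_le_minus_one) auto
    then have "ln (norm z) \<le> \<delta> * norm z + K"
      using nz \<delta> by (simp add: ln_mult K_def)
    moreover have "- ln (norm z) \<le> \<delta> * norm z + K"
    proof -
      have "ln T \<le> ln (norm z)" using nz assms by simp
      moreover have "0 \<le> \<delta> * norm z" using \<delta> by simp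
      ultimately show ?thesis unfolding K_def by linarith
    qed
    ultimately have "\<bar>ln (norm z)\<bar> \<le> \<delta> * norm z + K" by linarith
    then have "\<bar>Re a * ln (norm z)\<bar> \<le> \<bar>Re a\<bar> * (\<delta> * norm z + K)"
      unfolding abs_mult by (intro mult_left_mono) auto
    also have "\<dots> = (\<bar>Re a\<bar> * \<delta>) * norm z + \<bar>Re a\<bar> * K" by (simp add: algebra_simps)
    also have "\<dots> \<le> \<epsilon> * norm z + \<bar>Re a\<bar> * K" using \<delta> by (intro add_right_mono mult_right_mono) auto
    also have "\<epsilon> * norm z \<le> \<epsilon> * (Re z + \<bar>Im z\<bar>)"
      using cmod_le[of z] z assms by (intro mult_left_mono) auto
    finally have "Re a * ln (norm z) \<le> \<epsilon> * (Re z + \<bar>Im z\<bar>) + \<bar>Re a\<bar> * K" by linarith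
    with norm_powr_le[OF nz(2), of a]
    have "norm (z powr a) \<le> exp ((\<bar>Re a\<bar> * K + \<bar>Im a\<bar> * pi) + (\<epsilon> * Re z + \<epsilon> * \<bar>Im z\<bar>))"
      by (elim order_trans) (simp add: algebra_simps)
    then show "norm (z powr a) \<le> exp (\<bar>Re a\<bar> * K + \<bar>Im a\<bar> * pi) * exp (\<epsilon> * Re z + \<epsilon> * \<bar>Im z\<bar>)"
      by (simp add: exp_add)
  qed
qed

lemma holomorphic_powr_right_halfplane:
  "(\<lambda>z. z powr a) holomorphic_on {z. Re z > 0}"
  by (intro holomorphic_intros) (auto simp: complex_nonpos_Reals_iff)

lemma subexponential_mult_powr:
  fixes a :: complex
  assumes "T > 0" and bd: "\<And>z. Re z \<ge> T \<Longrightarrow> norm (h z) \<le> M * exp (B * Re z)" and "\<epsilon> > 0"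
  shows "\<exists>M. \<forall>z. Re z \<ge> T \<longrightarrow> norm (h z * z powr a) \<le> M * exp ((B + \<epsilon>) * Re z + \<epsilon> * \<bar>Im z\<bar>)"
proof -
  obtain M' where M': "\<And>z. Re z \<ge> T \<Longrightarrow> norm (z powr a) \<le> M' * exp (\<epsilon> * Re z + \<epsilon> * \<bar>Im z\<bar>)"
    using norm_powr_subexponential[OF assms(1,3)] by blast
  have "norm (h z * z powr a) \<le> (M * M') * exp ((B + \<epsilon>) * Re z + \<epsilon> * \<bar>Im z\<bar>)" if "Re z \<ge> T" for z
  proof -
    have "norm (h z * z powr a) \<le> (M * exp (B * Re z)) * (M' * exp (\<epsilon> * Re z + \<epsilon> * \<bar>Im z\<bar>))"
      unfolding norm_mult using bd[OF that] M'[OF that] order_trans[OF norm_ge_zero bd[OF that]]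
      by (intro mult_mono) auto
    also have "\<dots> = (M * M') * exp ((B + \<epsilon>) * Re z + \<epsilon> * \<bar>Im z\<bar>)"
      by (simp add: algebra_simps exp_add)
    finally show ?thesis .
  qed
  then show ?thesis by blast
qed

text \<open>The continuation to \<open>\<sigma> * Im w > 0\<close> of the Laplace transform of \<open>t powr (s - 1)\<close> on \<open>{T..}\<close>, an incomplete Gamma function.\<close>
definition rotated_gamma :: "real \<Rightarrow> real \<Rightarrow> complex \<Rightarrow> complex \<Rightarrow> complex" where
  "rotated_gamma \<sigma> T s w = rotated_laplace \<sigma> T (\<lambda>z. z powr (s - 1)) w"

section \<open>Boundary values of the incomplete Gamma function on the real axis\<close>

context
  fixes \<sigma> T :: real
  assumes \<sigma>: "\<sigma> = 1 \<or> \<sigma> = -1" and T: "1 \<le> T"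
begin

text \<open>In majorants \<open>max T u\<close> replaces the modulus of T - i \<sigma> u: being a
  lower bound for it, it gives an upper bound after raising to a negative power, and its powers
  integrate explicitly.\<close>

lemma max_le_norm_ray: "max T u \<le> norm (complex_of_real T + of_real u * (- \<i> * of_real \<sigma>))"
  using abs_Re_le_cmod[of "complex_of_real T + of_real u * (- \<i> * of_real \<sigma>)"]
     abs_Im_le_cmod[of "complex_of_real T + of_real u * (- \<i> * of_real \<sigma>)"] \<sigma> T
  by auto

lemma integrable_max_powr:
  assumes "e < -1"
  shows "(\<lambda>u. max T u powr e) integrable_on {0..}"
proof -
  have "(\<lambda>u. max T u powr e) integrable_on {0..T}"
    by (rule integrable_continuous_real) (use T in \<open>auto intro!: continuous_intros\<close>)
  moreover have "(\<lambda>u. max T u powr e) integrable_on {T..}"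
    by (rule integrable_eq[of "\<lambda>u. u powr e"])
       (use has_integral_powr_to_inf[OF assms, of T] T in \<open>auto simp: max_def integrable_on_def\<close>)
  moreover have "negligible ({0..T} \<inter> {T..})"
    by (rule negligible_subset[of "{T}"]) auto
  ultimately have "(\<lambda>u. max T u powr e) integrable_on ({0..T} \<union> {T..})"
    by (intro integrable_Un) auto
  also have "{0..T} \<union> {T..} = {0..}" using T by auto
  finally show ?thesis .
qed

lemma norm_powr_ray_le:
  assumes "Re s \<le> 0"
  shows "norm ((complex_of_real T + of_real u * (- \<i> * of_real \<sigma>)) powr s) \<le> exp (\<bar>Im s\<bar> * pi) * max T u powr Re s"
proof -
  let ?z = "complex_of_real T + of_real u * (- \<i> * of_real \<sigma>)"
  have z: "max T u \<le> norm ?z" "?z \<noteq> 0" "max T u > 0" using max_le_norm_ray[of u] T by auto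
  have "norm (?z powr s) \<le> exp (\<bar>Im s\<bar> * pi) * norm ?z powr Re s"
    using norm_powr_le[OF z(2), of s] z by (simp add: powr_def exp_add mult.commute)
  also have "norm ?z powr Re s \<le> max T u powr Re s"
    using z assms by (intro powr_mono2') auto
  finally show ?thesis by simp
qed

text \<open>For Re s < 0 the power z^(s - 1) is integrable along the ray by itself. The exponential
  factor only has to stay bounded, which it does because w is bounded and \<sigma> Im w > 0.
  Dominated convergence therefore reaches every real boundary point, 0 included.\<close>

lemma rotated_gamma_tendsto_neg:
  assumes s: "Re s < 0"
  shows "((\<lambda>w. rotated_gamma \<sigma> T s w) \<longlongrightarrow> rotated_gamma \<sigma> T s (of_real x)) (at (of_real x) within {w. \<sigma> * Im w > 0})"
  unfolding tendsto_at_iff_sequentially o_def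
proof (intro allI impI)
  let ?z = "\<lambda>u. complex_of_real T + of_real u * (- \<i> * of_real \<sigma>)"
  fix X assume X: "\<forall>i. X i \<in> {w. \<sigma> * Im w > 0} - {complex_of_real x}" "X \<longlonglongrightarrow> complex_of_real x"
  have "bounded (range X)" using X(2) by (rule convergent_imp_bounded)
  then obtain R where R: "\<And>n. norm (X n) \<le> R" by (auto simp: bounded_iff)
  have zne: "?z u \<noteq> 0" "Re (?z u) > 0" for u using T by (auto simp: complex_eq_iff)
  have le: "norm (exp (- X n * ?z u) * ?z u powr (s - 1)) \<le> exp (R * T + \<bar>Im (s - 1)\<bar> * pi) * max T u powr (Re s - 1)"
    if "u \<in> {0..}" for n u
  proof -
    have "0 \<le> \<sigma> * Im (X n) * u" using X(1) that by (intro mult_nonneg_nonneg[OF less_imp_le]) auto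
    moreover have "- Re (X n) * T \<le> R * T"
      using R[of n] abs_Re_le_cmod[of "X n"] T by (intro mult_right_mono) auto
    ultimately have "norm (exp (- X n * ?z u)) \<le> exp (R * T)" by (simp add: algebra_simps)
    moreover have "norm (?z u powr (s - 1)) \<le> exp (\<bar>Im (s - 1)\<bar> * pi) * max T u powr Re (s - 1)"
      by (rule norm_powr_ray_le) (use s in auto)
    ultimately have "norm (exp (- X n * ?z u) * ?z u powr (s - 1)) \<le> exp (R * T) * (exp (\<bar>Im (s - 1)\<bar> * pi) * max T u powr Re (s - 1))"
      unfolding norm_mult by (intro mult_mono) auto
    then show ?thesis by (simp add: exp_add mult.assoc)
  qed
  have "(\<lambda>n. integral {0..} (\<lambda>u. exp (- X n * ?z u) * ?z u powr (s - 1))) \<longlonglongrightarrow>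
      integral {0..} (\<lambda>u. exp (- of_real x * ?z u) * ?z u powr (s - 1))"
  proof (rule dominated_convergence(2))
    show "(\<lambda>u. exp (R * T + \<bar>Im (s - 1)\<bar> * pi) * max T u powr (Re s - 1)) integrable_on {0..}"
      by (intro integrable_on_mult_right integrable_max_powr) (use s in auto)
    show "(\<lambda>u. exp (- X n * ?z u) * ?z u powr (s - 1)) integrable_on {0..}" for n
    proof (rule set_lebesgue_integral_eq_integral(1)[OF absolutely_integrable_on_Ici_bound])
      show "continuous_on {0..} (\<lambda>u. exp (- X n * ?z u) * ?z u powr (s - 1))"
        using zne by (intro continuous_intros) (auto simp: complex_nonpos_Reals_iff)
      show "(\<lambda>u. exp (R * T + \<bar>Im (s - 1)\<bar> * pi) * max T u powr (Re s - 1)) integrable_on {0..}" by fact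
      show "norm (exp (- X n * ?z u) * ?z u powr (s - 1)) \<le> exp (R * T + \<bar>Im (s - 1)\<bar> * pi) * max T u powr (Re s - 1)"
        if "0 \<le> u" for u using le that by auto
    qed
    show "(\<lambda>n. exp (- X n * ?z u) * ?z u powr (s - 1)) \<longlonglongrightarrow> exp (- of_real x * ?z u) * ?z u powr (s - 1)" for u
      by (intro tendsto_intros X(2))
  qed (use le in auto)
  then show "(\<lambda>n. rotated_gamma \<sigma> T s (X n)) \<longlonglongrightarrow> rotated_gamma \<sigma> T s (of_real x)"
    unfolding rotated_gamma_def rotated_laplace_def by (intro tendsto_intros)
qed

lemma rotated_gamma_holomorphic_neg:
  "(\<lambda>s. rotated_gamma \<sigma> T s (of_real x)) holomorphic_on {s. Re s < 0}"
proof -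
  let ?z = "\<lambda>u. complex_of_real T + of_real u * (- \<i> * of_real \<sigma>)"
  have zne: "?z u \<noteq> 0" "Re (?z u) > 0" for u using T by (auto simp: complex_eq_iff)
  have "(\<lambda>s. integral {0..} (\<lambda>u. exp (s * Ln (?z u)) * (exp (- of_real x * ?z u) / ?z u))) holomorphic_on {s. Re s < 0}"
  proof (rule holomorphic_integral_exp_kernel_Ici(1))
    show "open {s. Re s < 0}" by (rule open_halfspace_Re_lt)
    show "continuous_on {0..} (\<lambda>u. Ln (?z u))"
      using zne by (intro continuous_intros) (auto simp: complex_nonpos_Reals_iff)
    show "continuous_on {0..} (\<lambda>u. exp (- of_real x * ?z u) / ?z u)"
      using zne by (intro continuous_intros) auto
    fix s assume "s \<in> {s. Re s < 0}"
    define d where "d = - Re s / 2"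
    have d: "d > 0" "Re s = - 2 * d" using \<open>s \<in> _\<close> by (auto simp: d_def)
    have *: "Re z \<le> - d" "\<bar>Im z\<bar> \<le> norm s + d" if "z \<in> cball s d" for z
    proof -
      show "Re z \<le> - d"
        using that d abs_Re_le_cmod[of "s - z"] by (auto simp: dist_norm)
      have "\<bar>Im z\<bar> \<le> norm z" by (rule abs_Im_le_cmod)
      also have "\<dots> \<le> norm s + d" using that norm_triangle_ineq2[of z s] by (auto simp: dist_norm norm_minus_commute)
      finally show "\<bar>Im z\<bar> \<le> norm s + d" .
    qed
    show "\<exists>d>0. \<exists>m. cball s d \<subseteq> {s. Re s < 0} \<and> m integrable_on {0..} \<and>
       (\<forall>z\<in>cball s d. \<forall>t\<ge>0. norm (exp (z * Ln (?z t)) * (exp (- of_real x * ?z t) / ?z t)) \<le> m t)"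
    proof (intro exI[of _ d] conjI exI[of _ "\<lambda>t. exp ((norm s + d) * pi - x * T) * max T t powr (- d - 1)"] ballI allI impI)
      show "cball s d \<subseteq> {s. Re s < 0}"
      proof
        fix z assume "z \<in> cball s d"
        from *(1)[OF this] show "z \<in> {s. Re s < 0}" using d by simp
      qed
      show "(\<lambda>t. exp ((norm s + d) * pi - x * T) * max T t powr (- d - 1)) integrable_on {0..}"
        by (intro integrable_on_mult_right integrable_max_powr) (use d in auto)
      fix z and t :: real assume z: "z \<in> cball s d" and t: "0 \<le> t"
      have m1: "1 \<le> max T t" using T by auto
      have "norm (exp (z * Ln (?z t))) = norm (?z t powr z)" using zne by (simp add: powr_def)
      also have "\<dots> \<le> exp (\<bar>Im z\<bar> * pi) * max T t powr Re z"
        by (rule norm_powr_ray_le) (use *[OF z] d in auto)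
      also have "\<dots> \<le> exp ((norm s + d) * pi) * max T t powr (- d)"
        using *[OF z] m1 by (intro mult_mono powr_mono) (auto intro: mult_right_mono)
      finally have A: "norm (exp (z * Ln (?z t))) \<le> exp ((norm s + d) * pi) * max T t powr (- d)" .
      have "norm (exp (- of_real x * ?z t) / ?z t) = exp (- x * T) / norm (?z t)"
        by (simp add: norm_divide)
      also have "\<dots> \<le> exp (- x * T) / max T t"
      proof (rule divide_left_mono[OF max_le_norm_ray])
        have "0 < norm (?z t)" using zne(1)[of t] by (subst zero_less_norm_iff)
        then show "0 < norm (?z t) * max T t" using m1 by (intro mult_pos_pos) auto
      qed auto
      also have "\<dots> = exp (- x * T) * max T t powr (-1)"
        using m1 by (simp add: powr_minus field_simps)
      finally have Bb: "norm (exp (- of_real x * ?z t) / ?z t) \<le> exp (- x * T) * max T t powr (-1)" .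
      have "norm (exp (z * Ln (?z t)) * (exp (- of_real x * ?z t) / ?z t)) \<le>
        (exp ((norm s + d) * pi) * max T t powr (- d)) * (exp (- x * T) * max T t powr (-1))"
        unfolding norm_mult using A Bb by (intro mult_mono) auto
      also have "\<dots> = exp ((norm s + d) * pi - x * T) * (max T t powr (- d) * max T t powr (- 1))"
        by (simp add: exp_diff exp_minus field_simps)
      also have "max T t powr (- d) * max T t powr (- 1) = max T t powr (- d - 1)"
        unfolding diff_conv_add_uminus powr_add ..
      finally show "norm (exp (z * Ln (?z t)) * (exp (- of_real x * ?z t) / ?z t)) \<le>
          exp ((norm s + d) * pi - x * T) * max T t powr (- d - 1)" .
    qed (use d in auto)
  qed
  note hol = this
  have eq: "rotated_gamma \<sigma> T s (of_real x) =
      (- \<i> * of_real \<sigma>) * integral {0..} (\<lambda>u. exp (s * Ln (?z u)) * (exp (- of_real x * ?z u) / ?z u))" for s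
    unfolding rotated_gamma_def rotated_laplace_def
    by (intro arg_cong[where f = "\<lambda>x. _ * x"] integral_cong)
       (use zne in \<open>simp add: powr_def algebra_simps exp_diff\<close>)
  show ?thesis unfolding eq by (intro holomorphic_on_mult holomorphic_on_const hol)
qed

text \<open>Integration by parts along the ray. The boundary term at infinity vanishes because the
  decay due to \<sigma> Im w > 0 beats the subexponential power. Divided by w, the identity
  expresses the value at s by the one at s - 1.\<close>

lemma rotated_gamma_recurrence:
  assumes w: "\<sigma> * Im w > 0"
  shows "w * rotated_gamma \<sigma> T s w = exp (- w * of_real T) * of_real T powr (s - 1) + (s - 1) * rotated_gamma \<sigma> T (s - 1) w"
proof -
  define \<rho> where "\<rho> = - \<i> * complex_of_real \<sigma>"
  let ?z = "\<lambda>u. complex_of_real T + of_real u * \<rho>"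
  have [simp]: "Re \<rho> = 0" "Im \<rho> = - \<sigma>" by (auto simp: \<rho>_def)
  have zne: "?z u \<noteq> 0" "Re (?z u) > 0" for u using T by (auto simp: complex_eq_iff)
  define \<Phi> where "\<Phi> = (\<lambda>z. exp (- w * z) * z powr (s - 1))"
  define q where "q = (\<lambda>s z. exp (- w * z) * z powr (s - 1))"
  have powr_minus_1: "(z::complex) powr (s - 1 - 1) = z powr (s - 1) / z" if "z \<noteq> 0" for z
    using that by (simp add: powr_diff power2_eq_square)
  have D: "(\<Phi> has_field_derivative (- w * q s z + (s - 1) * q (s - 1) z)) (at z)" if "Re z > 0" for z
    unfolding \<Phi>_def q_def using that
    by (auto intro!: derivative_eq_intros simp: complex_nonpos_Reals_iff powr_minus_1)
  have ab: "(\<lambda>u. q s (?z u)) absolutely_integrable_on {0..}" for s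
  proof -
    have "\<exists>M. \<forall>z. Re z \<ge> T \<longrightarrow> norm (z powr (s - 1)) \<le> M * exp ((0 + \<epsilon>) * Re z + \<epsilon> * \<bar>Im z\<bar>)" if "\<epsilon> > 0" for \<epsilon>
      using norm_powr_subexponential[of T \<epsilon> "s - 1"] T that by simp
    from laplace_rotation(4)[OF \<sigma> holomorphic_powr_right_halfplane _ _ this w] T
    show ?thesis unfolding q_def \<rho>_def by auto
  qed
  have I: "integral {0..0 + real n} (\<lambda>u. \<rho> * (- w * q s (?z u) + (s - 1) * q (s - 1) (?z u))) = \<Phi> (?z (real n)) - \<Phi> T" for n
    using integral_complex_primitive[of 0 "real n" \<Phi> "\<lambda>z. - w * q s z + (s - 1) * q (s - 1) z" "of_real T" \<rho>] D T
    by (intro integral_unique) auto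
  have ab2: "(\<lambda>u. \<rho> * (- w * q s (?z u) + (s - 1) * q (s - 1) (?z u))) absolutely_integrable_on {0..}"
    using ab[of s] ab[of "s - 1"] by (intro set_integrable_mult_right set_integral_add) auto
  have "(\<lambda>n. \<Phi> (?z (real n))) \<longlonglongrightarrow> 0"
  proof -
    define \<epsilon> where "\<epsilon> = \<sigma> * Im w / 2"
    have \<epsilon>: "\<epsilon> > 0" "\<sigma> * Im w = 2 * \<epsilon>" using w by (auto simp: \<epsilon>_def)
    obtain M where M: "\<And>z. Re z \<ge> T \<Longrightarrow> norm (z powr (s - 1)) \<le> M * exp (\<epsilon> * Re z + \<epsilon> * \<bar>Im z\<bar>)"
      using norm_powr_subexponential[of T \<epsilon> "s - 1"] T \<epsilon> by auto
    have "norm (\<Phi> (?z (real n))) \<le> exp (- Re w * T) * (M * exp (\<epsilon> * T)) * exp (- \<epsilon> * real n)" for n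
    proof -
      have "Re (- w * ?z (real n)) = - Re w * T - (\<sigma> * Im w) * real n" by (simp add: algebra_simps)
      then have a: "Re (- w * ?z (real n)) = - Re w * T - 2 * \<epsilon> * real n" unfolding \<epsilon>(2) .
      have "norm (\<Phi> (?z (real n))) \<le> exp (- Re w * T - 2 * \<epsilon> * real n) * (M * exp (\<epsilon> * T + \<epsilon> * real n))"
        unfolding \<Phi>_def norm_mult
      proof (rule mult_mono)
        show "norm (exp (- w * ?z (real n))) \<le> exp (- Re w * T - 2 * \<epsilon> * real n)"
          unfolding norm_exp_eq_Re a ..
        have "\<bar>\<sigma>\<bar> = 1" using \<sigma> by auto
        then show "norm (?z (real n) powr (s - 1)) \<le> M * exp (\<epsilon> * T + \<epsilon> * real n)"
          using M[of "?z (real n)"] by (simp add: abs_mult)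
      qed auto
      also have "\<dots> = exp (- Re w * T) * (M * exp (\<epsilon> * T)) * exp (- \<epsilon> * real n)"
        by (simp add: algebra_simps flip: exp_add)
      finally show ?thesis .
    qed
    moreover have "(\<lambda>n. exp (- Re w * T) * (M * exp (\<epsilon> * T)) * exp (- \<epsilon> * real n)) \<longlonglongrightarrow> 0"
    proof (rule tendsto_mult_right_zero)
      show "(\<lambda>n. exp (- \<epsilon> * real n)) \<longlonglongrightarrow> 0" using \<epsilon>(1) by real_asymp
    qed
    ultimately show ?thesis by (rule Lim_null_comparison[OF always_eventually[OF allI]])
  qed
  then have l1: "(\<lambda>n. \<Phi> (?z (real n)) - \<Phi> T) \<longlonglongrightarrow> 0 - \<Phi> T" by (intro tendsto_intros)
  have l2: "(\<lambda>n. \<Phi> (?z (real n)) - \<Phi> T) \<longlonglongrightarrow> integral {0..} (\<lambda>u. \<rho> * (- w * q s (?z u) + (s - 1) * q (s - 1) (?z u)))"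
    unfolding I[symmetric] by (rule integral_Ici_tendsto[OF ab2])
  have "integral {0..} (\<lambda>u. \<rho> * (- w * q s (?z u) + (s - 1) * q (s - 1) (?z u))) = - \<Phi> T"
    using LIMSEQ_unique[OF l2 l1] by simp
  moreover have "integral {0..} (\<lambda>u. \<rho> * (- w * q s (?z u) + (s - 1) * q (s - 1) (?z u))) =
      \<rho> * (- w * integral {0..} (\<lambda>u. q s (?z u)) + (s - 1) * integral {0..} (\<lambda>u. q (s - 1) (?z u)))"
  proof -
    have "(\<lambda>u. q s (?z u)) integrable_on {0..}" for s
      using ab by (rule set_lebesgue_integral_eq_integral(1))
    then show ?thesis
      by (subst integral_mult_right, subst integral_add) (auto intro!: integrable_on_mult_right integrable_neg)
  qed
  ultimately show ?thesis
    unfolding rotated_gamma_def rotated_laplace_def \<rho>_def[symmetric] \<Phi>_def q_def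
    by (simp add: algebra_simps)
qed

text \<open>The recurrence divided by w carries the boundary value from Re s < m to Re s < m + 1,
  starting from \<open>rotated_gamma_tendsto_neg\<close>. The division is harmless near x because x
  is not 0; at 0 this argument breaks down, and the case of the constant Fourier coefficient has to
  be treated differently.\<close>

lemma rotated_gamma_tendsto:
  assumes x: "x \<noteq> 0"
  shows "\<exists>e. e holomorphic_on UNIV \<and>
     (\<forall>s. ((\<lambda>w. rotated_gamma \<sigma> T s w) \<longlongrightarrow> e s) (at (of_real x) within {w. \<sigma> * Im w > 0}))"
proof -
  let ?H = "{w. \<sigma> * Im w > 0}" and ?x = "complex_of_real x"
  have "?x islimpt ?H"
    unfolding islimpt_sequential
  proof (intro exI[of _ "\<lambda>n. ?x + \<i> * of_real (\<sigma> / real (Suc n))"] conjI allI)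
    show "?x + \<i> * of_real (\<sigma> / real (Suc n)) \<in> ?H - {?x}" for n
      using \<sigma> by (auto simp: complex_eq_iff)
    have "(\<lambda>n. ?x + \<i> * of_real (\<sigma> / real (Suc n))) \<longlonglongrightarrow> ?x + \<i> * of_real 0"
      by (intro tendsto_intros) real_asymp
    then show "(\<lambda>n. ?x + \<i> * of_real (\<sigma> / real (Suc n))) \<longlonglongrightarrow> ?x" by simp
  qed
  then have nt: "at ?x within ?H \<noteq> bot" by (simp add: trivial_limit_within)
  have "\<exists>e. e holomorphic_on {s. Re s < real m} \<and> (\<forall>s. Re s < real m \<longrightarrow> (rotated_gamma \<sigma> T s \<longlongrightarrow> e s) (at ?x within ?H))" for m
  proof (induction m)
    case 0
    show ?case
      using rotated_gamma_holomorphic_neg[of x] rotated_gamma_tendsto_neg[of _ x]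
      by (intro exI[of _ "\<lambda>s. rotated_gamma \<sigma> T s ?x"]) auto
  next
    case (Suc m)
    then obtain e where e: "e holomorphic_on {s. Re s < real m}"
      "\<And>s. Re s < real m \<Longrightarrow> (rotated_gamma \<sigma> T s \<longlongrightarrow> e s) (at ?x within ?H)" by blast
    let ?e = "\<lambda>s. (exp (- ?x * of_real T) * of_real T powr (s - 1) + (s - 1) * e (s - 1)) / ?x"
    have "(\<lambda>s. e (s - 1)) holomorphic_on {s. Re s < real (Suc m)}"
      by (rule holomorphic_on_compose_gen[OF _ e(1), unfolded o_def]) (auto intro!: holomorphic_intros)
    then have "?e holomorphic_on {s. Re s < real (Suc m)}"
      using T x by (intro holomorphic_intros) auto
    moreover have "(rotated_gamma \<sigma> T s \<longlongrightarrow> ?e s) (at ?x within ?H)" if s: "Re s < real (Suc m)" for s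
    proof (rule Lim_transform_eventually)
      show "((\<lambda>w. (exp (- w * of_real T) * of_real T powr (s - 1) + (s - 1) * rotated_gamma \<sigma> T (s - 1) w) / w) \<longlongrightarrow> ?e s) (at ?x within ?H)"
        using x s by (intro tendsto_intros e(2)) auto
      have "eventually (\<lambda>w. w \<in> ?H) (at ?x within ?H)" by (simp add: eventually_at_topological) blast
      then show "\<forall>\<^sub>F w in at ?x within ?H. (exp (- w * of_real T) * of_real T powr (s - 1) + (s - 1) * rotated_gamma \<sigma> T (s - 1) w) / w = rotated_gamma \<sigma> T s w"
      proof eventually_elim
        case (elim w)
        then have "w \<noteq> 0" by auto
        then show ?case using rotated_gamma_recurrence[of w s] elim by (simp add: field_simps)
      qed
    qed
    ultimately show ?case by blast
  qed
  then obtain E where E: "\<And>m. E m holomorphic_on {s. Re s < real m}"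
    "\<And>m s. Re s < real m \<Longrightarrow> (rotated_gamma \<sigma> T s \<longlongrightarrow> E m s) (at ?x within ?H)" by metis
  \<comment> \<open>Each \<open>E m\<close> is a limit of the same function, so they agree where
    several of them apply; taking the limit as the definition glues them to one entire
    function.\<close>
  define e where "e = (\<lambda>s. Lim (at ?x within ?H) (rotated_gamma \<sigma> T s))"
  have eE: "e s = E m s" if "Re s < real m" for m s
    unfolding e_def by (rule tendsto_Lim[OF nt E(2)[OF that]])
  have "e analytic_on {s}" for s
  proof -
    obtain m where m: "Re s < real m" using reals_Archimedean2 by blast
    have "e holomorphic_on {s. Re s < real m}"
      by (rule holomorphic_transform[OF E(1)[of m]]) (use eE in auto)
    then show ?thesis
      using m open_halfspace_Re_lt[of "real m"] by (auto simp: analytic_at)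
  qed
  then have "e holomorphic_on UNIV"
    by (meson analytic_imp_holomorphic analytic_on_analytic_at)
  moreover have "(rotated_gamma \<sigma> T s \<longlongrightarrow> e s) (at ?x within ?H)" for s
  proof -
    obtain m where m: "Re s < real m" using reals_Archimedean2 by blast
    then show ?thesis using E(2)[OF m] eE[OF m] by simp
  qed
  ultimately show ?thesis by blast
qed

text \<open>For Re s < 0 the primitive z^s / s vanishes at infinity along the ray. The value found
  makes sense for every s except 0; this continuation is the source of all poles of the
  L-functions.\<close>

lemma rotated_gamma_at_0:
  assumes s: "Re s < 0"
  shows "rotated_gamma \<sigma> T s 0 = - (of_real T powr s) / s"
proof -
  define \<rho> where "\<rho> = - \<i> * complex_of_real \<sigma>"
  let ?z = "\<lambda>u. complex_of_real T + of_real u * \<rho>"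
  have [simp]: "Re \<rho> = 0" "Im \<rho> = - \<sigma>" by (auto simp: \<rho>_def)
  have zne: "?z u \<noteq> 0" "Re (?z u) > 0" for u using T by (auto simp: complex_eq_iff)
  have s0: "s \<noteq> 0" using s by auto
  have D: "((\<lambda>z. z powr s / s) has_field_derivative z powr (s - 1)) (at z)" if "Re z > 0" for z
    using that s0 by (auto intro!: derivative_eq_intros simp: complex_nonpos_Reals_iff)
  have ab: "(\<lambda>u. ?z u powr (s - 1)) absolutely_integrable_on {0..}"
  proof (rule absolutely_integrable_on_Ici_bound)
    show "continuous_on {0..} (\<lambda>u. ?z u powr (s - 1))"
      using zne by (intro continuous_intros) (auto simp: complex_nonpos_Reals_iff)
    show "(\<lambda>u. exp (\<bar>Im (s - 1)\<bar> * pi) * max T u powr (Re (s - 1))) integrable_on {0..}"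
      by (intro integrable_on_mult_right integrable_max_powr) (use s in auto)
    show "norm (?z u powr (s - 1)) \<le> exp (\<bar>Im (s - 1)\<bar> * pi) * max T u powr (Re (s - 1))" for u
      unfolding \<rho>_def by (rule norm_powr_ray_le) (use s in auto)
  qed
  have I: "\<rho> * integral {0..0 + real n} (\<lambda>u. ?z u powr (s - 1)) = ?z (real n) powr s / s - of_real T powr s / s" for n
  proof -
    have "((\<lambda>u. \<rho> * ?z u powr (s - 1)) has_integral ?z (real n) powr s / s - of_real T powr s / s) {0..0 + real n}"
      using integral_complex_primitive[of 0 "real n" "\<lambda>z. z powr s / s" "\<lambda>z. z powr (s - 1)" "of_real T" \<rho>] D T by auto
    from integral_unique[OF this] show ?thesis by simp
  qed
  have "(\<lambda>n. ?z (real n) powr s) \<longlonglongrightarrow> 0"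
  proof (rule Lim_null_comparison)
    show "\<forall>\<^sub>F n in sequentially. norm (?z (real n) powr s) \<le> exp (\<bar>Im s\<bar> * pi) * max T (real n) powr Re s"
      unfolding \<rho>_def using s by (intro always_eventually allI norm_powr_ray_le) auto
    have "(\<lambda>n. real n powr Re s) \<longlonglongrightarrow> 0" using s by real_asymp
    moreover have "\<forall>\<^sub>F n in sequentially. real n powr Re s = max T (real n) powr Re s"
    proof -
      have "\<forall>\<^sub>F n in sequentially. real n \<ge> T" by real_asymp
      then show ?thesis by eventually_elim (auto simp: max_def)
    qed
    ultimately have "(\<lambda>n. max T (real n) powr Re s) \<longlonglongrightarrow> 0" by (rule Lim_transform_eventually)
    then show "(\<lambda>n. exp (\<bar>Im s\<bar> * pi) * max T (real n) powr Re s) \<longlonglongrightarrow> 0"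
      by (rule tendsto_mult_right_zero)
  qed
  then have "(\<lambda>n. ?z (real n) powr s / s - of_real T powr s / s) \<longlonglongrightarrow> 0 / s - of_real T powr s / s"
    using s0 by (intro tendsto_intros) auto
  moreover have "(\<lambda>n. ?z (real n) powr s / s - of_real T powr s / s) \<longlonglongrightarrow> \<rho> * integral {0..} (\<lambda>u. ?z u powr (s - 1))"
    unfolding I[symmetric] by (intro tendsto_intros integral_Ici_tendsto[OF ab])
  ultimately have "\<rho> * integral {0..} (\<lambda>u. ?z u powr (s - 1)) = 0 / s - of_real T powr s / s"
    using LIMSEQ_unique by blast
  then show ?thesis
    unfolding rotated_gamma_def rotated_laplace_def \<rho>_def[symmetric] by simp
qed

end

section \<open>Divergences of incomplete Gamma functions at w = 0 do not cancel\<close>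

abbreviation quadrant_filter :: "real \<Rightarrow> complex filter" where
  "quadrant_filter \<sigma> \<equiv> at 0 within {w. Re w > 0 \<and> \<sigma> * Im w > 0}"

context
  fixes \<sigma> T :: real
  assumes \<sigma>: "\<sigma> = 1 \<or> \<sigma> = -1" and T: "1 \<le> T"
begin

lemma quadrant_filter_neq_bot: "quadrant_filter \<sigma> \<noteq> bot"
proof -
  let ?H = "{w. Re w > 0 \<and> \<sigma> * Im w > 0}"
  have "(0::complex) islimpt ?H"
    unfolding islimpt_sequential
  proof (intro exI[of _ "\<lambda>n. Complex (1 / real (Suc n)) (\<sigma> / real (Suc n))"] conjI allI)
    show "Complex (1 / real (Suc n)) (\<sigma> / real (Suc n)) \<in> ?H - {0}" for n
      using \<sigma> by (auto simp: complex_eq_iff)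
    have "(\<lambda>n. Complex (1 / real (Suc n)) (\<sigma> / real (Suc n))) \<longlonglongrightarrow> Complex 0 0"
      by (intro tendsto_Complex) real_asymp+
    then show "(\<lambda>n. Complex (1 / real (Suc n)) (\<sigma> / real (Suc n))) \<longlonglongrightarrow> 0" by (simp add: Complex_eq)
  qed
  then show ?thesis by (simp add: trivial_limit_within)
qed

lemma filterlim_scale_quadrant:
  assumes "\<mu> > 0"
  shows "filterlim (\<lambda>w. of_real \<mu> * w) (quadrant_filter \<sigma>) (quadrant_filter \<sigma>)"
proof (rule filterlim_at_withinI)
  have "((\<lambda>w. complex_of_real \<mu> * w) \<longlongrightarrow> of_real \<mu> * 0) (quadrant_filter \<sigma>)"
    by (intro tendsto_intros)
  then show "((\<lambda>w. complex_of_real \<mu> * w) \<longlongrightarrow> 0) (quadrant_filter \<sigma>)" by simp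
  have "\<forall>\<^sub>F w in quadrant_filter \<sigma>. Re w > 0 \<and> \<sigma> * Im w > 0"
    by (auto simp: eventually_at_filter)
  then show "\<forall>\<^sub>F w in quadrant_filter \<sigma>. complex_of_real \<mu> * w \<in> {w. Re w > 0 \<and> \<sigma> * Im w > 0} - {0}"
  proof eventually_elim
    case (elim w)
    have "\<mu> * (\<sigma> * Im w) > 0" by (rule mult_pos_pos) (use elim assms in auto)
    moreover have "\<mu> * (\<sigma> * Im w) = \<sigma> * Im (of_real \<mu> * w)" by simp
    ultimately have "\<sigma> * Im (of_real \<mu> * w) > 0" by simp
    then show ?case using elim assms by auto
  qed
qed

lemma laplace_powr:
  assumes "Re w > 0"
  shows "(\<lambda>t. exp (- w * of_real t) * of_real t powr (s - 1)) absolutely_integrable_on {T..}"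
    and "\<sigma> * Im w > 0 \<Longrightarrow> rotated_gamma \<sigma> T s w = integral {T..} (\<lambda>t. exp (- w * of_real t) * of_real t powr (s - 1))"
proof -
  have bd: "\<exists>M. \<forall>z. Re z \<ge> T \<longrightarrow> norm (z powr (s - 1)) \<le> M * exp ((0 + \<epsilon>) * Re z + \<epsilon> * \<bar>Im z\<bar>)" if "\<epsilon> > 0" for \<epsilon>
    using norm_powr_subexponential[of T \<epsilon> "s - 1"] T that by simp
  have T': "0 < T" "0 \<le> T" using T by auto
  note L = laplace_rotation[OF \<sigma> holomorphic_powr_right_halfplane T' bd]
  show "(\<lambda>t. exp (- w * of_real t) * of_real t powr (s - 1)) absolutely_integrable_on {T..}"
    by (rule L(2)) (use assms in auto)
  show "rotated_gamma \<sigma> T s w = integral {T..} (\<lambda>t. exp (- w * of_real t) * of_real t powr (s - 1))" if "\<sigma> * Im w > 0"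
    unfolding rotated_gamma_def rotated_laplace_def
    by (rule L(5)) (use assms that in auto)
qed

text \<open>Substitution of \<mu> t for t in the Laplace integral. The function is homogeneous of
  degree - s in w, up to the piece between the old and the new end point, which is entire in
  w.\<close>

lemma rotated_gamma_scale:
  assumes w: "Re w > 0" "\<sigma> * Im w > 0" and \<mu>: "\<mu> \<ge> 1"
  shows "rotated_gamma \<sigma> T s (of_real \<mu> * w) = of_real \<mu> powr (- s) *
     (rotated_gamma \<sigma> T s w - integral {T..\<mu> * T} (\<lambda>t. exp (- w * of_real t) * of_real t powr (s - 1)))"
proof -
  let ?f = "\<lambda>t. exp (- w * of_real t) * complex_of_real t powr (s - 1)"
  have ab: "?f absolutely_integrable_on {T..}" by (rule laplace_powr(1)[OF w(1)])
  have "\<mu> * T \<ge> T" using T \<mu> by simp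
  then have sub: "{\<mu> * T..} \<subseteq> {T..}" by auto
  have img: "(\<lambda>x. \<mu> * x) ` {T..} = {\<mu> * T..}"
  proof (intro set_eqI iffI)
    fix y assume "y \<in> {\<mu> * T..}"
    then show "y \<in> (\<lambda>x. \<mu> * x) ` {T..}"
      using \<mu> by (intro image_eqI[of _ _ "y / \<mu>"]) (auto simp: field_simps)
  qed (use \<mu> in auto)
  have "(\<lambda>x. \<bar>\<mu>\<bar> *\<^sub>R ?f (\<mu> * x)) absolutely_integrable_on {T..} \<and> integral {T..} (\<lambda>x. \<bar>\<mu>\<bar> *\<^sub>R ?f (\<mu> * x)) = integral {\<mu> * T..} ?f"
    unfolding img[symmetric]
  proof (subst has_absolute_integral_change_of_variables_real)
    show "?f absolutely_integrable_on (*) \<mu> ` {T..} \<and> integral ((*) \<mu> ` {T..}) ?f = integral ((*) \<mu> ` {T..}) ?f"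
      unfolding img using set_integrable_subset[OF ab _ sub] by auto
    show "inj_on ((*) \<mu>) {T..}" using \<mu> by (auto simp: inj_on_def)
  qed (auto intro!: derivative_eq_intros)
  then have "integral {T..} (\<lambda>x. \<bar>\<mu>\<bar> *\<^sub>R ?f (\<mu> * x)) = integral {\<mu> * T..} ?f" by blast
  moreover have "integral {T..} (\<lambda>x. \<bar>\<mu>\<bar> *\<^sub>R ?f (\<mu> * x)) = integral {T..} (\<lambda>x. of_real \<mu> * of_real \<mu> powr (s - 1) *
      (exp (- (of_real \<mu> * w) * of_real x) * complex_of_real x powr (s - 1)))" (is "_ = integral _ ?g")
    by (rule integral_cong) (use T \<mu> in \<open>auto simp: scaleR_conv_of_real powr_times_real mult_ac\<close>)
  ultimately have "integral {T..} ?g = integral {\<mu> * T..} ?f" by metis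
  moreover have "of_real \<mu> * of_real \<mu> powr (s - 1) = complex_of_real \<mu> powr s"
    using \<mu> by (simp add: powr_diff)
  ultimately have "of_real \<mu> powr s * integral {T..} (\<lambda>x. (exp (- (of_real \<mu> * w) * of_real x) * complex_of_real x powr (s - 1))) = integral {\<mu> * T..} ?f"
    by simp
  moreover have "\<sigma> * Im (of_real \<mu> * w) > 0" "Re (of_real \<mu> * w) > 0"
    using w \<mu> mult_pos_pos[of \<mu> "\<sigma> * Im w"] by (auto simp: mult_ac)
  ultimately have "of_real \<mu> powr s * rotated_gamma \<sigma> T s (of_real \<mu> * w) = integral {\<mu> * T..} ?f"
    by (subst laplace_powr(2)) auto
  also have "\<dots> = rotated_gamma \<sigma> T s w - integral {T..\<mu> * T} ?f"
    using integral_Ici_split[OF ab \<open>\<mu> * T \<ge> T\<close>] laplace_powr(2)[OF w] by simp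
  finally show ?thesis
    using \<mu> by (simp add: powr_minus field_simps)
qed

lemma integral_exp_powr_tendsto:
  assumes "\<mu> \<ge> 1"
  shows "((\<lambda>w. integral {T..\<mu> * T} (\<lambda>t. exp (- w * of_real t) * of_real t powr (s - 1))) \<longlongrightarrow>
     integral {T..\<mu> * T} (\<lambda>t. of_real t powr (s - 1))) (quadrant_filter \<sigma>)"
proof -
  let ?G = "\<lambda>w. integral {T..\<mu> * T} (\<lambda>t. exp (w * (- of_real t)) * complex_of_real t powr (s - 1))"
  have "?G holomorphic_on UNIV"
    by (rule holomorphic_integral_exp_kernel)
       (use T in \<open>auto intro!: continuous_intros simp: complex_nonpos_Reals_iff\<close>)
  then have "isCont ?G 0"
    using holomorphic_on_imp_continuous_on[of ?G UNIV] by (simp add: continuous_on_eq_continuous_at)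
  then have "(?G \<longlongrightarrow> ?G 0) (quadrant_filter \<sigma>)"
    unfolding isCont_def by (rule tendsto_within_subset) auto
  then show ?thesis by simp
qed

text \<open>The piece left over by \<open>rotated_gamma_scale\<close> is continuous at w = 0, so
  this difference converges even for those s where \<open>rotated_gamma\<close> itself
  diverges.\<close>

lemma rotated_gamma_scale_tendsto:
  assumes "\<mu> \<ge> 1"
  shows "((\<lambda>w. rotated_gamma \<sigma> T s (of_real \<mu> * w) - of_real \<mu> powr (- s) * rotated_gamma \<sigma> T s w) \<longlongrightarrow>
     - (of_real \<mu> powr (- s) * integral {T..\<mu> * T} (\<lambda>t. of_real t powr (s - 1)))) (quadrant_filter \<sigma>)"
proof (rule Lim_transform_eventually)
  show "((\<lambda>w. - (of_real \<mu> powr (- s) * integral {T..\<mu> * T} (\<lambda>t. exp (- w * of_real t) * of_real t powr (s - 1)))) \<longlongrightarrow>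
     - (of_real \<mu> powr (- s) * integral {T..\<mu> * T} (\<lambda>t. of_real t powr (s - 1)))) (quadrant_filter \<sigma>)"
    by (intro tendsto_intros integral_exp_powr_tendsto assms)
  have "\<forall>\<^sub>F w in quadrant_filter \<sigma>. Re w > 0 \<and> \<sigma> * Im w > 0"
    by (auto simp: eventually_at_filter)
  then show "\<forall>\<^sub>F w in quadrant_filter \<sigma>. - (of_real \<mu> powr (- s) * integral {T..\<mu> * T} (\<lambda>t. exp (- w * of_real t) * of_real t powr (s - 1))) =
     rotated_gamma \<sigma> T s (of_real \<mu> * w) - of_real \<mu> powr (- s) * rotated_gamma \<sigma> T s w"
    by eventually_elim (subst rotated_gamma_scale, use assms in \<open>auto simp: algebra_simps\<close>)
qed

text \<open>Induction on R. If the sum D has the limit L, then so has D (2 w), and D (2 w) - 2^(- S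
  r0) D (w) eliminates the term r0 up to convergent expressions. The other coefficients get
  multiplied by 2^(- S r) - 2^(- S r0), which is not 0 because distinct real parts give distinct
  moduli. Once the other terms are known to converge, r0 converges as the rest of D.\<close>

lemma rotated_gamma_sum_separate:
  assumes "finite R" "inj_on (\<lambda>r. Re (S r)) R"
    and "((\<lambda>w. \<Sum>r\<in>R. b r * rotated_gamma \<sigma> T (S r) w) \<longlongrightarrow> L) (quadrant_filter \<sigma>)"
    and "r \<in> R" "b r \<noteq> 0"
  shows "\<exists>l. (rotated_gamma \<sigma> T (S r) \<longlongrightarrow> l) (quadrant_filter \<sigma>)"
  using assms
proof (induction R arbitrary: b L r rule: finite_induct)
  case empty
  then show ?case by simp
next
  case (insert r0 R)
  let ?E = "\<lambda>r. rotated_gamma \<sigma> T (S r)" and ?F = "quadrant_filter \<sigma>"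
  let ?D = "\<lambda>w. \<Sum>r\<in>insert r0 R. b r * ?E r w"
  let ?c = "\<lambda>r. complex_of_real 2 powr (- S r)"
  have D2: "((\<lambda>w. ?D (of_real 2 * w)) \<longlongrightarrow> L) ?F"
    by (rule filterlim_compose[OF insert.prems(2) filterlim_scale_quadrant]) simp
  let ?l = "\<lambda>r. - (?c r * integral {T..2 * T} (\<lambda>t. of_real t powr (S r - 1)))"
  have "((\<lambda>w. ?D (of_real 2 * w) - ?c r0 * ?D w - (\<Sum>r\<in>insert r0 R. b r * (?E r (of_real 2 * w) - ?c r * ?E r w))) \<longlongrightarrow>
      L - ?c r0 * L - (\<Sum>r\<in>insert r0 R. b r * ?l r)) ?F"
    by (intro tendsto_intros D2 insert.prems(2) rotated_gamma_scale_tendsto) simp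
  also have "(\<lambda>w. ?D (of_real 2 * w) - ?c r0 * ?D w - (\<Sum>r\<in>insert r0 R. b r * (?E r (of_real 2 * w) - ?c r * ?E r w))) =
      (\<lambda>w. \<Sum>r\<in>R. (b r * (?c r - ?c r0)) * ?E r w)"
  proof
    fix w
    have "?D (of_real 2 * w) - ?c r0 * ?D w - (\<Sum>r\<in>insert r0 R. b r * (?E r (of_real 2 * w) - ?c r * ?E r w)) =
       (\<Sum>r\<in>insert r0 R. (b r * (?c r - ?c r0)) * ?E r w)"
      by (simp add: sum_distrib_left sum_subtractf[symmetric] algebra_simps)
    also have "\<dots> = (\<Sum>r\<in>R. (b r * (?c r - ?c r0)) * ?E r w)"
      using insert.hyps by simp
    finally show "?D (of_real 2 * w) - ?c r0 * ?D w - (\<Sum>r\<in>insert r0 R. b r * (?E r (of_real 2 * w) - ?c r * ?E r w)) =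
       (\<Sum>r\<in>R. (b r * (?c r - ?c r0)) * ?E r w)" .
  qed
  finally have lim: "((\<lambda>w. \<Sum>r\<in>R. (b r * (?c r - ?c r0)) * ?E r w) \<longlongrightarrow> L - ?c r0 * L - (\<Sum>r\<in>insert r0 R. b r * ?l r)) ?F" .
  have conv: "\<exists>l. (?E r \<longlongrightarrow> l) ?F" if r: "r \<in> R" "b r \<noteq> 0" for r
  proof (rule insert.IH[OF _ lim r(1)])
    show "inj_on (\<lambda>r. Re (S r)) R" using insert.prems(1) by auto
    have "Re (S r) \<in> (\<lambda>x. Re (S x)) ` R" using r by blast
    then have "Re (S r) \<noteq> Re (S r0)" using insert.prems(1) insert.hyps by auto
    then have "norm (?c r) \<noteq> norm (?c r0)" by (simp add: norm_powr_real_powr powr_inj)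
    then show "b r * (?c r - ?c r0) \<noteq> 0" using r by auto
  qed
  show ?case
  proof (cases "r = r0")
    case False
    then show ?thesis using conv insert.prems by auto
  next
    case True
    from conv obtain l where l: "\<And>r. r \<in> R \<Longrightarrow> b r \<noteq> 0 \<Longrightarrow> (?E r \<longlongrightarrow> l r) ?F" by metis
    have l': "((\<lambda>w. b r * ?E r w) \<longlongrightarrow> b r * l r) ?F" if "r \<in> R" for r
      using l[OF that] by (cases "b r = 0") (auto intro!: tendsto_intros)
    have "((\<lambda>w. (?D w - (\<Sum>r\<in>R. b r * ?E r w)) / b r0) \<longlongrightarrow> (L - (\<Sum>r\<in>R. b r * l r)) / b r0) ?F"
      using insert.prems True by (intro tendsto_intros l' insert.prems(2)) auto
    also have "(\<lambda>w. (?D w - (\<Sum>r\<in>R. b r * ?E r w)) / b r0) = ?E r0"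
      using insert.hyps insert.prems True by auto
    finally show ?thesis using True by blast
  qed
qed

text \<open>By dilation a limit l satisfies l = \<mu>^(- s) (l - I) for every \<mu> at least 1,
  where I is the integral of t^(s - 1) over [T, \<mu> T]. For s = 0 this would make ln (2 T) equal
  to ln T; otherwise any \<mu> with \<mu>^s different from 1 determines l.\<close>

lemma rotated_gamma_limit_unique:
  assumes lim: "(rotated_gamma \<sigma> T s \<longlongrightarrow> l) (quadrant_filter \<sigma>)"
  shows "s \<noteq> 0" "l = - (of_real T powr s) / s"
proof -
  have key: "l = of_real \<mu> powr (- s) * (l - integral {T..\<mu> * T} (\<lambda>t. of_real t powr (s - 1)))" if \<mu>: "\<mu> \<ge> 1" for \<mu> :: real
  proof -
    have "((\<lambda>w. rotated_gamma \<sigma> T s (of_real \<mu> * w)) \<longlongrightarrow> l) (quadrant_filter \<sigma>)"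
      by (rule filterlim_compose[OF lim filterlim_scale_quadrant]) (use \<mu> in simp)
    then have "((\<lambda>w. rotated_gamma \<sigma> T s (of_real \<mu> * w) - of_real \<mu> powr (- s) * rotated_gamma \<sigma> T s w) \<longlongrightarrow> l - of_real \<mu> powr (- s) * l) (quadrant_filter \<sigma>)"
      by (intro tendsto_intros lim)
    from tendsto_unique[OF quadrant_filter_neq_bot this rotated_gamma_scale_tendsto[OF \<mu>]]
    show ?thesis by (simp add: algebra_simps)
  qed
  have P: "((\<lambda>t. complex_of_real t powr (s - 1)) has_integral \<Phi> (of_real (\<mu> * T)) - \<Phi> (of_real T)) {T..\<mu> * T}"
    if "\<mu> \<ge> 1" and D: "\<And>z. Re z > 0 \<Longrightarrow> (\<Phi> has_field_derivative z powr (s - 1)) (at z)" for \<mu> :: real and \<Phi>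
    using integral_complex_primitive[of T "\<mu> * T" \<Phi> "\<lambda>z. z powr (s - 1)" 0 1] that T by auto
  show s0: "s \<noteq> 0"
  proof
    assume "s = 0"
    have "((\<lambda>t. complex_of_real t powr (s - 1)) has_integral Ln (of_real (2 * T)) - Ln (of_real T)) {T..2 * T}"
      using \<open>s = 0\<close> by (intro P) (auto intro!: derivative_eq_intros simp: complex_nonpos_Reals_iff powr_minus field_simps)
    from integral_unique[OF this] key[of 2] \<open>s = 0\<close> have "Ln (of_real (2 * T)) = Ln (complex_of_real T)" by simp
    then have "complex_of_real (ln (2 * T)) = of_real (ln T)"
      using T Ln_of_real[of "2 * T"] Ln_of_real[of T] by simp
    then show False using T by (simp only: of_real_eq_iff) simp
  qed
  have D: "((\<lambda>z. z powr s / s) has_field_derivative z powr (s - 1)) (at z)" if "Re z > 0" for z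
    using that s0 by (auto intro!: derivative_eq_intros simp: complex_nonpos_Reals_iff)
  have eq: "(of_real \<mu> powr s - 1) * (l + of_real T powr s / s) = 0" if \<mu>: "\<mu> \<ge> 1" for \<mu> :: real
  proof -
    have "integral {T..\<mu> * T} (\<lambda>t. complex_of_real t powr (s - 1)) = (of_real \<mu> powr s - 1) * (of_real T powr s / s)"
      using integral_unique[OF P[OF \<mu> D]] T \<mu> s0 by (simp add: powr_times_real field_simps)
    with key[OF \<mu>] have "of_real \<mu> powr s * l = l - (of_real \<mu> powr s - 1) * (of_real T powr s / s)"
      using \<mu> by (simp add: powr_minus field_simps)
    then show ?thesis by (simp add: algebra_simps)
  qed
  have "\<exists>\<mu>\<ge>1. complex_of_real \<mu> powr s \<noteq> 1"
  proof (cases "Re s = 0")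
    case False
    then have "norm (complex_of_real 2 powr s) \<noteq> 1"
      by (simp add: norm_powr_real_powr)
    then show ?thesis by (intro exI[of _ 2]) auto
  next
    case True
    then have im: "Im s \<noteq> 0" using s0 by (auto simp: complex_eq_iff)
    \<comment> \<open>For purely imaginary s all \<mu>^s have modulus 1, so \<mu> is chosen by its
      argument: \<mu> = exp (pi / |Im s|) gives \<mu>^s = - 1.\<close>
    let ?x = "pi / \<bar>Im s\<bar>"
    have "complex_of_real (exp ?x) powr s = exp (s * of_real ?x)"
      by (simp add: powr_def Ln_of_real)
    also have "Re (exp (s * of_real ?x)) = cos (Im s * ?x)"
      using True by (simp add: Re_exp)
    also have "Im s * ?x = sgn (Im s) * pi" by (simp add: sgn_if)
    also have "cos (sgn (Im s) * pi) = -1" using im by (simp add: sgn_if)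
    finally have "Re (complex_of_real (exp ?x) powr s) = -1" .
    then show ?thesis by (intro exI[of _ "exp ?x"] conjI) auto
  qed
  then obtain \<mu> where "\<mu> \<ge> 1" "complex_of_real \<mu> powr s \<noteq> 1" by blast
  with eq[of \<mu>] have "l + of_real T powr s / s = 0" by simp
  then show "l = - (of_real T powr s) / s" by (simp add: eq_neg_iff_add_eq_0)
qed

text \<open>Wherever a combination converges at all, each term with nonzero coefficient does, and to
  the value known from Re s < 0. This makes the regularized integral agree with the continued
  formula also outside the half-plane where its existence is guaranteed.\<close>

lemma rotated_gamma_sum_limit:
  assumes "finite R" "inj_on (\<lambda>r. Re (S r)) R"
    and lim: "((\<lambda>w. \<Sum>r\<in>R. b r * rotated_gamma \<sigma> T (S r) w) \<longlongrightarrow> L) (quadrant_filter \<sigma>)"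
  shows "\<forall>r\<in>R. b r \<noteq> 0 \<longrightarrow> S r \<noteq> 0" "L = - (\<Sum>r\<in>R. b r * (of_real T powr S r / S r))"
proof -
  have *: "S r \<noteq> 0 \<and> (rotated_gamma \<sigma> T (S r) \<longlongrightarrow> - (of_real T powr S r) / S r) (quadrant_filter \<sigma>)" if "r \<in> R" "b r \<noteq> 0" for r
    using rotated_gamma_sum_separate[OF assms that] rotated_gamma_limit_unique by blast
  then show "\<forall>r\<in>R. b r \<noteq> 0 \<longrightarrow> S r \<noteq> 0" by blast
  have "((\<lambda>w. b r * rotated_gamma \<sigma> T (S r) w) \<longlongrightarrow> b r * (- (of_real T powr S r) / S r)) (quadrant_filter \<sigma>)" if "r \<in> R" for r
    using tendsto_mult[OF tendsto_const[of "b r"] conjunct2[OF *[OF that]]] by (cases "b r = 0") auto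
  then have "((\<lambda>w. \<Sum>r\<in>R. b r * rotated_gamma \<sigma> T (S r) w) \<longlongrightarrow> (\<Sum>r\<in>R. b r * (- (of_real T powr S r) / S r))) (quadrant_filter \<sigma>)"
    by (rule tendsto_sum)
  from tendsto_unique[OF quadrant_filter_neq_bot lim this]
  show "L = - (\<Sum>r\<in>R. b r * (of_real T powr S r / S r))" by (simp add: sum_negf)
qed

end

section \<open>Fourier expansions\<close>

abbreviation nome :: "complex \<Rightarrow> complex" where
  "nome \<tau> \<equiv> exp (2 * of_real pi * \<i> * \<tau>)"

text \<open>Multiplication by a power of the nome turns the Laurent expansion into a power series.
  The exponent N is free above a bound, so that two expansions can be brought to the same N.\<close>

lemma fourier_expansion_power_series:
  assumes "has_fourier_expansion f a"
  obtains N0 T where "\<And>N n. N \<ge> N0 \<Longrightarrow> n < - int N \<Longrightarrow> a n = 0"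
    "\<And>N \<tau>. N \<ge> N0 \<Longrightarrow> Im \<tau> > T \<Longrightarrow> (\<lambda>m. a (int m - int N) * nome \<tau> ^ m) sums (nome \<tau> ^ N * f \<tau>)"
proof -
  from assms obtain N1 T where a0: "\<And>n. n < - N1 \<Longrightarrow> a n = 0"
    and sum: "\<And>\<tau>. Im \<tau> > T \<Longrightarrow> ((\<lambda>n. a n * exp (2 * of_real pi * \<i> * of_int n * \<tau>)) has_sum f \<tau>) {- N1..}"
    unfolding has_fourier_expansion_def by blast
  have "(\<lambda>m. a (int m - int N) * nome \<tau> ^ m) sums (nome \<tau> ^ N * f \<tau>)"
    if N: "N \<ge> nat N1" and \<tau>: "Im \<tau> > T" for N \<tau>
  proof -
    let ?g = "\<lambda>n. a n * exp (2 * of_real pi * \<i> * of_int n * \<tau>)"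
    have "(?g has_sum f \<tau>) {- int N..} = (?g has_sum f \<tau>) {- N1..}"
      by (rule has_sum_cong_neutral) (use a0 N in auto)
    with sum[OF \<tau>] have "(?g has_sum f \<tau>) {- int N..}" by simp
    moreover have "bij_betw (\<lambda>m. int m - int N) UNIV {- int N..}"
      by (rule bij_betwI[where g = "\<lambda>n. nat (n + int N)"]) auto
    ultimately have "((\<lambda>m. ?g (int m - int N)) has_sum f \<tau>) UNIV"
      by (subst has_sum_reindex_bij_betw)
    then have "(\<lambda>m. ?g (int m - int N)) sums f \<tau>" by (rule has_sum_imp_sums)
    then have "(\<lambda>m. nome \<tau> ^ N * ?g (int m - int N)) sums (nome \<tau> ^ N * f \<tau>)" by (rule sums_mult)
    moreover have "nome \<tau> ^ N * ?g (int m - int N) = a (int m - int N) * nome \<tau> ^ m" for m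
    proof -
      have "exp (2 * of_real pi * \<i> * of_int (int m - int N) * \<tau>) = nome \<tau> ^ m / nome \<tau> ^ N"
        by (simp add: exp_diff exp_of_nat_mult[symmetric] algebra_simps)
      then show ?thesis by simp
    qed
    ultimately show ?thesis by (simp only:)
  qed
  note claim = this
  show thesis
  proof (rule that[of "nat N1" T])
    show "a n = 0" if "nat N1 \<le> N" "n < - int N" for N n
      using a0[of n] that by auto
  qed (rule claim)
qed

lemma nome_surj:
  assumes "q \<noteq> 0" "norm q < exp (- 2 * pi * T)"
  obtains \<tau> where "nome \<tau> = q" "Im \<tau> > T"
proof
  let ?\<tau> = "Ln q / (2 * of_real pi * \<i>)"
  show "nome ?\<tau> = q" using assms by simp
  have "ln (norm q) < ln (exp (- 2 * pi * T))"
    using assms by (subst ln_less_cancel_iff) auto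
  then have "ln (norm q) < - 2 * pi * T" by simp
  moreover have "Im ?\<tau> = - ln (norm q) / (2 * pi)"
    using assms by (simp add: Im_divide power2_eq_square field_simps)
  moreover have "T < - ln (norm q) / (2 * pi) \<longleftrightarrow> ln (norm q) < - 2 * pi * T"
    by (subst pos_less_divide_eq) (auto simp: mult_ac)
  ultimately show "Im ?\<tau> > T" by (simp only:)
qed

lemma fourier_expansion_unique:
  assumes "has_fourier_expansion f a" "has_fourier_expansion f a'"
  shows "a = a'"
proof -
  obtain N1 T1 where 1: "\<And>N n. N \<ge> N1 \<Longrightarrow> n < - int N \<Longrightarrow> a n = 0"
     "\<And>N \<tau>. N \<ge> N1 \<Longrightarrow> Im \<tau> > T1 \<Longrightarrow> (\<lambda>m. a (int m - int N) * nome \<tau> ^ m) sums (nome \<tau> ^ N * f \<tau>)" by (rule fourier_expansion_power_series[OF assms(1)]) (rule that)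
  obtain N2 T2 where 2: "\<And>N n. N \<ge> N2 \<Longrightarrow> n < - int N \<Longrightarrow> a' n = 0"
     "\<And>N \<tau>. N \<ge> N2 \<Longrightarrow> Im \<tau> > T2 \<Longrightarrow> (\<lambda>m. a' (int m - int N) * nome \<tau> ^ m) sums (nome \<tau> ^ N * f \<tau>)" by (rule fourier_expansion_power_series[OF assms(2)]) (rule that)
  define N where "N = max N1 N2"
  define T where "T = max T1 T2"
  define b where "b = (\<lambda>m. a (int m - int N) - a' (int m - int N))"
  have b_sums: "(\<lambda>m. b m * q ^ m) sums 0" if q: "q \<noteq> 0" "norm q < exp (- 2 * pi * T)" for q
  proof -
    obtain \<tau> where \<tau>: "nome \<tau> = q" "Im \<tau> > T" using nome_surj[OF q] by blast
    have "(\<lambda>m. a (int m - int N) * nome \<tau> ^ m - a' (int m - int N) * nome \<tau> ^ m) sums (nome \<tau> ^ N * f \<tau> - nome \<tau> ^ N * f \<tau>)"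
      by (rule sums_diff) (use 1(2)[of N \<tau>] 2(2)[of N \<tau>] \<tau> in \<open>auto simp: N_def T_def\<close>)
    then show ?thesis unfolding \<tau>(1) by (simp add: b_def left_diff_distrib)
  qed
  \<comment> \<open>The nome never takes the value 0, so b 0 is obtained as a limit. Only then does
    the series sum to 0 on a full disc, as \<open>powser_0_nonzero\<close> requires.\<close>
  have "((\<lambda>_. 0) \<longlongrightarrow> b 0) (at (0::complex))"
    by (rule powser_limit_0_strong[OF exp_gt_zero b_sums])
  then have b0: "b 0 = 0" using LIM_const_eq by fastforce
  have bm: "b m = 0" for m
  proof (rule ccontr)
    assume "b m \<noteq> 0"
    then have "m > 0" using b0 by (cases m) auto
    have sm: "(\<lambda>n. b n * (q - 0) ^ n) sums (\<lambda>_. 0) q" if "norm (q - 0) < exp (- 2 * pi * T)" for q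
      using b_sums[of q] powser_sums_zero[of b] b0 that by (cases "q = 0") auto
    obtain s where s: "0 < s" "\<And>z::complex. z \<in> cball 0 s - {0} \<Longrightarrow> (0::complex) \<noteq> 0"
      by (rule powser_0_nonzero[OF exp_gt_zero sm refl \<open>b m \<noteq> 0\<close> \<open>m > 0\<close>]) blast+
    from s(2)[of "of_real s"] s(1) show False by auto
  qed
  show ?thesis
  proof
    fix n
    show "a n = a' n"
    proof (cases "n < - int N")
      case True
      then show ?thesis using 1(1)[of N n] 2(1)[of N n] by (auto simp: N_def)
    next
      case False
      then show ?thesis using bm[of "nat (n + int N)"] by (auto simp: b_def)
    qed
  qed
qed

lemma fourier_coeff_eqI: "has_fourier_expansion f a \<Longrightarrow> fourier_coeff f = a"
  unfolding fourier_coeff_def using fourier_expansion_unique by blast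

lemma has_fourier_expansion_fourier_coeff:
  "meromorphic_at_infinity f \<Longrightarrow> has_fourier_expansion f (fourier_coeff f)"
  unfolding meromorphic_at_infinity_def using fourier_coeff_eqI by auto

lemma fourier_coeff_0 [simp]: "fourier_coeff (\<lambda>_. 0) n = 0"
proof -
  have "has_fourier_expansion (\<lambda>_. 0) (\<lambda>_. 0)"
    unfolding has_fourier_expansion_def by (simp add: has_sum_0)
  from fourier_coeff_eqI[OF this] show ?thesis by simp
qed

lemma has_fourier_expansion_cong:
  assumes "\<And>\<tau>. Im \<tau> > 0 \<Longrightarrow> f \<tau> = g \<tau>"
  shows "has_fourier_expansion f a = has_fourier_expansion g a"
proof -
  have "has_fourier_expansion g a" if fa: "has_fourier_expansion f a"
    and eq: "\<And>\<tau>. Im \<tau> > 0 \<Longrightarrow> f \<tau> = g \<tau>" for f g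
  proof -
    from fa obtain N T where "\<forall>n < - N. a n = 0"
      "\<forall>\<tau>. Im \<tau> > T \<longrightarrow> ((\<lambda>n. a n * exp (2 * of_real pi * \<i> * of_int n * \<tau>)) has_sum f \<tau>) {- N..}"
      unfolding has_fourier_expansion_def by blast
    then show ?thesis
      unfolding has_fourier_expansion_def using eq
      by (intro exI[of _ N] exI[of _ "max T 0"]) auto
  qed
  from this[of f g] this[of g f] assms show ?thesis by auto
qed

text \<open>The splitting is made for complex z because the ray of integration will be turned. The
  positive powers of the nome q form q P(q) with P bounded on each smaller closed disc, which gives
  decay exp (- 2 pi Re z) uniformly in Im z.\<close>

lemma fourier_decomposition:
  assumes "has_fourier_expansion f a"
  obtains N T h where "T \<ge> 1" "h holomorphic_on {z. Re z > T}"
    "\<And>T1. T1 > T \<Longrightarrow> \<exists>M. \<forall>z. Re z \<ge> T1 \<longrightarrow> norm (h z) \<le> M * exp (- 2 * pi * Re z)"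
    "\<And>z. Re z > T \<Longrightarrow> f (\<i> * z) = (\<Sum>n=1..N. a (- int n) * exp (of_real (2 * pi * real n) * z)) + a 0 + h z"
proof -
  obtain N T0 where
    "\<And>N' n. N' \<ge> N \<Longrightarrow> n < - int N' \<Longrightarrow> a n = 0" and
    sums0': "\<And>N' \<tau>. N' \<ge> N \<Longrightarrow> Im \<tau> > T0 \<Longrightarrow> (\<lambda>m. a (int m - int N') * nome \<tau> ^ m) sums (nome \<tau> ^ N' * f \<tau>)"
    by (rule fourier_expansion_power_series[OF assms]) (rule that)
  note sums0 = sums0'[OF order_refl]
  define T where "T = max T0 1"
  define \<rho> where "\<rho> = exp (- 2 * pi * T)"
  define P where "P = (\<lambda>q. \<Sum>m. a (int m + 1) * q ^ m)"
  have sumsP: "(\<lambda>m. a (int m + 1) * q ^ m) sums P q" if nq: "norm q < \<rho>" for q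
  proof (cases "q = 0")
    case True
    have "(\<lambda>m. a (int m + 1) * 0 ^ m) sums a (int 0 + 1)" by (rule powser_sums_zero)
    from this sums_unique[OF this] show ?thesis unfolding P_def True by (simp only:)
  next
    case False
    obtain \<tau> where \<tau>: "nome \<tau> = q" "Im \<tau> > T" using nome_surj[OF False nq[unfolded \<rho>_def]] by blast
    from sums0[of \<tau>] \<tau> have "summable (\<lambda>m. a (int m - int N) * q ^ m)"
      by (auto simp: T_def sums_iff)
    \<comment> \<open>Dropping N + 1 terms, and not N, removes the constant coefficient as well and
      leaves exactly the positive indices.\<close>
    then have "summable (\<lambda>m. a (int (m + (N + 1)) - int N) * q ^ (m + (N + 1)))"
      by (rule summable_ignore_initial_segment)
    then have "summable (\<lambda>m. inverse (q ^ (N + 1)) * (a (int (m + (N + 1)) - int N) * q ^ (m + (N + 1))))"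
      by (rule summable_mult)
    also have "(\<lambda>m. inverse (q ^ (N + 1)) * (a (int (m + (N + 1)) - int N) * q ^ (m + (N + 1)))) = (\<lambda>m. a (int m + 1) * q ^ m)"
      using False by (auto simp: power_add field_simps)
    finally show ?thesis unfolding P_def by (rule summable_sums)
  qed
  have holP: "P holomorphic_on ball 0 \<rho>"
    by (rule power_series_holomorphic[where a = "\<lambda>m. a (int m + 1)"]) (use sumsP in auto)
  define h where "h = (\<lambda>z. exp (- of_real (2 * pi) * z) * P (exp (- of_real (2 * pi) * z)))"
  show ?thesis
  proof (rule that[of T h N])
    show "T \<ge> 1" by (simp add: T_def)
    show "h holomorphic_on {z. Re z > T}"
    proof -
      have "(\<lambda>z. P (exp (- of_real (2 * pi) * z))) holomorphic_on {z. Re z > T}"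
        by (rule holomorphic_on_compose_gen[OF _ holP, unfolded o_def])
           (auto intro!: holomorphic_intros simp: \<rho>_def)
      then show ?thesis unfolding h_def by (intro holomorphic_intros)
    qed
    show "\<exists>M. \<forall>z. Re z \<ge> T1 \<longrightarrow> norm (h z) \<le> M * exp (- 2 * pi * Re z)" if "T1 > T" for T1
    proof -
      have "compact (cball (0::complex) (exp (- 2 * pi * T1)))" by simp
      moreover have "cball (0::complex) (exp (- 2 * pi * T1)) \<subseteq> ball 0 \<rho>"
      proof -
        have "exp (- 2 * pi * T1) < \<rho>" using that by (simp add: \<rho>_def)
        then show ?thesis by auto
      qed
      then have "continuous_on (cball 0 (exp (- 2 * pi * T1))) P"
        using holP holomorphic_on_imp_continuous_on continuous_on_subset by blast
      ultimately have "compact (P ` cball 0 (exp (- 2 * pi * T1)))" by (rule compact_continuous_image[rotated])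
      then obtain M where M: "\<And>q. q \<in> cball 0 (exp (- 2 * pi * T1)) \<Longrightarrow> norm (P q) \<le> M"
        using compact_imp_bounded by (force simp: bounded_iff)
      have "norm (h z) \<le> M * exp (- 2 * pi * Re z)" if "Re z \<ge> T1" for z
      proof -
        have "norm (P (exp (- of_real (2 * pi) * z))) \<le> M" by (rule M) (use that in simp)
        then show ?thesis unfolding h_def norm_mult by (simp add: mult.commute)
      qed
      then show ?thesis by blast
    qed
    fix z assume z: "Re z > T"
    let ?q = "exp (- of_real (2 * pi) * z)"
    have q: "nome (\<i> * z) = ?q" "?q \<noteq> 0" by (simp_all add: algebra_simps)
    have nq: "norm ?q < \<rho>" using z by (simp add: \<rho>_def)
    have "(\<lambda>m. a (int m - int N) * ?q ^ m) sums (?q ^ N * f (\<i> * z))"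
      using sums0[of "\<i> * z"] z unfolding q by (auto simp: T_def)
    moreover have "(\<lambda>m. a (int m - int N) * ?q ^ m) sums (?q ^ (N + 1) * P ?q + (\<Sum>m<N+1. a (int m - int N) * ?q ^ m))"
    proof (subst sums_iff_shift[symmetric])
      have "(\<lambda>m. ?q ^ (N + 1) * (a (int m + 1) * ?q ^ m)) sums (?q ^ (N + 1) * P ?q)"
        by (rule sums_mult[OF sumsP[OF nq]])
      moreover have "(\<lambda>m. ?q ^ (N + 1) * (a (int m + 1) * ?q ^ m)) = (\<lambda>m. a (int (m + (N + 1)) - int N) * ?q ^ (m + (N + 1)))"
        by (auto simp: power_add algebra_simps)
      ultimately show "(\<lambda>m. a (int (m + (N + 1)) - int N) * ?q ^ (m + (N + 1))) sums (?q ^ (N + 1) * P ?q)" by simp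
    qed
    ultimately have "?q ^ N * f (\<i> * z) = ?q ^ (N + 1) * P ?q + (\<Sum>m<N+1. a (int m - int N) * ?q ^ m)"
      using sums_unique2 by blast
    also have "(\<Sum>m<N+1. a (int m - int N) * ?q ^ m) = (\<Sum>n<N+1. a (- int n) * ?q ^ (N - n))"
      by (subst sum.nat_diff_reindex[symmetric]) (auto intro!: sum.cong)
    also have "\<dots> = (\<Sum>n<N+1. ?q ^ N * (a (- int n) * exp (of_real (2 * pi * real n) * z)))"
    proof (rule sum.cong[OF refl])
      fix n assume "n \<in> {..<N+1}"
      then have "?q ^ N = ?q ^ (N - n) * ?q ^ n" by (simp flip: power_add)
      moreover have "?q ^ n * exp (of_real (2 * pi * real n) * z) = 1"
        by (simp add: exp_of_nat_mult[symmetric] flip: exp_add)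
      ultimately show "a (- int n) * ?q ^ (N - n) = ?q ^ N * (a (- int n) * exp (of_real (2 * pi * real n) * z))"
        by (simp add: mult_ac)
    qed
    also have "\<dots> = ?q ^ N * (\<Sum>n<N+1. a (- int n) * exp (of_real (2 * pi * real n) * z))"
      by (rule sum_distrib_left[symmetric])
    also have "{..<N+1} = insert 0 {1..N}" by auto
    also have "(\<Sum>n\<in>insert 0 {1..N}. a (- int n) * exp (of_real (2 * pi * real n) * z)) = a 0 + (\<Sum>n=1..N. a (- int n) * exp (of_real (2 * pi * real n) * z))"
      by (subst sum.insert) auto
    finally have "?q ^ N * f (\<i> * z) = ?q ^ N * ((\<Sum>n=1..N. a (- int n) * exp (of_real (2 * pi * real n) * z)) + a 0 + h z)"
      by (simp add: h_def algebra_simps)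
    then show "f (\<i> * z) = (\<Sum>n=1..N. a (- int n) * exp (of_real (2 * pi * real n) * z)) + a 0 + h z"
      by simp
  qed
qed

section \<open>Regularized integrals at infinity\<close>

text \<open>The witnesses of \<open>has_reg_integral_inf\<close> are made explicit and the limit at
  0 is left out, so that continuations can be added and compared even when the limits of the single
  terms do not exist.\<close>

definition has_laplace_continuation ::
  "real \<Rightarrow> (real \<Rightarrow> complex) \<Rightarrow> real \<Rightarrow> real \<Rightarrow> (complex \<Rightarrow> complex) \<Rightarrow> bool" where
  "has_laplace_continuation \<sigma> g t0 C F \<longleftrightarrow>
     F holomorphic_on {w. Re w > C \<or> \<sigma> * Im w > 0} \<and>
        (\<forall>w. Re w > C \<longrightarrow>
           (\<lambda>t. exp (- w * of_real t) * g t) absolutely_integrable_on {t0..} \<and>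
           F w = integral {t0..} (\<lambda>t. exp (- w * of_real t) * g t))"

lemma has_reg_integral_inf_iff:
  "has_reg_integral_inf \<sigma> g t0 v \<longleftrightarrow>
     (\<exists>C F. has_laplace_continuation \<sigma> g t0 C F \<and> (F \<longlongrightarrow> v) (at 0 within {w. \<sigma> * Im w > 0}))"
  unfolding has_reg_integral_inf_def has_laplace_continuation_def by blast

lemma laplace_continuation_mono:
  assumes "has_laplace_continuation \<sigma> g t0 C F" "C \<le> C'"
  shows "has_laplace_continuation \<sigma> g t0 C' F"
  using assms unfolding has_laplace_continuation_def
  by (auto intro: holomorphic_on_subset)

lemma laplace_continuation_cong:
  assumes "has_laplace_continuation \<sigma> g t0 C F" "\<And>t. t \<ge> t0 \<Longrightarrow> g t = g' t"
  shows "has_laplace_continuation \<sigma> g' t0 C F"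
proof -
  have "(\<lambda>t. exp (- w * of_real t) * g t) absolutely_integrable_on {t0..} \<longleftrightarrow>
        (\<lambda>t. exp (- w * of_real t) * g' t) absolutely_integrable_on {t0..}" for w
    by (rule set_integrable_cong) (use assms in auto)
  moreover have "integral {t0..} (\<lambda>t. exp (- w * of_real t) * g t) = integral {t0..} (\<lambda>t. exp (- w * of_real t) * g' t)" for w
    by (rule integral_cong) (use assms in auto)
  ultimately show ?thesis using assms(1) unfolding has_laplace_continuation_def by simp
qed

lemma laplace_continuation_add:
  assumes "has_laplace_continuation \<sigma> f t0 C F" "has_laplace_continuation \<sigma> g t0 D G"
  shows "has_laplace_continuation \<sigma> (\<lambda>t. f t + g t) t0 (max C D) (\<lambda>w. F w + G w)"
proof -
  have F: "has_laplace_continuation \<sigma> f t0 (max C D) F" and G: "has_laplace_continuation \<sigma> g t0 (max C D) G"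
    using assms by (auto intro: laplace_continuation_mono)
  show ?thesis
    using F G unfolding has_laplace_continuation_def distrib_left
    by (auto intro!: holomorphic_intros set_integral_add integral_add[symmetric] set_lebesgue_integral_eq_integral(1))
qed

lemma laplace_continuation_cmult:
  assumes "has_laplace_continuation \<sigma> f t0 C F"
  shows "has_laplace_continuation \<sigma> (\<lambda>t. c * f t) t0 C (\<lambda>w. c * F w)"
  using assms unfolding has_laplace_continuation_def mult.left_commute[of _ c]
  by (auto intro!: holomorphic_intros set_integrable_mult_right)

lemma laplace_continuation_zero: "has_laplace_continuation \<sigma> (\<lambda>t. 0) t0 C (\<lambda>w. 0)"
  unfolding has_laplace_continuation_def by (auto simp: set_integrable_def)

lemma laplace_continuation_sum:
  assumes "finite R" "\<And>r. r \<in> R \<Longrightarrow> has_laplace_continuation \<sigma> (f r) t0 (C r) (F r)"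
  shows "\<exists>D. has_laplace_continuation \<sigma> (\<lambda>t. \<Sum>r\<in>R. f r t) t0 D (\<lambda>w. \<Sum>r\<in>R. F r w)"
  using assms
proof (induction R rule: finite_induct)
  case empty
  then show ?case using laplace_continuation_zero by auto
next
  case (insert x R)
  then obtain D where "has_laplace_continuation \<sigma> (\<lambda>t. \<Sum>r\<in>R. f r t) t0 D (\<lambda>w. \<Sum>r\<in>R. F r w)" by auto
  from laplace_continuation_add[OF _ this, of "f x" "C x" "F x"] insert show ?case by auto
qed

text \<open>Identity theorem on the union of the two half-planes, which is connected because they
  meet. Hence any witness of \<open>has_reg_integral_inf\<close> can be replaced by a continuation
  constructed by hand when limits at 0 are studied.\<close>

lemma laplace_continuation_unique:
  assumes "\<sigma> = 1 \<or> \<sigma> = -1"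
    and "has_laplace_continuation \<sigma> g t0 C F" "has_laplace_continuation \<sigma> g t0 D G" and "\<sigma> * Im w > 0"
  shows "F w = G w"
proof -
  define E where "E = max C D"
  have F: "has_laplace_continuation \<sigma> g t0 E F" and G: "has_laplace_continuation \<sigma> g t0 E G"
    using assms by (auto intro: laplace_continuation_mono simp: E_def)
  let ?A = "{w. Re w > E}" and ?B = "{w. \<sigma> * Im w > 0}"
  have u: "{w. Re w > E \<or> \<sigma> * Im w > 0} = ?A \<union> ?B" by auto
  have oA: "open ?A" by (rule open_halfspace_Re_gt)
  have oB: "open ?B" by (intro open_Collect_less continuous_intros)
  have "convex ?B" using assms(1) convex_halfspace_Im_gt[of 0] convex_halfspace_Im_lt[of 0] by auto
  have ne: "Complex (E + 1) \<sigma> \<in> ?A \<inter> ?B" using assms(1) by auto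
  show ?thesis
  proof (rule analytic_continuation_open[of ?A "?A \<union> ?B" F G w])
    show "connected (?A \<union> ?B)"
    proof -
      have "?A \<inter> ?B \<noteq> {}" using ne by blast
      then show ?thesis
        by (rule connected_Un[OF convex_connected[OF convex_halfspace_Re_gt] convex_connected[OF \<open>convex ?B\<close>]])
    qed
    show "?A \<noteq> {}" using ne by blast
    show "F holomorphic_on ?A \<union> ?B" "G holomorphic_on ?A \<union> ?B"
      using F G unfolding has_laplace_continuation_def u by auto
    show "F z = G z" if "z \<in> ?A" for z
      using F G that unfolding has_laplace_continuation_def by auto
  qed (use oA oB assms in auto)
qed

lemma integral_exp_tendsto:
  assumes g: "continuous_on {a..b} g"
  shows "((\<lambda>w. integral {a..b} (\<lambda>t. exp (- w * of_real t) * g t)) \<longlongrightarrow> integral {a..b} g) (at 0 within S)"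
    and "(\<lambda>w. integral {a..b} (\<lambda>t. exp (- w * of_real t) * g t)) holomorphic_on U"
proof -
  have hol: "(\<lambda>w. integral {a..b} (\<lambda>t. exp (- w * of_real t) * g t)) holomorphic_on U" for U
  proof -
    have "continuous_on {a..b} (\<lambda>t. - complex_of_real t)" by (intro continuous_intros)
    from holomorphic_integral_exp_kernel[OF this g, of U] show ?thesis by simp
  qed
  show "(\<lambda>w. integral {a..b} (\<lambda>t. exp (- w * of_real t) * g t)) holomorphic_on U" by (rule hol)
  have "isCont (\<lambda>w. integral {a..b} (\<lambda>t. exp (- w * of_real t) * g t)) 0"
    using holomorphic_on_imp_continuous_on[OF hol[of UNIV]] by (simp add: continuous_on_eq_continuous_at)
  then have "((\<lambda>w. integral {a..b} (\<lambda>t. exp (- w * of_real t) * g t)) \<longlongrightarrow> integral {a..b} g) (at 0)"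
    unfolding isCont_def by simp
  then show "((\<lambda>w. integral {a..b} (\<lambda>t. exp (- w * of_real t) * g t)) \<longlongrightarrow> integral {a..b} g) (at 0 within S)"
    by (rule tendsto_within_subset) auto
qed

text \<open>Moving the lower end point changes the continuation by an integral over a bounded
  interval, which is entire in w and tends to the plain integral of g as w tends to 0.\<close>

lemma laplace_continuation_extend_left:
  assumes F: "has_laplace_continuation \<sigma> g X C F" and "a \<le> X" and g: "continuous_on {a..X} g"
  shows "has_laplace_continuation \<sigma> g a C (\<lambda>w. integral {a..X} (\<lambda>t. exp (- w * of_real t) * g t) + F w)"
  unfolding has_laplace_continuation_def
proof (intro conjI allI impI)
  show "(\<lambda>w. integral {a..X} (\<lambda>t. exp (- w * of_real t) * g t) + F w) holomorphic_on {w. C < Re w \<or> 0 < \<sigma> * Im w}"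
    using F unfolding has_laplace_continuation_def by (intro holomorphic_intros integral_exp_tendsto(2) g) auto
  fix w assume w: "C < Re w"
  let ?f = "\<lambda>t. exp (- w * of_real t) * g t"
  have 1: "?f absolutely_integrable_on {X..}" and 2: "F w = integral {X..} ?f"
    using F w unfolding has_laplace_continuation_def by auto
  have 3: "?f absolutely_integrable_on {a..X}"
    by (rule absolutely_integrable_continuous_real) (intro continuous_intros g)
  have "{a..} = {a..X} \<union> {X..}" using assms(2) by auto
  then show ab: "?f absolutely_integrable_on {a..}"
    using set_integrable_Un[OF 3 1] by simp
  show "integral {a..X} ?f + F w = integral {a..} ?f"
    using integral_Ici_split[OF ab assms(2)] 2 by simp
qed

lemma laplace_continuation_restrict:
  assumes F: "has_laplace_continuation \<sigma> g a C F" and "a \<le> X" and g: "continuous_on {a..X} g"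
  shows "has_laplace_continuation \<sigma> g X C (\<lambda>w. F w - integral {a..X} (\<lambda>t. exp (- w * of_real t) * g t))"
  unfolding has_laplace_continuation_def
proof (intro conjI allI impI)
  show "(\<lambda>w. F w - integral {a..X} (\<lambda>t. exp (- w * of_real t) * g t)) holomorphic_on {w. C < Re w \<or> 0 < \<sigma> * Im w}"
    using F unfolding has_laplace_continuation_def by (intro holomorphic_intros integral_exp_tendsto(2) g) auto
  fix w assume w: "C < Re w"
  let ?f = "\<lambda>t. exp (- w * of_real t) * g t"
  have 1: "?f absolutely_integrable_on {a..}" and 2: "F w = integral {a..} ?f"
    using F w unfolding has_laplace_continuation_def by auto
  show ab: "?f absolutely_integrable_on {X..}"
    by (rule set_integrable_subset[OF 1]) (use assms in auto)
  show "F w - integral {a..X} ?f = integral {X..} ?f"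
    using integral_Ici_split[OF 1 assms(2)] 2 by simp
qed

section \<open>Entire dependence on s of regularized integrals of Fourier expansions\<close>

context
  fixes \<sigma> T :: real
  assumes \<sigma>: "\<sigma> = 1 \<or> \<sigma> = -1" and T: "1 \<le> T"
begin

abbreviation (input) boundary_filter :: "complex filter" where
  "boundary_filter \<equiv> at 0 within {w. \<sigma> * Im w > 0}"

text \<open>The zeroth Fourier coefficient is split off because its contribution \<open>rotated_gamma\<close>
  has no limit at \<open>0\<close> for \<open>Re s \<ge> 0\<close>.\<close>
definition laplace_limit :: "(real \<Rightarrow> complex) \<Rightarrow> complex \<Rightarrow> (complex \<Rightarrow> complex) \<Rightarrow> bool" where
  "laplace_limit g b J \<longleftrightarrow> J holomorphic_on UNIV \<and>
     (\<forall>s. \<exists>C F. has_laplace_continuation \<sigma> (\<lambda>t. g t * of_real t powr (s - 1)) T C F \<and>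
        ((\<lambda>w. F w - b * rotated_gamma \<sigma> T s w) \<longlongrightarrow> J s) boundary_filter)"

lemma laplace_limit_add:
  assumes "laplace_limit g b J" "laplace_limit g' b' J'"
  shows "laplace_limit (\<lambda>t. g t + g' t) (b + b') (\<lambda>s. J s + J' s)"
  unfolding laplace_limit_def
proof (intro conjI allI)
  show "(\<lambda>s. J s + J' s) holomorphic_on UNIV"
    using assms unfolding laplace_limit_def by (intro holomorphic_intros) auto
  fix s
  obtain C F C' F' where F: "has_laplace_continuation \<sigma> (\<lambda>t. g t * of_real t powr (s - 1)) T C F"
        "((\<lambda>w. F w - b * rotated_gamma \<sigma> T s w) \<longlongrightarrow> J s) boundary_filter"
    and F': "has_laplace_continuation \<sigma> (\<lambda>t. g' t * of_real t powr (s - 1)) T C' F'"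
        "((\<lambda>w. F' w - b' * rotated_gamma \<sigma> T s w) \<longlongrightarrow> J' s) boundary_filter"
    using assms unfolding laplace_limit_def by meson
  have "((\<lambda>w. (F w - b * rotated_gamma \<sigma> T s w) + (F' w - b' * rotated_gamma \<sigma> T s w)) \<longlongrightarrow> J s + J' s) boundary_filter"
    by (intro tendsto_intros F F')
  then have "((\<lambda>w. (F w + F' w) - (b + b') * rotated_gamma \<sigma> T s w) \<longlongrightarrow> J s + J' s) boundary_filter"
    by (simp add: algebra_simps)
  with laplace_continuation_add[OF F(1) F'(1)]
  show "\<exists>C F. has_laplace_continuation \<sigma> (\<lambda>t. (g t + g' t) * of_real t powr (s - 1)) T C F \<and>
        ((\<lambda>w. F w - (b + b') * rotated_gamma \<sigma> T s w) \<longlongrightarrow> J s + J' s) boundary_filter"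
    unfolding distrib_right by blast
qed

lemma laplace_limit_cmult:
  assumes "laplace_limit g b J"
  shows "laplace_limit (\<lambda>t. c * g t) (c * b) (\<lambda>s. c * J s)"
  unfolding laplace_limit_def
proof (intro conjI allI)
  show "(\<lambda>s. c * J s) holomorphic_on UNIV"
    using assms unfolding laplace_limit_def by (intro holomorphic_intros) auto
  fix s
  obtain C F where F: "has_laplace_continuation \<sigma> (\<lambda>t. g t * of_real t powr (s - 1)) T C F"
        "((\<lambda>w. F w - b * rotated_gamma \<sigma> T s w) \<longlongrightarrow> J s) boundary_filter"
    using assms unfolding laplace_limit_def by meson
  have "((\<lambda>w. c * (F w - b * rotated_gamma \<sigma> T s w)) \<longlongrightarrow> c * J s) boundary_filter"
    by (intro tendsto_intros F)
  then have "((\<lambda>w. c * F w - (c * b) * rotated_gamma \<sigma> T s w) \<longlongrightarrow> c * J s) boundary_filter"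
    by (simp add: algebra_simps)
  with laplace_continuation_cmult[OF F(1), of c]
  show "\<exists>C F. has_laplace_continuation \<sigma> (\<lambda>t. (c * g t) * of_real t powr (s - 1)) T C F \<and>
        ((\<lambda>w. F w - (c * b) * rotated_gamma \<sigma> T s w) \<longlongrightarrow> c * J s) boundary_filter"
    unfolding mult.assoc by blast
qed

lemma laplace_limit_sum:
  assumes "finite R" "\<And>r. r \<in> R \<Longrightarrow> laplace_limit (g r) 0 (J r)"
  shows "laplace_limit (\<lambda>t. \<Sum>r\<in>R. g r t) 0 (\<lambda>s. \<Sum>r\<in>R. J r s)"
  using assms
proof (induction R rule: finite_induct)
  case empty
  then show ?case
    using laplace_continuation_zero unfolding laplace_limit_def by fastforce
next
  case (insert x R)
  then show ?case using laplace_limit_add[of "g x" 0 "J x" "\<lambda>t. \<Sum>r\<in>R. g r t" 0] by auto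
qed

lemma laplace_continuation_powr:
  "\<exists>F. has_laplace_continuation \<sigma> (\<lambda>t. of_real t powr (s - 1)) T 0 F \<and> (\<forall>w. \<sigma> * Im w > 0 \<longrightarrow> F w = rotated_gamma \<sigma> T s w)"
proof -
  have bd: "\<exists>M. \<forall>z. Re z \<ge> T \<longrightarrow> norm (z powr (s - 1)) \<le> M * exp ((0 + \<epsilon>) * Re z + \<epsilon> * \<bar>Im z\<bar>)" if "\<epsilon> > 0" for \<epsilon>
    using norm_powr_subexponential[of T \<epsilon> "s - 1"] T that by simp
  have T': "0 < T" "0 \<le> T" using T by auto
  from laplace_continuation[OF \<sigma> holomorphic_powr_right_halfplane T' bd] obtain F where
    "F holomorphic_on {w. Re w > 0 \<or> \<sigma> * Im w > 0}"
    "\<forall>w. Re w > 0 \<longrightarrow> (\<lambda>t. exp (- w * of_real t) * of_real t powr (s - 1)) absolutely_integrable_on {T..} \<and>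
            F w = integral {T..} (\<lambda>t. exp (- w * of_real t) * of_real t powr (s - 1))"
    "\<forall>w. \<sigma> * Im w > 0 \<longrightarrow> F w = rotated_laplace \<sigma> T (\<lambda>z. z powr (s - 1)) w" by blast
  then show ?thesis unfolding has_laplace_continuation_def rotated_gamma_def by blast
qed

lemma eventually_boundary: "\<forall>\<^sub>F w in boundary_filter. \<sigma> * Im w > 0"
  by (auto simp: eventually_at_filter)

lemma laplace_limit_const: "laplace_limit (\<lambda>t. c) c (\<lambda>s. 0)"
  unfolding laplace_limit_def
proof (intro conjI allI)
  fix s
  obtain F where F: "has_laplace_continuation \<sigma> (\<lambda>t. of_real t powr (s - 1)) T 0 F"
    "\<And>w. \<sigma> * Im w > 0 \<Longrightarrow> F w = rotated_gamma \<sigma> T s w" using laplace_continuation_powr by blast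
  have "((\<lambda>w. c * F w - c * rotated_gamma \<sigma> T s w) \<longlongrightarrow> 0) boundary_filter"
    by (rule tendsto_eventually, rule eventually_mono[OF eventually_boundary]) (simp add: F)
  with laplace_continuation_cmult[OF F(1), of c]
  show "\<exists>C F. has_laplace_continuation \<sigma> (\<lambda>t. c * of_real t powr (s - 1)) T C F \<and>
        ((\<lambda>w. F w - c * rotated_gamma \<sigma> T s w) \<longlongrightarrow> 0) boundary_filter" by blast
qed auto

text \<open>The factor exp (x t) shifts w by x, so the limit at w = 0 is the boundary value of the
  incomplete Gamma function at the point - x, which is not 0. \<open>rotated_gamma_tendsto\<close>
  makes it entire in s.\<close>

lemma laplace_limit_exp:
  assumes "x \<noteq> 0"
  shows "\<exists>J. laplace_limit (\<lambda>t. exp (of_real x * of_real t)) 0 J"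
proof -
  obtain e where e: "e holomorphic_on UNIV"
     "\<And>s. (rotated_gamma \<sigma> T s \<longlongrightarrow> e s) (at (of_real (- x)) within {w. \<sigma> * Im w > 0})"
    using rotated_gamma_tendsto[OF \<sigma> T, of "- x"] assms by auto
  have "laplace_limit (\<lambda>t. exp (of_real x * of_real t)) 0 e"
    unfolding laplace_limit_def
  proof (intro conjI allI e(1))
    fix s
    obtain F where F: "has_laplace_continuation \<sigma> (\<lambda>t. of_real t powr (s - 1)) T 0 F"
      "\<And>w. \<sigma> * Im w > 0 \<Longrightarrow> F w = rotated_gamma \<sigma> T s w" using laplace_continuation_powr by blast
    let ?F = "\<lambda>w. F (w - of_real x)"
    have eq: "exp (- (w - of_real x) * of_real t) * of_real t powr (s - 1) =
       exp (- w * of_real t) * (exp (of_real x * of_real t) * of_real t powr (s - 1))" for w t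
      by (simp add: algebra_simps exp_diff exp_add exp_minus field_simps)
    have "has_laplace_continuation \<sigma> (\<lambda>t. exp (of_real x * of_real t) * of_real t powr (s - 1)) T x ?F"
      unfolding has_laplace_continuation_def
    proof (intro conjI allI impI)
      have "F holomorphic_on {w. Re w > 0 \<or> \<sigma> * Im w > 0}" using F(1) unfolding has_laplace_continuation_def by blast
      then show "?F holomorphic_on {w. x < Re w \<or> 0 < \<sigma> * Im w}"
        by (rule holomorphic_on_compose_gen[rotated, unfolded o_def]) (auto intro!: holomorphic_intros)
      fix w assume "x < Re w"
      then have "Re (w - of_real x) > 0" by simp
      with F(1) have "(\<lambda>t. exp (- (w - of_real x) * of_real t) * of_real t powr (s - 1)) absolutely_integrable_on {T..} \<and>
           ?F w = integral {T..} (\<lambda>t. exp (- (w - of_real x) * of_real t) * of_real t powr (s - 1))"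
        unfolding has_laplace_continuation_def by blast
      then show "(\<lambda>t. exp (- w * of_real t) * (exp (of_real x * of_real t) * of_real t powr (s - 1))) absolutely_integrable_on {T..}"
         "?F w = integral {T..} (\<lambda>t. exp (- w * of_real t) * (exp (of_real x * of_real t) * of_real t powr (s - 1)))"
        unfolding eq by blast+
    qed
    moreover have "((\<lambda>w. ?F w - 0 * rotated_gamma \<sigma> T s w) \<longlongrightarrow> e s) boundary_filter"
    proof (rule Lim_transform_eventually)
      have "filterlim (\<lambda>w. w - of_real x) (at (of_real (- x)) within {w. \<sigma> * Im w > 0}) boundary_filter"
      proof (rule filterlim_at_withinI)
        have "((\<lambda>w. w - complex_of_real x) \<longlongrightarrow> 0 - of_real x) boundary_filter" by (intro tendsto_intros)
        then show "((\<lambda>w. w - complex_of_real x) \<longlongrightarrow> of_real (- x)) boundary_filter" by simp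
        show "\<forall>\<^sub>F w in boundary_filter. w - complex_of_real x \<in> {w. 0 < \<sigma> * Im w} - {complex_of_real (- x)}"
          by (rule eventually_mono[OF eventually_boundary]) (auto simp: complex_eq_iff)
      qed
      from filterlim_compose[OF e(2) this]
      show "((\<lambda>w. rotated_gamma \<sigma> T s (w - of_real x)) \<longlongrightarrow> e s) boundary_filter" .
      show "\<forall>\<^sub>F w in boundary_filter. rotated_gamma \<sigma> T s (w - of_real x) = ?F w - 0 * rotated_gamma \<sigma> T s w"
        by (rule eventually_mono[OF eventually_boundary]) (simp add: F)
    qed
    ultimately show "\<exists>C F. has_laplace_continuation \<sigma> (\<lambda>t. exp (of_real x * of_real t) * of_real t powr (s - 1)) T C F \<and>
        ((\<lambda>w. F w - 0 * rotated_gamma \<sigma> T s w) \<longlongrightarrow> e s) boundary_filter" by blast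
  qed
  then show ?thesis by blast
qed

text \<open>The exponential decay lets the Laplace integral converge for Re w > - 2 pi, so the
  continuation is holomorphic at 0 and its limit there is the ordinary Mellin integral.\<close>

lemma laplace_limit_decaying:
  assumes h: "h holomorphic_on {z. Re z > T'}" and T': "0 \<le> T'" "T' < T"
    and M: "\<And>z. Re z \<ge> T \<Longrightarrow> norm (h z) \<le> M * exp (- 2 * pi * Re z)"
  shows "\<exists>J. laplace_limit (\<lambda>t. h (of_real t)) 0 J"
proof -
  have conth: "continuous_on {T..} (\<lambda>t. h (of_real t))"
    by (rule continuous_on_compose2[OF holomorphic_on_imp_continuous_on[OF h]])
       (use T' in \<open>auto intro!: continuous_intros\<close>)
  define J where "J = (\<lambda>s. integral {T..} (\<lambda>t. h (of_real t) * of_real t powr (s - 1)))"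
  have holJ: "J holomorphic_on UNIV"
  proof -
    have "(\<lambda>s. integral {T..} (\<lambda>t. exp (s * of_real (ln t)) * (h (of_real t) / of_real t))) holomorphic_on UNIV"
    proof (rule holomorphic_integral_exp_kernel_Ici(1))
      show "continuous_on {T..} (\<lambda>t. complex_of_real (ln t))" using T by (auto intro!: continuous_intros)
      show "continuous_on {T..} (\<lambda>t. h (of_real t) / of_real t)" using T by (intro continuous_intros conth) auto
      fix s :: complex
      obtain K where K: "\<And>z. Re z \<ge> T \<Longrightarrow> norm (z powr of_real (norm s + 1)) \<le> K * exp (1 * Re z + 1 * \<bar>Im z\<bar>)"
        using norm_powr_subexponential[of T 1 "of_real (norm s + 1)"] T by auto
      show "\<exists>d>0. \<exists>m. cball s d \<subseteq> UNIV \<and> m integrable_on {T..} \<and>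
         (\<forall>z\<in>cball s d. \<forall>t\<ge>T. norm (exp (z * of_real (ln t)) * (h (of_real t) / of_real t)) \<le> m t)"
      \<comment> \<open>On the disc of radius 1 the power of t is at most t^(|s| + 1), hence at most
        K exp t. This spends one unit of the decay rate 2 pi.\<close>
      proof (intro exI[of _ 1] conjI exI[of _ "\<lambda>t. (K * M) * exp (- (2 * pi - 1) * t)"] ballI allI impI)
        show "(\<lambda>t. (K * M) * exp (- (2 * pi - 1) * t)) integrable_on {T..}"
          using integrable_on_exp_minus_to_infinity[of "2 * pi - 1" T] pi_gt3 by (intro integrable_on_mult_right) auto
        fix z and t :: real assume z: "z \<in> cball s 1" and t: "T \<le> t"
        have t1: "t \<ge> 1" using t T by simp
        have "Re z \<le> norm s + 1"
          using z complex_Re_le_cmod[of z] norm_triangle_ineq2[of z s] by (auto simp: dist_norm norm_minus_commute)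
        then have "t powr Re z \<le> t powr (norm s + 1)" using t1 by (intro powr_mono) auto
        moreover have "norm (exp (z * of_real (ln t))) = t powr Re z" using t1 by (simp add: powr_def)
        moreover have "t powr (norm s + 1) \<le> K * exp t"
          using K[of "of_real t"] t t1 by (simp add: norm_powr_real_powr)
        ultimately have a: "norm (exp (z * of_real (ln t))) \<le> K * exp t" by linarith
        have "norm (h (of_real t) / of_real t) \<le> norm (h (of_real t))"
          using t1 by (simp add: norm_divide divide_le_eq mult_le_cancel_left1)
        also have "\<dots> \<le> M * exp (- 2 * pi * t)" using M[of "of_real t"] t by simp
        finally have b: "norm (h (of_real t) / of_real t) \<le> M * exp (- 2 * pi * t)" .
        have "norm (exp (z * of_real (ln t)) * (h (of_real t) / of_real t)) \<le> (K * exp t) * (M * exp (- 2 * pi * t))"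
          unfolding norm_mult using a b order_trans[OF norm_ge_zero a] by (intro mult_mono) auto
        also have "\<dots> = (K * M) * exp (- (2 * pi - 1) * t)"
          by (simp add: algebra_simps flip: exp_add)
        finally show "norm (exp (z * of_real (ln t)) * (h (of_real t) / of_real t)) \<le> (K * M) * exp (- (2 * pi - 1) * t)" .
      qed auto
    qed simp
    moreover have "J = (\<lambda>s. integral {T..} (\<lambda>t. exp (s * of_real (ln t)) * (h (of_real t) / of_real t)))"
      unfolding J_def
      by (rule ext, rule integral_cong) (use T in \<open>auto simp: powr_def Ln_of_real exp_diff left_diff_distrib exp_of_real\<close>)
    ultimately show ?thesis by simp
  qed
  have "laplace_limit (\<lambda>t. h (of_real t)) 0 J"
    unfolding laplace_limit_def
  proof (intro conjI allI holJ)
    fix s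
    have hol: "(\<lambda>z. h z * z powr (s - 1)) holomorphic_on {z. Re z > T'}"
      by (intro holomorphic_intros h holomorphic_on_subset[OF holomorphic_powr_right_halfplane]) (use T' in auto)
    have bd: "\<exists>K. \<forall>z. Re z \<ge> T \<longrightarrow> norm (h z * z powr (s - 1)) \<le> K * exp ((- 2 * pi + \<epsilon>) * Re z + \<epsilon> * \<bar>Im z\<bar>)" if "\<epsilon> > 0" for \<epsilon>
      by (rule subexponential_mult_powr[OF _ M that]) (use T in auto)
    have "0 \<le> T" using T by simp
    from laplace_continuation[OF \<sigma> hol T'(2) this bd] obtain F where F:
      "F holomorphic_on {w. Re w > - 2 * pi \<or> \<sigma> * Im w > 0}"
      "\<And>w. Re w > - 2 * pi \<Longrightarrow> (\<lambda>t. exp (- w * of_real t) * (h (of_real t) * of_real t powr (s - 1))) absolutely_integrable_on {T..} \<and>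
            F w = integral {T..} (\<lambda>t. exp (- w * of_real t) * (h (of_real t) * of_real t powr (s - 1)))" by blast
    have "has_laplace_continuation \<sigma> (\<lambda>t. h (of_real t) * of_real t powr (s - 1)) T (- 2 * pi) F"
      unfolding has_laplace_continuation_def using F by blast
    moreover have "F holomorphic_on {w. Re w > - 2 * pi}" by (rule holomorphic_on_subset[OF F(1)]) auto
    then have "isCont F 0"
      using holomorphic_on_imp_continuous_on[of F "{w. Re w > - 2 * pi}"] open_halfspace_Re_gt[of "- 2 * pi"]
      by (simp add: continuous_on_eq_continuous_at)
    then have "(F \<longlongrightarrow> F 0) boundary_filter" unfolding isCont_def by (rule tendsto_within_subset) auto
    then have "((\<lambda>w. F w - 0 * rotated_gamma \<sigma> T s w) \<longlongrightarrow> J s) boundary_filter"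
      using F(2)[of 0] by (simp add: J_def)
    ultimately show "\<exists>C F. has_laplace_continuation \<sigma> (\<lambda>t. h (of_real t) * of_real t powr (s - 1)) T C F \<and>
        ((\<lambda>w. F w - 0 * rotated_gamma \<sigma> T s w) \<longlongrightarrow> J s) boundary_filter" by blast
  qed
  then show ?thesis by blast
qed

lemma laplace_limit_fourier:
  assumes f: "has_fourier_expansion f a"
    and dec: "h holomorphic_on {z. Re z > T'}" "0 \<le> T'" "T' < T"
    "\<And>z. Re z \<ge> T \<Longrightarrow> norm (h z) \<le> M * exp (- 2 * pi * Re z)"
    "\<And>z. Re z > T' \<Longrightarrow> f (\<i> * z) = (\<Sum>n=1..N. a (- int n) * exp (of_real (2 * pi * real n) * z)) + a 0 + h z"
  shows "\<exists>J. laplace_limit (\<lambda>t. f (\<i> * of_real t)) (a 0) J"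
proof -
  obtain Jh where Jh: "laplace_limit (\<lambda>t. h (of_real t)) 0 Jh" using laplace_limit_decaying[OF dec(1-4)] by blast
  have "\<exists>J. laplace_limit (\<lambda>t. exp (of_real (2 * pi * real n) * of_real t)) 0 J" if "n \<in> {1..N}" for n
    by (rule laplace_limit_exp) (use that in auto)
  then obtain Jn where Jn: "\<And>n. n \<in> {1..N} \<Longrightarrow> laplace_limit (\<lambda>t. exp (of_real (2 * pi * real n) * of_real t)) 0 (Jn n)"
    by metis
  have "laplace_limit (\<lambda>t. a (- int n) * exp (of_real (2 * pi * real n) * of_real t)) 0 (\<lambda>s. a (- int n) * Jn n s)" if "n \<in> {1..N}" for n
    using laplace_limit_cmult[OF Jn[OF that], of "a (- int n)"] by simp
  from laplace_limit_sum[OF _ this, of "{1..N}"]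
  have "laplace_limit (\<lambda>t. \<Sum>n=1..N. a (- int n) * exp (of_real (2 * pi * real n) * of_real t)) 0 (\<lambda>s. \<Sum>n=1..N. a (- int n) * Jn n s)" by simp
  from laplace_limit_add[OF laplace_limit_add[OF this laplace_limit_const[of "a 0"]] Jh]
  obtain J where J: "laplace_limit (\<lambda>t. (\<Sum>n=1..N. a (- int n) * exp (of_real (2 * pi * real n) * of_real t)) + a 0 + h (of_real t)) (a 0) J"
    by auto
  have "laplace_limit (\<lambda>t. f (\<i> * of_real t)) (a 0) J"
    unfolding laplace_limit_def
  proof (intro conjI allI)
    show "J holomorphic_on UNIV" using J unfolding laplace_limit_def by blast
    fix s
    from J obtain C F where F: "has_laplace_continuation \<sigma> (\<lambda>t. ((\<Sum>n=1..N. a (- int n) * exp (of_real (2 * pi * real n) * of_real t)) + a 0 + h (of_real t)) * of_real t powr (s - 1)) T C F"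
      "((\<lambda>w. F w - a 0 * rotated_gamma \<sigma> T s w) \<longlongrightarrow> J s) boundary_filter"
      unfolding laplace_limit_def by blast
    have "has_laplace_continuation \<sigma> (\<lambda>t. f (\<i> * of_real t) * of_real t powr (s - 1)) T C F"
      by (rule laplace_continuation_cong[OF F(1)]) (use dec in auto)
    with F(2) show "\<exists>C F. has_laplace_continuation \<sigma> (\<lambda>t. f (\<i> * of_real t) * of_real t powr (s - 1)) T C F \<and>
        ((\<lambda>w. F w - a 0 * rotated_gamma \<sigma> T s w) \<longlongrightarrow> J s) boundary_filter" by blast
  qed
  then show ?thesis by blast
qed

text \<open>Both ends of the axis are instances: at infinity there is one term with exponent 0, at 0
  there are the terms of the transformation under S with exponents k - 2 m - l. The first conclusion
  gives existence where all shifted exponents have negative real part. The second says that a value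
  existing anywhere comes from the same formula and that no term with nonzero coefficient has its
  pole there; for this the exponents e have to be distinct.\<close>

lemma has_reg_integral_inf_combination:
  fixes R :: "nat set" and c b :: "nat \<Rightarrow> complex" and e :: "nat \<Rightarrow> int" and H :: "nat \<Rightarrow> real \<Rightarrow> complex"
  assumes R: "finite R" "inj_on e R" and H: "\<And>r. r \<in> R \<Longrightarrow> laplace_limit (H r) (b r) (J r)"
    and \<phi>: "\<And>t. t \<ge> T \<Longrightarrow> \<phi> t = (\<Sum>r\<in>R. c r * of_real t powi e r * H r t)"
    and cont: "continuous_on {t0..} \<phi>" "continuous_on {T..} \<phi>"
    and X: "0 < t0" "t0 \<le> X" "T \<le> X"
  defines "I \<equiv> \<lambda>s. integral {t0..X} (\<lambda>t. \<phi> t * of_real t powr (s - 1)) - integral {T..X} (\<lambda>t. \<phi> t * of_real t powr (s - 1)) +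
     (\<Sum>r\<in>R. c r * (J r (s + of_int (e r)) - b r * (of_real T powr (s + of_int (e r)) / (s + of_int (e r)))))"
  shows "(\<And>r. r \<in> R \<Longrightarrow> Re s + of_int (e r) < 0) \<Longrightarrow>
      has_reg_integral_inf \<sigma> (\<lambda>t. \<phi> t * of_real t powr (s - 1)) t0 (I s)"
    and "has_reg_integral_inf \<sigma> (\<lambda>t. \<phi> t * of_real t powr (s - 1)) t0 v \<Longrightarrow>
      v = I s \<and> (\<forall>r\<in>R. c r * b r \<noteq> 0 \<longrightarrow> s + of_int (e r) \<noteq> 0)"
proof -
  let ?S = "\<lambda>r. s + of_int (e r)"
  let ?g = "\<lambda>t. \<phi> t * complex_of_real t powr (s - 1)"
  have cp: "continuous_on {u..} (\<lambda>t. complex_of_real t powr (s - 1))" if "u > 0" for u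
    using that by (intro continuous_intros) (auto simp: complex_nonpos_Reals_iff)
  have "T > 0" using T by simp
  have contg: "continuous_on {t0..} ?g" "continuous_on {T..} ?g"
    by (rule continuous_on_mult[OF cont(1) cp[OF X(1)]], rule continuous_on_mult[OF cont(2) cp[OF \<open>T > 0\<close>]])
  have "\<forall>r\<in>R. \<exists>CF. has_laplace_continuation \<sigma> (\<lambda>t. H r t * of_real t powr (?S r - 1)) T (fst CF) (snd CF) \<and>
        ((\<lambda>w. snd CF w - b r * rotated_gamma \<sigma> T (?S r) w) \<longlongrightarrow> J r (?S r)) boundary_filter"
  proof
    fix r assume "r \<in> R"
    then obtain C F where "has_laplace_continuation \<sigma> (\<lambda>t. H r t * of_real t powr (?S r - 1)) T C F"
        "((\<lambda>w. F w - b r * rotated_gamma \<sigma> T (?S r) w) \<longlongrightarrow> J r (?S r)) boundary_filter"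
      using H[of r] unfolding laplace_limit_def by meson
    then show "\<exists>CF. has_laplace_continuation \<sigma> (\<lambda>t. H r t * of_real t powr (?S r - 1)) T (fst CF) (snd CF) \<and>
        ((\<lambda>w. snd CF w - b r * rotated_gamma \<sigma> T (?S r) w) \<longlongrightarrow> J r (?S r)) boundary_filter"
      by (intro exI[of _ "(C, F)"]) simp
  qed
  from bchoice[OF this] obtain CF where CF: "\<forall>r\<in>R. has_laplace_continuation \<sigma> (\<lambda>t. H r t * of_real t powr (?S r - 1)) T (fst (CF r)) (snd (CF r)) \<and>
        ((\<lambda>w. snd (CF r) w - b r * rotated_gamma \<sigma> T (?S r) w) \<longlongrightarrow> J r (?S r)) boundary_filter" by (elim exE)
  define C where "C = (\<lambda>r. fst (CF r))"
  define F where "F = (\<lambda>r. snd (CF r))"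
  have F: "has_laplace_continuation \<sigma> (\<lambda>t. H r t * of_real t powr (?S r - 1)) T (C r) (F r)"
    "((\<lambda>w. F r w - b r * rotated_gamma \<sigma> T (?S r) w) \<longlongrightarrow> J r (?S r)) boundary_filter" if "r \<in> R" for r
    using bspec[OF CF that] unfolding C_def F_def by (elim conjunct1, elim conjunct2)
  have "has_laplace_continuation \<sigma> (\<lambda>t. c r * (H r t * of_real t powr (?S r - 1))) T (C r) (\<lambda>w. c r * F r w)" if "r \<in> R" for r
    by (rule laplace_continuation_cmult[OF F(1)[OF that]])
  then have "\<exists>D. has_laplace_continuation \<sigma> (\<lambda>t. \<Sum>r\<in>R. c r * (H r t * of_real t powr (?S r - 1))) T D (\<lambda>w. \<Sum>r\<in>R. c r * F r w)"
    by (rule laplace_continuation_sum[OF R(1)])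
  then obtain D where "has_laplace_continuation \<sigma> (\<lambda>t. \<Sum>r\<in>R. c r * (H r t * of_real t powr (?S r - 1))) T D (\<lambda>w. \<Sum>r\<in>R. c r * F r w)"
    by blast
  then have "has_laplace_continuation \<sigma> ?g T D (\<lambda>w. \<Sum>r\<in>R. c r * F r w)"
  proof (rule laplace_continuation_cong)
    fix t assume t: "T \<le> t"
    then have t0: "t > 0" using T by simp
    have "complex_of_real t powi e r * of_real t powr (s - 1) = of_real t powr (?S r - 1)" for r
      using t0 by (simp add: complex_powr_of_int[symmetric] powr_add[symmetric] algebra_simps)
    then show "(\<Sum>r\<in>R. c r * (H r t * of_real t powr (?S r - 1))) = ?g t"
      unfolding \<phi>[OF t] sum_distrib_right by (intro sum.cong) (auto simp: mult_ac)
  qed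
  note lc = this
  have c1: "continuous_on {t0..X} ?g" and c2: "continuous_on {T..X} ?g"
    by (rule continuous_on_subset[OF contg(1)], force, rule continuous_on_subset[OF contg(2)], force)
  \<comment> \<open>t0 may lie on either side of T. Going from T up to X and back down to t0 avoids
    the distinction and uses only intervals on which the integrand is continuous.\<close>
  have lc2: "has_laplace_continuation \<sigma> ?g X D (\<lambda>w. (\<Sum>r\<in>R. c r * F r w) - integral {T..X} (\<lambda>t. exp (- w * of_real t) * ?g t))"
    by (rule laplace_continuation_restrict[OF lc X(3) c2])
  have G: "has_laplace_continuation \<sigma> ?g t0 D (\<lambda>w. integral {t0..X} (\<lambda>t. exp (- w * of_real t) * ?g t) +
       ((\<Sum>r\<in>R. c r * F r w) - integral {T..X} (\<lambda>t. exp (- w * of_real t) * ?g t)))" (is "has_laplace_continuation _ _ _ _ ?G")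
    by (rule laplace_continuation_extend_left[OF lc2 X(2) c1])
  let ?E = "\<lambda>w. \<Sum>r\<in>R. (c r * b r) * rotated_gamma \<sigma> T (?S r) w"
  let ?J = "integral {t0..X} ?g + ((\<Sum>r\<in>R. c r * J r (?S r)) - integral {T..X} ?g)"
  have "((\<lambda>w. integral {t0..X} (\<lambda>t. exp (- w * of_real t) * ?g t) +
       ((\<Sum>r\<in>R. c r * (F r w - b r * rotated_gamma \<sigma> T (?S r) w)) - integral {T..X} (\<lambda>t. exp (- w * of_real t) * ?g t))) \<longlongrightarrow> ?J) boundary_filter"
    by (intro tendsto_intros F(2) integral_exp_tendsto c1 c2)
  then have lim: "((\<lambda>w. ?G w - ?E w) \<longlongrightarrow> ?J) boundary_filter"
    by (simp add: algebra_simps sum_subtractf)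
  have I: "I s = ?J - (\<Sum>r\<in>R. (c r * b r) * (of_real T powr ?S r / ?S r))"
    unfolding I_def by (simp add: algebra_simps sum_subtractf)
  show "has_reg_integral_inf \<sigma> ?g t0 (I s)" if neg: "\<And>r. r \<in> R \<Longrightarrow> Re s + of_int (e r) < 0"
    unfolding has_reg_integral_inf_iff
  proof (intro exI conjI)
    show "has_laplace_continuation \<sigma> ?g t0 D ?G" by (rule G)
    have "(rotated_gamma \<sigma> T (?S r) \<longlongrightarrow> - (of_real T powr ?S r) / ?S r) boundary_filter" if "r \<in> R" for r
      using rotated_gamma_tendsto_neg[OF \<sigma> T, of "?S r" 0] rotated_gamma_at_0[OF \<sigma> T, of "?S r"] neg[OF that] by simp
    then have "((\<lambda>w. (?G w - ?E w) + ?E w) \<longlongrightarrow> ?J + (\<Sum>r\<in>R. (c r * b r) * (- (of_real T powr ?S r) / ?S r))) boundary_filter"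
      by (intro tendsto_intros lim)
    then show "(?G \<longlongrightarrow> I s) boundary_filter" unfolding I by (simp add: sum_negf)
  qed
  show "v = I s \<and> (\<forall>r\<in>R. c r * b r \<noteq> 0 \<longrightarrow> s + of_int (e r) \<noteq> 0)" if "has_reg_integral_inf \<sigma> ?g t0 v"
  proof -
    from that obtain C' F' where F': "has_laplace_continuation \<sigma> ?g t0 C' F'" "(F' \<longlongrightarrow> v) boundary_filter"
      unfolding has_reg_integral_inf_iff by blast
    have "(?G \<longlongrightarrow> v) boundary_filter"
      by (rule Lim_transform_eventually[OF F'(2)], rule eventually_mono[OF eventually_boundary])
         (rule laplace_continuation_unique[OF \<sigma> F'(1) G])
    \<comment> \<open>The assumed value v and the part that converges for every s are subtracted;
      what is left is a pure combination of incomplete Gamma functions that has a limit, and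
      \<open>rotated_gamma_sum_limit\<close> applies in the smaller quadrant.\<close>
    from tendsto_diff[OF this lim] have "(?E \<longlongrightarrow> v - ?J) boundary_filter" by simp
    then have "(?E \<longlongrightarrow> v - ?J) (quadrant_filter \<sigma>)" by (rule tendsto_within_subset) auto
    from rotated_gamma_sum_limit[OF \<sigma> T R(1) _ this]
    have "\<forall>r\<in>R. c r * b r \<noteq> 0 \<longrightarrow> ?S r \<noteq> 0" "v - ?J = - (\<Sum>r\<in>R. (c r * b r) * (of_real T powr ?S r / ?S r))"
      using R(2) by (auto simp: inj_on_def)
    then show ?thesis unfolding I by (auto simp: algebra_simps)
  qed
qed

end

section \<open>Regularized integrals at a pole\<close>

text \<open>The end point u = 0 is covered by the default value 0 powr z = 0, which is the correct
  limit because Re z > 0.\<close>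

lemma continuous_on_of_real_powr:
  assumes "Re z > 0"
  shows "continuous_on {0..d} (\<lambda>u. complex_of_real u powr z)"
  unfolding continuous_on_eq_continuous_within
proof
  fix x assume x: "x \<in> {0..d}"
  show "continuous (at x within {0..d}) (\<lambda>u. complex_of_real u powr z)"
  proof (cases "x = 0")
    case False
    then have "complex_of_real x \<notin> \<real>\<^sub>\<le>\<^sub>0" using x by (auto simp: complex_nonpos_Reals_iff)
    then have "isCont (\<lambda>u. complex_of_real u powr z) x"
      by (intro continuous_intros) auto
    then show ?thesis by (rule continuous_at_imp_continuous_at_within)
  next
    case True
    have "((\<lambda>u. complex_of_real u powr z) \<longlongrightarrow> 0) (at 0 within {0..d})"
    proof (rule Lim_null_comparison)
      show "\<forall>\<^sub>F u in at 0 within {0..d}. norm (complex_of_real u powr z) \<le> u powr Re z"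
        by (auto simp: eventually_at_filter norm_powr_real_powr)
      show "((\<lambda>u. u powr Re z) \<longlongrightarrow> 0) (at 0 within {0..d})"
      proof (rule tendsto_zero_powrI)
        show "((\<lambda>u. u) \<longlongrightarrow> 0) (at 0 within {0..d})" by (rule tendsto_ident_at)
        show "((\<lambda>_. Re z) \<longlongrightarrow> Re z) (at 0 within {0..d})" by simp
      qed (use assms in \<open>auto simp: eventually_at_filter\<close>)
    qed
    then show ?thesis using True by (simp add: continuous_within)
  qed
qed

lemma has_integral_of_real_powr:
  assumes "Re z > 0" "0 \<le> d"
  shows "((\<lambda>u. complex_of_real u powr (z - 1)) has_integral (of_real d powr z / z)) {0..d}"
proof -
  have z0: "z \<noteq> 0" using assms by auto
  have "((\<lambda>u. complex_of_real u powr (z - 1)) has_integral (of_real d powr z / z - of_real 0 powr z / z)) {0..d}"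
  proof (rule fundamental_theorem_of_calculus_interior[OF assms(2)])
    show "continuous_on {0..d} (\<lambda>u. complex_of_real u powr z / z)"
      using z0 by (intro continuous_intros continuous_on_of_real_powr assms) auto
    fix u assume u: "u \<in> {0<..<d}"
    have D: "((\<lambda>x. x powr z / z) has_field_derivative complex_of_real u powr (z - 1)) (at (of_real u))"
      using u z0 by (auto intro!: derivative_eq_intros simp: complex_nonpos_Reals_iff)
    have "(complex_of_real has_vector_derivative 1) (at u)"
      by (auto intro!: derivative_eq_intros simp: has_vector_derivative_of_real)
    from field_vector_diff_chain_at[OF this D]
    show "((\<lambda>u. complex_of_real u powr z / z) has_vector_derivative complex_of_real u powr (z - 1)) (at u)"
      by (simp add: o_def)
  qed
  then show ?thesis by simp
qed

text \<open>One-sided version of \<open>has_reg_integral_pole\<close>, with the pole moved to the left end point.\<close>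
definition half_reg_integral :: "(real \<Rightarrow> complex) \<Rightarrow> real \<Rightarrow> complex \<Rightarrow> bool" where
  "half_reg_integral g d v \<longleftrightarrow>
     (\<exists>G L C. G meromorphic_on UNIV \<and>
        (\<forall>z. Re z > C \<longrightarrow>
           (\<lambda>u. of_real u powr z * g u) absolutely_integrable_on {0..d} \<and>
           G z = integral {0..d} (\<lambda>u. of_real u powr z * g u)) \<and>
        G has_laurent_expansion L \<and> fls_nth L 0 = v)"

lemma half_reg_integral_add:
  assumes "half_reg_integral g d v" "half_reg_integral h d w"
  shows "half_reg_integral (\<lambda>u. g u + h u) d (v + w)"
proof -
  obtain G L C where G: "G meromorphic_on UNIV"
    "\<And>z. Re z > C \<Longrightarrow> (\<lambda>u. of_real u powr z * g u) absolutely_integrable_on {0..d} \<and> G z = integral {0..d} (\<lambda>u. of_real u powr z * g u)"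
    "G has_laurent_expansion L" "fls_nth L 0 = v"
    using assms(1) unfolding half_reg_integral_def by blast
  obtain H M D where H: "H meromorphic_on UNIV"
    "\<And>z. Re z > D \<Longrightarrow> (\<lambda>u. of_real u powr z * h u) absolutely_integrable_on {0..d} \<and> H z = integral {0..d} (\<lambda>u. of_real u powr z * h u)"
    "H has_laurent_expansion M" "fls_nth M 0 = w"
    using assms(2) unfolding half_reg_integral_def by blast
  show ?thesis
    unfolding half_reg_integral_def
  proof (intro exI conjI allI impI)
    show "(\<lambda>z. G z + H z) meromorphic_on UNIV" by (intro meromorphic_intros G H)
    show "(\<lambda>z. G z + H z) has_laurent_expansion L + M" by (intro laurent_expansion_intros G H)
    show "fls_nth (L + M) 0 = v + w" using G H by simp
    fix z assume "max C D < Re z"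
    then have 1: "(\<lambda>u. of_real u powr z * g u) absolutely_integrable_on {0..d}" "G z = integral {0..d} (\<lambda>u. of_real u powr z * g u)"
      and 2: "(\<lambda>u. of_real u powr z * h u) absolutely_integrable_on {0..d}" "H z = integral {0..d} (\<lambda>u. of_real u powr z * h u)"
      using G(2)[of z] H(2)[of z] by auto
    show "(\<lambda>u. of_real u powr z * (g u + h u)) absolutely_integrable_on {0..d}"
      unfolding distrib_left by (intro set_integral_add 1 2)
    show "G z + H z = integral {0..d} (\<lambda>u. of_real u powr z * (g u + h u))"
      unfolding distrib_left 1 2
      by (intro integral_add[symmetric] set_lebesgue_integral_eq_integral(1)[OF 1(1)] set_lebesgue_integral_eq_integral(1)[OF 2(1)])
  qed
qed

lemma half_reg_integral_cmult:
  assumes "half_reg_integral g d v"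
  shows "half_reg_integral (\<lambda>u. c * g u) d (c * v)"
proof -
  obtain G L C where G: "G meromorphic_on UNIV"
    "\<And>z. Re z > C \<Longrightarrow> (\<lambda>u. of_real u powr z * g u) absolutely_integrable_on {0..d} \<and> G z = integral {0..d} (\<lambda>u. of_real u powr z * g u)"
    "G has_laurent_expansion L" "fls_nth L 0 = v"
    using assms(1) unfolding half_reg_integral_def by blast
  show ?thesis
    unfolding half_reg_integral_def
  proof (intro exI conjI allI impI)
    show "(\<lambda>z. c * G z) meromorphic_on UNIV" by (intro meromorphic_intros G)
    show "(\<lambda>z. c * G z) has_laurent_expansion fls_const c * L" by (intro laurent_expansion_intros G)
    show "fls_nth (fls_const c * L) 0 = c * v" using G by simp
    fix z assume "C < Re z"
    then have 1: "(\<lambda>u. of_real u powr z * g u) absolutely_integrable_on {0..d}" "G z = integral {0..d} (\<lambda>u. of_real u powr z * g u)"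
      using G(2)[of z] by auto
    show "(\<lambda>u. of_real u powr z * (c * g u)) absolutely_integrable_on {0..d}"
      unfolding mult.left_commute[of _ c] by (intro set_integrable_mult_right 1)
    show "c * G z = integral {0..d} (\<lambda>u. of_real u powr z * (c * g u))"
      unfolding mult.left_commute[of _ c] 1 by simp
  qed
qed

lemma half_reg_integral_sum:
  assumes "finite R" "\<And>r. r \<in> R \<Longrightarrow> half_reg_integral (g r) d (v r)"
  shows "half_reg_integral (\<lambda>u. \<Sum>r\<in>R. g r u) d (\<Sum>r\<in>R. v r)"
  using assms
proof (induction R rule: finite_induct)
  case empty
  have "half_reg_integral (\<lambda>u. 0) d 0"
    unfolding half_reg_integral_def
    by (intro exI[of _ "\<lambda>z. 0"] exI[of _ 0]) (auto intro!: meromorphic_intros laurent_expansion_intros simp: set_integrable_def)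
  then show ?case by simp
next
  case (insert x F)
  then show ?case using half_reg_integral_add[of "g x" d "v x" "\<lambda>u. \<Sum>r\<in>F. g r u"] by auto
qed

lemma half_reg_integral_cong:
  assumes "half_reg_integral g d v" "\<And>u. 0 < u \<Longrightarrow> u \<le> d \<Longrightarrow> g u = h u"
  shows "half_reg_integral h d v"
proof -
  have eq: "complex_of_real u powr z * g u = of_real u powr z * h u" if "u \<in> {0..d}" for u z
    using assms(2)[of u] that by (cases "u = 0") auto
  have "(\<lambda>u. complex_of_real u powr z * g u) absolutely_integrable_on {0..d} \<longleftrightarrow> (\<lambda>u. complex_of_real u powr z * h u) absolutely_integrable_on {0..d}"
    "integral {0..d} (\<lambda>u. complex_of_real u powr z * g u) = integral {0..d} (\<lambda>u. complex_of_real u powr z * h u)" for z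
    by (rule set_integrable_cong[OF refl refl eq], assumption, rule integral_cong[OF eq])
  then show ?thesis using assms(1) unfolding half_reg_integral_def by simp
qed

lemma analytic_imp_laurent_nth_0:
  assumes "G analytic_on {0}"
  shows "\<exists>L. G has_laurent_expansion L \<and> fls_nth L 0 = G 0"
proof -
  have "G has_fps_expansion fps_expansion G 0"
    using assms by (rule analytic_at_imp_has_fps_expansion_0)
  from has_laurent_expansion_fps[OF this] show ?thesis
    by (intro exI[of _ "fps_to_fls (fps_expansion G 0)"]) (auto simp: fps_expansion_def)
qed

text \<open>The integral of u^(z - j - 1) is d^(z - j) / (z - j). For j > 0 this is regular at z = 0
  and the constant term is its value. For j = 0 it is 1 / z + ln d + O(z), and only the logarithm is
  kept.\<close>

lemma half_reg_integral_pole: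
  assumes d: "d > 0"
  shows "half_reg_integral (\<lambda>u. 1 / of_real u ^ Suc j) d (if j = 0 then of_real (ln d) else - (1 / (of_nat j * of_real d ^ j)))"
proof -
  let ?G = "\<lambda>z. complex_of_real d powr (z - of_nat j) / (z - of_nat j)"
  have int: "((\<lambda>u. of_real u powr z * (1 / of_real u ^ Suc j)) has_integral ?G z) {0..d}"
    "(\<lambda>u. complex_of_real u powr z * (1 / of_real u ^ Suc j)) absolutely_integrable_on {0..d}"
    if z: "Re z > real j + 2" for z
  proof -
    have "of_real u powr z * (1 / of_real u ^ Suc j) = complex_of_real u powr (z - of_nat j - 1)" for u
      by (cases "u = 0") (simp_all add: powr_diff powr_nat')
    note eq = this
    show "((\<lambda>u. of_real u powr z * (1 / of_real u ^ Suc j)) has_integral ?G z) {0..d}"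
      unfolding eq by (rule has_integral_of_real_powr) (use z d in auto)
    show "(\<lambda>u. complex_of_real u powr z * (1 / of_real u ^ Suc j)) absolutely_integrable_on {0..d}"
      unfolding eq by (intro absolutely_integrable_continuous_real continuous_on_of_real_powr) (use z in auto)
  qed
  have mero: "?G meromorphic_on UNIV"
    by (intro meromorphic_intros analytic_on_imp_meromorphic_on analytic_intros) (use d in auto)
  have "\<exists>L. ?G has_laurent_expansion L \<and> fls_nth L 0 = (if j = 0 then of_real (ln d) else - (1 / (of_nat j * of_real d ^ j)))"
  proof (cases "j = 0")
    case False
    have "?G analytic_on {0}" using False d by (intro analytic_intros) auto
    moreover have "?G 0 = - (1 / (of_nat j * of_real d ^ j))"
      using False d by (simp add: powr_minus powr_nat' field_simps)
    ultimately show ?thesis using analytic_imp_laurent_nth_0[of ?G] False by simp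
  next
    case True
    let ?p = "\<lambda>z. complex_of_real d powr z"
    \<comment> \<open>The divided difference of d^z at 0 is entire and d^z / z is its sum with 1 /
      z; its value at 0 is the derivative ln d.\<close>
    let ?E = "\<lambda>z. if z = 0 then deriv ?p 0 else (?p z - ?p 0) / (z - 0)"
    have "?p holomorphic_on UNIV" using d by (intro holomorphic_intros) auto
    then have "?E holomorphic_on UNIV" by (rule pole_lemma) auto
    then have "?E analytic_on {0}" by (auto simp: analytic_at)
    from analytic_imp_laurent_nth_0[OF this] obtain L where L: "?E has_laurent_expansion L" "fls_nth L 0 = deriv ?p 0" by auto
    have "(?p has_field_derivative of_real (ln d)) (at 0)"
      using d by (auto intro!: derivative_eq_intros simp: Ln_of_real)
    then have "deriv ?p 0 = of_real (ln d)" by (rule DERIV_imp_deriv)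
    moreover have "(\<lambda>z. ?E z + inverse z) has_laurent_expansion L + fls_X_inv"
      using L by (intro laurent_expansion_intros) (auto intro: laurent_expansion_intros)
    then have "?G has_laurent_expansion L + fls_X_inv"
    proof (subst has_laurent_expansion_cong)
      show "\<forall>\<^sub>F z in at 0. ?G z = ?E z + inverse z"
        using d True by (auto simp: eventually_at_filter field_simps)
    qed auto
    ultimately show ?thesis using L True by (intro exI[of _ "L + fls_X_inv"]) auto
  qed
  then obtain L where "?G has_laurent_expansion L" "fls_nth L 0 = (if j = 0 then of_real (ln d) else - (1 / (of_nat j * of_real d ^ j)))" by blast
  then show ?thesis
    unfolding half_reg_integral_def
  proof (intro exI conjI allI impI)
    fix z assume z: "real j + 2 < Re z"
    show "(\<lambda>u. complex_of_real u powr z * (1 / of_real u ^ Suc j)) absolutely_integrable_on {0..d}"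
      by (rule int(2)[OF z])
    show "?G z = integral {0..d} (\<lambda>u. of_real u powr z * (1 / of_real u ^ Suc j))"
      by (rule integral_unique[OF int(1)[OF z], symmetric])
  qed (rule mero)
qed

text \<open>The poles are at - 1, - 2, and so on. After removal of K terms every denominator has
  modulus at least 1 / 2 on Re z > - K - 1 / 2, so the rest converges uniformly there, and these
  half-planes exhaust the plane.\<close>

lemma meromorphic_partial_fraction_series:
  fixes \<beta> :: "nat \<Rightarrow> complex"
  assumes \<beta>: "summable (\<lambda>j. norm (\<beta> j))"
  shows "(\<lambda>z. \<Sum>j. \<beta> j / (z + of_nat (Suc j))) meromorphic_on UNIV"
    and "(\<lambda>z. \<Sum>j. \<beta> j / (z + of_nat (Suc j))) holomorphic_on {z. Re z > - 1 / 2}"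
    and "Re z > - 1 / 2 \<Longrightarrow> summable (\<lambda>j. \<beta> j / (z + of_nat (Suc j)))"
proof -
  let ?D = "\<lambda>K. {z. Re z > - real K - 1 / 2}"
  have bd: "norm (\<beta> (j + K) / (z + of_nat (Suc (j + K)))) \<le> 2 * norm (\<beta> (j + K))" if "z \<in> ?D K" for z j K
  proof -
    have "1 / 2 \<le> Re (z + of_nat (Suc (j + K)))" using that by auto
    also have "\<dots> \<le> norm (z + of_nat (Suc (j + K)))" by (rule complex_Re_le_cmod)
    finally have 1: "1 / 2 \<le> norm (z + of_nat (Suc (j + K)))" .
    then have "norm (\<beta> (j + K)) / norm (z + of_nat (Suc (j + K))) \<le> norm (\<beta> (j + K)) / (1 / 2)"
      by (intro divide_left_mono) auto
    then show ?thesis by (simp add: norm_divide)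
  qed
  have sm: "summable (\<lambda>j. 2 * norm (\<beta> (j + K)))" for K
    by (intro summable_mult summable_ignore_initial_segment \<beta>)
  have sum: "summable (\<lambda>j. \<beta> (j + K) / (z + of_nat (Suc (j + K))))" if "z \<in> ?D K" for z K
    by (rule summable_comparison_test'[OF sm[of K], of 0]) (use bd[OF that] in auto)
  have hol: "(\<lambda>z. \<Sum>j. \<beta> (j + K) / (z + of_nat (Suc (j + K)))) holomorphic_on ?D K" for K
  proof (rule holomorphic_uniform_sequence)
    show op: "open (?D K)" by (rule open_halfspace_Re_gt)
    show "(\<lambda>z. \<Sum>j<n. \<beta> (j + K) / (z + of_nat (Suc (j + K)))) holomorphic_on ?D K" for n
    proof (intro holomorphic_intros)
      fix z j assume "z \<in> ?D K"
      then have "Re (z + of_nat (Suc (j + K))) > 0" by auto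
      then show "z + of_nat (Suc (j + K)) \<noteq> 0" by (metis less_irrefl zero_complex.sel(1))
    qed
    fix z assume "z \<in> ?D K"
    then obtain d where d: "d > 0" "cball z d \<subseteq> ?D K" using op open_contains_cball by blast
    have "uniform_limit (cball z d) (\<lambda>n z. \<Sum>j<n. \<beta> (j + K) / (z + of_nat (Suc (j + K)))) (\<lambda>z. \<Sum>j. \<beta> (j + K) / (z + of_nat (Suc (j + K)))) sequentially"
      by (rule Weierstrass_m_test[OF _ sm[of K]]) (use bd d in blast)
    then show "\<exists>d>0. cball z d \<subseteq> ?D K \<and> uniform_limit (cball z d) (\<lambda>n z. \<Sum>j<n. \<beta> (j + K) / (z + of_nat (Suc (j + K)))) (\<lambda>z. \<Sum>j. \<beta> (j + K) / (z + of_nat (Suc (j + K)))) sequentially"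
      using d by blast
  qed
  show "(\<lambda>z. \<Sum>j. \<beta> j / (z + of_nat (Suc j))) holomorphic_on {z. Re z > - 1 / 2}" using hol[of 0] by simp
  show "Re z > - 1 / 2 \<Longrightarrow> summable (\<lambda>j. \<beta> j / (z + of_nat (Suc j)))" using sum[of z 0] by simp
  show "(\<lambda>z. \<Sum>j. \<beta> j / (z + of_nat (Suc j))) meromorphic_on UNIV"
  proof (subst meromorphic_on_meromorphic_at, intro ballI)
    fix z0 :: complex
    obtain K where K: "- Re z0 < real K" using reals_Archimedean2 by blast
    let ?H = "\<lambda>z. (\<Sum>j. \<beta> (j + K) / (z + of_nat (Suc (j + K)))) + (\<Sum>j<K. \<beta> j / (z + of_nat (Suc j)))"
    have "(\<lambda>z. \<Sum>j. \<beta> (j + K) / (z + of_nat (Suc (j + K)))) meromorphic_on ?D K"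
      by (intro analytic_on_imp_meromorphic_on) (use hol[of K] open_halfspace_Re_gt in \<open>auto simp: analytic_on_open\<close>)
    then have "?H meromorphic_on ?D K" by (intro meromorphic_intros) auto
    then have "?H meromorphic_on {z0}" by (rule meromorphic_on_subset) (use K in auto)
    also have "?this \<longleftrightarrow> (\<lambda>z. \<Sum>j. \<beta> j / (z + of_nat (Suc j))) meromorphic_on {z0}"
    proof (rule meromorphic_on_cong)
      fix z assume "z \<in> {z0}"
      then have "\<forall>\<^sub>F w in at z. w \<in> ?D K" using K by (intro eventually_at_in_open' open_halfspace_Re_gt) auto
      then show "\<forall>\<^sub>F w in at z. ?H w = (\<Sum>j. \<beta> j / (w + of_nat (Suc j)))"
      proof eventually_elim
        case (elim w)
        have "summable (\<lambda>j. \<beta> j / (w + of_nat (Suc j)))"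
          using sum[OF elim] by (subst summable_iff_shift[symmetric, of _ K])
        from suminf_split_initial_segment[OF this, of K] show ?case by simp
      qed
    qed auto
    finally show "(\<lambda>z. \<Sum>j. \<beta> j / (z + of_nat (Suc j))) meromorphic_on {z0}" .
  qed
qed

text \<open>Near 0 the power series of p is integrated term by term against u^z. This gives
  \<epsilon>^(z + 1) times a partial fraction series, which is meromorphic on the plane and
  holomorphic at z = 0, while the interval from \<epsilon> to d contributes an entire function. So
  for an analytic integrand the finite part is the ordinary integral.\<close>

lemma half_reg_integral_analytic:
  assumes g: "continuous_on {0..d} g" and p: "p holomorphic_on ball 0 R" "R > 0" and d: "d > 0"
    and eq: "\<And>u. 0 \<le> u \<Longrightarrow> u < R \<Longrightarrow> u \<le> d \<Longrightarrow> g u = p (of_real u)"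
  shows "half_reg_integral g d (integral {0..d} g)"
proof -
  \<comment> \<open>Strictly inside the disc of convergence, so that the coefficients weighted by
    \<epsilon>^j are absolutely summable.\<close>
  define \<epsilon> where "\<epsilon> = min (R / 2) d"
  have \<epsilon>: "0 < \<epsilon>" "\<epsilon> < R" "\<epsilon> \<le> d" using p d by (auto simp: \<epsilon>_def)
  define \<alpha> where "\<alpha> = (\<lambda>j. (deriv ^^ j) p 0 / fact j)"
  have sums: "(\<lambda>j. \<alpha> j * w ^ j) sums p w" if "norm w < R" for w
    using holomorphic_power_series[OF p(1), of w] that by (simp add: \<alpha>_def)
  define \<beta> where "\<beta> = (\<lambda>j. \<alpha> j * of_real \<epsilon> ^ j)"
  have sm: "summable (\<lambda>j. norm (\<beta> j))"
  proof -
    obtain R' where R': "\<epsilon> < R'" "R' < R" using \<epsilon> dense by blast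
    have "summable (\<lambda>j. \<alpha> j * of_real R' ^ j)" using sums[of "of_real R'"] R' \<epsilon> by (auto intro: sums_summable)
    then show ?thesis unfolding \<beta>_def by (rule powser_insidea) (use R' \<epsilon> in auto)
  qed
  \<comment> \<open>Termwise integration for a general continuous kernel k: it is applied with k u =
    u powr z, and with k = 1 for the value at z = 0.\<close>
  have inner: "((\<lambda>u. k u * g u) has_integral (\<Sum>j. \<alpha> j * v j)) {0..\<epsilon>}"
    if k: "continuous_on {0..\<epsilon>} k" and v: "\<And>j. ((\<lambda>u. k u * of_real u ^ j) has_integral v j) {0..\<epsilon>}" for k v
  proof -
    have bk: "bounded (k ` {0..\<epsilon>})" using compact_continuous_image[OF k] compact_imp_bounded by blast
    then obtain B where B: "\<And>u. u \<in> {0..\<epsilon>} \<Longrightarrow> norm (k u) \<le> B" by (force simp: bounded_iff)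
    have B0: "B \<ge> 0" using order_trans[OF norm_ge_zero B[of 0]] \<epsilon> by auto
    have ul: "uniform_limit {0..\<epsilon>} (\<lambda>n u. \<Sum>j<n. \<alpha> j * (k u * of_real u ^ j)) (\<lambda>u. \<Sum>j. \<alpha> j * (k u * of_real u ^ j)) sequentially"
    proof (rule Weierstrass_m_test)
      show "summable (\<lambda>j. B * norm (\<beta> j))" by (intro summable_mult sm)
      fix j u assume u: "u \<in> {0..\<epsilon>}"
      have "norm (\<alpha> j * (k u * of_real u ^ j)) = norm (k u) * (norm (\<alpha> j) * u ^ j)" using u by (simp add: norm_mult norm_power)
      also have "\<dots> \<le> B * (norm (\<alpha> j) * \<epsilon> ^ j)" using u B[OF u] B0 by (intro mult_mono mult_left_mono power_mono) auto
      also have "\<dots> = B * norm (\<beta> j)" using \<epsilon> by (simp add: \<beta>_def norm_mult norm_power)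
      finally show "norm (\<alpha> j * (k u * of_real u ^ j)) \<le> B * norm (\<beta> j)" .
    qed
    obtain I J where IJ: "\<And>n. ((\<lambda>u. \<Sum>j<n. \<alpha> j * (k u * of_real u ^ j)) has_integral I n) {0..\<epsilon>}"
      "((\<lambda>u. \<Sum>j. \<alpha> j * (k u * of_real u ^ j)) has_integral J) {0..\<epsilon>}" "I \<longlonglongrightarrow> J"
    proof (rule uniform_limit_integral[OF ul])
      show "continuous_on {0..\<epsilon>} (\<lambda>u. \<Sum>j<n. \<alpha> j * (k u * of_real u ^ j))" for n by (intro continuous_intros k)
    qed (auto intro: that)
    have "I n = (\<Sum>j<n. \<alpha> j * v j)" for n
      by (rule has_integral_unique[OF IJ(1)]) (intro has_integral_sum has_integral_mult_right v finite_lessThan)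
    then have "(\<lambda>j. \<alpha> j * v j) sums J" using IJ(3) unfolding sums_def by presburger
    moreover have "(\<Sum>j. \<alpha> j * (k u * of_real u ^ j)) = k u * g u" if u: "u \<in> {0..\<epsilon>}" for u
    proof -
      have "(\<lambda>j. k u * (\<alpha> j * of_real u ^ j)) sums (k u * p (of_real u))"
        by (rule sums_mult[OF sums]) (use u \<epsilon> in auto)
      moreover have "p (of_real u) = g u" using eq[of u] u \<epsilon> by auto
      ultimately show ?thesis by (simp add: sums_iff mult_ac)
    qed
    then have "((\<lambda>u. k u * g u) has_integral J) {0..\<epsilon>}" using has_integral_eq[OF _ IJ(2)] by simp
    ultimately show ?thesis by (simp add: sums_iff)
  qed
  let ?S = "\<lambda>z. \<Sum>j. \<beta> j / (z + of_nat (Suc j))"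
  define Q where "Q = (\<lambda>z. complex_of_real \<epsilon> powr (z + 1) * ?S z)"
  let ?O = "\<lambda>z. integral {\<epsilon>..d} (\<lambda>u. exp (z * of_real (ln u)) * g u)"
  have contg: "continuous_on {\<epsilon>..d} g" by (rule continuous_on_subset[OF g]) (use \<epsilon> in auto)
  have holO: "?O holomorphic_on UNIV"
    by (rule holomorphic_integral_exp_kernel) (use \<epsilon> in \<open>auto intro!: continuous_intros contg\<close>)
  have tm: "\<alpha> j * (complex_of_real \<epsilon> powr (z + of_nat j + 1) / (z + of_nat j + 1)) = of_real \<epsilon> powr (z + 1) * (\<beta> j / (z + of_nat (Suc j)))" for z j
    using \<epsilon> by (simp add: \<beta>_def powr_add powr_nat' add_ac mult_ac)
  have Qint: "((\<lambda>u. of_real u powr z * g u) has_integral Q z) {0..\<epsilon>}" if z: "Re z > 0" for z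
  proof -
    have "((\<lambda>u. of_real u powr z * g u) has_integral (\<Sum>j. \<alpha> j * (complex_of_real \<epsilon> powr (z + of_nat j + 1) / (z + of_nat j + 1)))) {0..\<epsilon>}"
    proof (rule inner)
      show "continuous_on {0..\<epsilon>} (\<lambda>u. complex_of_real u powr z)" by (rule continuous_on_of_real_powr[OF z])
      fix j
      have "((\<lambda>u. complex_of_real u powr (z + of_nat j + 1 - 1)) has_integral (complex_of_real \<epsilon> powr (z + of_nat j + 1) / (z + of_nat j + 1))) {0..\<epsilon>}"
        by (rule has_integral_of_real_powr) (use z \<epsilon> in auto)
      moreover have "complex_of_real u powr (z + of_nat j + 1 - 1) = of_real u powr z * of_real u ^ j" for u
        by (cases "u = 0") (auto simp: powr_add powr_nat')
      ultimately show "((\<lambda>u. complex_of_real u powr z * of_real u ^ j) has_integral (complex_of_real \<epsilon> powr (z + of_nat j + 1) / (z + of_nat j + 1))) {0..\<epsilon>}"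
        by simp
    qed
    moreover have "summable (\<lambda>j. \<beta> j / (z + of_nat (Suc j)))"
      using meromorphic_partial_fraction_series(3)[OF sm, of z] z by simp
    ultimately show ?thesis unfolding tm Q_def by (simp only: suminf_mult)
  qed
  \<comment> \<open>For z = 0 the kernel has to be the constant 1, because u powr 0 is 0 at u = 0.
    Ignoring that single point also settles j = 0, where u^j is 1.\<close>
  have Q0: "(g has_integral Q 0) {0..\<epsilon>}"
  proof -
    have "((\<lambda>u. 1 * g u) has_integral (\<Sum>j. \<alpha> j * (complex_of_real \<epsilon> powr (0 + of_nat j + 1) / (0 + of_nat j + 1)))) {0..\<epsilon>}"
    proof (rule inner)
      fix j
      have A: "((\<lambda>u. complex_of_real u powr (of_nat j + 1 - 1)) has_integral (complex_of_real \<epsilon> powr (of_nat j + 1) / (of_nat j + 1))) {0..\<epsilon>}"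
        by (rule has_integral_of_real_powr) (use \<epsilon> in auto)
      show "((\<lambda>u. 1 * complex_of_real u ^ j) has_integral (complex_of_real \<epsilon> powr (0 + of_nat j + 1) / (0 + of_nat j + 1))) {0..\<epsilon>}"
        unfolding add_0_left
      proof (rule has_integral_spike_finite[OF _ _ A])
        show "1 * complex_of_real u ^ j = complex_of_real u powr (of_nat j + 1 - 1)" if "u \<in> {0..\<epsilon>} - {0}" for u
          using that by (auto simp: powr_nat')
      qed simp
    qed auto
    moreover have "summable (\<lambda>j. \<beta> j / (0 + of_nat (Suc j)))"
      using meromorphic_partial_fraction_series(3)[OF sm, of 0] by simp
    ultimately show ?thesis unfolding tm Q_def by (simp only: suminf_mult mult_1_left)
  qed
  have Gint: "((\<lambda>u. of_real u powr z * g u) has_integral (Q z + ?O z)) {0..d}" if z: "Re z > 0" for z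
  proof (rule has_integral_combine[OF _ _ Qint[OF z]])
    have "((\<lambda>u. exp (z * of_real (ln u)) * g u) has_integral ?O z) {\<epsilon>..d}"
      using \<epsilon> by (intro integrable_integral integrable_continuous_real continuous_intros contg) auto
    then show "((\<lambda>u. of_real u powr z * g u) has_integral ?O z) {\<epsilon>..d}"
      by (rule has_integral_eq[rotated]) (use \<epsilon> in \<open>auto simp: powr_def Ln_of_real\<close>)
  qed (use \<epsilon> in auto)
  have G0: "Q 0 + ?O 0 = integral {0..d} g"
  proof (rule integral_unique[symmetric], rule has_integral_combine[OF _ _ Q0])
    show "(g has_integral ?O 0) {\<epsilon>..d}"
      using \<epsilon> by (auto intro!: integrable_integral integrable_continuous_real contg)
  qed (use \<epsilon> in auto)
  have meroG: "(\<lambda>z. Q z + ?O z) meromorphic_on UNIV"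
    unfolding Q_def
    by (intro meromorphic_intros meromorphic_partial_fraction_series(1)[OF sm] analytic_on_imp_meromorphic_on)
       (use holO \<epsilon> in \<open>auto intro!: holomorphic_intros simp: analytic_on_open\<close>)
  have "(\<lambda>z. Q z + ?O z) holomorphic_on {z. Re z > - 1 / 2}"
    unfolding Q_def
    by (intro holomorphic_intros meromorphic_partial_fraction_series(2)[OF sm] holomorphic_on_subset[OF holO]) (use \<epsilon> in auto)
  then have "(\<lambda>z. Q z + ?O z) analytic_on {z. Re z > - 1 / 2}"
    using open_halfspace_Re_gt by (auto simp: analytic_on_open)
  then have "(\<lambda>z. Q z + ?O z) analytic_on {0}" by (rule analytic_on_subset) auto
  from analytic_imp_laurent_nth_0[OF this] obtain L where L: "(\<lambda>z. Q z + ?O z) has_laurent_expansion L" "fls_nth L 0 = integral {0..d} g"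
    using G0 by auto
  show ?thesis
    unfolding half_reg_integral_def
  proof (intro exI conjI allI impI)
    show "(\<lambda>z. Q z + ?O z) meromorphic_on UNIV" by (rule meroG)
    show "(\<lambda>z. Q z + ?O z) has_laurent_expansion L" "fls_nth L 0 = integral {0..d} g" by (rule L)+
    fix z :: complex assume z: "0 < Re z"
    show "(\<lambda>u. of_real u powr z * g u) absolutely_integrable_on {0..d}"
      by (intro absolutely_integrable_continuous_real continuous_on_mult continuous_on_of_real_powr z g)
    show "Q z + ?O z = integral {0..d} (\<lambda>u. of_real u powr z * g u)"
      using integral_unique[OF Gint[OF z]] by simp
  qed
qed

lemma half_reg_integral_imp_pole:
  assumes ab: "a < c" "c < b"
    and 1: "half_reg_integral (\<lambda>u. g (c + u)) (b - c) v" and 2: "half_reg_integral (\<lambda>u. g (c - u)) (c - a) w"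
  shows "has_reg_integral_pole g a b c (v + w)"
proof -
  obtain G L C where G: "G meromorphic_on UNIV"
    "\<And>z. Re z > C \<Longrightarrow> (\<lambda>u. of_real u powr z * g (c + u)) absolutely_integrable_on {0..b - c} \<and> G z = integral {0..b - c} (\<lambda>u. of_real u powr z * g (c + u))"
    "G has_laurent_expansion L" "fls_nth L 0 = v"
    using 1 unfolding half_reg_integral_def by blast
  obtain H M D where H: "H meromorphic_on UNIV"
    "\<And>z. Re z > D \<Longrightarrow> (\<lambda>u. of_real u powr z * g (c - u)) absolutely_integrable_on {0..c - a} \<and> H z = integral {0..c - a} (\<lambda>u. of_real u powr z * g (c - u))"
    "H has_laurent_expansion M" "fls_nth M 0 = w"
    using 2 unfolding half_reg_integral_def by blast
  show ?thesis
    unfolding has_reg_integral_pole_def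
  proof (intro exI conjI allI impI)
    show "(\<lambda>z. G z + H z) meromorphic_on UNIV" by (intro meromorphic_intros G H)
    show "(\<lambda>z. G z + H z) has_laurent_expansion L + M" by (intro laurent_expansion_intros G H)
    show "fls_nth (L + M) 0 = v + w" using G H by simp
    fix z assume "max C D < Re z"
    then have 1: "(\<lambda>u. of_real u powr z * g (c + u)) absolutely_integrable_on {0..b - c}" "G z = integral {0..b - c} (\<lambda>u. of_real u powr z * g (c + u))"
      and 2: "(\<lambda>u. of_real u powr z * g (c - u)) absolutely_integrable_on {0..c - a}" "H z = integral {0..c - a} (\<lambda>u. of_real u powr z * g (c - u))"
      using G(2)[of z] H(2)[of z] by auto
    let ?f = "\<lambda>t. of_real \<bar>t - c\<bar> powr z * g t"
    have i1: "(\<lambda>u. c + u) ` {0..b - c} = {c..b}"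
      using image_add_atLeastAtMost[of c 0 "b - c"] by simp
    have i2: "(\<lambda>u. c - u) ` {0..c - a} = {a..c}"
      using image_diff_atLeastAtMost[of c 0 "c - a"] by simp
    have r: "?f absolutely_integrable_on {c..b} \<and> integral {c..b} ?f = G z"
    proof -
      have "(\<lambda>x. \<bar>1\<bar> *\<^sub>R ?f (c + x)) absolutely_integrable_on {0..b - c} \<and> integral {0..b - c} (\<lambda>x. \<bar>1\<bar> *\<^sub>R ?f (c + x)) = G z"
      proof -
        have "(\<lambda>x. \<bar>1\<bar> *\<^sub>R ?f (c + x)) absolutely_integrable_on {0..b - c} \<longleftrightarrow> (\<lambda>u. of_real u powr z * g (c + u)) absolutely_integrable_on {0..b - c}"
          by (rule set_integrable_cong) auto
        moreover have "integral {0..b - c} (\<lambda>x. \<bar>1\<bar> *\<^sub>R ?f (c + x)) = integral {0..b - c} (\<lambda>u. of_real u powr z * g (c + u))"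
          by (rule integral_cong) auto
        ultimately show ?thesis using 1 by simp
      qed
      then show ?thesis
        by (subst (asm) has_absolute_integral_change_of_variables_real) (auto intro!: derivative_eq_intros simp: i1 inj_on_def)
    qed
    have l: "?f absolutely_integrable_on {a..c} \<and> integral {a..c} ?f = H z"
    proof -
      have "(\<lambda>x. \<bar>-1\<bar> *\<^sub>R ?f (c - x)) absolutely_integrable_on {0..c - a} \<and> integral {0..c - a} (\<lambda>x. \<bar>-1\<bar> *\<^sub>R ?f (c - x)) = H z"
      proof -
        have "(\<lambda>x. \<bar>-1\<bar> *\<^sub>R ?f (c - x)) absolutely_integrable_on {0..c - a} \<longleftrightarrow> (\<lambda>u. of_real u powr z * g (c - u)) absolutely_integrable_on {0..c - a}"
          by (rule set_integrable_cong) auto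
        moreover have "integral {0..c - a} (\<lambda>x. \<bar>-1\<bar> *\<^sub>R ?f (c - x)) = integral {0..c - a} (\<lambda>u. of_real u powr z * g (c - u))"
          by (rule integral_cong) auto
        ultimately show ?thesis using 2 by simp
      qed
      then show ?thesis
        by (subst (asm) has_absolute_integral_change_of_variables_real) (auto intro!: derivative_eq_intros simp: i2 inj_on_def)
    qed
    have u: "{a..b} = {a..c} \<union> {c..b}" using ab by auto
    show "?f absolutely_integrable_on {a..b}" unfolding u using r l by (intro set_integrable_Un) auto
    then have "?f integrable_on {a..b}" by (rule set_lebesgue_integral_eq_integral(1))
    then show "G z + H z = integral {a..b} ?f"
      using Henstock_Kurzweil_Integration.integral_combine[OF less_imp_le[OF ab(1)] less_imp_le[OF ab(2)], of ?f] r l by (simp add: add.commute)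
  qed
qed

section \<open>Principal values in the logarithmic coordinate\<close>

text \<open>Averaging over both sides of the axis makes the limit exist for poles of every order.\<close>
definition has_pv :: "(complex \<Rightarrow> complex) \<Rightarrow> real \<Rightarrow> real \<Rightarrow> complex \<Rightarrow> bool" where
  "has_pv g A B v \<longleftrightarrow>
     (\<forall>\<^sub>F \<eta> in at_right 0. (\<lambda>x. g (Complex x \<eta>)) integrable_on {A..B} \<and> (\<lambda>x. g (Complex x (- \<eta>))) integrable_on {A..B}) \<and>
     ((\<lambda>\<eta>. (integral {A..B} (\<lambda>x. g (Complex x \<eta>)) + integral {A..B} (\<lambda>x. g (Complex x (- \<eta>)))) / 2) \<longlongrightarrow> v) (at_right 0)"

lemma has_pv_unique: "has_pv g A B v \<Longrightarrow> has_pv g A B w \<Longrightarrow> v = w"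
  unfolding has_pv_def using tendsto_unique[OF trivial_limit_at_right_real] by blast

lemma has_pv_add:
  assumes "has_pv g A B v" "has_pv h A B w"
  shows "has_pv (\<lambda>x. g x + h x) A B (v + w)"
  unfolding has_pv_def
proof
  have ev: "\<forall>\<^sub>F \<eta> in at_right 0. ((\<lambda>x. g (Complex x \<eta>)) integrable_on {A..B} \<and> (\<lambda>x. g (Complex x (- \<eta>))) integrable_on {A..B}) \<and>
     (\<lambda>x. h (Complex x \<eta>)) integrable_on {A..B} \<and> (\<lambda>x. h (Complex x (- \<eta>))) integrable_on {A..B}"
    using assms unfolding has_pv_def by (simp add: eventually_conj_iff)
  then show "\<forall>\<^sub>F \<eta> in at_right 0. (\<lambda>x. g (Complex x \<eta>) + h (Complex x \<eta>)) integrable_on {A..B} \<and> (\<lambda>x. g (Complex x (- \<eta>)) + h (Complex x (- \<eta>))) integrable_on {A..B}"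
    by eventually_elim (auto intro: integrable_add)
  have "((\<lambda>\<eta>. (integral {A..B} (\<lambda>x. g (Complex x \<eta>)) + integral {A..B} (\<lambda>x. g (Complex x (- \<eta>)))) / 2 +
       (integral {A..B} (\<lambda>x. h (Complex x \<eta>)) + integral {A..B} (\<lambda>x. h (Complex x (- \<eta>)))) / 2) \<longlongrightarrow> v + w) (at_right 0)"
    using assms unfolding has_pv_def by (intro tendsto_add) auto
  then show "((\<lambda>\<eta>. (integral {A..B} (\<lambda>x. g (Complex x \<eta>) + h (Complex x \<eta>)) + integral {A..B} (\<lambda>x. g (Complex x (- \<eta>)) + h (Complex x (- \<eta>)))) / 2) \<longlongrightarrow> v + w) (at_right 0)"
    by (rule Lim_transform_eventually) (use ev in eventually_elim, simp add: integral_add add_divide_distrib)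
qed

lemma has_pv_cmult:
  assumes "has_pv g A B v"
  shows "has_pv (\<lambda>x. c * g x) A B (c * v)"
  unfolding has_pv_def
proof
  show "\<forall>\<^sub>F \<eta> in at_right 0. (\<lambda>x. c * g (Complex x \<eta>)) integrable_on {A..B} \<and> (\<lambda>x. c * g (Complex x (- \<eta>))) integrable_on {A..B}"
    using assms unfolding has_pv_def by (auto elim!: eventually_mono intro!: integrable_on_mult_right)
  have "((\<lambda>\<eta>. c * ((integral {A..B} (\<lambda>x. g (Complex x \<eta>)) + integral {A..B} (\<lambda>x. g (Complex x (- \<eta>)))) / 2)) \<longlongrightarrow> c * v) (at_right 0)"
    using assms unfolding has_pv_def by (intro tendsto_mult tendsto_const) auto
  then show "((\<lambda>\<eta>. (integral {A..B} (\<lambda>x. c * g (Complex x \<eta>)) + integral {A..B} (\<lambda>x. c * g (Complex x (- \<eta>)))) / 2) \<longlongrightarrow> c * v) (at_right 0)"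
    by (simp add: distrib_left add_divide_distrib)
qed

lemma has_pv_sum:
  assumes "finite R" "\<And>r. r \<in> R \<Longrightarrow> has_pv (g r) A B (v r)"
  shows "has_pv (\<lambda>x. \<Sum>r\<in>R. g r x) A B (\<Sum>r\<in>R. v r)"
  using assms
proof (induction R rule: finite_induct)
  case empty
  then show ?case by (simp add: has_pv_def integrable_0)
next
  case (insert x F)
  then show ?case using has_pv_add[of "g x" A B "v x" "\<lambda>u. \<Sum>r\<in>F. g r u"] by auto
qed

text \<open>Only heights \<eta> different from 0 are compared, so two integrands may differ on the
  axis itself, where default values at poles or at c would disturb.\<close>

lemma has_pv_cong:
  assumes g: "has_pv g A B v" and "\<delta> > 0"
    and eq: "\<And>x \<eta>. A \<le> x \<Longrightarrow> x \<le> B \<Longrightarrow> \<eta> \<noteq> 0 \<Longrightarrow> \<bar>\<eta>\<bar> < \<delta> \<Longrightarrow> g (Complex x \<eta>) = h (Complex x \<eta>)"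
  shows "has_pv h A B v"
proof -
  have 1: "integral {A..B} (\<lambda>x. g (Complex x \<eta>)) = integral {A..B} (\<lambda>x. h (Complex x \<eta>))"
    "(\<lambda>x. g (Complex x \<eta>)) integrable_on {A..B} \<longleftrightarrow> (\<lambda>x. h (Complex x \<eta>)) integrable_on {A..B}" if "\<eta> \<noteq> 0" "\<bar>\<eta>\<bar> < \<delta>" for \<eta>
    using eq that by (auto intro!: integral_cong integrable_cong)
  have ev: "\<forall>\<^sub>F \<eta> in at_right (0::real). 0 < \<eta> \<and> \<eta> < \<delta>"
    using eventually_at_right_real[OF \<open>\<delta> > 0\<close>] by (auto elim: eventually_mono)
  have ev1: "\<forall>\<^sub>F \<eta> in at_right 0. (\<lambda>x. g (Complex x \<eta>)) integrable_on {A..B} \<and> (\<lambda>x. g (Complex x (- \<eta>))) integrable_on {A..B}"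
    and lim: "((\<lambda>\<eta>. (integral {A..B} (\<lambda>x. g (Complex x \<eta>)) + integral {A..B} (\<lambda>x. g (Complex x (- \<eta>)))) / 2) \<longlongrightarrow> v) (at_right 0)"
    using g unfolding has_pv_def by auto
  show ?thesis
    unfolding has_pv_def
  proof
    show "\<forall>\<^sub>F \<eta> in at_right 0. (\<lambda>x. h (Complex x \<eta>)) integrable_on {A..B} \<and> (\<lambda>x. h (Complex x (- \<eta>))) integrable_on {A..B}"
      using ev1 ev by eventually_elim (use 1 in auto)
    show "((\<lambda>\<eta>. (integral {A..B} (\<lambda>x. h (Complex x \<eta>)) + integral {A..B} (\<lambda>x. h (Complex x (- \<eta>)))) / 2) \<longlongrightarrow> v) (at_right 0)"
      by (rule Lim_transform_eventually[OF lim]) (use ev in eventually_elim, simp add: 1)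
  qed
qed

lemma has_pv_combine:
  assumes g: "has_pv g A B v" "has_pv g B C w" and AB: "A \<le> B" "B \<le> C"
  shows "has_pv g A C (v + w)"
proof -
  have ev: "\<forall>\<^sub>F \<eta> in at_right 0. ((\<lambda>x. g (Complex x \<eta>)) integrable_on {A..B} \<and> (\<lambda>x. g (Complex x (- \<eta>))) integrable_on {A..B}) \<and>
     (\<lambda>x. g (Complex x \<eta>)) integrable_on {B..C} \<and> (\<lambda>x. g (Complex x (- \<eta>))) integrable_on {B..C}"
    using g unfolding has_pv_def by (simp add: eventually_conj_iff)
  have ev': "\<forall>\<^sub>F \<eta> in at_right 0. (\<lambda>x. g (Complex x \<eta>)) integrable_on {A..C} \<and> (\<lambda>x. g (Complex x (- \<eta>))) integrable_on {A..C}"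
    using ev by eventually_elim (auto intro: Henstock_Kurzweil_Integration.integrable_combine[OF AB])
  have "((\<lambda>\<eta>. (integral {A..B} (\<lambda>x. g (Complex x \<eta>)) + integral {A..B} (\<lambda>x. g (Complex x (- \<eta>)))) / 2 +
       (integral {B..C} (\<lambda>x. g (Complex x \<eta>)) + integral {B..C} (\<lambda>x. g (Complex x (- \<eta>)))) / 2) \<longlongrightarrow> v + w) (at_right 0)"
    using g unfolding has_pv_def by (intro tendsto_add) auto
  then have "((\<lambda>\<eta>. (integral {A..C} (\<lambda>x. g (Complex x \<eta>)) + integral {A..C} (\<lambda>x. g (Complex x (- \<eta>)))) / 2) \<longlongrightarrow> v + w) (at_right 0)"
  proof (rule Lim_transform_eventually)
    show "\<forall>\<^sub>F \<eta> in at_right 0. (integral {A..B} (\<lambda>x. g (Complex x \<eta>)) + integral {A..B} (\<lambda>x. g (Complex x (- \<eta>)))) / 2 +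
       (integral {B..C} (\<lambda>x. g (Complex x \<eta>)) + integral {B..C} (\<lambda>x. g (Complex x (- \<eta>)))) / 2 =
       (integral {A..C} (\<lambda>x. g (Complex x \<eta>)) + integral {A..C} (\<lambda>x. g (Complex x (- \<eta>)))) / 2"
      using ev'
    proof eventually_elim
      case (elim \<eta>)
      have e: "integral {A..B} (\<lambda>x. g (Complex x \<eta>)) + integral {B..C} (\<lambda>x. g (Complex x \<eta>)) = integral {A..C} (\<lambda>x. g (Complex x \<eta>))"
        "integral {A..B} (\<lambda>x. g (Complex x (- \<eta>))) + integral {B..C} (\<lambda>x. g (Complex x (- \<eta>))) = integral {A..C} (\<lambda>x. g (Complex x (- \<eta>)))"
        using elim AB by (auto intro: Henstock_Kurzweil_Integration.integral_combine)
      show ?case unfolding e[symmetric] by (simp add: add_divide_distrib)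
    qed
  qed
  with ev' show ?thesis unfolding has_pv_def by blast
qed

text \<open>Negation exchanges the lines at heights \<eta> and - \<eta>, and the mean over the two
  is symmetric.\<close>

lemma has_pv_reflect:
  assumes "has_pv g A B v"
  shows "has_pv (\<lambda>x. g (- x)) (- B) (- A) v"
proof -
  have r: "g (- Complex x \<eta>) = (\<lambda>x. g (Complex x (- \<eta>))) (- x)" for x \<eta>
  proof -
    have "- Complex x \<eta> = Complex (- x) (- \<eta>)" by (simp add: complex_eq_iff)
    then show ?thesis by simp
  qed
  have "(\<lambda>x. g (- Complex x \<eta>)) integrable_on {-B..-A} \<longleftrightarrow> (\<lambda>x. g (Complex x (- \<eta>))) integrable_on {A..B}"
    "integral {-B..-A} (\<lambda>x. g (- Complex x \<eta>)) = integral {A..B} (\<lambda>x. g (Complex x (- \<eta>)))" for \<eta>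
    using Henstock_Kurzweil_Integration.integrable_reflect_real[where f = "\<lambda>x. g (Complex x (- \<eta>))" and a = A and b = B]
      Henstock_Kurzweil_Integration.integral_reflect_real[where f = "\<lambda>x. g (Complex x (- \<eta>))" and a = A and b = B]
    by (simp_all only: r)
  from this[of "\<eta>" for \<eta>] this[of "- \<eta>" for \<eta>]
  show ?thesis using assms unfolding has_pv_def by (simp add: conj_commute add.commute)
qed

text \<open>The derivative is taken relative to S because \<open>has_pv_entire\<close> has its
  primitive only on a rectangle that contains part of its boundary.\<close>

lemma integral_complex_primitive_within:
  fixes \<Phi> q :: "complex \<Rightarrow> complex"
  assumes "\<alpha> \<le> \<beta>"
    and "\<And>t. \<alpha> \<le> t \<Longrightarrow> t \<le> \<beta> \<Longrightarrow> p + of_real t * d \<in> S"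
    and "\<And>z. z \<in> S \<Longrightarrow> (\<Phi> has_field_derivative q z) (at z within S)"
  shows "((\<lambda>t. d * q (p + of_real t * d)) has_integral (\<Phi> (p + of_real \<beta> * d) - \<Phi> (p + of_real \<alpha> * d))) {\<alpha>..\<beta>}"
proof (rule fundamental_theorem_of_calculus[OF assms(1)])
  fix t assume t: "t \<in> {\<alpha>..\<beta>}"
  then have "(\<Phi> has_field_derivative q (p + of_real t * d)) (at (p + of_real t * d) within S)"
    using assms(2,3) by auto
  then have D: "(\<Phi> has_field_derivative q (p + of_real t * d)) (at (p + of_real t * d) within (\<lambda>t. p + of_real t * d) ` {\<alpha>..\<beta>})"
    by (rule DERIV_subset) (use assms(2) in auto)
  have "((\<lambda>t. p + of_real t * d) has_vector_derivative d) (at t within {\<alpha>..\<beta>})"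
    by (auto intro!: derivative_eq_intros simp: scaleR_conv_of_real)
  from field_vector_diff_chain_within[OF this D]
  show "((\<lambda>t. \<Phi> (p + of_real t * d)) has_vector_derivative d * q (p + of_real t * d)) (at t within {\<alpha>..\<beta>})"
    by (simp add: o_def)
qed

lemma integral_horizontal:
  assumes "A \<le> B" "\<And>x. A \<le> x \<Longrightarrow> x \<le> B \<Longrightarrow> Complex x \<eta> \<in> S"
    and "\<And>z. z \<in> S \<Longrightarrow> (\<Phi> has_field_derivative g z) (at z within S)"
  shows "((\<lambda>x. g (Complex x \<eta>)) has_integral (\<Phi> (Complex B \<eta>) - \<Phi> (Complex A \<eta>))) {A..B}"
proof -
  have c: "\<i> * complex_of_real \<eta> + of_real x * 1 = Complex x \<eta>" for x by (simp add: complex_eq_iff)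
  have "((\<lambda>t. 1 * g (\<i> * complex_of_real \<eta> + of_real t * 1)) has_integral (\<Phi> (\<i> * of_real \<eta> + of_real B * 1) - \<Phi> (\<i> * of_real \<eta> + of_real A * 1))) {A..B}"
    by (rule integral_complex_primitive_within[OF assms(1) _ assms(3)]) (use assms(2) in \<open>simp add: c del: mult_1_right\<close>)
  then show ?thesis unfolding c by simp
qed

lemma integral_vertical:
  assumes "\<alpha> \<le> \<beta>" "\<And>y. \<alpha> \<le> y \<Longrightarrow> y \<le> \<beta> \<Longrightarrow> Complex X (\<epsilon> * y) \<in> S"
    and "\<And>z. z \<in> S \<Longrightarrow> (\<Phi> has_field_derivative g z) (at z within S)"
  shows "((\<lambda>y. \<i> * of_real \<epsilon> * g (Complex X (\<epsilon> * y))) has_integral (\<Phi> (Complex X (\<epsilon> * \<beta>)) - \<Phi> (Complex X (\<epsilon> * \<alpha>)))) {\<alpha>..\<beta>}"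
proof -
  have c: "complex_of_real X + of_real y * (\<i> * of_real \<epsilon>) = Complex X (\<epsilon> * y)" for y by (simp add: complex_eq_iff)
  have "((\<lambda>t. (\<i> * of_real \<epsilon>) * g (complex_of_real X + of_real t * (\<i> * of_real \<epsilon>))) has_integral
     (\<Phi> (of_real X + of_real \<beta> * (\<i> * of_real \<epsilon>)) - \<Phi> (of_real X + of_real \<alpha> * (\<i> * of_real \<epsilon>)))) {\<alpha>..\<beta>}"
    by (rule integral_complex_primitive_within[OF assms(1) _ assms(3)]) (use assms(2) in \<open>simp add: c del: mult_1_right\<close>)
  then show ?thesis unfolding c by simp
qed

lemma has_pv_primitive:
  assumes AB: "A \<le> B" and \<delta>: "\<delta> > 0"
    and \<Phi>: "\<And>z. A \<le> Re z \<Longrightarrow> Re z \<le> B \<Longrightarrow> 0 < Im z \<Longrightarrow> Im z < \<delta> \<Longrightarrow> (\<Phi> has_field_derivative g z) (at z)"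
    and \<Psi>: "\<And>z. A \<le> Re z \<Longrightarrow> Re z \<le> B \<Longrightarrow> - \<delta> < Im z \<Longrightarrow> Im z < 0 \<Longrightarrow> (\<Psi> has_field_derivative g z) (at z)"
    and lim: "isCont \<Phi> (of_real A)" "isCont \<Phi> (of_real B)" "isCont \<Psi> (of_real A)" "isCont \<Psi> (of_real B)"
  shows "has_pv g A B ((\<Phi> (of_real B) - \<Phi> (of_real A) + (\<Psi> (of_real B) - \<Psi> (of_real A))) / 2)"
proof -
  have 1: "((\<lambda>x. g (Complex x \<eta>)) has_integral (\<Phi> (Complex B \<eta>) - \<Phi> (Complex A \<eta>))) {A..B}"
    "((\<lambda>x. g (Complex x (- \<eta>))) has_integral (\<Psi> (Complex B (- \<eta>)) - \<Psi> (Complex A (- \<eta>)))) {A..B}"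
    if "0 < \<eta>" "\<eta> < \<delta>" for \<eta>
  proof -
    show "((\<lambda>x. g (Complex x \<eta>)) has_integral (\<Phi> (Complex B \<eta>) - \<Phi> (Complex A \<eta>))) {A..B}"
      by (rule integral_horizontal[where S = "{z. A \<le> Re z \<and> Re z \<le> B \<and> 0 < Im z \<and> Im z < \<delta>}"])
         (use that AB \<Phi> in \<open>auto intro: has_field_derivative_at_within\<close>)
    show "((\<lambda>x. g (Complex x (- \<eta>))) has_integral (\<Psi> (Complex B (- \<eta>)) - \<Psi> (Complex A (- \<eta>)))) {A..B}"
      by (rule integral_horizontal[where S = "{z. A \<le> Re z \<and> Re z \<le> B \<and> - \<delta> < Im z \<and> Im z < 0}"])
         (use that AB \<Psi> in \<open>auto intro: has_field_derivative_at_within\<close>)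
  qed
  have ev: "\<forall>\<^sub>F \<eta> in at_right (0::real). 0 < \<eta> \<and> \<eta> < \<delta>"
    using eventually_at_right_real[OF \<delta>] by (auto elim: eventually_mono)
  have c: "((\<lambda>\<eta>. Complex X (\<epsilon> * \<eta>)) \<longlongrightarrow> of_real X) (at_right 0)" for X \<epsilon> :: real
  proof -
    have "((\<lambda>\<eta>. Complex X (\<epsilon> * \<eta>)) \<longlongrightarrow> Complex X (\<epsilon> * 0)) (at_right 0)"
      by (intro tendsto_Complex tendsto_intros)
    then show ?thesis by (simp add: complex_of_real_def)
  qed
  have lim: "((\<lambda>\<eta>. (\<Phi> (Complex B (1 * \<eta>)) - \<Phi> (Complex A (1 * \<eta>)) + (\<Psi> (Complex B (- 1 * \<eta>)) - \<Psi> (Complex A (- 1 * \<eta>)))) / 2) \<longlongrightarrow>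
     (\<Phi> (of_real B) - \<Phi> (of_real A) + (\<Psi> (of_real B) - \<Psi> (of_real A))) / 2) (at_right 0)"
    by (intro tendsto_intros isCont_tendsto_compose[OF lim(1) c] isCont_tendsto_compose[OF lim(2) c]
      isCont_tendsto_compose[OF lim(3) c] isCont_tendsto_compose[OF lim(4) c]) auto
  show ?thesis
    unfolding has_pv_def
  proof
    show "\<forall>\<^sub>F \<eta> in at_right 0. (\<lambda>x. g (Complex x \<eta>)) integrable_on {A..B} \<and> (\<lambda>x. g (Complex x (- \<eta>))) integrable_on {A..B}"
      using ev by eventually_elim (use 1 in blast)
    show "((\<lambda>\<eta>. (integral {A..B} (\<lambda>x. g (Complex x \<eta>)) + integral {A..B} (\<lambda>x. g (Complex x (- \<eta>)))) / 2) \<longlongrightarrow>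
       (\<Phi> (of_real B) - \<Phi> (of_real A) + (\<Psi> (of_real B) - \<Psi> (of_real A))) / 2) (at_right 0)"
    proof (rule Lim_transform_eventually[OF lim])
      show "\<forall>\<^sub>F \<eta> in at_right 0. (\<Phi> (Complex B (1 * \<eta>)) - \<Phi> (Complex A (1 * \<eta>)) + (\<Psi> (Complex B (- 1 * \<eta>)) - \<Psi> (Complex A (- 1 * \<eta>)))) / 2 =
         (integral {A..B} (\<lambda>x. g (Complex x \<eta>)) + integral {A..B} (\<lambda>x. g (Complex x (- \<eta>)))) / 2"
        using ev
      proof eventually_elim
        case (elim \<eta>)
        then show ?case using integral_unique[OF 1(1)[of \<eta>]] integral_unique[OF 1(2)[of \<eta>]] by simp
      qed
    qed
  qed
qed

lemma has_pv_holomorphic: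
  assumes AB: "A \<le> B" and U: "open U" "complex_of_real ` {A..B} \<subseteq> U" and g: "g holomorphic_on U"
  shows "has_pv g A B (integral {A..B} (\<lambda>x. g (of_real x)))"
proof -
  have "compact (complex_of_real ` {A..B})" by (intro compact_continuous_image continuous_intros) auto
  from compact_subset_open_imp_ball_epsilon_subset[OF this U] obtain e where e: "e > 0" "(\<Union>x\<in>complex_of_real ` {A..B}. ball x e) \<subseteq> U"
    by blast
  \<comment> \<open>A rectangle around [A, B]: convex, so that g has a primitive on it, and thin
    enough to lie in U.\<close>
  define W where "W = {z. Re z > A - e / 2} \<inter> {z. Re z < B + e / 2} \<inter> {z. Im z > - e / 2} \<inter> {z. Im z < e / 2}"
  have W: "open W" "convex W"
    unfolding W_def by (intro open_Int open_halfspace_Re_gt open_halfspace_Re_lt open_halfspace_Im_gt open_halfspace_Im_lt,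
       intro convex_Int convex_halfspace_Re_gt convex_halfspace_Re_lt convex_halfspace_Im_gt convex_halfspace_Im_lt)
  have "W \<subseteq> U"
  proof
    fix z assume z: "z \<in> W"
    define x where "x = max A (min B (Re z))"
    have x: "x \<in> {A..B}" "\<bar>Re z - x\<bar> < e / 2" using z AB e by (auto simp: x_def W_def max_def min_def)
    have "norm (z - of_real x) \<le> \<bar>Re z - x\<bar> + \<bar>Im z\<bar>" using cmod_le[of "z - of_real x"] by simp
    also have "\<dots> < e"
    proof -
      have "\<bar>Im z\<bar> < e / 2" using z by (auto simp: W_def)
      then show ?thesis using x by linarith
    qed
    finally have "z \<in> ball (of_real x) e" by (simp add: dist_norm norm_minus_commute)
    then show "z \<in> U" using e x by blast
  qed
  with g have "g holomorphic_on W" by (rule holomorphic_on_subset)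
  from holomorphic_convex_primitive'[OF W(2,1) this] obtain \<Phi> where \<Phi>0: "\<And>z. z \<in> W \<Longrightarrow> (\<Phi> has_field_derivative g z) (at z within W)" by auto
  have \<Phi>: "(\<Phi> has_field_derivative g z) (at z)" if "z \<in> W" for z
    using \<Phi>0[OF that] unfolding at_within_open[OF that W(1)] .
  have inW: "of_real x \<in> W" if "x \<in> {A..B}" for x using that e by (auto simp: W_def)
  have cont: "isCont \<Phi> (of_real x)" if "x \<in> {A..B}" for x
    using DERIV_isCont[OF \<Phi>[OF inW[OF that]]] .
  have "has_pv g A B ((\<Phi> (of_real B) - \<Phi> (of_real A) + (\<Phi> (of_real B) - \<Phi> (of_real A))) / 2)"
  proof (rule has_pv_primitive[where \<delta> = "e / 2"])
    show "(\<Phi> has_field_derivative g z) (at z)" if "A \<le> Re z" "Re z \<le> B" "0 < Im z" "Im z < e / 2" for z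
      by (rule \<Phi>) (use that e in \<open>auto simp: W_def\<close>)
    show "(\<Phi> has_field_derivative g z) (at z)" if "A \<le> Re z" "Re z \<le> B" "- (e / 2) < Im z" "Im z < 0" for z
      by (rule \<Phi>) (use that e in \<open>auto simp: W_def\<close>)
  qed (use AB e cont in auto)
  moreover have "((\<lambda>x. g (Complex x 0)) has_integral (\<Phi> (Complex B 0) - \<Phi> (Complex A 0))) {A..B}"
    by (rule integral_horizontal[OF AB _ \<Phi>0]) (use inW in \<open>auto simp: complex_of_real_def\<close>)
  then have "integral {A..B} (\<lambda>x. g (of_real x)) = \<Phi> (of_real B) - \<Phi> (of_real A)"
    by (simp add: complex_of_real_def integral_unique)
  ultimately show ?thesis by (simp add: diff_divide_distrib)
qed

text \<open>For j > 0 the primitive - (exp x - c)^(- j) / j is single valued. For j = 0 the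
  primitives Ln (- i (exp x - c)) above and Ln (i (exp x - c)) below stay off the branch cut; their
  phases at the ends are i pi / 2 with opposite signs and cancel in the mean, which leaves ln (b -
  c) - ln (c - a).\<close>

lemma has_pv_pole:
  assumes ab: "0 < a" "a < c" "c < b"
  shows "has_pv (\<lambda>x. 1 / (exp x - of_real c) ^ Suc j * exp x) (ln a) (ln b)
     (if j = 0 then of_real (ln (b - c)) - of_real (ln (c - a))
      else - (1 / (of_nat j * of_real (b - c) ^ j)) + 1 / (of_nat j * of_real (a - c) ^ j))"
proof -
  let ?g = "\<lambda>x. 1 / (exp x - of_real c) ^ Suc j * exp x"
  have le: "ln a \<le> ln b" using ab by simp
  \<comment> \<open>For |Im z| < pi the exponential preserves the sign of the imaginary part, so a
    horizontal line off the axis never reaches the real point c.\<close>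
  have im: "exp z - of_real c \<noteq> 0" "sgn (Im (exp z)) = sgn (Im z)" if "Im z \<noteq> 0" "\<bar>Im z\<bar> < pi" for z
  proof -
    show s: "sgn (Im (exp z)) = sgn (Im z)"
      using that sin_gt_zero[of "Im z"] sin_gt_zero[of "- Im z"] by (cases "Im z > 0") (auto simp: Im_exp sgn_if zero_less_mult_iff)
    then have "Im (exp z) \<noteq> 0" using that by (auto simp: sgn_if split: if_splits)
    then show "exp z - of_real c \<noteq> 0" by (auto simp: complex_eq_iff)
  qed
  have e[simp]: "exp (of_real (ln a)) = complex_of_real a" "exp (of_real (ln b)) = complex_of_real b"
    using ab by (simp_all add: exp_of_real)
  show ?thesis
  proof (cases "j = 0")
    case False
    let ?\<Phi> = "\<lambda>x. - ((exp x - complex_of_real c) powi (- int j)) / of_nat j"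
    have m: "- int j - 1 = - int (Suc j)" by simp
    have D: "(?\<Phi> has_field_derivative ?g z) (at z)" if z: "exp z - of_real c \<noteq> 0" for z
    proof -
      have "((\<lambda>x. (exp x - complex_of_real c) powi (- int j)) has_field_derivative
          of_int (- int j) * (exp z - of_real c) powi (- int j - 1) * exp z) (at z)"
        using z by (auto intro!: derivative_eq_intros)
      from DERIV_cdivide[OF DERIV_minus[OF this], of "of_nat j"] show ?thesis
        by (rule DERIV_cong) (use z False in \<open>simp add: m power_int_minus field_simps del: of_nat_Suc power_Suc\<close>)
    qed
    have C: "isCont ?\<Phi> z" if "exp z - of_real c \<noteq> 0" for z
      using DERIV_isCont[OF D[OF that]] .
    have "has_pv ?g (ln a) (ln b) ((?\<Phi> (of_real (ln b)) - ?\<Phi> (of_real (ln a)) + (?\<Phi> (of_real (ln b)) - ?\<Phi> (of_real (ln a)))) / 2)"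
    proof (rule has_pv_primitive[OF le pi_gt_zero, where \<Phi> = ?\<Phi> and \<Psi> = ?\<Phi>])
      show "(?\<Phi> has_field_derivative ?g z) (at z)" if "0 < Im z" "Im z < pi" for z
        by (rule D[OF im(1)]) (use that in auto)
      show "(?\<Phi> has_field_derivative ?g z) (at z)" if "- pi < Im z" "Im z < 0" for z
        by (rule D[OF im(1)]) (use that in auto)
    qed (rule C, unfold e, use ab in simp)+
    moreover have "(w + w) / 2 = w" for w :: complex by simp
    moreover have "?\<Phi> (of_real (ln b)) - ?\<Phi> (of_real (ln a)) = - (1 / (of_nat j * of_real (b - c) ^ j)) + 1 / (of_nat j * of_real (a - c) ^ j)"
      unfolding e by (simp add: power_int_minus divide_inverse)
    ultimately show ?thesis using False by (simp only: if_False)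
  next
    case True
    let ?\<Phi> = "\<lambda>x. Ln (- \<i> * (exp x - complex_of_real c))"
    let ?\<Psi> = "\<lambda>x. Ln (\<i> * (exp x - complex_of_real c))"
    have D0: "((\<lambda>x. Ln (w * (exp x - complex_of_real c))) has_field_derivative ?g z) (at z)"
      if "Re (w * (exp z - complex_of_real c)) > 0" for w z
    proof -
      have nz: "w * (exp z - complex_of_real c) \<noteq> 0" "w \<noteq> 0" "exp z - complex_of_real c \<noteq> 0"
        using that by auto
      have "w * (exp z - complex_of_real c) \<notin> \<real>\<^sub>\<le>\<^sub>0" using that by (auto simp: complex_nonpos_Reals_iff)
      then have "((\<lambda>x. Ln (w * (exp x - complex_of_real c))) has_field_derivative
          inverse (w * (exp z - complex_of_real c)) * (w * exp z)) (at z)"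
        by (auto intro!: derivative_eq_intros)
      then show ?thesis by (rule DERIV_cong) (use nz True in \<open>simp add: field_simps\<close>)
    qed
    have D1: "(?\<Phi> has_field_derivative ?g z) (at z)" if "0 < Im z" "Im z < pi" for z
    proof (rule D0)
      have "sgn (Im (exp z)) = 1" using im(2)[of z] that by simp
      then show "Re (- \<i> * (exp z - complex_of_real c)) > 0" by (simp add: sgn_1_pos)
    qed
    have D2: "(?\<Psi> has_field_derivative ?g z) (at z)" if "- pi < Im z" "Im z < 0" for z
    proof (rule D0)
      have "sgn (Im (exp z)) = - 1" using im(2)[of z] that by simp
      then show "Re (\<i> * (exp z - complex_of_real c)) > 0" by (simp add: sgn_1_neg)
    qed
    have C: "isCont ?\<Phi> (of_real (ln a))" "isCont ?\<Phi> (of_real (ln b))" "isCont ?\<Psi> (of_real (ln a))" "isCont ?\<Psi> (of_real (ln b))"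
      by (intro continuous_intros; use ab e in \<open>simp add: complex_nonpos_Reals_iff\<close>)+
    have "has_pv ?g (ln a) (ln b) ((?\<Phi> (of_real (ln b)) - ?\<Phi> (of_real (ln a)) + (?\<Psi> (of_real (ln b)) - ?\<Psi> (of_real (ln a)))) / 2)"
      by (rule has_pv_primitive[OF le pi_gt_zero, where \<Phi> = ?\<Phi> and \<Psi> = ?\<Psi>]) (fact C | rule D1 D2, assumption+)+
    moreover have L: "Ln (\<i> * of_real x) = of_real (ln x) + \<i> * of_real (pi / 2)" "Ln (- (\<i> * of_real x)) = of_real (ln x) - \<i> * of_real (pi / 2)"
      if "x > 0" for x
      using Ln_times_of_real[of x \<i>] Ln_times_of_real[of x "- \<i>"] that by (simp_all add: mult.commute Ln_of_real)
    have "?\<Phi> (of_real (ln b)) = of_real (ln (b - c)) - \<i> * of_real (pi / 2)" "?\<Psi> (of_real (ln b)) = of_real (ln (b - c)) + \<i> * of_real (pi / 2)"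
      using L[of "b - c"] ab unfolding e by (simp_all add: algebra_simps)
    moreover have "?\<Phi> (of_real (ln a)) = of_real (ln (c - a)) + \<i> * of_real (pi / 2)" "?\<Psi> (of_real (ln a)) = of_real (ln (c - a)) - \<i> * of_real (pi / 2)"
    proof -
      have "- \<i> * (complex_of_real a - of_real c) = \<i> * of_real (c - a)" "\<i> * (complex_of_real a - of_real c) = - (\<i> * of_real (c - a))"
        by (simp_all add: algebra_simps)
      then show "?\<Phi> (of_real (ln a)) = of_real (ln (c - a)) + \<i> * of_real (pi / 2)" "?\<Psi> (of_real (ln a)) = of_real (ln (c - a)) - \<i> * of_real (pi / 2)"
        using L[of "c - a"] ab unfolding e by simp_all
    qed
    ultimately show ?thesis using True by (simp add: diff_divide_distrib)
  qed
qed

text \<open>One power is peeled off at a time: P z = P c + (z - c) P1 z, where the divided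
  difference P1 is again holomorphic on U.\<close>

lemma principal_part_decomposition:
  assumes "P holomorphic_on U" "open U" "c \<in> U"
  shows "\<exists>q r. r holomorphic_on U \<and>
     (\<forall>z\<in>U - {c}. P z / (z - c) ^ m = (\<Sum>j<m. q j / (z - c) ^ Suc j) + r z)"
  using assms(1)
proof (induction m arbitrary: P)
  case 0
  then show ?case by (intro exI[of _ "\<lambda>_. 0"] exI[of _ P]) auto
next
  case (Suc m)
  define P1 where "P1 = (\<lambda>z. if z = c then deriv P c else (P z - P c) / (z - c))"
  have "P1 holomorphic_on U"
    unfolding P1_def by (rule pole_lemma_open) (use Suc.prems assms in auto)
  from Suc.IH[OF this] obtain q r where r: "r holomorphic_on U"
    and eq: "\<And>z. z \<in> U - {c} \<Longrightarrow> P1 z / (z - c) ^ m = (\<Sum>j<m. q j / (z - c) ^ Suc j) + r z" by blast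
  have "P z / (z - c) ^ Suc m = (\<Sum>j<Suc m. (if j = m then P c else q j) / (z - c) ^ Suc j) + r z" if z: "z \<in> U - {c}" for z
  proof -
    have "P z = P c + (z - c) * P1 z" using z by (simp add: P1_def)
    then have "P z / (z - c) ^ Suc m = P1 z / (z - c) ^ m + P c / (z - c) ^ Suc m"
      using z by (simp add: add_divide_distrib)
    also have "\<dots> = (\<Sum>j<Suc m. (if j = m then P c else q j) / (z - c) ^ Suc j) + r z"
      unfolding eq[OF z] by simp
    finally show ?thesis .
  qed
  then show ?case using r by (intro exI[of _ "\<lambda>j. if j = m then P c else q j"] exI[of _ r]) blast
qed

lemma integral_exp_substitution:
  fixes f :: "real \<Rightarrow> complex"
  assumes "0 < a" "a \<le> b" "continuous_on {a..b} f"
  shows "integral {ln a..ln b} (\<lambda>x. f (exp x) * of_real (exp x)) = integral {a..b} f"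
proof -
  have img: "exp ` {ln a..ln b} = {a..b}"
  proof (intro set_eqI iffI)
    fix y assume "y \<in> {a..b}"
    then show "y \<in> exp ` {ln a..ln b}"
      using assms by (intro image_eqI[of _ _ "ln y"]) auto
  next
    fix y assume "y \<in> exp ` {ln a..ln b}"
    then obtain x where x: "y = exp x" "ln a \<le> x" "x \<le> ln b" by auto
    then have "exp (ln a) \<le> y" "y \<le> exp (ln b)" by (simp_all only: exp_le_cancel_iff)
    then show "y \<in> {a..b}" using assms by auto
  qed
  have "f absolutely_integrable_on {a..b}" using assms by (intro absolutely_integrable_continuous_real)
  then have "f absolutely_integrable_on exp ` {ln a..ln b} \<and> integral (exp ` {ln a..ln b}) f = integral {a..b} f"
    unfolding img by simp
  then have "(\<lambda>x. \<bar>exp x\<bar> *\<^sub>R f (exp x)) absolutely_integrable_on {ln a..ln b} \<and> integral {ln a..ln b} (\<lambda>x. \<bar>exp x\<bar> *\<^sub>R f (exp x)) = integral {a..b} f"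
    by (subst has_absolute_integral_change_of_variables_real) (auto intro!: derivative_eq_intros simp: inj_on_def)
  then show ?thesis by (simp add: scaleR_conv_of_real mult.commute)
qed

lemma has_pv_log_holomorphic:
  assumes ab: "0 < a" "a \<le> b" and U: "open U" "complex_of_real ` {a..b} \<subseteq> U" and r: "r holomorphic_on U"
  shows "has_pv (\<lambda>x. r (exp x) * exp x) (ln a) (ln b) (integral {a..b} (\<lambda>t. r (of_real t)))"
proof -
  have oV: "open (exp -` U)" by (intro open_vimage U continuous_intros)
  have "has_pv (\<lambda>x. r (exp x) * exp x) (ln a) (ln b) (integral {ln a..ln b} (\<lambda>x. r (exp (of_real x)) * exp (of_real x)))"
  proof (rule has_pv_holomorphic[OF _ oV, where g = "\<lambda>x. r (exp x) * exp x"])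
    show "ln a \<le> ln b" using ab by simp
    show "complex_of_real ` {ln a..ln b} \<subseteq> exp -` U"
    proof
      fix y assume "y \<in> complex_of_real ` {ln a..ln b}"
      then obtain x where x: "x \<in> {ln a..ln b}" and y: "y = of_real x" by auto
      from x have "exp (ln a) \<le> exp x" "exp x \<le> exp (ln b)" by (simp_all only: exp_le_cancel_iff atLeastAtMost_iff)
      then have "exp x \<in> {a..b}" using ab by auto
      then show "y \<in> exp -` U" using U(2) unfolding y by (auto simp: exp_of_real)
    qed
    have "(\<lambda>x. r (exp x)) holomorphic_on exp -` U"
      by (rule holomorphic_on_compose_gen[OF _ r, unfolded o_def]) (auto intro!: holomorphic_intros)
    then show "(\<lambda>x. r (exp x) * exp x) holomorphic_on exp -` U" by (intro holomorphic_intros)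
  qed
  moreover have "continuous_on {a..b} (\<lambda>t. r (of_real t))"
    by (rule continuous_on_compose2[OF holomorphic_on_imp_continuous_on[OF r]])
       (use U in \<open>auto intro!: continuous_intros\<close>)
  then have "integral {ln a..ln b} (\<lambda>x. r (exp (of_real x)) * exp (of_real x)) = integral {a..b} (\<lambda>t. r (of_real t))"
    using integral_exp_substitution[of a b "\<lambda>t. r (of_real t)"] ab by (simp add: exp_of_real)
  ultimately show ?thesis by simp
qed

text \<open>The finite part in t and the principal value in ln t are both linear, so they are
  compared on the principal part and on the remainder separately. The remainder gives the ordinary
  integral both times; for each 1 / (t - c)^(j + 1) the explicit values of
  \<open>half_reg_integral_pole\<close>, taken from both sides of c, add up to the value of
  \<open>has_pv_pole\<close>.\<close>

lemma reg_integral_pole_has_pv: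
  assumes ab: "0 < a" "a < c" "c < b" and U: "open U" "complex_of_real ` {a..b} \<subseteq> U"
    and P: "P holomorphic_on U" and \<phi>: "\<And>z. z \<in> U \<Longrightarrow> z \<noteq> of_real c \<Longrightarrow> \<phi> z = P z / (z - of_real c) ^ m"
  shows "\<exists>v. has_reg_integral_pole (\<lambda>t. \<phi> (of_real t)) a b c v \<and> has_pv (\<lambda>x. \<phi> (exp x) * exp x) (ln a) (ln b) v"
proof -
  have cU: "complex_of_real c \<in> U" using U ab by auto
  from principal_part_decomposition[OF P U(1) cU, of m] obtain q r where r: "r holomorphic_on U"
    and dec: "\<And>z. z \<in> U \<Longrightarrow> z \<noteq> of_real c \<Longrightarrow> P z / (z - of_real c) ^ m = (\<Sum>j<m. q j / (z - of_real c) ^ Suc j) + r z" by blast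
  have \<phi>': "\<phi> z = (\<Sum>j<m. q j * (1 / (z - of_real c) ^ Suc j)) + r z" if "z \<in> U" "z \<noteq> of_real c" for z
    using \<phi>[OF that] dec[OF that] by simp
  define H where "H = (\<lambda>j d. if j = 0 then complex_of_real (ln d) else - (1 / (of_nat j * of_real d ^ j)))"
  have H: "half_reg_integral (\<lambda>u. 1 / of_real u ^ Suc j) d (H j d)" if "d > 0" for j d
    unfolding H_def by (rule half_reg_integral_pole[OF that])
  obtain R where R: "R > 0" "ball (complex_of_real c) R \<subseteq> U" using U(1) cU open_contains_ball by blast
  have contr: "continuous_on {a..b} (\<lambda>t. r (of_real t))"
    by (rule continuous_on_compose2[OF holomorphic_on_imp_continuous_on[OF r]])
       (use U in \<open>auto intro!: continuous_intros\<close>)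
  define vr where "vr = integral {0..b - c} (\<lambda>u. r (of_real (c + u)))"
  define vl where "vl = integral {0..c - a} (\<lambda>u. r (of_real (c - u)))"
  have right: "half_reg_integral (\<lambda>u. r (of_real (c + u))) (b - c) vr"
    unfolding vr_def
  proof (rule half_reg_integral_analytic[where p = "\<lambda>z. r (of_real c + z)" and R = R])
    show "continuous_on {0..b - c} (\<lambda>u. r (of_real (c + u)))"
      by (rule continuous_on_compose2[OF contr]) (use ab in \<open>auto intro!: continuous_intros\<close>)
    show "(\<lambda>z. r (of_real c + z)) holomorphic_on ball 0 R"
      by (rule holomorphic_on_compose_gen[OF _ r, unfolded o_def]) (use R in \<open>auto intro!: holomorphic_intros simp: dist_norm\<close>)
  qed (use R ab in auto)
  have left: "half_reg_integral (\<lambda>u. r (of_real (c - u))) (c - a) vl"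
    unfolding vl_def
  proof (rule half_reg_integral_analytic[where p = "\<lambda>z. r (of_real c - z)" and R = R])
    show "continuous_on {0..c - a} (\<lambda>u. r (of_real (c - u)))"
      by (rule continuous_on_compose2[OF contr]) (use ab in \<open>auto intro!: continuous_intros\<close>)
    show "(\<lambda>z. r (of_real c - z)) holomorphic_on ball 0 R"
      by (rule holomorphic_on_compose_gen[OF _ r, unfolded o_def]) (use R in \<open>auto intro!: holomorphic_intros simp: dist_norm\<close>)
  qed (use R ab in auto)
  have vrl: "vr + vl = integral {a..b} (\<lambda>t. r (of_real t))"
  proof -
    have "((\<lambda>t. r (of_real t)) has_integral vr) {c..b}"
    proof -
      have "continuous_on {0..b - c} (\<lambda>u. r (of_real (c + u)))"
        by (rule continuous_on_compose2[OF contr]) (use ab in \<open>auto intro!: continuous_intros\<close>)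
      then have "((\<lambda>u. r (of_real (c + u))) has_integral vr) {0..b - c}"
        unfolding vr_def by (intro integrable_integral integrable_continuous_real)
      then show ?thesis
        using has_integral_shift_Icc_real[of "\<lambda>t. r (of_real t)" c vr 0 "b - c"] by (simp add: o_def)
    qed
    moreover have "((\<lambda>t. r (of_real t)) has_integral vl) {a..c}"
    proof -
      have "continuous_on {0..c - a} (\<lambda>u. r (of_real (c - u)))"
        by (rule continuous_on_compose2[OF contr]) (use ab in \<open>auto intro!: continuous_intros\<close>)
      then have "((\<lambda>u. r (of_real (c - u))) has_integral vl) {0..c - a}"
        unfolding vl_def by (intro integrable_integral integrable_continuous_real)
      then have "((\<lambda>u. r (of_real (c + u))) has_integral vl) {- (c - a)..- 0}"
        using Henstock_Kurzweil_Integration.has_integral_reflect_real[of "\<lambda>u. r (of_real (c - u))" vl "c - a" 0] by simp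
      then show ?thesis
        using has_integral_shift_Icc_real[of "\<lambda>t. r (of_real t)" c vl "- (c - a)" "- 0"] by (simp add: o_def)
    qed
    ultimately have "((\<lambda>t. r (of_real t)) has_integral (vl + vr)) {a..b}"
      by (intro has_integral_combine[of a c b]) (use ab in auto)
    then show ?thesis by (simp add: integral_unique add.commute)
  qed
  \<comment> \<open>On the left of c one has t - c = - u, which produces the signs (- 1)^(j + 1) in
    the second sum.\<close>
  let ?right = "(\<Sum>j<m. q j * H j (b - c)) + vr" and ?left = "(\<Sum>j<m. ((-1) ^ Suc j * q j) * H j (c - a)) + vl"
  have "half_reg_integral (\<lambda>u. (\<Sum>j<m. q j * (1 / of_real u ^ Suc j)) + r (of_real (c + u))) (b - c) ?right"
    using ab by (intro half_reg_integral_add half_reg_integral_sum half_reg_integral_cmult H right) auto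
  then have 1: "half_reg_integral (\<lambda>u. \<phi> (of_real (c + u))) (b - c) ?right"
  proof (rule half_reg_integral_cong)
    fix u assume u: "0 < u" "u \<le> b - c"
    have "complex_of_real (c + u) \<in> complex_of_real ` {a..b}" by (rule imageI) (use u ab in auto)
    then have "of_real (c + u) \<in> U" using U(2) by blast
    then show "(\<Sum>j<m. q j * (1 / of_real u ^ Suc j)) + r (of_real (c + u)) = \<phi> (of_real (c + u))"
      using \<phi>'[of "of_real (c + u)"] u by simp
  qed
  have "half_reg_integral (\<lambda>u. (\<Sum>j<m. ((-1) ^ Suc j * q j) * (1 / of_real u ^ Suc j)) + r (of_real (c - u))) (c - a) ?left"
    using ab by (intro half_reg_integral_add half_reg_integral_sum half_reg_integral_cmult H left) auto
  then have 2: "half_reg_integral (\<lambda>u. \<phi> (of_real (c - u))) (c - a) ?left"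
  proof (rule half_reg_integral_cong)
    fix u assume u: "0 < u" "u \<le> c - a"
    have "complex_of_real (c - u) \<in> complex_of_real ` {a..b}" by (rule imageI) (use u ab in auto)
    then have "of_real (c - u) \<in> U" using U(2) by blast
    moreover have "q j * (1 / (- complex_of_real u) ^ Suc j) = ((-1) ^ Suc j * q j) * (1 / of_real u ^ Suc j)" for j
      using u by (simp add: power_minus[of "complex_of_real u"] field_simps del: power_Suc)
    ultimately show "(\<Sum>j<m. ((-1) ^ Suc j * q j) * (1 / of_real u ^ Suc j)) + r (of_real (c - u)) = \<phi> (of_real (c - u))"
      using \<phi>'[of "of_real (c - u)"] u by (simp del: power_Suc)
  qed
  have reg: "has_reg_integral_pole (\<lambda>t. \<phi> (of_real t)) a b c (?right + ?left)"
    by (rule half_reg_integral_imp_pole[OF ab(2,3) 1 2])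
  let ?K = "\<lambda>j. (if j = 0 then complex_of_real (ln (b - c)) - of_real (ln (c - a))
      else - (1 / (of_nat j * of_real (b - c) ^ j)) + 1 / (of_nat j * of_real (a - c) ^ j))"
  have "has_pv (\<lambda>x. (\<Sum>j<m. q j * (1 / (exp x - of_real c) ^ Suc j * exp x)) + r (exp x) * exp x) (ln a) (ln b)
     ((\<Sum>j<m. q j * ?K j) + integral {a..b} (\<lambda>t. r (of_real t)))"
    using ab by (intro has_pv_add has_pv_sum has_pv_cmult has_pv_pole has_pv_log_holomorphic[OF _ _ U r]) auto
  also have "(\<Sum>j<m. q j * ?K j) + integral {a..b} (\<lambda>t. r (of_real t)) = ?right + ?left"
  proof -
    have "q j * ?K j = q j * H j (b - c) + ((-1) ^ Suc j * q j) * H j (c - a)" for j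
    proof (cases "j = 0")
      case False
      have "complex_of_real (a - c) ^ j = (-1) ^ j * of_real (c - a) ^ j"
        using power_minus[of "complex_of_real (c - a)" j] by simp
      moreover have "(-1) ^ j * (-1) ^ j = (1::complex)" by (simp flip: power_mult_distrib)
      ultimately show ?thesis
        using False ab by (simp add: H_def field_simps)
    qed (simp add: H_def algebra_simps)
    then show ?thesis unfolding vrl[symmetric] by (simp add: sum_subtractf sum_negf)
  qed
  finally have pv: "has_pv (\<lambda>x. (\<Sum>j<m. q j * (1 / (exp x - of_real c) ^ Suc j * exp x)) + r (exp x) * exp x) (ln a) (ln b) (?right + ?left)" .
  have "has_pv (\<lambda>x. \<phi> (exp x) * exp x) (ln a) (ln b) (?right + ?left)"
  proof -
    have "compact (complex_of_real ` {ln a..ln b})" by (intro compact_continuous_image continuous_intros) auto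
    moreover have "open (exp -` U :: complex set)" by (intro open_vimage U continuous_intros)
    moreover have "complex_of_real ` {ln a..ln b} \<subseteq> exp -` U"
    proof
      fix y assume "y \<in> complex_of_real ` {ln a..ln b}"
      then obtain x where x: "x \<in> {ln a..ln b}" and y: "y = of_real x" by auto
      from x have "exp (ln a) \<le> exp x" "exp x \<le> exp (ln b)" by (simp_all only: exp_le_cancel_iff atLeastAtMost_iff)
      then have "exp x \<in> {a..b}" using ab by auto
      then show "y \<in> exp -` U" using U(2) unfolding y by (auto simp: exp_of_real)
    qed
    ultimately obtain e where e: "e > 0" "(\<Union>x\<in>complex_of_real ` {ln a..ln b}. ball x e) \<subseteq> exp -` U"
      by (rule compact_subset_open_imp_ball_epsilon_subset)
    show ?thesis
    proof (rule has_pv_cong[OF pv, of "min e pi"])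
      fix x \<eta> assume x: "ln a \<le> x" "x \<le> ln b" "\<eta> \<noteq> 0" "\<bar>\<eta>\<bar> < min e pi"
      have "Complex x \<eta> - of_real x = \<i> * of_real \<eta>" by (simp add: complex_eq_iff)
      then have "dist (of_real x) (Complex x \<eta>) = \<bar>\<eta>\<bar>"
        by (simp add: dist_norm norm_minus_commute[of "of_real x"] norm_mult)
      then have "Complex x \<eta> \<in> ball (of_real x) e" using x by simp
      moreover have "complex_of_real x \<in> complex_of_real ` {ln a..ln b}" using x by auto
      ultimately have "Complex x \<eta> \<in> exp -` U" using e(2) by blast
      then have inU: "exp (Complex x \<eta>) \<in> U" by simp
      have "sin \<eta> \<noteq> 0" using x sin_gt_zero[of \<eta>] sin_gt_zero[of "- \<eta>"] by (cases "\<eta> > 0") auto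
      then have "Im (exp (Complex x \<eta>)) \<noteq> 0" by (simp add: Im_exp)
      then have ne: "exp (Complex x \<eta>) \<noteq> of_real c" by (metis Im_complex_of_real)
      show "(\<Sum>j<m. q j * (1 / (exp (Complex x \<eta>) - of_real c) ^ Suc j * exp (Complex x \<eta>))) + r (exp (Complex x \<eta>)) * exp (Complex x \<eta>) =
          \<phi> (exp (Complex x \<eta>)) * exp (Complex x \<eta>)"
        unfolding \<phi>'[OF inU ne] by (simp add: distrib_right sum_distrib_right mult.assoc)
    qed (use e in auto)
  qed
  with reg show ?thesis by blast
qed

text \<open>By Cauchy's theorem each line is pushed out to the fixed height \<delta>, at the price
  of vertical edges over A and B, where \<psi> is analytic down to the axis. The horizontal edge
  does not depend on \<eta>, the vertical ones converge as \<eta> tends to 0, and all of them are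
  integrals of exp (s z) over bounded paths, hence entire in s.\<close>

lemma has_pv_entire:
  assumes AB: "A \<le> B" and \<delta>: "\<delta> > 0"
    and an: "\<And>z. A \<le> Re z \<Longrightarrow> Re z \<le> B \<Longrightarrow> \<bar>Im z\<bar> \<le> \<delta> \<Longrightarrow> Im z \<noteq> 0 \<or> Re z = A \<or> Re z = B \<Longrightarrow> \<psi> analytic_on {z}"
  shows "\<exists>V. V holomorphic_on UNIV \<and> (\<forall>s. has_pv (\<lambda>x. \<psi> x * exp (s * x)) A B (V s))"
proof -
  \<comment> \<open>L is the edge at height \<epsilon> * \<delta> and E a vertical edge from the
    axis to it, with \<epsilon> = 1 above and \<epsilon> = - 1 below. None of them meets a
    singularity.\<close>
  define L where "L = (\<lambda>\<epsilon> s. integral {A..B} (\<lambda>x. exp (s * Complex x (\<epsilon> * \<delta>)) * \<psi> (Complex x (\<epsilon> * \<delta>))))"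
  define E where "E = (\<lambda>\<epsilon> X s. integral {0..\<delta>} (\<lambda>y. exp (s * Complex X (\<epsilon> * y)) * (\<i> * of_real \<epsilon> * \<psi> (Complex X (\<epsilon> * y)))))"
  define D where "D = (\<lambda>\<epsilon> s. L \<epsilon> s - E \<epsilon> B s + E \<epsilon> A s)"
  have cont: "isCont \<psi> z" if "A \<le> Re z" "Re z \<le> B" "\<bar>Im z\<bar> \<le> \<delta>" "Im z \<noteq> 0 \<or> Re z = A \<or> Re z = B" for z
    using an[OF that] by (rule analytic_at_imp_isCont)
  have c1: "continuous_on {A..B} (\<lambda>x. \<psi> (Complex x (\<epsilon> * \<eta>)))" if "\<epsilon> = 1 \<or> \<epsilon> = - 1" "0 < \<eta>" "\<eta> \<le> \<delta>" for \<epsilon> \<eta>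
  proof (rule continuous_at_imp_continuous_on, intro ballI)
    fix x assume "x \<in> {A..B}"
    then have "isCont \<psi> (Complex x (\<epsilon> * \<eta>))" by (intro cont) (use that in auto)
    then show "isCont (\<lambda>x. \<psi> (Complex x (\<epsilon> * \<eta>))) x"
      by (rule isCont_o2[rotated]) (simp add: Complex_eq)
  qed
  have c2: "continuous_on {0..\<delta>} (\<lambda>y. \<psi> (Complex X (\<epsilon> * y)))" if "\<epsilon> = 1 \<or> \<epsilon> = - 1" "X = A \<or> X = B" for \<epsilon> X
  proof (rule continuous_at_imp_continuous_on, intro ballI)
    fix y assume "y \<in> {0..\<delta>}"
    then have "isCont \<psi> (Complex X (\<epsilon> * y))" by (intro cont) (use that AB in auto)
    then show "isCont (\<lambda>y. \<psi> (Complex X (\<epsilon> * y))) y"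
      by (rule isCont_o2[rotated]) (simp add: Complex_eq)
  qed
  have cc: "continuous_on S (\<lambda>x. Complex x (\<epsilon> * \<eta>))" "continuous_on S (\<lambda>y. Complex X (\<epsilon> * y))" for S \<epsilon> \<eta> X
    by (auto simp: Complex_eq intro!: continuous_intros)
  have holD: "D \<epsilon> holomorphic_on UNIV" if "\<epsilon> = 1 \<or> \<epsilon> = - 1" for \<epsilon>
    unfolding D_def L_def E_def
    by (intro holomorphic_intros holomorphic_integral_exp_kernel cc continuous_intros c1 c2 that) (use \<delta> in auto)
  have line: "integral {A..B} (\<lambda>x. \<psi> (Complex x (\<epsilon> * \<eta>)) * exp (s * Complex x (\<epsilon> * \<eta>))) =
      L \<epsilon> s - integral {\<eta>..\<delta>} (\<lambda>y. exp (s * Complex B (\<epsilon> * y)) * (\<i> * of_real \<epsilon> * \<psi> (Complex B (\<epsilon> * y)))) +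
       integral {\<eta>..\<delta>} (\<lambda>y. exp (s * Complex A (\<epsilon> * y)) * (\<i> * of_real \<epsilon> * \<psi> (Complex A (\<epsilon> * y))))"
    if \<epsilon>: "\<epsilon> = 1 \<or> \<epsilon> = - 1" and \<eta>: "0 < \<eta>" "\<eta> < \<delta>" for \<epsilon> \<eta> s
  proof -
    define g where "g = (\<lambda>z. \<psi> z * exp (s * z))"
    define S where "S = {z. A \<le> Re z \<and> Re z \<le> B \<and> 0 < \<epsilon> * Im z \<and> \<epsilon> * Im z \<le> \<delta>}"
    have anS: "\<psi> analytic_on {z}" if "z \<in> S" for z
      by (rule an) (use that \<epsilon> in \<open>auto simp: S_def\<close>)
    have S1: "convex S"
    proof -
      have "S = {z. A \<le> Re z} \<inter> {z. Re z \<le> B} \<inter> (if \<epsilon> = 1 then {z. 0 < Im z} \<inter> {z. Im z \<le> \<delta>} else {z. Im z < 0} \<inter> {z. - \<delta> \<le> Im z})"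
        using \<epsilon> by (auto simp: S_def)
      also have "convex \<dots>"
        using convex_halfspace_Re_ge[of A] convex_halfspace_Re_le[of B] convex_halfspace_Im_gt[of 0] convex_halfspace_Im_le[of \<delta>]
          convex_halfspace_Im_lt[of 0] convex_halfspace_Im_ge[of "- \<delta>"]
        by (auto intro!: convex_Int)
      finally show ?thesis .
    qed
    have S2: "continuous_on S g"
      unfolding g_def using anS analytic_at_imp_isCont
      by (intro continuous_intros) (auto intro!: continuous_at_imp_continuous_on)
    have S3: "g field_differentiable at z" if "z \<in> interior S - {}" for z
    proof -
      have "\<psi> analytic_on {z}" using that interior_subset anS by blast
      then have "\<psi> field_differentiable at z" by (simp add: analytic_on_imp_differentiable_at)
      moreover have "(\<lambda>z. exp (s * z)) field_differentiable at z"
        by (rule holomorphic_on_imp_differentiable_at[of _ UNIV]) (auto intro!: holomorphic_intros)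
      ultimately show ?thesis unfolding g_def by (rule field_differentiable_mult)
    qed
    \<comment> \<open>S contains the edge at height \<epsilon> * \<delta> and the vertical edges
      without their points on the axis. It is not open, so the primitive is taken relative to
      S.\<close>
    obtain \<Phi> where \<Phi>: "\<And>z. z \<in> S \<Longrightarrow> (\<Phi> has_field_derivative g z) (at z within S)"
      using holomorphic_convex_primitive[OF S1 finite.emptyI S2 S3] by auto
    have h: "integral {A..B} (\<lambda>x. g (Complex x (\<epsilon> * \<zeta>))) = \<Phi> (Complex B (\<epsilon> * \<zeta>)) - \<Phi> (Complex A (\<epsilon> * \<zeta>))" if "0 < \<zeta>" "\<zeta> \<le> \<delta>" for \<zeta>
      by (rule integral_unique, rule integral_horizontal[OF AB _ \<Phi>]) (use that \<epsilon> in \<open>auto simp: S_def\<close>)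
    have v: "integral {\<eta>..\<delta>} (\<lambda>y. \<i> * of_real \<epsilon> * g (Complex X (\<epsilon> * y))) = \<Phi> (Complex X (\<epsilon> * \<delta>)) - \<Phi> (Complex X (\<epsilon> * \<eta>))" if "X = A \<or> X = B" for X
      by (rule integral_unique, rule integral_vertical[OF _ _ \<Phi>]) (use that \<epsilon> AB \<eta> in \<open>auto simp: S_def\<close>)
    have re: "exp (s * z) * (\<i> * of_real \<epsilon> * \<psi> z) = \<i> * of_real \<epsilon> * g z" "exp (s * z) * \<psi> z = g z" "\<psi> z * exp (s * z) = g z" for z
      by (simp_all add: g_def)
    show ?thesis unfolding re L_def using h[of \<eta>] h[of \<delta>] v[of A] v[of B] \<eta> \<delta> by simp
  qed
  have lim: "((\<lambda>\<eta>. integral {A..B} (\<lambda>x. \<psi> (Complex x (\<epsilon> * \<eta>)) * exp (s * Complex x (\<epsilon> * \<eta>)))) \<longlongrightarrow> D \<epsilon> s) (at_right 0)"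
    if \<epsilon>: "\<epsilon> = 1 \<or> \<epsilon> = - 1" for \<epsilon> s
  proof -
    have "((\<lambda>\<eta>. integral {\<eta>..\<delta>} (\<lambda>y. exp (s * Complex X (\<epsilon> * y)) * (\<i> * of_real \<epsilon> * \<psi> (Complex X (\<epsilon> * y))))) \<longlongrightarrow> E \<epsilon> X s) (at_right 0)"
      if X: "X = A \<or> X = B" for X
    proof -
      have "continuous_on {0..\<delta>} (\<lambda>y. exp (s * Complex X (\<epsilon> * y)) * (\<i> * of_real \<epsilon> * \<psi> (Complex X (\<epsilon> * y))))"
        by (intro continuous_intros cc c2 \<epsilon> X)
      then have "continuous_on {0..\<delta>} (\<lambda>\<eta>. integral {\<eta>..\<delta>} (\<lambda>y. exp (s * Complex X (\<epsilon> * y)) * (\<i> * of_real \<epsilon> * \<psi> (Complex X (\<epsilon> * y)))))"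
        by (intro indefinite_integral_continuous_1' integrable_continuous_real)
      then have "((\<lambda>\<eta>. integral {\<eta>..\<delta>} (\<lambda>y. exp (s * Complex X (\<epsilon> * y)) * (\<i> * of_real \<epsilon> * \<psi> (Complex X (\<epsilon> * y))))) \<longlongrightarrow> E \<epsilon> X s) (at 0 within {0..\<delta>})"
        using \<delta> unfolding E_def by (auto simp: continuous_on_def)
      then show ?thesis using \<delta> by (simp add: at_within_Icc_at_right)
    qed
    then have "((\<lambda>\<eta>. L \<epsilon> s - integral {\<eta>..\<delta>} (\<lambda>y. exp (s * Complex B (\<epsilon> * y)) * (\<i> * of_real \<epsilon> * \<psi> (Complex B (\<epsilon> * y)))) +
       integral {\<eta>..\<delta>} (\<lambda>y. exp (s * Complex A (\<epsilon> * y)) * (\<i> * of_real \<epsilon> * \<psi> (Complex A (\<epsilon> * y))))) \<longlongrightarrow> D \<epsilon> s) (at_right 0)"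
      unfolding D_def by (intro tendsto_intros) auto
    then show ?thesis
      by (rule Lim_transform_eventually)
         (use eventually_at_right_real[OF \<delta>] in eventually_elim, simp add: line[OF \<epsilon>])
  qed
  have "has_pv (\<lambda>x. \<psi> x * exp (s * x)) A B ((D 1 s + D (- 1) s) / 2)" for s
    unfolding has_pv_def
  proof
    show "\<forall>\<^sub>F \<eta> in at_right 0. (\<lambda>x. \<psi> (Complex x \<eta>) * exp (s * Complex x \<eta>)) integrable_on {A..B} \<and>
       (\<lambda>x. \<psi> (Complex x (- \<eta>)) * exp (s * Complex x (- \<eta>))) integrable_on {A..B}"
      using eventually_at_right_real[OF \<delta>]
    proof eventually_elim
      case (elim \<eta>)
      have "(\<lambda>x. \<psi> (Complex x (\<epsilon> * \<eta>)) * exp (s * Complex x (\<epsilon> * \<eta>))) integrable_on {A..B}" if "\<epsilon> = 1 \<or> \<epsilon> = - 1" for \<epsilon>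
        by (intro integrable_continuous_real continuous_intros cc c1 that) (use elim in auto)
      from this[of 1] this[of "- 1"] show ?case by simp
    qed
    have "((\<lambda>\<eta>. (integral {A..B} (\<lambda>x. \<psi> (Complex x (1 * \<eta>)) * exp (s * Complex x (1 * \<eta>))) +
        integral {A..B} (\<lambda>x. \<psi> (Complex x (- 1 * \<eta>)) * exp (s * Complex x (- 1 * \<eta>)))) / 2) \<longlongrightarrow> (D 1 s + D (- 1) s) / 2) (at_right 0)"
      by (intro tendsto_intros lim) auto
    then show "((\<lambda>\<eta>. (integral {A..B} (\<lambda>x. \<psi> (Complex x \<eta>) * exp (s * Complex x \<eta>)) +
        integral {A..B} (\<lambda>x. \<psi> (Complex x (- \<eta>)) * exp (s * Complex x (- \<eta>)))) / 2) \<longlongrightarrow> (D 1 s + D (- 1) s) / 2) (at_right 0)"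
      by simp
  qed
  moreover have "(\<lambda>s. (D 1 s + D (- 1) s) / 2) holomorphic_on UNIV"
    by (intro holomorphic_intros holD) auto
  ultimately show ?thesis by (intro exI[of _ "\<lambda>s. (D 1 s + D (- 1) s) / 2"]) auto
qed

section \<open>The components of a quasi-modular form\<close>

lemma nicely_meromorphic_poles_countable:
  assumes "f nicely_meromorphic_on A" "open A"
  shows "countable {z\<in>A. is_pole f z}"
proof -
  have "eventually (\<lambda>z. \<not> is_pole f z) (cosparse A)"
    using assms by (intro meromorphic_on_imp_not_pole_cosparse) (auto simp: nicely_meromorphic_on_def)
  then have "{z. is_pole f z} sparse_in A" by (simp add: eventually_cosparse)
  from sparse_imp_countable[OF assms(2) this] show ?thesis by (simp add: Collect_conj_eq Int_commute)
qed

lemma nicely_meromorphic_isCont: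
  assumes "f nicely_meromorphic_on A" "z \<in> A" "\<not> is_pole f z"
  shows "isCont f z"
  using nicely_meromorphic_on_imp_analytic_at[OF assms] by (rule analytic_at_imp_isCont)

text \<open>A ball is uncountable, so an exceptional set may be any countable set and is free to
  accumulate.\<close>

lemma eq_off_countable_imp_eq:
  fixes F G :: "complex \<Rightarrow> complex"
  assumes "countable B" "open U" "z \<in> U" and eq: "\<And>w. w \<in> U - B \<Longrightarrow> F w = G w"
    and cont: "isCont F z" "isCont G z"
  shows "F z = G z"
proof (rule ccontr)
  assume "F z \<noteq> G z"
  have "isCont (\<lambda>w. F w - G w) z" by (intro continuous_intros cont)
  then have "((\<lambda>w. F w - G w) \<longlongrightarrow> F z - G z) (at z)" by (simp add: isCont_def)
  then have "\<forall>\<^sub>F w in at z. F w - G w \<noteq> 0"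
    by (rule tendsto_imp_eventually_ne) (use \<open>F z \<noteq> G z\<close> in simp)
  moreover have "\<forall>\<^sub>F w in at z. w \<in> U" using assms by (intro eventually_at_in_open')
  ultimately have "\<forall>\<^sub>F w in at z. F w \<noteq> G w \<and> w \<in> U" by eventually_elim auto
  then obtain e where e: "e > 0" "\<And>w. w \<noteq> z \<Longrightarrow> dist w z < e \<Longrightarrow> F w \<noteq> G w \<and> w \<in> U"
    by (auto simp: eventually_at)
  have sub: "ball z e \<subseteq> insert z B"
  proof
    fix w assume "w \<in> ball z e"
    then have "dist w z < e" by (simp add: dist_commute)
    then show "w \<in> insert z B" using e(2)[of w] eq[of w] by blast
  qed
  have "countable (ball z e)" by (rule countable_subset[OF sub]) (use assms(1) in simp)
  then show False using uncountable_ball[OF e(1)] by blast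
qed

lemma nicely_meromorphic_eqI:
  assumes f: "f nicely_meromorphic_on A" and g: "g nicely_meromorphic_on A" and "z \<in> A"
    and ev: "\<forall>\<^sub>F w in at z. f w = g w"
  shows "f z = g z"
proof -
  have p: "is_pole f z \<longleftrightarrow> is_pole g z" by (rule is_pole_cong[OF ev refl])
  show ?thesis
  proof (cases "is_pole f z")
    case True
    then show ?thesis using f g p \<open>z \<in> A\<close> unfolding nicely_meromorphic_on_def
      by (metis at_neq_bot is_pole_def not_tendsto_and_filterlim_at_infinity)
  next
    case False
    then have "f \<midarrow>z\<rightarrow> f z" "g \<midarrow>z\<rightarrow> g z" using f g p \<open>z \<in> A\<close> unfolding nicely_meromorphic_on_def by auto
    moreover have "g \<midarrow>z\<rightarrow> f z" using \<open>f \<midarrow>z\<rightarrow> f z\<close> ev by (rule Lim_transform_eventually)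
    ultimately show ?thesis using LIM_unique by blast
  qed
qed

lemma polyfun_eq_infinite:
  fixes c d :: "nat \<Rightarrow> complex"
  assumes "infinite {x. (\<Sum>i\<le>n. c i * x ^ i) = (\<Sum>i\<le>n. d i * x ^ i)}" "i \<le> n"
  shows "c i = d i"
proof (rule ccontr)
  assume "c i \<noteq> d i"
  then have "finite {x. (\<Sum>i\<le>n. (c i - d i) * x ^ i) = 0}"
    using polyfun_finite_roots[of "\<lambda>i. c i - d i" n] assms(2) by auto
  moreover have "{x. (\<Sum>i\<le>n. (c i - d i) * x ^ i) = 0} = {x. (\<Sum>i\<le>n. c i * x ^ i) = (\<Sum>i\<le>n. d i * x ^ i)}"
    by (simp add: left_diff_distrib sum_subtractf)
  ultimately show False using assms(1) by simp
qed

lemma sum_binomial_shift: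
  fixes a :: "nat \<Rightarrow> complex"
  shows "(\<Sum>r\<le>p. a r * (Y + w) ^ r) = (\<Sum>m\<le>p. (\<Sum>l\<le>p - m. of_nat ((m + l) choose l) * a (m + l) * w ^ l) * Y ^ m)"
proof -
  have "(\<Sum>r\<le>p. a r * (Y + w) ^ r) = (\<Sum>r\<le>p. \<Sum>m\<le>r. of_nat (r choose m) * a r * w ^ (r - m) * Y ^ m)"
    unfolding binomial_ring sum_distrib_left by (intro sum.cong refl) (simp add: mult_ac)
  also have "\<dots> = (\<Sum>(r, m)\<in>(SIGMA r:{..p}. {..r}). of_nat (r choose m) * a r * w ^ (r - m) * Y ^ m)"
    by (subst sum.Sigma) auto
  also have "\<dots> = (\<Sum>(m, l)\<in>(SIGMA m:{..p}. {..p - m}). of_nat ((m + l) choose m) * a (m + l) * w ^ l * Y ^ m)"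
    by (rule sum.reindex_bij_witness[where i = "\<lambda>(m, l). (m + l, m)" and j = "\<lambda>(r, m). (m, r - m)"]) auto
  also have "\<dots> = (\<Sum>m\<le>p. \<Sum>l\<le>p - m. of_nat ((m + l) choose m) * a (m + l) * w ^ l * Y ^ m)"
    by (subst sum.Sigma) auto
  finally have eq: "(\<Sum>r\<le>p. a r * (Y + w) ^ r) = (\<Sum>m\<le>p. \<Sum>l\<le>p - m. of_nat ((m + l) choose m) * a (m + l) * w ^ l * Y ^ m)" .
  have "(m + l) choose m = (m + l) choose l" for m l :: nat
    using binomial_symmetric[of m "m + l"] by simp
  note sym = this
  show ?thesis unfolding eq sum_distrib_right
    by (rule sum.cong[OF refl], rule sum.cong[OF refl], subst sym, rule refl)
qed

section \<open>Transformation of the components under S and parity of the weight\<close>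

context
  fixes k :: int and p :: nat and f :: "complex \<Rightarrow> complex" and fs :: "nat \<Rightarrow> complex \<Rightarrow> complex"
  assumes qm: "mero_quasi_modular k p f fs"
begin

lemma component_nicely_meromorphic: "r \<le> p \<Longrightarrow> fs r nicely_meromorphic_on upper_half_plane"
  using qm unfolding mero_quasi_modular_def by blast

lemma component_fourier: "r \<le> p \<Longrightarrow> has_fourier_expansion (fs r) (fourier_coeff (fs r))"
  using qm has_fourier_expansion_fourier_coeff unfolding mero_quasi_modular_def by blast

lemma open_upper_half_plane: "open upper_half_plane"
  by (rule open_halfspace_Im_gt)

lemma quasi_modular_law:
  assumes "a * d - b * c = 1" "Im \<tau> > 0"
    "\<not> is_pole f ((of_int a * \<tau> + of_int b) / (of_int c * \<tau> + of_int d))" "\<forall>r\<le>p. \<not> is_pole (fs r) \<tau>"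
  shows "(of_int c * \<tau> + of_int d) powi (-k) * f ((of_int a * \<tau> + of_int b) / (of_int c * \<tau> + of_int d)) =
      (\<Sum>r\<le>p. fs r \<tau> * (of_int c / (of_int c * \<tau> + of_int d)) ^ r)"
  using qm assms unfolding mero_quasi_modular_def slash_def by blast

lemma quasi_modular_f_nicely: "f nicely_meromorphic_on upper_half_plane"
  using qm unfolding mero_quasi_modular_def by blast

text \<open>The identity matrix has c = 0, so only r = 0 survives; normalisation carries the
  equality to the poles. Nothing relates the two functions outside the upper half-plane.\<close>

lemma component_0:
  assumes "Im \<tau> > 0"
  shows "f \<tau> = fs 0 \<tau>"
proof -
  have nice: "f nicely_meromorphic_on upper_half_plane" by (rule quasi_modular_f_nicely)
  have ev: "\<forall>\<^sub>F w in at \<tau>. w \<in> upper_half_plane"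
    using assms open_upper_half_plane by (intro eventually_at_in_open') auto
  have np: "\<forall>\<^sub>F w in at \<tau>. \<not> is_pole g w" if "g nicely_meromorphic_on upper_half_plane" for g
    using that assms by (intro eventually_not_pole meromorphic_on_isolated_singularity)
      (auto simp: nicely_meromorphic_on_def intro: meromorphic_on_subset)
  have "\<forall>\<^sub>F w in at \<tau>. \<forall>r\<in>{..p}. \<not> is_pole (fs r) w"
    by (intro eventually_ball_finite ballI np component_nicely_meromorphic) auto
  with np[OF nice] ev have "\<forall>\<^sub>F w in at \<tau>. f w = fs 0 w"
  proof eventually_elim
    case (elim w)
    have "(\<Sum>r\<le>p. fs r w * 0 ^ r) = fs 0 w"
      by (subst sum.remove[of _ 0]) (auto simp: power_0_left)
    then show ?case using quasi_modular_law[of 1 1 0 0 w] elim by auto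
  qed
  then show ?thesis
    using nicely_meromorphic_eqI[OF nice component_nicely_meromorphic[of 0]] assms by auto
qed

text \<open>The law is given for f only. For fixed w and each integer c the value f (- 1 / (w - c))
  is computed twice: by the matrix (0, -1; 1, -c) at w and by (1, 0; c, 1) at - 1 / w. Both results
  are polynomials in X = 1 / (w - c) - 1 / w, with coefficients formed from the components at w and
  at - 1 / w. They agree for infinitely many X, so the coefficients of X^m agree. Continuity then
  fills in the countably many excluded points.\<close>

lemma component_S_transform:
  assumes m: "m \<le> p" and \<tau>: "Im \<tau> > 0" and np: "\<And>r. r \<le> p \<Longrightarrow> \<not> is_pole (fs r) \<tau>"
    and np': "\<not> is_pole (fs m) (- 1 / \<tau>)"
  shows "fs m (- 1 / \<tau>) = (\<Sum>l\<le>p - m. of_nat ((m + l) choose l) * \<tau> powi (k - 2 * int m - int l) * fs (m + l) \<tau>)"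
proof -
  define B0 where "B0 = {z\<in>upper_half_plane. is_pole f z} \<union> (\<Union>r\<le>p. {z\<in>upper_half_plane. is_pole (fs r) z})"
  have cB0: "countable B0"
    unfolding B0_def using nicely_meromorphic_poles_countable[OF quasi_modular_f_nicely open_upper_half_plane]
      nicely_meromorphic_poles_countable[OF component_nicely_meromorphic open_upper_half_plane]
    by (intro countable_Un countable_UN) auto
  \<comment> \<open>All w for which one of the evaluations below would hit a pole. Because every
    integer c occurs, the set is countable but need not be discrete.\<close>
  define B where "B = B0 \<union> (\<lambda>z. - 1 / z) ` B0 \<union> (\<Union>c::int. (\<lambda>z. of_int c - 1 / z) ` B0)"
  have cB: "countable B" unfolding B_def by (intro countable_Un countable_UN countable_image cB0) auto
  have ImS: "Im (- 1 / w) > 0" if "Im w > 0" for w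
    using that by (auto simp: Im_divide zero_less_divide_iff intro!: sum_power2_gt_zero_iff[THEN iffD2])
  have main: "fs m (- 1 / w) = (\<Sum>l\<le>p - m. of_nat ((m + l) choose l) * w powi (k - 2 * int m - int l) * fs (m + l) w)"
    if w: "w \<in> upper_half_plane - B" for w
  proof -
    have Imw: "Im w > 0" and wB: "w \<notin> B" using w by auto
    have w0: "w \<noteq> 0" using Imw by auto
    have wc: "w - of_int c \<noteq> 0" for c using Imw by (auto simp: complex_eq_iff)
    have np1: "\<not> is_pole (fs r) w" if "r \<le> p" for r
      using wB Imw that unfolding B_def B0_def by auto
    have np2: "\<not> is_pole (fs r) (- 1 / w)" if "r \<le> p" for r
    proof
      assume "is_pole (fs r) (- 1 / w)"
      then have "- 1 / w \<in> B0" using ImS[OF Imw] that unfolding B0_def by auto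
      then have "- 1 / (- 1 / w) \<in> (\<lambda>z. - 1 / z) ` B0" by (rule imageI)
      then show False using wB unfolding B_def by auto
    qed
    have np3: "\<not> is_pole f (- 1 / (w - of_int c))" for c
    proof
      assume "is_pole f (- 1 / (w - of_int c))"
      then have "- 1 / (w - of_int c) \<in> B0" using ImS[of "w - of_int c"] Imw unfolding B0_def by auto
      then have "of_int c - 1 / (- 1 / (w - of_int c)) \<in> (\<lambda>z. of_int c - 1 / z) ` B0" by (rule imageI)
      then show False using wB unfolding B_def by auto
    qed
    have eq: "(\<Sum>r\<le>p. (fs r (- 1 / w) * w ^ (2 * r)) * (1 / (w - of_int c) - 1 / w) ^ r) =
        w powi k * (\<Sum>r\<le>p. fs r w * (1 / (w - of_int c)) ^ r)" for c
    proof -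
      have e1: "of_int c * (- 1 / w) + 1 = (w - of_int c) / w" using w0 by (simp add: field_simps)
      have e2: "- 1 / w / ((w - of_int c) / w) = - 1 / (w - of_int c)" using w0 by simp
      have L1: "((w - of_int c) / w) powi (- k) * f (- 1 / (w - of_int c)) =
          (\<Sum>r\<le>p. fs r (- 1 / w) * (of_int c / ((w - of_int c) / w)) ^ r)"
        using quasi_modular_law[of 1 1 0 c "- 1 / w"] np3[of c] np2 ImS[OF Imw] unfolding of_int_1 of_int_0 e1 mult_1_left add_0_right e2 by simp
      have L2: "(w - of_int c) powi (- k) * f (- 1 / (w - of_int c)) = (\<Sum>r\<le>p. fs r w * (1 / (w - of_int c)) ^ r)"
        using quasi_modular_law[of 0 "- c" "-1" 1 w] np3[of c] np1 Imw by simp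
      have "((w - of_int c) / w) powi (- k) = w powi k * (w - of_int c) powi (- k)"
        using w0 wc[of c] by (simp add: power_int_divide_distrib power_int_minus field_simps)
      then have f1: "(\<Sum>r\<le>p. fs r (- 1 / w) * (of_int c / ((w - of_int c) / w)) ^ r) = w powi k * (\<Sum>r\<le>p. fs r w * (1 / (w - of_int c)) ^ r)"
        using L1 L2 by (simp add: mult.assoc)
      have f2: "fs r (- 1 / w) * (of_int c / ((w - of_int c) / w)) ^ r = (fs r (- 1 / w) * w ^ (2 * r)) * (1 / (w - of_int c) - 1 / w) ^ r" for r
      proof -
        have "of_int c / ((w - of_int c) / w) = w ^ 2 * (1 / (w - of_int c) - 1 / w)"
          using w0 wc[of c] by (simp add: field_simps power2_eq_square)
        then show ?thesis by (simp add: power_mult_distrib power_mult)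
      qed
      show ?thesis using f1 unfolding f2 .
    qed
    define C where "C = (\<lambda>i. fs i (- 1 / w) * w ^ (2 * i))"
    define Q where "Q = (\<lambda>i. \<Sum>l\<le>p - i. of_nat ((i + l) choose l) * fs (i + l) w * (1 / w) ^ l)"
    define D where "D = (\<lambda>i. w powi k * Q i)"
    have "(\<Sum>i\<le>p. C i * (1 / (w - of_int c) - 1 / w) ^ i) = (\<Sum>i\<le>p. D i * (1 / (w - of_int c) - 1 / w) ^ i)" for c
    proof -
      have "(\<Sum>r\<le>p. fs r w * (1 / (w - of_int c)) ^ r) = (\<Sum>r\<le>p. fs r w * ((1 / (w - of_int c) - 1 / w) + 1 / w) ^ r)" by simp
      also have "\<dots> = (\<Sum>i\<le>p. Q i * (1 / (w - of_int c) - 1 / w) ^ i)"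
        unfolding Q_def by (rule sum_binomial_shift)
      finally show ?thesis using eq[of c] unfolding C_def D_def by (simp add: sum_distrib_left mult.assoc)
    qed
    then have "range (\<lambda>c::int. 1 / (w - of_int c) - 1 / w) \<subseteq> {x. (\<Sum>i\<le>p. C i * x ^ i) = (\<Sum>i\<le>p. D i * x ^ i)}" by blast
    moreover have "infinite (range (\<lambda>c::int. 1 / (w - of_int c) - 1 / w))"
    proof -
      have "inj (\<lambda>c::int. 1 / (w - of_int c) - 1 / w)"
      proof (rule injI)
        fix c d :: int assume "1 / (w - of_int c) - 1 / w = 1 / (w - of_int d) - 1 / w"
        then have "w - of_int c = w - of_int d" using wc by (simp add: field_simps)
        then show "c = d" by simp
      qed
      then show ?thesis using infinite_UNIV_int finite_imageD by blast
    qed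
    ultimately have "infinite {x. (\<Sum>i\<le>p. C i * x ^ i) = (\<Sum>i\<le>p. D i * x ^ i)}" by (rule infinite_super)
    from polyfun_eq_infinite[OF this m] have CD: "C m = D m" .
    have "w powi (- 2 * int m) = inverse (w ^ (2 * m))"
      by (simp add: power_int_def nat_mult_distrib power_inverse)
    then have "fs m (- 1 / w) = w powi (- 2 * int m) * C m"
      using w0 by (simp add: C_def)
    also have "\<dots> = (\<Sum>l\<le>p - m. of_nat ((m + l) choose l) * w powi (k - 2 * int m - int l) * fs (m + l) w)"
      unfolding CD D_def Q_def sum_distrib_left
    proof (rule sum.cong[OF refl])
      fix l
      have "(1 / w) ^ l = w powi (- int l)" by (simp add: power_int_minus power_one_over inverse_eq_divide)
      moreover have "k - 2 * int m - int l = (- 2 * int m) + k + (- int l)" by simp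
      ultimately have "w powi (k - 2 * int m - int l) = w powi (- 2 * int m) * w powi k * (1 / w) ^ l"
        by (simp only: power_int_add[OF disjI1[OF w0]])
      then show "w powi (- 2 * int m) * (w powi k * (of_nat ((m + l) choose l) * fs (m + l) w * (1 / w) ^ l)) =
         of_nat ((m + l) choose l) * w powi (k - 2 * int m - int l) * fs (m + l) w" by (simp add: mult_ac)
    qed
    finally show ?thesis .
  qed
  show ?thesis
  proof (rule eq_off_countable_imp_eq[OF cB open_upper_half_plane _ main])
    have t0: "\<tau> \<noteq> 0" using \<tau> by auto
    have "isCont (fs m) (- 1 / \<tau>)"
      by (rule nicely_meromorphic_isCont[OF component_nicely_meromorphic[OF m] _ np']) (use ImS[OF \<tau>] in simp)
    then show "isCont (\<lambda>w. fs m (- 1 / w)) \<tau>"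
      by (rule isCont_o2[rotated]) (use t0 in \<open>auto intro!: continuous_intros\<close>)
    have "isCont (fs (m + l)) \<tau>" if "l \<le> p - m" for l
      by (rule nicely_meromorphic_isCont[OF component_nicely_meromorphic _ np]) (use \<tau> that m in auto)
    then show "isCont (\<lambda>w. \<Sum>l\<le>p - m. of_nat ((m + l) choose l) * w powi (k - 2 * int m - int l) * fs (m + l) w) \<tau>"
      using t0 by (intro continuous_intros) auto
  qed (use \<tau> in auto)
qed

text \<open>The top component transforms by a single factor, fs p (- 1 / w) = w^(k - 2 p) fs p w.
  Applying this twice gives the factor (- 1)^k, so for odd k the top component would vanish, against
  the condition on the depth.\<close>

lemma weight_even: "even k"
proof (rule ccontr)
  assume odd: "odd k"
  from qm obtain \<tau> where \<tau>: "Im \<tau> > 0" "fs p \<tau> \<noteq> 0" unfolding mero_quasi_modular_def by auto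
  have nice: "fs p nicely_meromorphic_on upper_half_plane" by (rule component_nicely_meromorphic) simp
  have main: "fs p w = (\<lambda>_. 0) w" if w: "w \<in> upper_half_plane - ((\<Union>r\<le>p. {z\<in>upper_half_plane. is_pole (fs r) z}) \<union> (\<lambda>z. - 1 / z) ` (\<Union>r\<le>p. {z\<in>upper_half_plane. is_pole (fs r) z}))" for w
  proof -
    let ?P = "\<Union>r\<le>p. {z\<in>upper_half_plane. is_pole (fs r) z}"
    have Imw: "Im w > 0" and w0: "w \<noteq> 0" using w by auto
    have ImS: "Im (- 1 / w) > 0"
      using Imw by (auto simp: Im_divide zero_less_divide_iff intro!: sum_power2_gt_zero_iff[THEN iffD2])
    have np1: "\<not> is_pole (fs r) w" if "r \<le> p" for r using w that by auto
    have np2: "\<not> is_pole (fs r) (- 1 / w)" if "r \<le> p" for r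
    proof
      assume "is_pole (fs r) (- 1 / w)"
      then have "- 1 / (- 1 / w) \<in> (\<lambda>z. - 1 / z) ` ?P" using ImS that by (intro imageI) auto
      then show False using w by auto
    qed
    have 1: "fs p (- 1 / w) = w powi (k - 2 * int p) * fs p w"
      using component_S_transform[OF order_refl Imw np1 np2[OF order_refl]] by simp
    have 2: "fs p (- 1 / (- 1 / w)) = (- 1 / w) powi (k - 2 * int p) * fs p (- 1 / w)"
      using component_S_transform[OF order_refl ImS np2] np1[of p] by simp
    have "(- 1 / w) powi (k - 2 * int p) * w powi (k - 2 * int p) = (- 1) powi (k - 2 * int p)"
      using w0 by (simp flip: power_int_mult_distrib)
    also have "\<dots> = - 1" using odd by (simp add: power_int_minus_left)
    finally have "(- 1 / w) powi (k - 2 * int p) * w powi (k - 2 * int p) = - 1" .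
    with 1 2 have "fs p w = - fs p w" by (simp add: mult.assoc[symmetric])
    then show ?thesis by (simp add: eq_neg_iff_add_eq_0 mult_2[symmetric])
  qed
  have cB: "countable ((\<Union>r\<le>p. {z\<in>upper_half_plane. is_pole (fs r) z}) \<union> (\<lambda>z. - 1 / z) ` (\<Union>r\<le>p. {z\<in>upper_half_plane. is_pole (fs r) z}))"
    using nicely_meromorphic_poles_countable[OF component_nicely_meromorphic open_upper_half_plane]
    by (intro countable_Un countable_image countable_UN) auto
  have "\<not> is_pole (fs p) \<tau>"
    using nice \<tau> unfolding nicely_meromorphic_on_def
    by (metis at_neq_bot is_pole_def mem_Collect_eq not_tendsto_and_filterlim_at_infinity)
  then have cont: "isCont (fs p) \<tau>" using nicely_meromorphic_isCont[OF nice] \<tau> by auto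
  have "fs p \<tau> = 0"
    by (rule eq_off_countable_imp_eq[OF cB open_upper_half_plane _ main cont]) (use \<tau> in auto)
  with \<tau> show False by simp
qed

end

section \<open>Uniqueness of the complete L-function\<close>

lemma meromorphic_eq_on_open:
  assumes F: "F meromorphic_on UNIV" and G: "G meromorphic_on UNIV"
    and W: "open W" "W \<noteq> {}" "\<And>z. z \<in> W \<Longrightarrow> F z = G z"
  shows "\<forall>\<^sub>F w in at z. F w = G w"
proof -
  let ?D = "\<lambda>z. F z - G z"
  have D: "?D meromorphic_on UNIV" by (intro meromorphic_intros F G)
  have ev: "\<forall>\<^sub>F w in at z. remove_sings ?D w = ?D w" for z
    by (rule eventually_remove_sings_eq_at) (use D meromorphic_on_isolated_singularity[of ?D z] meromorphic_on_subset in blast)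
  obtain z0 where z0: "z0 \<in> W" using W by blast
  have "\<forall>\<^sub>F w in at z0. w \<in> W" using W z0 by (intro eventually_at_in_open') auto
  with ev[of z0] have "\<forall>\<^sub>F w in at z0. remove_sings ?D w = 0" by eventually_elim (use W in auto)
  then have "\<exists>\<^sub>F w in at z0. remove_sings ?D w = 0" by (intro eventually_frequently) auto
  then have "remove_sings ?D w = 0" for w
    by (rule frequently_eq_meromorphic_imp_constant[OF _ remove_sings_nicely_meromorphic[OF D]]) auto
  with ev[of z] show ?thesis by (auto elim: eventually_mono)
qed

lemma has_reg_integral_pole_unique:
  assumes "has_reg_integral_pole g a b c v" "has_reg_integral_pole g a b c w"
  shows "v = w"
proof -
  obtain G L C where G: "G meromorphic_on UNIV" "\<And>z. Re z > C \<Longrightarrow> G z = integral {a..b} (\<lambda>t. of_real \<bar>t - c\<bar> powr z * g t)"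
     "G has_laurent_expansion L" "fls_nth L 0 = v"
    using assms(1) unfolding has_reg_integral_pole_def by blast
  obtain H M D where H: "H meromorphic_on UNIV" "\<And>z. Re z > D \<Longrightarrow> H z = integral {a..b} (\<lambda>t. of_real \<bar>t - c\<bar> powr z * g t)"
     "H has_laurent_expansion M" "fls_nth M 0 = w"
    using assms(2) unfolding has_reg_integral_pole_def by blast
  have "\<forall>\<^sub>F z in at 0. G z = H z"
  proof (rule meromorphic_eq_on_open[OF G(1) H(1)])
    show "open {z. Re z > max C D}" by (rule open_halfspace_Re_gt)
    have "of_real (max C D + 1) \<in> {z. Re z > max C D}" by (auto simp: max_def)
    then show "{z. Re z > max C D} \<noteq> {}" by blast
  qed (use G(2) H(2) in auto)
  then have "G has_laurent_expansion M" using H(3) has_laurent_expansion_cong[of G H M M] by auto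
  with G(3) have "L = M" by (rule has_laurent_expansion_unique)
  with G H show ?thesis by simp
qed

text \<open>Each end piece is determined on a half-plane by the existence clauses for Re s > C and
  Re s < C, and then everywhere by the identity theorem. One splitting suffices for this, and it
  makes the description in \<open>complete_L\<close> meaningful.\<close>

lemma is_complete_L_unique:
  assumes 1: "is_complete_L \<sigma> f \<Lambda>" and 2: "is_complete_L \<sigma> f \<Lambda>'"
  shows "\<Lambda> = \<Lambda>'"
proof -
  obtain n a c where adm: "admissible_splitting f n a c" using 1 unfolding is_complete_L_def by blast
  let ?R0 = "\<lambda>s. has_reg_integral_zero \<sigma> (mellin_integrand f s) (a 0)" and ?R1 = "\<lambda>s. has_reg_integral_inf \<sigma> (mellin_integrand f s) (a n)"
  have split: "\<exists>I0 I1 M. meromorphically_extends I0 ?R0 \<and> (\<exists>C. \<forall>s. Re s > C \<longrightarrow> (\<exists>v. ?R0 s v)) \<and>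
    meromorphically_extends I1 ?R1 \<and> (\<exists>C. \<forall>s. Re s < C \<longrightarrow> (\<exists>v. ?R1 s v)) \<and>
    (\<forall>j<n. \<forall>s. has_reg_integral_pole (mellin_integrand f s) (a j) (a (Suc j)) (c j) (M j s)) \<and>
    L = remove_sings (\<lambda>s. I0 s + (\<Sum>j<n. M j s) + I1 s)" if "is_complete_L \<sigma> f L" for L
    using that[unfolded is_complete_L_def, THEN conjunct2, THEN conjunct2, rule_format, OF adm] .
  from split[OF 1] obtain I0 I1 M where I: "meromorphically_extends I0 ?R0" "\<exists>C. \<forall>s. Re s > C \<longrightarrow> (\<exists>v. ?R0 s v)"
    "meromorphically_extends I1 ?R1" "\<exists>C. \<forall>s. Re s < C \<longrightarrow> (\<exists>v. ?R1 s v)"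
    "\<forall>j<n. \<forall>s. has_reg_integral_pole (mellin_integrand f s) (a j) (a (Suc j)) (c j) (M j s)"
    "\<Lambda> = remove_sings (\<lambda>s. I0 s + (\<Sum>j<n. M j s) + I1 s)"
    by (elim exE conjE) (rule that, (assumption | rule exI)+)
  from split[OF 2] obtain I0' I1' M' where I': "meromorphically_extends I0' ?R0"
    "meromorphically_extends I1' ?R1"
    "\<forall>j<n. \<forall>s. has_reg_integral_pole (mellin_integrand f s) (a j) (a (Suc j)) (c j) (M' j s)"
    "\<Lambda>' = remove_sings (\<lambda>s. I0' s + (\<Sum>j<n. M' j s) + I1' s)"
    by (elim exE conjE) (rule that, (assumption | rule exI)+)
  have M: "M j s = M' j s" if "j < n" for j s
    by (rule has_reg_integral_pole_unique[OF I(5)[rule_format, OF that] I'(3)[rule_format, OF that]])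
  obtain C0 where C0: "\<And>s. Re s > C0 \<Longrightarrow> \<exists>v. ?R0 s v" using I(2) by blast
  obtain C1 where C1: "\<And>s. Re s < C1 \<Longrightarrow> \<exists>v. ?R1 s v" using I(4) by blast
  have e0: "\<forall>\<^sub>F s in at z. I0 s = I0' s" for z
  proof (rule meromorphic_eq_on_open)
    show "open {s. Re s > C0}" by (rule open_halfspace_Re_gt)
    have "of_real (C0 + 1) \<in> {s. Re s > C0}" by simp
    then show "{s. Re s > C0} \<noteq> {}" by blast
    show "I0 s = I0' s" if "s \<in> {s. Re s > C0}" for s
    proof -
      from that C0[of s] obtain v where "?R0 s v" by auto
      then show ?thesis using I(1) I'(1) unfolding meromorphically_extends_def by simp
    qed
  qed (use I(1) I'(1) in \<open>auto simp: meromorphically_extends_def nicely_meromorphic_on_def\<close>)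
  have e1: "\<forall>\<^sub>F s in at z. I1 s = I1' s" for z
  proof (rule meromorphic_eq_on_open)
    show "open {s. Re s < C1}" by (rule open_halfspace_Re_lt)
    have "of_real (C1 - 1) \<in> {s. Re s < C1}" by simp
    then show "{s. Re s < C1} \<noteq> {}" by blast
    show "I1 s = I1' s" if "s \<in> {s. Re s < C1}" for s
    proof -
      from that C1[of s] obtain v where "?R1 s v" by auto
      then show ?thesis using I(3) I'(2) unfolding meromorphically_extends_def by simp
    qed
  qed (use I(3) I'(2) in \<open>auto simp: meromorphically_extends_def nicely_meromorphic_on_def\<close>)
  show ?thesis
    unfolding I(6) I'(4)
  proof (rule ext, rule remove_sings_cong[OF _ refl])
    fix z
    show "\<forall>\<^sub>F s in at z. I0 s + (\<Sum>j<n. M j s) + I1 s = I0' s + (\<Sum>j<n. M' j s) + I1' s"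
      using e0[of z] e1[of z] by eventually_elim (simp add: M)
  qed
qed

lemma complete_L_eqI: "is_complete_L \<sigma> f \<Lambda> \<Longrightarrow> complete_L \<sigma> f = \<Lambda>"
  unfolding complete_L_def using is_complete_L_unique by blast

lemma has_reg_integral_inf_cong:
  assumes "\<And>t. t \<ge> t0 \<Longrightarrow> g t = h t"
  shows "has_reg_integral_inf \<sigma> g t0 v = has_reg_integral_inf \<sigma> h t0 v"
proof -
  have "has_reg_integral_inf \<sigma> h t0 v" if "has_reg_integral_inf \<sigma> g t0 v" "\<And>t. t \<ge> t0 \<Longrightarrow> g t = h t" for g h
    using that laplace_continuation_cong unfolding has_reg_integral_inf_iff by meson
  from this[of g h] this[of h g] assms show ?thesis by metis
qed

lemma has_reg_integral_pole_cong:
  assumes "has_reg_integral_pole g a b c v" "\<And>t. a \<le> t \<Longrightarrow> t \<le> b \<Longrightarrow> g t = h t"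
  shows "has_reg_integral_pole h a b c v"
proof -
  have eq: "complex_of_real \<bar>t - c\<bar> powr z * g t = of_real \<bar>t - c\<bar> powr z * h t" if "t \<in> {a..b}" for t z
    using assms(2)[of t] that by auto
  have "(\<lambda>t. complex_of_real \<bar>t - c\<bar> powr z * g t) absolutely_integrable_on {a..b} \<longleftrightarrow> (\<lambda>t. complex_of_real \<bar>t - c\<bar> powr z * h t) absolutely_integrable_on {a..b}"
    "integral {a..b} (\<lambda>t. complex_of_real \<bar>t - c\<bar> powr z * g t) = integral {a..b} (\<lambda>t. complex_of_real \<bar>t - c\<bar> powr z * h t)" for z
    by (rule set_integrable_cong[OF refl refl eq], assumption, rule integral_cong[OF eq])
  then show ?thesis using assms(1) unfolding has_reg_integral_pole_def by simp
qed

section \<open>Cut points and poles of admissible splittings\<close>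

lemma admissible_splitting_mono:
  assumes "admissible_splitting f n a c"
  shows "i \<le> j \<Longrightarrow> j \<le> n \<Longrightarrow> a i \<le> a j" "j \<le> n \<Longrightarrow> 0 < a j"
proof -
  have step: "a j \<le> a (Suc j)" if "j < n" for j
    using assms that unfolding admissible_splitting_def by force
  show mono: "a i \<le> a j" if "i \<le> j" "j \<le> n" for i j
    using that by (induction j rule: dec_induct) (use step in \<open>auto intro: order_trans\<close>)
  show "j \<le> n \<Longrightarrow> 0 < a j"
    using mono[of 0 j] assms unfolding admissible_splitting_def by force
qed

lemma admissible_splitting_poles:
  assumes adm: "admissible_splitting f n a c" and t: "0 < t" "is_pole f (\<i> * of_real t)"
  obtains j where "j < n" "t = c j" "a j < t" "t < a (Suc j)"
proof -
  have "t \<in> c ` {..<n}" using adm t unfolding admissible_splitting_def by blast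
  then show ?thesis using that adm unfolding admissible_splitting_def by blast
qed

lemma admissible_splitting_no_pole:
  assumes adm: "admissible_splitting f n a c" and t: "0 < t" "is_pole f (\<i> * of_real t)"
  shows "a 0 < t" "t < a n" "j \<le> n \<Longrightarrow> t \<noteq> a j" "j < n \<Longrightarrow> a j \<le> t \<Longrightarrow> t \<le> a (Suc j) \<Longrightarrow> t = c j"
proof -
  obtain i where i: "i < n" "t = c i" "a i < t" "t < a (Suc i)" by (rule admissible_splitting_poles[OF assms])
  note mono = admissible_splitting_mono(1)[OF adm]
  show "a 0 < t" using mono[of 0 i] i by auto
  show "t < a n" using mono[of "Suc i" n] i by auto
  show "t \<noteq> a j" if "j \<le> n"
    using mono[of j i] mono[of "Suc i" j] i that by (cases "j \<le> i") auto
  show "t = c j" if "j < n" "a j \<le> t" "t \<le> a (Suc j)"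
    using mono[of "Suc j" i] mono[of "Suc i" j] i that by (cases i j rule: linorder_cases) auto
qed

lemma admissible_splitting_exists:
  assumes fin: "finite {t. 0 < t \<and> is_pole f (\<i> * of_real t)}"
  shows "\<exists>n a c. admissible_splitting f n a c"
proof -
  let ?P = "{t. 0 < t \<and> is_pole f (\<i> * of_real t)}"
  define xs where "xs = sorted_list_of_set ?P"
  define n where "n = length xs"
  define c where "c = (\<lambda>j. xs ! j)"
  \<comment> \<open>Half the first pole, the midpoints between neighbours, and the last pole plus 1;
    without poles the single cut point is 1.\<close>
  define a where "a = (\<lambda>j. if j = 0 then (if n = 0 then 1 else c 0 / 2) else if j < n then (c (j - 1) + c j) / 2 else c (n - 1) + 1)"
  have set: "set xs = ?P" unfolding xs_def using fin by simp
  have lt: "c i < c j" if "i < j" "j < n" for i j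
    using that sorted_wrt_nth_less[OF strict_sorted_list_of_set[of ?P], of i j] unfolding c_def xs_def n_def by simp
  have "c ` {..<n} = ?P" unfolding set[symmetric] c_def n_def by (auto simp: set_conv_nth)
  then have pos: "c j > 0" if "j < n" for j using that by blast
  have "admissible_splitting f n a c"
    unfolding admissible_splitting_def
  proof (intro conjI allI impI)
    show "0 < a 0" using pos[of 0] by (auto simp: a_def)
    show "?P = c ` {..<n}" by (rule \<open>c ` {..<n} = ?P\<close>[symmetric])
    fix j assume j: "j < n"
    show "a j < c j" using pos[OF j] lt[of "j - 1" j] j by (auto simp: a_def field_simps)
    show "c j < a (Suc j)" using lt[of j "Suc j"] j by (auto simp: a_def field_simps not_less le_Suc_eq less_Suc_eq)
  qed
  then show ?thesis by blast
qed

text \<open>F is left open on N, where the formula divides by 0, and \<rho> n may vanish. In that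
  case the singularity at n is removable, so the order is asserted at actual poles only.\<close>

lemma simple_pole_sum:
  fixes N :: "int set" and \<rho> :: "int \<Rightarrow> complex" and E F :: "complex \<Rightarrow> complex"
  assumes N: "finite N" and E: "E holomorphic_on UNIV" and F: "\<And>s. s \<notin> of_int ` N \<Longrightarrow> F s = E s + (\<Sum>n\<in>N. \<rho> n / (s - of_int n))"
  shows "is_pole F s \<Longrightarrow> zorder F s = -1 \<and> (\<exists>n\<in>N. s = of_int n)"
    and "n \<in> N \<Longrightarrow> residue F (of_int n) = \<rho> n"
proof -
  have fin: "finite (of_int ` N :: complex set)" using N by simp
  have ev: "\<forall>\<^sub>F w in at s. w \<notin> of_int ` N" for s :: complex
    using islimpt_finite[OF fin, of s] by (simp add: islimpt_iff_eventually)
  define G where "G = (\<lambda>n w. (E w + (\<Sum>m\<in>N - {n}. \<rho> m / (w - of_int m))) * (w - of_int n) + \<rho> n)"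
  have FG: "\<forall>\<^sub>F w in at (of_int n). F w = G n w / (w - of_int n)" if n: "n \<in> N" for n
    using ev[of "of_int n"]
  proof eventually_elim
    case (elim w)
    then have "w - of_int n \<noteq> 0" using n by auto
    then show ?case unfolding F[OF elim] G_def using N n by (simp add: sum.remove[of N n] field_simps)
  qed
  define S where "S = (\<lambda>n. - (of_int ` (N - {n})) :: complex set)"
  have opS: "open (S n)" for n unfolding S_def using N by (intro open_Compl finite_imp_closed) auto
  have nS: "of_int n \<in> S n" for n by (auto simp: S_def)
  have holG: "G n holomorphic_on S n" for n
    unfolding G_def S_def by (intro holomorphic_intros holomorphic_on_subset[OF E]) auto
  have Gn: "G n (of_int n) = \<rho> n" for n by (simp add: G_def)
  show "residue F (of_int n) = \<rho> n" if n: "n \<in> N" for n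
  proof -
    have "residue F (of_int n) = residue (\<lambda>w. G n w / (w - of_int n)) (of_int n)"
      by (rule residue_cong[OF FG[OF n] refl])
    also have "\<dots> = \<rho> n" using residue_simple[OF opS nS holG] Gn by simp
    finally show ?thesis .
  qed
  show "zorder F s = -1 \<and> (\<exists>n\<in>N. s = of_int n)" if pole: "is_pole F s" for s
  proof (cases "s \<in> of_int ` N")
    case False
    let ?H = "\<lambda>s. E s + (\<Sum>n\<in>N. \<rho> n / (s - of_int n))"
    have "?H holomorphic_on - (of_int ` N)"
      by (intro holomorphic_intros holomorphic_on_subset[OF E]) auto
    moreover have "open (- (of_int ` N :: complex set))" using fin by (intro open_Compl finite_imp_closed)
    ultimately have "?H analytic_on {s}" using False by (auto simp: analytic_at)
    then have "\<not> is_pole ?H s" by (rule analytic_at_imp_no_pole)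
    moreover have "\<forall>\<^sub>F w in at s. F w = ?H w" using ev[of s] by eventually_elim (rule F)
    ultimately show ?thesis using pole is_pole_cong[of F ?H s s] by auto
  next
    case True
    then obtain n where n: "n \<in> N" "s = of_int n" by auto
    have "\<rho> n \<noteq> 0"
    proof
      assume "\<rho> n = 0"
      let ?H = "\<lambda>w. E w + (\<Sum>m\<in>N - {n}. \<rho> m / (w - of_int m))"
      have "?H holomorphic_on S n"
        unfolding S_def by (intro holomorphic_intros holomorphic_on_subset[OF E]) auto
      then have "?H analytic_on {of_int n}" using opS nS by (auto simp: analytic_at)
      then have "\<not> is_pole ?H (of_int n)" by (rule analytic_at_imp_no_pole)
      moreover have "\<forall>\<^sub>F w in at (of_int n). F w = ?H w"
        using FG[OF n(1)] ev[of "of_int n"]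
      proof eventually_elim
        case (elim w)
        then have "w - of_int n \<noteq> 0" using n by auto
        then show ?case using elim(1) \<open>\<rho> n = 0\<close> by (simp add: G_def)
      qed
      ultimately show False using pole n is_pole_cong[of F ?H s s] by auto
    qed
    have "zorder F s = zorder (\<lambda>w. G n w / (w - of_int n) ^ 1) (of_int n)"
      unfolding n(2) using FG[OF n(1)] by (intro zorder_cong) auto
    also have "\<dots> = - int 1"
      by (rule zorder_nonzero_div_power[OF opS nS holG]) (use Gn \<open>\<rho> n \<noteq> 0\<close> in auto)
    finally show ?thesis using n by auto
  qed
qed

section \<open>Components on the imaginary axis\<close>

lemma exp_box_Re_pos: "\<bar>Im z\<bar> \<le> 1 \<Longrightarrow> Re (exp z) > 0"
proof -
  assume "\<bar>Im z\<bar> \<le> 1"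
  then have "\<bar>Im z\<bar> < pi / 2" using pi_gt3 by linarith
  then show ?thesis unfolding Re_exp by (intro mult_pos_pos cos_gt_zero_pi) (auto simp: abs_if split: if_splits)
qed

text \<open>With t = exp x the measure t^(s - 1) dt becomes exp (s x) dx. The bound on \<eta> keeps
  x in the strip where Ln inverts exp.\<close>

lemma mellin_log_substitution:
  assumes "\<bar>\<eta>\<bar> < pi"
  shows "g (\<i> * exp (Complex x \<eta>)) * exp (Complex x \<eta>) powr (s - 1) * exp (Complex x \<eta>) =
     g (\<i> * exp (Complex x \<eta>)) * exp (s * Complex x \<eta>)"
proof -
  have "exp (Complex x \<eta>) powr (s - 1) = exp ((s - 1) * Complex x \<eta>)"
    using assms by (simp add: powr_def Ln_exp)
  then show ?thesis by (simp add: exp_add[symmetric] algebra_simps)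
qed

context
  fixes k :: int and p :: nat and f :: "complex \<Rightarrow> complex" and fs :: "nat \<Rightarrow> complex \<Rightarrow> complex"
  assumes qm: "mero_quasi_modular k p f fs"
begin

lemma component_axis_analytic:
  assumes "r \<le> p" "Re z > 0" "\<not> is_pole (fs r) (\<i> * z)"
  shows "(\<lambda>z. fs r (\<i> * z)) analytic_on {z}"
proof -
  have "fs r analytic_on {\<i> * z}"
    by (rule nicely_meromorphic_on_imp_analytic_at[OF component_nicely_meromorphic[OF qm assms(1)]])
       (use assms in auto)
  then have "(fs r \<circ> (\<lambda>z. \<i> * z)) analytic_on {z}"
    by (intro analytic_on_compose analytic_intros) auto
  then show ?thesis by (simp add: o_def)
qed

text \<open>One T has to serve all components, because S expresses a single component near 0 by
  several ones near infinity. It is the maximum of the single thresholds, plus 1 to exceed each of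
  them strictly.\<close>

lemma component_threshold:
  assumes \<sigma>: "\<sigma> = 1 \<or> \<sigma> = -1"
  shows "\<exists>T J. 1 < T \<and> (\<forall>r\<le>p. laplace_limit \<sigma> T (\<lambda>t. fs r (\<i> * of_real t)) (fourier_coeff (fs r) 0) (J r)) \<and>
     (\<forall>r\<le>p. \<forall>z. Re z \<ge> T \<longrightarrow> \<not> is_pole (fs r) (\<i> * z))"
proof -
  let ?Q = "\<lambda>r T0. 1 \<le> T0 \<and> (\<forall>T>T0. \<exists>J. laplace_limit \<sigma> T (\<lambda>t. fs r (\<i> * of_real t)) (fourier_coeff (fs r) 0) J) \<and>
     (\<forall>z. Re z > T0 \<longrightarrow> \<not> is_pole (fs r) (\<i> * z))"
  have single: "\<exists>T0. ?Q r T0" if r: "r \<le> p" for r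
  proof -
    note four = component_fourier[OF qm r]
    obtain N T0 h where T0: "T0 \<ge> 1" "h holomorphic_on {z. Re z > T0}"
      and bound: "\<And>T1. T1 > T0 \<Longrightarrow> \<exists>M. \<forall>z. Re z \<ge> T1 \<longrightarrow> norm (h z) \<le> M * exp (- 2 * pi * Re z)"
      and dec: "\<And>z. Re z > T0 \<Longrightarrow> fs r (\<i> * z) = (\<Sum>n=1..N. fourier_coeff (fs r) (- int n) * exp (of_real (2 * pi * real n) * z)) + fourier_coeff (fs r) 0 + h z"
      by (rule fourier_decomposition[OF four]) (rule that)
    have "\<exists>J. laplace_limit \<sigma> T (\<lambda>t. fs r (\<i> * of_real t)) (fourier_coeff (fs r) 0) J" if T: "T > T0" for T
    proof -
      from bound[OF T] obtain M where M: "\<And>z. Re z \<ge> T \<Longrightarrow> norm (h z) \<le> M * exp (- 2 * pi * Re z)" by auto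
      show ?thesis
        by (rule laplace_limit_fourier[OF \<sigma> _ four T0(2) _ T M dec]) (use T0 T in auto)
    qed
    moreover have "\<not> is_pole (fs r) (\<i> * z)" if z: "Re z > T0" for z
    proof -
      let ?F = "\<lambda>z. (\<Sum>n=1..N. fourier_coeff (fs r) (- int n) * exp (of_real (2 * pi * real n) * z)) + fourier_coeff (fs r) 0 + h z"
      have op: "open {z. Re z > T0}" by (rule open_halfspace_Re_gt)
      have "?F holomorphic_on {z. Re z > T0}" by (intro holomorphic_intros T0)
      then have "(\<lambda>w. ?F (w / \<i>)) holomorphic_on {w. Im w > T0}"
        by (rule holomorphic_on_compose_gen[where f = "\<lambda>w. w / \<i>" and t = "{z. Re z > T0}", unfolded o_def, rotated])
           (auto intro!: holomorphic_intros)
      then have "fs r holomorphic_on {w. Im w > T0}"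
      proof (rule holomorphic_transform)
        fix w assume "w \<in> {w. Im w > T0}"
        then show "?F (w / \<i>) = fs r w" using dec[of "w / \<i>"] by simp
      qed
      moreover have "open {w. Im w > T0}" by (rule open_halfspace_Im_gt)
      ultimately have "fs r analytic_on {\<i> * z}" using z by (auto simp: analytic_at)
      then show ?thesis by (rule analytic_at_imp_no_pole)
    qed
    ultimately show ?thesis using T0(1) by (intro exI[of _ T0]) simp
  qed
  define T0 where "T0 = (\<lambda>r. SOME T0. ?Q r T0)"
  have T0: "?Q r (T0 r)" if "r \<le> p" for r
    unfolding T0_def by (rule someI_ex) (rule single[OF that])
  have T1: "1 \<le> T0 r" if "r \<le> p" for r using T0[OF that] by (elim conjE)
  have T2: "\<exists>J. laplace_limit \<sigma> T (\<lambda>t. fs r (\<i> * of_real t)) (fourier_coeff (fs r) 0) J" if "r \<le> p" "T0 r < T" for r T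
    by (rule T0[OF that(1), THEN conjunct2, THEN conjunct1, THEN spec, THEN mp, OF that(2)])
  have T3: "\<not> is_pole (fs r) (\<i> * z)" if "r \<le> p" "T0 r < Re z" for r z
    by (rule T0[OF that(1), THEN conjunct2, THEN conjunct2, THEN spec, THEN mp, OF that(2)])
  define T where "T = Max (T0 ` {..p}) + 1"
  have T: "T0 r < T" if "r \<le> p" for r
  proof -
    have "T0 r \<le> Max (T0 ` {..p})" using that by (intro Max_ge) auto
    then show ?thesis by (simp add: T_def)
  qed
  define J where "J = (\<lambda>r. SOME J. laplace_limit \<sigma> T (\<lambda>t. fs r (\<i> * of_real t)) (fourier_coeff (fs r) 0) J)"
  have "laplace_limit \<sigma> T (\<lambda>t. fs r (\<i> * of_real t)) (fourier_coeff (fs r) 0) (J r)" if "r \<le> p" for r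
    unfolding J_def by (rule someI_ex[OF T2[OF that T[OF that]]])
  moreover have "1 < T" using T1[of 0] T[of 0] by simp
  moreover have "\<not> is_pole (fs r) (\<i> * z)" if "r \<le> p" "Re z \<ge> T" for r z
    by (rule T3) (use T[of r] that in auto)
  ultimately show ?thesis by (intro exI[of _ T] exI[of _ J] conjI allI impI)
qed

text \<open>\<open>component_S_transform\<close> presupposes that there is no pole at - 1 / \<tau>.
  Near \<tau> its formula holds at all other points, and the right-hand side is continuous at
  \<tau>, so the left-hand side cannot tend to infinity.\<close>

lemma component_no_pole_inverse:
  assumes m: "m \<le> p" and \<tau>: "Im \<tau> > 0" and np: "\<And>r. r \<le> p \<Longrightarrow> \<not> is_pole (fs r) \<tau>"
  shows "\<not> is_pole (fs m) (- 1 / \<tau>)"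
proof
  assume pole: "is_pole (fs m) (- 1 / \<tau>)"
  have \<tau>0: "\<tau> \<noteq> 0" using \<tau> by auto
  have ImS: "Im (- 1 / \<tau>) > 0"
    using \<tau> by (auto simp: Im_divide zero_less_divide_iff intro!: sum_power2_gt_zero_iff[THEN iffD2])
  have evnp: "\<forall>\<^sub>F w in at u. \<not> is_pole (fs r) w" if "r \<le> p" "Im u > 0" for r u
    using component_nicely_meromorphic[OF qm that(1)] that(2) by (intro eventually_not_pole meromorphic_on_isolated_singularity)
      (auto simp: nicely_meromorphic_on_def intro: meromorphic_on_subset)
  have "((\<lambda>w. - 1 / w) \<longlongrightarrow> - 1 / \<tau>) (at \<tau>)" using \<tau>0 by (intro tendsto_intros)
  moreover have "\<forall>\<^sub>F w in at \<tau>. w \<in> - {0} - {\<tau>}" using \<tau>0 by (intro eventually_at_in_open) auto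
  then have "\<forall>\<^sub>F w in at \<tau>. - 1 / w \<noteq> - 1 / \<tau>" by eventually_elim (use \<tau>0 in \<open>auto simp: field_simps\<close>)
  ultimately have inv: "filterlim (\<lambda>w. - 1 / w) (at (- 1 / \<tau>)) (at \<tau>)" by (simp add: filterlim_at)
  have lim: "filterlim (\<lambda>w. fs m (- 1 / w)) at_infinity (at \<tau>)"
    using filterlim_compose[OF pole[unfolded is_pole_def] inv] .
  let ?G = "\<lambda>\<tau>. \<Sum>l\<le>p - m. of_nat ((m + l) choose l) * \<tau> powi (k - 2 * int m - int l) * fs (m + l) \<tau>"
  have "isCont (fs r) \<tau>" if "r \<le> p" for r
    by (rule nicely_meromorphic_isCont[OF component_nicely_meromorphic[OF qm that]]) (use \<tau> np[OF that] in auto)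
  then have "isCont ?G \<tau>" using m \<tau>0 by (intro continuous_intros) auto
  then have "(?G \<longlongrightarrow> ?G \<tau>) (at \<tau>)" by (simp add: isCont_def)
  moreover have "\<forall>\<^sub>F w in at \<tau>. ?G w = fs m (- 1 / w)"
  proof -
    have "\<forall>\<^sub>F w in at \<tau>. \<forall>r\<in>{..p}. \<not> is_pole (fs r) w"
      using evnp \<tau> by (subst eventually_ball_finite_distrib) auto
    moreover have "\<forall>\<^sub>F w in at \<tau>. \<not> is_pole (fs m) (- 1 / w)"
      using eventually_compose_filterlim[OF evnp[OF m ImS] inv] .
    moreover have "\<forall>\<^sub>F w in at \<tau>. w \<in> upper_half_plane"
      using \<tau> open_upper_half_plane[OF qm] by (intro eventually_at_in_open') auto
    ultimately show ?thesis
      by eventually_elim (rule component_S_transform[OF qm m, symmetric], auto)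
  qed
  ultimately have "((\<lambda>w. fs m (- 1 / w)) \<longlongrightarrow> ?G \<tau>) (at \<tau>)" by (rule Lim_transform_eventually)
  from not_tendsto_and_filterlim_at_infinity[OF at_neq_bot this lim] show False .
qed

lemma component_poles_finite:
  assumes "m \<le> p" "compact K" "K \<subseteq> upper_half_plane"
  shows "finite {z\<in>K. is_pole (fs m) z}"
proof -
  have "eventually (\<lambda>z. \<not> is_pole (fs m) z) (cosparse upper_half_plane)"
    using component_nicely_meromorphic[OF qm assms(1)]
    by (intro meromorphic_on_imp_not_pole_cosparse) (auto simp: nicely_meromorphic_on_def)
  then have "{z. is_pole (fs m) z} sparse_in upper_half_plane" by (simp add: eventually_cosparse)
  then have "{z. is_pole (fs m) z} sparse_in K" using assms(3) by (rule sparse_in_subset)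
  from sparse_in_compact_finite[OF this assms(2)] show ?thesis by (simp add: Collect_conj_eq Int_commute)
qed

text \<open>The box |Im z| <= 1 is mapped by i exp z injectively into a compact subset of the upper
  half-plane, so it contains finitely many preimages of poles. Half the least nonzero height among
  them, capped at 1, is a suitable \<delta>.\<close>

lemma component_pole_free_strip:
  assumes m: "m \<le> p"
  shows "\<exists>\<delta>>0. \<delta> \<le> 1 \<and> (\<forall>z. A \<le> Re z \<longrightarrow> Re z \<le> B \<longrightarrow> \<bar>Im z\<bar> \<le> \<delta> \<longrightarrow> Im z \<noteq> 0 \<longrightarrow> \<not> is_pole (fs m) (\<i> * exp z))"
proof -
  define S where "S = cbox (Complex A (- 1)) (Complex B 1)"
  have S: "z \<in> S \<longleftrightarrow> A \<le> Re z \<and> Re z \<le> B \<and> \<bar>Im z\<bar> \<le> 1" for z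
    unfolding S_def by (auto simp: in_cbox_complex_iff)
  have Reexp: "Re (exp z) > 0" if "z \<in> S" for z using exp_box_Re_pos that S by blast
  define Q where "Q = {z\<in>S. is_pole (fs m) (\<i> * exp z)}"
  have "compact ((\<lambda>z. \<i> * exp z) ` S)"
    unfolding S_def by (intro compact_continuous_image continuous_intros compact_cbox)
  moreover have "(\<lambda>z. \<i> * exp z) ` S \<subseteq> upper_half_plane" using Reexp by auto
  ultimately have "finite {z \<in> (\<lambda>z. \<i> * exp z) ` S. is_pole (fs m) z}" by (rule component_poles_finite[OF m])
  then have "finite ((\<lambda>z. \<i> * exp z) ` Q)" by (rule rev_finite_subset) (auto simp: Q_def)
  moreover have "inj_on (\<lambda>z. \<i> * exp z) Q"
  proof (rule inj_onI)
    fix x y assume xy: "x \<in> Q" "y \<in> Q" "\<i> * exp x = \<i> * exp y"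
    then have "\<bar>Im x - Im y\<bar> < 2 * pi" using pi_gt3 unfolding Q_def S by auto
    moreover from xy(3) have "exp x = exp y" by simp
    ultimately show "x = y" by (rule exp_complex_eqI)
  qed
  ultimately have Q: "finite Q" by (rule finite_imageD)
  define \<delta> where "\<delta> = Min (insert 1 ((\<lambda>z. \<bar>Im z\<bar> / 2) ` {z\<in>Q. Im z \<noteq> 0}))"
  have \<delta>: "\<delta> > 0" "\<delta> \<le> 1" unfolding \<delta>_def using Q by auto
  have \<delta>Q: "\<delta> \<le> \<bar>Im z\<bar> / 2" if "z \<in> Q" "Im z \<noteq> 0" for z
    unfolding \<delta>_def using Q that by (intro Min_le) auto
  have "\<not> is_pole (fs m) (\<i> * exp z)" if z: "A \<le> Re z" "Re z \<le> B" "\<bar>Im z\<bar> \<le> \<delta>" "Im z \<noteq> 0" for z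
  proof
    assume "is_pole (fs m) (\<i> * exp z)"
    then have "z \<in> Q" using z \<delta> unfolding Q_def S by auto
    with \<delta>Q[of z] z \<delta> show False by auto
  qed
  then show ?thesis using \<delta> by (intro exI[of _ \<delta>]) simp
qed

lemma component_pv_entire:
  assumes m: "m \<le> p" and AB: "A \<le> B" and ends: "\<not> is_pole (fs m) (\<i> * of_real (exp A))" "\<not> is_pole (fs m) (\<i> * of_real (exp B))"
  shows "\<exists>V. V holomorphic_on UNIV \<and> (\<forall>s. has_pv (\<lambda>x. fs m (\<i> * exp x) * exp (s * x)) A B (V s))"
proof -
  from component_pole_free_strip[OF m, of A B] obtain \<delta> where \<delta>: "\<delta> > 0" "\<delta> \<le> 1" and
    np: "\<And>z. A \<le> Re z \<Longrightarrow> Re z \<le> B \<Longrightarrow> \<bar>Im z\<bar> \<le> \<delta> \<Longrightarrow> Im z \<noteq> 0 \<Longrightarrow> \<not> is_pole (fs m) (\<i> * exp z)" by auto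
  show ?thesis
  proof (rule has_pv_entire[OF AB \<delta>(1)])
    fix z assume z: "A \<le> Re z" "Re z \<le> B" "\<bar>Im z\<bar> \<le> \<delta>" "Im z \<noteq> 0 \<or> Re z = A \<or> Re z = B"
    have "\<not> is_pole (fs m) (\<i> * exp z)"
    proof (cases "Im z = 0")
      case True
      then have "z = of_real A \<or> z = of_real B" using z by (auto simp: complex_eq_iff)
      then show ?thesis using ends by (auto simp: exp_of_real)
    qed (use np z in auto)
    moreover have "Re (exp z) > 0" using z \<delta> by (intro exp_box_Re_pos) auto
    ultimately have "(\<lambda>z. fs m (\<i> * z)) analytic_on {exp z}" by (intro component_axis_analytic m)
    then have "((\<lambda>z. fs m (\<i> * z)) \<circ> exp) analytic_on {z}"
      by (intro analytic_on_compose analytic_intros) auto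
    then show "(\<lambda>z. fs m (\<i> * exp z)) analytic_on {z}" by (simp add: o_def)
  qed
qed

text \<open>For the normalised representative, being no pole is the same as being analytic, and
  analyticity at a point is an open condition.\<close>

lemma open_component_domain:
  assumes "m \<le> p"
  shows "open {z. Re z > 0 \<and> \<not> is_pole (fs m) (\<i> * z)}"
proof -
  have "open {z. Re z > 0 \<and> (\<lambda>z. fs m (\<i> * z)) analytic_on {z}}"
    by (intro open_Collect_conj open_halfspace_Re_gt) (auto simp: analytic_at open_subopen[of "Collect _"])
  also have "{z. Re z > 0 \<and> (\<lambda>z. fs m (\<i> * z)) analytic_on {z}} = {z. Re z > 0 \<and> \<not> is_pole (fs m) (\<i> * z)}"
  proof -
    have "\<not> is_pole (fs m) (\<i> * z)" if "(\<lambda>z. fs m (\<i> * z)) analytic_on {z}" for z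
    proof -
      have "((\<lambda>z. fs m (\<i> * z)) \<circ> (\<lambda>w. w / \<i>)) analytic_on {\<i> * z}"
        using that by (intro analytic_on_compose analytic_intros) auto
      then have "fs m analytic_on {\<i> * z}" by (simp add: o_def)
      then show ?thesis by (rule analytic_at_imp_no_pole)
    qed
    then show ?thesis using component_axis_analytic[OF assms] by blast
  qed
  finally show ?thesis .
qed

lemma component_pv_regular:
  assumes m: "m \<le> p" and ab: "0 < a" "a \<le> b" and np: "\<And>t. a \<le> t \<Longrightarrow> t \<le> b \<Longrightarrow> \<not> is_pole (fs m) (\<i> * of_real t)"
  shows "has_pv (\<lambda>x. fs m (\<i> * exp x) * exp (s * x)) (ln a) (ln b) (integral {a..b} (mellin_integrand (fs m) s))"
proof -
  let ?U = "{z. Re z > 0 \<and> \<not> is_pole (fs m) (\<i> * z)}"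
  have "(\<lambda>z. fs m (\<i> * z)) holomorphic_on ?U"
    by (rule analytic_imp_holomorphic, subst analytic_on_analytic_at) (use component_axis_analytic[OF m] in auto)
  then have "(\<lambda>z. fs m (\<i> * z) * z powr (s - 1)) holomorphic_on ?U"
    by (intro holomorphic_intros) (auto simp: complex_nonpos_Reals_iff)
  moreover have "complex_of_real ` {a..b} \<subseteq> ?U" using np ab by auto
  ultimately have "has_pv (\<lambda>x. fs m (\<i> * exp x) * exp x powr (s - 1) * exp x) (ln a) (ln b)
      (integral {a..b} (\<lambda>t. fs m (\<i> * of_real t) * of_real t powr (s - 1)))"
    by (intro has_pv_log_holomorphic[OF ab open_component_domain[OF m]])
  then
  have "has_pv (\<lambda>x. fs m (\<i> * exp x) * exp x powr (s - 1) * exp x) (ln a) (ln b) (integral {a..b} (mellin_integrand (fs m) s))"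
    unfolding mellin_integrand_def .
  then show ?thesis by (rule has_pv_cong[where \<delta> = pi]) (simp_all add: mellin_log_substitution)
qed

lemma component_pv_pole:
  assumes m: "m \<le> p" and ab: "0 < a" "a < c" "c < b" and pole: "is_pole (fs m) (\<i> * of_real c)"
    and np: "\<And>t. a \<le> t \<Longrightarrow> t \<le> b \<Longrightarrow> t \<noteq> c \<Longrightarrow> \<not> is_pole (fs m) (\<i> * of_real t)"
  shows "\<exists>v. has_reg_integral_pole (mellin_integrand (fs m) s) a b c v \<and>
     has_pv (\<lambda>x. fs m (\<i> * exp x) * exp (s * x)) (ln a) (ln b) v"
proof -
  let ?U = "{z. Re z > 0 \<and> \<not> is_pole (fs m) (\<i> * z)}" and ?g = "\<lambda>z. fs m (\<i> * z)"
  have hol: "?g holomorphic_on ?U"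
    by (rule analytic_imp_holomorphic, subst analytic_on_analytic_at) (use component_axis_analytic[OF m] in auto)
  have "isolated_singularity_at (fs m) (\<i> * of_real c)"
    using component_nicely_meromorphic[OF qm m] ab
    by (intro meromorphic_on_isolated_singularity) (auto simp: nicely_meromorphic_on_def intro: meromorphic_on_subset)
  then have "\<forall>\<^sub>F w in at (\<i> * of_real c). \<not> is_pole (fs m) w" by (rule eventually_not_pole)
  moreover have "filterlim (\<lambda>z. \<i> * z) (at (\<i> * of_real c)) (at (of_real c))"
    by (auto simp: filterlim_at eventually_at_filter intro!: tendsto_intros)
  ultimately have "\<forall>\<^sub>F z in at (of_real c). \<not> is_pole (fs m) (\<i> * z)" by (rule eventually_compose_filterlim)
  moreover have "\<forall>\<^sub>F z in at (complex_of_real c). z \<in> {z. Re z > 0}"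
    using ab by (intro eventually_at_in_open' open_halfspace_Re_gt) auto
  ultimately have "\<forall>\<^sub>F z in at (of_real c). z \<in> ?U" by eventually_elim auto
  then obtain d where d: "d > 0" "ball (complex_of_real c) d - {of_real c} \<subseteq> ?U"
    unfolding eventually_at by (force simp: dist_commute)
  let ?V = "?U \<union> ball (of_real c) d"
  have pg: "is_pole ?g (of_real c)"
    unfolding is_pole_def
    by (rule filterlim_compose[OF pole[unfolded is_pole_def]])
       (auto simp: filterlim_at eventually_at_filter intro!: tendsto_intros)
  have "?g holomorphic_on ball (of_real c) d - {of_real c}" by (rule holomorphic_on_subset[OF hol d(2)])
  from zorder_exist_pole[OF this _ _ pg] d(1) obtain h r where h: "r > 0" "h holomorphic_on cball (of_real c) r"
    and eq: "\<And>w. w \<in> cball (of_real c) r - {of_real c} \<Longrightarrow> ?g w = h w / (w - of_real c) ^ nat (- zorder ?g (of_real c))"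
    by auto
  define n where "n = nat (- zorder ?g (of_real c))"
  \<comment> \<open>\<open>zorder_exist_pole\<close> clears the pole only near c. Multiplication by
    (z - c)^n extends h to the whole domain; at c itself the product would be a default value, so h
    is used there.\<close>
  define P where "P = (\<lambda>z. if z = of_real c then h z else ?g z * (z - of_real c) ^ n)"
  have "P holomorphic_on ball (of_real c) r"
    by (rule holomorphic_transform[OF holomorphic_on_subset[OF h(2)]]) (auto simp: P_def eq n_def)
  moreover have "P holomorphic_on ?U"
  proof (rule holomorphic_transform)
    show "(\<lambda>z. ?g z * (z - of_real c) ^ n) holomorphic_on ?U" by (intro holomorphic_intros hol)
  qed (use pole in \<open>auto simp: P_def\<close>)
  ultimately have "P holomorphic_on ?U \<union> ball (of_real c) r"
    using open_component_domain[OF m] by (intro holomorphic_on_Un) auto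
  then have P: "P holomorphic_on ?U \<union> (ball (of_real c) r \<inter> {z. Re z > 0})" by (rule holomorphic_on_subset) auto
  let ?W = "?U \<union> (ball (of_real c) r \<inter> {z. Re z > 0})"
  have Q: "(\<lambda>z. P z * z powr (s - 1)) holomorphic_on ?W"
    by (intro holomorphic_intros P) (auto simp: complex_nonpos_Reals_iff)
  have W: "open ?W" by (intro open_Un open_Int open_component_domain m open_ball open_halfspace_Re_gt)
  have sub: "complex_of_real ` {a..b} \<subseteq> ?W"
  proof
    fix z assume "z \<in> complex_of_real ` {a..b}"
    then obtain t where "z = of_real t" "a \<le> t" "t \<le> b" by auto
    then show "z \<in> ?W" using np[of t] ab h(1) by (cases "t = c") auto
  qed
  have quot: "fs m (\<i> * z) * z powr (s - 1) = P z * z powr (s - 1) / (z - of_real c) ^ n" if "z \<noteq> of_real c" for z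
    using that by (simp add: P_def)
  have "\<exists>v. has_reg_integral_pole (mellin_integrand (fs m) s) a b c v \<and>
    has_pv (\<lambda>x. fs m (\<i> * exp x) * exp x powr (s - 1) * exp x) (ln a) (ln b) v"
    unfolding mellin_integrand_def
    by (rule reg_integral_pole_has_pv[where \<phi> = "\<lambda>z. fs m (\<i> * z) * z powr (s - 1)", OF ab W sub Q quot])
  then obtain v where v: "has_reg_integral_pole (mellin_integrand (fs m) s) a b c v"
    "has_pv (\<lambda>x. fs m (\<i> * exp x) * exp x powr (s - 1) * exp x) (ln a) (ln b) v" by (elim exE conjE)
  from v(2) have "has_pv (\<lambda>x. fs m (\<i> * exp x) * exp (s * x)) (ln a) (ln b) v"
    by (rule has_pv_cong[where \<delta> = pi]) (simp_all add: mellin_log_substitution)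
  with v(1) show ?thesis by (intro exI conjI)
qed

end

section \<open>The inversion t -> 1 / t on integrals and integrands\<close>

lemma integral_inversion:
  fixes F :: "real \<Rightarrow> complex"
  assumes uv: "0 < u" "u \<le> v" and F: "continuous_on {1 / v..1 / u} F"
  shows "integral {u..v} (\<lambda>t. F (1 / t) / of_real (t\<^sup>2)) = integral {1 / v..1 / u} F"
proof -
  have c: "continuous_on {u..v} (\<lambda>t. F (1 / t) / of_real (t\<^sup>2))"
    using uv by (intro continuous_intros continuous_on_compose2[OF F]) (auto intro!: divide_left_mono)
  have "integral {u..v} (\<lambda>t. F (1 / t) / of_real (t\<^sup>2)) =
      integral {ln u..ln v} (\<lambda>x. F (1 / exp x) / of_real ((exp x)\<^sup>2) * of_real (exp x))"
    by (rule integral_exp_substitution[OF uv c, symmetric])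
  also have "\<dots> = integral {ln u..ln v} (\<lambda>x. (\<lambda>x. F (exp x) * of_real (exp x)) (- x))"
    by (rule integral_cong) (simp add: exp_minus power2_eq_square field_simps)
  also have "\<dots> = integral {- ln v..- ln u} (\<lambda>x. F (exp x) * of_real (exp x))"
    by (rule Henstock_Kurzweil_Integration.integral_reflect_real[of "- ln u" "- ln v", simplified])
  also have "\<dots> = integral {ln (1 / v)..ln (1 / u)} (\<lambda>x. F (exp x) * of_real (exp x))"
    using uv by (simp add: ln_div)
  also have "\<dots> = integral {1 / v..1 / u} F"
    using uv by (intro integral_exp_substitution F) (auto intro!: divide_left_mono)
  finally show ?thesis .
qed

text \<open>The Jacobian 1 / t^2 turns the Mellin kernel for s into the one for - s, so the end at 0
  becomes an end at infinity with parameter - s.\<close>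

lemma mellin_integrand_inverse:
  assumes "0 < t"
  shows "mellin_integrand g s (1 / t) / of_real (t\<^sup>2) = g (\<i> * of_real (1 / t)) * of_real t powr (- s - 1)"
proof -
  have t: "complex_of_real t \<noteq> 0" using assms by simp
  have "complex_of_real (1 / t) powr (s - 1) = of_real t powr (1 - s)"
    using assms by (simp add: powr_def Ln_of_real ln_div algebra_simps del: of_real_divide)
  moreover have "complex_of_real t powr (1 - s) / of_real (t\<^sup>2) = of_real t powr (- s - 1)"
  proof -
    have "complex_of_real t powr (1 - s) = of_real t powr (- s - 1 + of_nat 2)" by (simp add: algebra_simps)
    also have "\<dots> = of_real t powr (- s - 1) * of_real t powr (of_nat 2)" by (rule powr_add)
    also have "complex_of_real t powr (of_nat 2) = of_real t ^ 2" using powr_nat'[of "complex_of_real t" 2] t by simp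
    finally show ?thesis using t by simp
  qed
  ultimately show ?thesis
    by (simp add: mellin_integrand_def times_divide_eq_right[symmetric] del: times_divide_eq_right of_real_divide)
qed

text \<open>\<open>remove_sings\<close> keeps the value at points of analyticity, and by R the
  relation only ever holds at such points.\<close>

lemma meromorphically_extends_remove_sings:
  assumes F: "F meromorphic_on UNIV" and R: "\<And>s v. R s v \<Longrightarrow> v = F s \<and> F analytic_on {s}"
  shows "meromorphically_extends (remove_sings F) R"
  unfolding meromorphically_extends_def
proof (intro conjI allI impI)
  show "remove_sings F nicely_meromorphic_on UNIV" by (rule remove_sings_nicely_meromorphic[OF F])
  fix s v assume "R s v"
  from R[OF this] have v: "v = F s" and an: "F analytic_on {s}" by auto
  have "\<not> is_pole F s" by (rule analytic_at_imp_no_pole[OF an])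
  moreover have "isolated_singularity_at F s" using an by (rule isolated_singularity_at_analytic)
  ultimately show "\<not> is_pole (remove_sings F) s" by simp
  show "remove_sings F s = v" using an v by simp
qed

lemma eventually_remove_sings_meromorphic:
  assumes "F meromorphic_on UNIV"
  shows "\<forall>\<^sub>F w in at z. remove_sings F w = F w"
  by (rule eventually_remove_sings_eq_at, rule meromorphic_on_isolated_singularity)
     (use assms meromorphic_on_subset in blast)

text \<open>All notions in \<open>is_complete_L\<close> look at the positive imaginary axis and its
  neighbourhood only. This transfers the result from fs 0 to f, which agree just on the upper
  half-plane.\<close>

lemma is_complete_L_cong:
  assumes eq: "\<And>\<tau>. Im \<tau> > 0 \<Longrightarrow> g \<tau> = h \<tau>"
  shows "is_complete_L \<sigma> g L = is_complete_L \<sigma> h L"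
proof -
  have pole: "is_pole g (\<i> * of_real t) = is_pole h (\<i> * of_real t)" if "0 < t" for t
  proof (rule is_pole_cong[OF _ refl])
    have "\<forall>\<^sub>F w in at (\<i> * of_real t). w \<in> upper_half_plane"
      using that by (intro eventually_at_in_open' open_halfspace_Im_gt) auto
    then show "\<forall>\<^sub>F w in at (\<i> * of_real t). g w = h w" by eventually_elim (use eq in auto)
  qed
  have adm: "admissible_splitting g n a c = admissible_splitting h n a c" for n a c
    unfolding admissible_splitting_def using pole by (intro conj_cong refl arg_cong2[where f = "(=)"]) auto
  have mell: "mellin_integrand g s t = mellin_integrand h s t" if "0 < t" for s t
    using eq that by (simp add: mellin_integrand_def)
  have 1: "has_reg_integral_inf \<sigma> (mellin_integrand g s) (a n) = has_reg_integral_inf \<sigma> (mellin_integrand h s) (a n)"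
    and 2: "has_reg_integral_zero \<sigma> (mellin_integrand g s) (a 0) = has_reg_integral_zero \<sigma> (mellin_integrand h s) (a 0)"
    and 3: "j < n \<Longrightarrow> has_reg_integral_pole (mellin_integrand g s) (a j) (a (Suc j)) (c j) v = has_reg_integral_pole (mellin_integrand h s) (a j) (a (Suc j)) (c j) v"
    if "admissible_splitting h n a c" for n a c s j v
  proof -
    have pos: "a j > 0" if "j \<le> n" for j by (rule admissible_splitting_mono(2)[OF \<open>admissible_splitting h n a c\<close> that])
    show "has_reg_integral_inf \<sigma> (mellin_integrand g s) (a n) = has_reg_integral_inf \<sigma> (mellin_integrand h s) (a n)"
      using pos[of n] by (intro ext has_reg_integral_inf_cong mell) auto
    show "has_reg_integral_zero \<sigma> (mellin_integrand g s) (a 0) = has_reg_integral_zero \<sigma> (mellin_integrand h s) (a 0)"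
    proof (rule ext)
      fix v
      have "mellin_integrand g s (1 / t) / of_real (t\<^sup>2) = mellin_integrand h s (1 / t) / of_real (t\<^sup>2)" if t: "1 / a 0 \<le> t" for t
      proof -
        have "0 < 1 / a 0" using pos[of 0] by simp
        then have "0 < t" using t by linarith
        then show ?thesis by (simp add: mell)
      qed
      then show "has_reg_integral_zero \<sigma> (mellin_integrand g s) (a 0) v = has_reg_integral_zero \<sigma> (mellin_integrand h s) (a 0) v"
        unfolding has_reg_integral_zero_def by (rule has_reg_integral_inf_cong)
    qed
    show "has_reg_integral_pole (mellin_integrand g s) (a j) (a (Suc j)) (c j) v = has_reg_integral_pole (mellin_integrand h s) (a j) (a (Suc j)) (c j) v" if j: "j < n"
    proof -
      have m: "mellin_integrand g s t = mellin_integrand h s t" if "a j \<le> t" for t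
        by (rule mell) (use pos[of j] j that in auto)
      show ?thesis by (rule iffI; erule has_reg_integral_pole_cong) (auto simp: m)
    qed
  qed
  show ?thesis
    unfolding is_complete_L_def adm
    by (intro conj_cong refl all_cong1 imp_cong ex_cong1) (simp_all add: 1 2 3)
qed

section \<open>Principal values of the components over intervals of the axis\<close>

definition axis_pv :: "(complex \<Rightarrow> complex) \<Rightarrow> real \<Rightarrow> real \<Rightarrow> complex \<Rightarrow> complex" where
  "axis_pv g a b s = (THE v. has_pv (\<lambda>x. g (\<i> * exp x) * exp (s * x)) (ln a) (ln b) v)"

lemma axis_pv_eqI: "has_pv (\<lambda>x. g (\<i> * exp x) * exp (s * x)) (ln a) (ln b) v \<Longrightarrow> axis_pv g a b s = v"
  unfolding axis_pv_def by (rule the_equality) (auto intro: has_pv_unique)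

context
  fixes k :: int and p :: nat and f :: "complex \<Rightarrow> complex" and fs :: "nat \<Rightarrow> complex \<Rightarrow> complex"
  assumes qm: "mero_quasi_modular k p f fs"
begin

lemma axis_pv_entire:
  assumes m: "m \<le> p" and ab: "0 < a" "a \<le> b" and np: "\<not> is_pole (fs m) (\<i> * of_real a)" "\<not> is_pole (fs m) (\<i> * of_real b)"
  shows "has_pv (\<lambda>x. fs m (\<i> * exp x) * exp (s * x)) (ln a) (ln b) (axis_pv (fs m) a b s)"
    and "axis_pv (fs m) a b holomorphic_on UNIV"
proof -
  have "\<exists>V. V holomorphic_on UNIV \<and> (\<forall>s. has_pv (\<lambda>x. fs m (\<i> * exp x) * exp (s * x)) (ln a) (ln b) (V s))"
    by (rule component_pv_entire[OF qm m]) (use ab np in auto)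
  then obtain V where V: "V holomorphic_on UNIV" "\<forall>s. has_pv (\<lambda>x. fs m (\<i> * exp x) * exp (s * x)) (ln a) (ln b) (V s)"
    by (elim exE conjE)
  have "axis_pv (fs m) a b = V" by (rule ext, rule axis_pv_eqI, rule spec[OF V(2)])
  with V show "axis_pv (fs m) a b holomorphic_on UNIV"
    "has_pv (\<lambda>x. fs m (\<i> * exp x) * exp (s * x)) (ln a) (ln b) (axis_pv (fs m) a b s)" by simp_all
qed

lemma axis_pv_combine:
  assumes m: "m \<le> p" and ab: "0 < a" "a \<le> b" "b \<le> c" and np: "\<not> is_pole (fs m) (\<i> * of_real a)" "\<not> is_pole (fs m) (\<i> * of_real b)" "\<not> is_pole (fs m) (\<i> * of_real c)"
  shows "axis_pv (fs m) a c s = axis_pv (fs m) a b s + axis_pv (fs m) b c s"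
  by (rule axis_pv_eqI, rule has_pv_combine[OF axis_pv_entire(1)[OF m] axis_pv_entire(1)[OF m]]) (use ab np in auto)

lemma axis_pv_regular:
  assumes "m \<le> p" "0 < a" "a \<le> b" "\<And>t. a \<le> t \<Longrightarrow> t \<le> b \<Longrightarrow> \<not> is_pole (fs m) (\<i> * of_real t)"
  shows "integral {a..b} (mellin_integrand (fs m) s) = axis_pv (fs m) a b s"
  by (rule axis_pv_eqI[symmetric]) (rule component_pv_regular[OF qm assms])

lemma axis_pv_pole:
  assumes m: "m \<le> p" and ab: "0 < a" "a < c" "c < b" and pole: "is_pole (fs m) (\<i> * of_real c)"
    and np: "\<And>t. a \<le> t \<Longrightarrow> t \<le> b \<Longrightarrow> t \<noteq> c \<Longrightarrow> \<not> is_pole (fs m) (\<i> * of_real t)"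
  shows "has_reg_integral_pole (mellin_integrand (fs m) s) a b c (axis_pv (fs m) a b s)"
proof -
  have "\<exists>v. has_reg_integral_pole (mellin_integrand (fs m) s) a b c v \<and> has_pv (\<lambda>x. fs m (\<i> * exp x) * exp (s * x)) (ln a) (ln b) v"
    by (rule component_pv_pole[OF qm m ab pole]) (rule np)
  then obtain v where v: "has_reg_integral_pole (mellin_integrand (fs m) s) a b c v"
     "has_pv (\<lambda>x. fs m (\<i> * exp x) * exp (s * x)) (ln a) (ln b) v" by (elim exE conjE)
  from axis_pv_eqI[OF v(2)] v(1) show ?thesis by simp
qed

lemma axis_continuous:
  assumes m: "m \<le> p" and np: "\<And>t. t \<in> S \<Longrightarrow> 0 < t \<and> \<not> is_pole (fs m) (\<i> * of_real t)"
  shows "continuous_on S (\<lambda>t. fs m (\<i> * of_real t))"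
proof (intro continuous_at_imp_continuous_on ballI)
  fix t assume t: "t \<in> S"
  have "isCont (fs m) (\<i> * of_real t)"
    by (rule nicely_meromorphic_isCont[OF component_nicely_meromorphic[OF qm m]]) (use np[OF t] in auto)
  then show "isCont (\<lambda>t. fs m (\<i> * of_real t)) t"
    by (intro isCont_o2[of t "\<lambda>t. \<i> * of_real t" "fs m"] continuous_intros)
qed

lemma mellin_integrand_continuous:
  assumes m: "m \<le> p" and np: "\<And>t. t \<in> S \<Longrightarrow> 0 < t \<and> \<not> is_pole (fs m) (\<i> * of_real t)"
  shows "continuous_on S (mellin_integrand (fs m) s)"
  unfolding mellin_integrand_def
  by (intro continuous_intros axis_continuous m np) (use np in \<open>auto simp: complex_nonpos_Reals_iff not_le[symmetric] dest: np\<close>)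

text \<open>The coefficient in \<open>component_S_transform\<close> at \<tau> = i z, with the power
  of i split off from (i z)^(k - 2 m - l).\<close>

definition axis_coeff :: "nat \<Rightarrow> nat \<Rightarrow> complex" where
  "axis_coeff m l = of_nat ((m + l) choose l) * \<i> powi (k - 2 * int m - int l)"

lemma axis_transform:
  assumes m: "m \<le> p" and z: "Re z > 0" and np: "\<And>r. r \<le> p \<Longrightarrow> \<not> is_pole (fs r) (\<i> * z)"
  shows "fs m (\<i> / z) = (\<Sum>l\<le>p - m. axis_coeff m l * z powi (k - 2 * int m - int l) * fs (m + l) (\<i> * z))"
proof -
  have z0: "z \<noteq> 0" using z by auto
  have eq: "- 1 / (\<i> * z) = \<i> / z" using z0 by (simp add: field_simps)
  have Im: "Im (\<i> * z) > 0" using z by simp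
  have "\<not> is_pole (fs m) (- 1 / (\<i> * z))" by (rule component_no_pole_inverse[OF qm m Im np])
  from component_S_transform[OF qm m Im np this]
  show ?thesis unfolding eq axis_coeff_def by (simp add: power_int_mult_distrib mult_ac)
qed

section \<open>Closed form and functional equation for the L-functions of all components\<close>

context
  fixes \<sigma> T :: real and J :: "nat \<Rightarrow> complex \<Rightarrow> complex"
  assumes \<sigma>: "\<sigma> = 1 \<or> \<sigma> = -1" and T: "1 < T"
    and J: "\<And>r. r \<le> p \<Longrightarrow> laplace_limit \<sigma> T (\<lambda>t. fs r (\<i> * of_real t)) (fourier_coeff (fs r) 0) (J r)"
    and npT: "\<And>r z. r \<le> p \<Longrightarrow> Re z \<ge> T \<Longrightarrow> \<not> is_pole (fs r) (\<i> * z)"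
begin

lemma axis_no_pole_right: "r \<le> p \<Longrightarrow> T \<le> t \<Longrightarrow> \<not> is_pole (fs r) (\<i> * of_real t)"
  using npT[of r "of_real t"] by simp

lemma axis_no_pole_left:
  assumes r: "r \<le> p" and t: "0 < t" "t \<le> 1 / T"
  shows "\<not> is_pole (fs r) (\<i> * of_real t)"
proof -
  have T1: "T \<le> 1 / t" using t T by (simp add: field_simps)
  have eq: "- 1 / (\<i> * of_real (1 / t)) = \<i> * of_real t" using t by (simp add: field_simps)
  have "\<not> is_pole (fs r) (- 1 / (\<i> * of_real (1 / t)))"
    by (rule component_no_pole_inverse[OF qm r _ axis_no_pole_right[OF _ T1]]) (use t in simp)
  then show ?thesis unfolding eq .
qed

lemma axis_poles_finite:
  assumes r: "r \<le> p"
  shows "finite {t. 0 < t \<and> is_pole (fs r) (\<i> * of_real t)}"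
proof -
  let ?K = "(\<lambda>t. \<i> * complex_of_real t) ` {1 / T..T}"
  have "compact ?K" by (intro compact_continuous_image continuous_intros) auto
  moreover have "?K \<subseteq> upper_half_plane" using T by (auto intro: less_le_trans[of _ "1 / T"])
  ultimately have fin: "finite {z \<in> ?K. is_pole (fs r) z}" by (rule component_poles_finite[OF qm r])
  have "(\<lambda>t. \<i> * complex_of_real t) ` {t. 0 < t \<and> is_pole (fs r) (\<i> * of_real t)} \<subseteq> {z \<in> ?K. is_pole (fs r) z}"
  proof (rule image_subsetI)
    fix t assume "t \<in> {t. 0 < t \<and> is_pole (fs r) (\<i> * complex_of_real t)}"
    then have t: "0 < t" "is_pole (fs r) (\<i> * complex_of_real t)" by auto
    have "t < T" using axis_no_pole_right[OF r, of t] t by force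
    moreover have "1 / T < t" using axis_no_pole_left[OF r, of t] t by force
    ultimately show "\<i> * of_real t \<in> {z \<in> ?K. is_pole (fs r) z}" using t by auto
  qed
  then have "finite ((\<lambda>t. \<i> * complex_of_real t) ` {t. 0 < t \<and> is_pole (fs r) (\<i> * of_real t)})" by (rule finite_subset[OF _ fin])
  moreover have "inj_on (\<lambda>t. \<i> * complex_of_real t) {t. 0 < t \<and> is_pole (fs r) (\<i> * of_real t)}" by (rule inj_onI) simp
  ultimately show ?thesis by (rule finite_imageD)
qed

text \<open>The function K of the overview. Division by 0 gives it a default value at s = 0; this is
  why the L-functions are obtained from these formulas through \<open>remove_sings\<close>.\<close>

definition tail_term :: "nat \<Rightarrow> complex \<Rightarrow> complex" where
  "tail_term m s = J m s - fourier_coeff (fs m) 0 * (of_real T powr s / s)"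

lemma J_holomorphic: "m \<le> p \<Longrightarrow> J m holomorphic_on A"
  using J unfolding laplace_limit_def[OF \<sigma> less_imp_le[OF T]] by (meson holomorphic_on_subset subset_UNIV)

lemma tail_term_analytic:
  assumes "m \<le> p" "fourier_coeff (fs m) 0 \<noteq> 0 \<longrightarrow> s \<noteq> 0"
  shows "tail_term m analytic_on {s}"
proof (cases "fourier_coeff (fs m) 0 = 0")
  case True
  then have "tail_term m = J m" unfolding tail_term_def by auto
  then show ?thesis using J_holomorphic[OF assms(1), of UNIV] unfolding analytic_at by (intro exI[of _ UNIV]) simp
next
  case False
  have "J m analytic_on {s}" using J_holomorphic[OF assms(1), of UNIV] unfolding analytic_at by (intro exI[of _ UNIV]) simp
  then show ?thesis unfolding tail_term_def[abs_def] using T False assms(2) by (intro analytic_intros) auto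
qed

lemma tail_term_meromorphic:
  assumes m: "m \<le> p"
  shows "tail_term m meromorphic_on UNIV"
proof -
  have "J m meromorphic_on UNIV" using J_holomorphic[OF m] by (intro analytic_on_imp_meromorphic_on) (simp add: analytic_on_open)
  moreover have "(\<lambda>s. of_real T powr s :: complex) meromorphic_on UNIV"
    using T by (intro analytic_on_imp_meromorphic_on analytic_intros) auto
  ultimately show ?thesis unfolding tail_term_def[abs_def] by (intro meromorphic_intros)
qed

lemma reg_integral_inf_axis:
  assumes m: "m \<le> p" and t0: "0 < t0" "t0 \<le> X" "T \<le> X" and np: "\<And>t. t0 \<le> t \<Longrightarrow> \<not> is_pole (fs m) (\<i> * of_real t)"
  defines "I \<equiv> \<lambda>s. axis_pv (fs m) t0 X s - axis_pv (fs m) T X s + tail_term m s"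
  shows "Re s < 0 \<Longrightarrow> has_reg_integral_inf \<sigma> (mellin_integrand (fs m) s) t0 (I s)"
    and "has_reg_integral_inf \<sigma> (mellin_integrand (fs m) s) t0 v \<Longrightarrow> v = I s \<and> (fourier_coeff (fs m) 0 \<noteq> 0 \<longrightarrow> s \<noteq> 0)"
proof -
  have int: "integral {t0..X} (\<lambda>t. fs m (\<i> * of_real t) * of_real t powr (s - 1)) = axis_pv (fs m) t0 X s"
    "integral {T..X} (\<lambda>t. fs m (\<i> * of_real t) * of_real t powr (s - 1)) = axis_pv (fs m) T X s"
    using axis_pv_regular[OF m, of t0 X s] axis_pv_regular[OF m, of T X s] t0 T np axis_no_pole_right[OF m]
    unfolding mellin_integrand_def by auto
  have cont: "continuous_on {t0..} (\<lambda>t. fs m (\<i> * of_real t))" "continuous_on {T..} (\<lambda>t. fs m (\<i> * of_real t))"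
    by (rule axis_continuous[OF m], use t0 np in force) (rule axis_continuous[OF m], use T axis_no_pole_right[OF m] in force)
  note comb = has_reg_integral_inf_combination[OF \<sigma> less_imp_le[OF T], where R = "{0}" and c = "\<lambda>_. 1" and b = "\<lambda>_. fourier_coeff (fs m) 0"
     and e = "\<lambda>_. 0" and H = "\<lambda>_ t. fs m (\<i> * of_real t)" and J = "\<lambda>_. J m" and \<phi> = "\<lambda>t. fs m (\<i> * of_real t)" and s = s,
     OF _ _ J[OF m] _ cont t0, simplified, unfolded int]
  show "has_reg_integral_inf \<sigma> (mellin_integrand (fs m) s) t0 (I s)" if "Re s < 0"
    using comb(1)[OF that] unfolding mellin_integrand_def I_def tail_term_def by (simp add: algebra_simps)
  show "v = I s \<and> (fourier_coeff (fs m) 0 \<noteq> 0 \<longrightarrow> s \<noteq> 0)" if "has_reg_integral_inf \<sigma> (mellin_integrand (fs m) s) t0 v"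
    using comb(2)[of v] that unfolding mellin_integrand_def I_def tail_term_def by (simp add: algebra_simps)
qed

lemma axis_coeff_nonzero: "axis_coeff m l \<noteq> 0"
  unfolding axis_coeff_def by (simp add: binomial_eq_0_iff)

lemma inverse_axis_continuous:
  assumes m: "m \<le> p" and u: "0 < u" and np: "\<And>t. 0 < t \<Longrightarrow> t \<le> 1 / u \<Longrightarrow> \<not> is_pole (fs m) (\<i> * of_real t)"
  shows "continuous_on {u..} (\<lambda>t. fs m (\<i> * of_real (1 / t)))"
proof -
  have "continuous_on {0<..1 / u} (\<lambda>t. fs m (\<i> * of_real t))" by (rule axis_continuous[OF m]) (use np in auto)
  moreover have "continuous_on {u..} (\<lambda>t. 1 / t :: real)" using u by (intro continuous_intros) auto
  moreover have "(\<lambda>t. 1 / t) ` {u..} \<subseteq> {0<..1 / u}" using u by (auto simp: field_simps)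
  ultimately show ?thesis by (rule continuous_on_compose2)
qed

lemma integral_mellin_inverse:
  assumes m: "m \<le> p" and u: "0 < u" "u \<le> v" and np: "\<And>t. 0 < t \<Longrightarrow> t \<le> 1 / u \<Longrightarrow> \<not> is_pole (fs m) (\<i> * of_real t)"
  shows "integral {u..v} (\<lambda>t. fs m (\<i> * of_real (1 / t)) * of_real t powr (- s - 1)) = axis_pv (fs m) (1 / v) (1 / u) s"
proof -
  have v: "0 < 1 / v" using u by simp
  have "integral {u..v} (\<lambda>t. fs m (\<i> * of_real (1 / t)) * of_real t powr (- s - 1)) =
      integral {u..v} (\<lambda>t. mellin_integrand (fs m) s (1 / t) / of_real (t\<^sup>2))"
    by (rule integral_cong, rule mellin_integrand_inverse[symmetric]) (use u in auto)
  also have "\<dots> = integral {1 / v..1 / u} (mellin_integrand (fs m) s)"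
  proof (rule integral_inversion[OF u mellin_integrand_continuous[OF m]])
    fix t assume t: "t \<in> {1 / v..1 / u}"
    then have "1 / v \<le> t" by simp
    with v have "0 < t" by (rule less_le_trans)
    then show "0 < t \<and> \<not> is_pole (fs m) (\<i> * of_real t)" using np t by simp
  qed
  also have "\<dots> = axis_pv (fs m) (1 / v) (1 / u) s"
  proof (rule axis_pv_regular[OF m v])
    show "1 / v \<le> 1 / u" using u by (auto intro!: divide_left_mono)
    fix t assume t: "1 / v \<le> t" "t \<le> 1 / u"
    from v t(1) have "0 < t" by (rule less_le_trans)
    then show "\<not> is_pole (fs m) (\<i> * of_real t)" by (rule np[OF _ t(2)])
  qed
  finally show ?thesis .
qed

text \<open>The inversion gives a regularized integral at infinity with parameter - s, and
  \<open>axis_transform\<close> expands its integrand into terms with the pairwise distinct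
  exponents k - 2 m - l, as \<open>has_reg_integral_inf_combination\<close> requires.\<close>

lemma reg_integral_zero_axis:
  assumes m: "m \<le> p" and a: "0 < a" "1 / a \<le> X" "T \<le> X" and np: "\<And>t. 0 < t \<Longrightarrow> t \<le> a \<Longrightarrow> \<not> is_pole (fs m) (\<i> * of_real t)"
  defines "I \<equiv> \<lambda>s. axis_pv (fs m) (1 / X) a s - axis_pv (fs m) (1 / X) (1 / T) s +
     (\<Sum>l\<le>p - m. axis_coeff m l * tail_term (m + l) (of_int (k - 2 * int m - int l) - s))"
  shows "(\<And>l. l \<le> p - m \<Longrightarrow> Re s > of_int (k - 2 * int m - int l)) \<Longrightarrow> has_reg_integral_zero \<sigma> (mellin_integrand (fs m) s) a (I s)"
    and "has_reg_integral_zero \<sigma> (mellin_integrand (fs m) s) a v \<Longrightarrow>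
      v = I s \<and> (\<forall>l\<le>p - m. fourier_coeff (fs (m + l)) 0 \<noteq> 0 \<longrightarrow> of_int (k - 2 * int m - int l) - s \<noteq> 0)"
proof -
  let ?\<phi> = "\<lambda>t. fs m (\<i> * of_real (1 / t))" and ?e = "\<lambda>l. k - 2 * int m - int l"
  have a': "0 < 1 / a" "1 / (1 / a) = a" using a by auto
  have T0: "0 < T" using T by simp
  have zero: "has_reg_integral_zero \<sigma> (mellin_integrand (fs m) s) a v =
      has_reg_integral_inf \<sigma> (\<lambda>t. ?\<phi> t * of_real t powr (- s - 1)) (1 / a) v" for v
    unfolding has_reg_integral_zero_def
  proof (rule has_reg_integral_inf_cong)
    fix t assume "1 / a \<le> t"
    then have "0 < t" using a' by linarith
    then show "mellin_integrand (fs m) s (1 / t) / of_real (t\<^sup>2) = ?\<phi> t * of_real t powr (- s - 1)" by (rule mellin_integrand_inverse)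
  qed
  have int1: "integral {1 / a..X} (\<lambda>t. ?\<phi> t * of_real t powr (- s - 1)) = axis_pv (fs m) (1 / X) a s"
    using integral_mellin_inverse[OF m a'(1) a(2), of s] np unfolding a'(2) by simp
  have int2: "integral {T..X} (\<lambda>t. ?\<phi> t * of_real t powr (- s - 1)) = axis_pv (fs m) (1 / X) (1 / T) s"
    by (rule integral_mellin_inverse[OF m T0 a(3) axis_no_pole_left[OF m]])
  have cont: "continuous_on {1 / a..} ?\<phi>" "continuous_on {T..} ?\<phi>"
    using inverse_axis_continuous[OF m a'(1)] np inverse_axis_continuous[OF m T0 axis_no_pole_left[OF m]] unfolding a'(2) by auto
  have \<phi>: "?\<phi> t = (\<Sum>l\<in>{..p - m}. axis_coeff m l * of_real t powi ?e l * fs (m + l) (\<i> * of_real t))" if "T \<le> t" for t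
    using axis_transform[OF m, of "of_real t"] axis_no_pole_right[of _ t] that T by simp
  have inj: "inj_on ?e {..p - m}" by (rule inj_onI) simp
  have J': "laplace_limit \<sigma> T (\<lambda>t. fs (m + l) (\<i> * of_real t)) (fourier_coeff (fs (m + l)) 0) (J (m + l))" if "l \<in> {..p - m}" for l
    by (rule J) (use that m in auto)
  note comb = has_reg_integral_inf_combination[OF \<sigma> less_imp_le[OF T], where R = "{..p - m}" and c = "axis_coeff m" and b = "\<lambda>l. fourier_coeff (fs (m + l)) 0"
     and e = ?e and H = "\<lambda>l t. fs (m + l) (\<i> * of_real t)" and J = "\<lambda>l. J (m + l)" and \<phi> = ?\<phi> and s = "- s",
     OF finite_atMost inj J' \<phi> cont a'(1) a(2,3), unfolded int1 int2]
  have I: "axis_pv (fs m) (1 / X) a s - axis_pv (fs m) (1 / X) (1 / T) s +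
     (\<Sum>l\<in>{..p - m}. axis_coeff m l * (J (m + l) (- s + of_int (?e l)) - fourier_coeff (fs (m + l)) 0 * (of_real T powr (- s + of_int (?e l)) / (- s + of_int (?e l))))) = I s"
    unfolding I_def tail_term_def by (simp add: algebra_simps)
  show "has_reg_integral_zero \<sigma> (mellin_integrand (fs m) s) a (I s)" if "\<And>l. l \<le> p - m \<Longrightarrow> Re s > of_int (?e l)"
    unfolding zero I[symmetric]
  proof (rule comb(1))
    fix l assume "l \<in> {..p - m}"
    then have "Re s > of_int (?e l)" by (intro that) simp
    then show "Re (- s) + of_int (?e l) < 0" unfolding uminus_complex.sel by linarith
  qed
  show "v = I s \<and> (\<forall>l\<le>p - m. fourier_coeff (fs (m + l)) 0 \<noteq> 0 \<longrightarrow> of_int (?e l) - s \<noteq> 0)" if "has_reg_integral_zero \<sigma> (mellin_integrand (fs m) s) a v"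
  proof -
    have "v = I s \<and> (\<forall>l\<in>{..p - m}. axis_coeff m l * fourier_coeff (fs (m + l)) 0 \<noteq> 0 \<longrightarrow> - s + of_int (?e l) \<noteq> 0)"
      unfolding I[symmetric] by (rule comb(2)[OF _ _ that[unfolded zero]])
    then show ?thesis using axis_coeff_nonzero by (auto simp: algebra_simps)
  qed
qed

definition axis_Lambda :: "nat \<Rightarrow> complex \<Rightarrow> complex" where
  "axis_Lambda m s = axis_pv (fs m) (1 / T) T s + tail_term m s +
     (\<Sum>l\<le>p - m. axis_coeff m l * tail_term (m + l) (of_int (k - 2 * int m - int l) - s))"

lemma tail_sum_meromorphic:
  assumes m: "m \<le> p"
  shows "(\<lambda>s. \<Sum>l\<le>p - m. axis_coeff m l * tail_term (m + l) (of_int (k - 2 * int m - int l) - s)) meromorphic_on UNIV"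
proof -
  have "(\<lambda>s. tail_term (m + l) (of_int (k - 2 * int m - int l) - s)) meromorphic_on UNIV" if "l \<le> p - m" for l
    by (rule meromorphic_on_compose[OF tail_term_meromorphic]) (use that m in \<open>auto intro!: analytic_intros\<close>)
  then show ?thesis by (intro meromorphic_intros) auto
qed

lemma tail_sum_analytic:
  assumes m: "m \<le> p" and nz: "\<And>l. l \<le> p - m \<Longrightarrow> fourier_coeff (fs (m + l)) 0 \<noteq> 0 \<longrightarrow> of_int (k - 2 * int m - int l) - s \<noteq> 0"
  shows "(\<lambda>s. \<Sum>l\<le>p - m. axis_coeff m l * tail_term (m + l) (of_int (k - 2 * int m - int l) - s)) analytic_on {s}"
proof -
  have "(tail_term (m + l) \<circ> (\<lambda>s. of_int (k - 2 * int m - int l) - s)) analytic_on {s}" if "l \<le> p - m" for l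
  proof (rule analytic_on_compose)
    show "tail_term (m + l) analytic_on (\<lambda>s. of_int (k - 2 * int m - int l) - s) ` {s}"
      using tail_term_analytic[of "m + l", OF _ nz] that m by simp
  qed (intro analytic_intros)
  then show ?thesis by (intro analytic_intros) (auto simp: o_def)
qed

lemma axis_pv_meromorphic:
  assumes m: "m \<le> p" and ab: "0 < a" "a \<le> b" and np: "\<not> is_pole (fs m) (\<i> * of_real a)" "\<not> is_pole (fs m) (\<i> * of_real b)"
  shows "axis_pv (fs m) a b meromorphic_on UNIV" "axis_pv (fs m) a b analytic_on {s}"
  using axis_pv_entire(2)[OF assms] unfolding analytic_at
  by (auto intro!: analytic_on_imp_meromorphic_on simp: analytic_on_open)

lemma T_inverse: "0 < 1 / T" "1 / T \<le> T"
  using T by (auto intro: order_trans[of _ 1])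

lemma axis_pv_T_entire: "m \<le> p \<Longrightarrow> axis_pv (fs m) (1 / T) T holomorphic_on UNIV"
  by (rule axis_pv_entire(2)[OF _ T_inverse axis_no_pole_left[OF _ T_inverse(1)] axis_no_pole_right]) simp_all

lemma axis_Lambda_meromorphic:
  assumes m: "m \<le> p"
  shows "axis_Lambda m meromorphic_on UNIV"
proof -
  have "axis_pv (fs m) (1 / T) T meromorphic_on UNIV"
    using axis_pv_T_entire[OF m] by (intro analytic_on_imp_meromorphic_on) (simp add: analytic_on_open)
  then show ?thesis unfolding axis_Lambda_def[abs_def]
    by (intro meromorphic_on_add tail_sum_meromorphic tail_term_meromorphic m)
qed

lemma axis_pv_telescope:
  assumes m: "m \<le> p" and adm: "admissible_splitting (fs m) n a c" and x: "0 < x" "x \<le> a 0" "\<not> is_pole (fs m) (\<i> * of_real x)" and i: "i \<le> n"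
  shows "axis_pv (fs m) x (a i) s = axis_pv (fs m) x (a 0) s + (\<Sum>j<i. axis_pv (fs m) (a j) (a (Suc j)) s)"
  using i
proof (induction i)
  case (Suc i)
  have np: "\<not> is_pole (fs m) (\<i> * of_real (a j))" if "j \<le> n" for j
    using admissible_splitting_no_pole(3)[OF adm, of "a j" j] admissible_splitting_mono(2)[OF adm that] that by auto
  have "axis_pv (fs m) x (a (Suc i)) s = axis_pv (fs m) x (a i) s + axis_pv (fs m) (a i) (a (Suc i)) s"
  proof (rule axis_pv_combine[OF m x(1) _ _ x(3)])
    show "x \<le> a i" using admissible_splitting_mono(1)[OF adm, of 0 i] x(2) Suc.prems by simp
    show "a i \<le> a (Suc i)" using admissible_splitting_mono(1)[OF adm, of i "Suc i"] Suc.prems by simp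
  qed (use np[of i] np[of "Suc i"] Suc.prems in auto)
  with Suc show ?case by simp
qed simp

text \<open>The closed form is built on the end points 1 / T and T, but every admissible splitting
  has to yield it. Both are compared over the interval from 1 / X to X, where \<open>axis_pv\<close>
  is additive and the contributions of the outer pieces cancel.\<close>

lemma is_complete_L_axis_Lambda:
  assumes m: "m \<le> p"
  shows "is_complete_L \<sigma> (fs m) (remove_sings (axis_Lambda m))"
  unfolding is_complete_L_def
proof (intro conjI allI impI)
  show "remove_sings (axis_Lambda m) nicely_meromorphic_on UNIV"
    by (rule remove_sings_nicely_meromorphic[OF axis_Lambda_meromorphic[OF m]])
  show "\<exists>n a c. admissible_splitting (fs m) n a c"
    by (rule admissible_splitting_exists[OF axis_poles_finite[OF m]])
  fix n a c assume adm: "admissible_splitting (fs m) n a c"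
  note pos = admissible_splitting_mono(2)[OF adm]
  \<comment> \<open>Large enough for [1 / X, X] to contain both [1 / T, T] and all cut
    points.\<close>
  define X where "X = max T (max (a n) (1 / a 0))"
  have X: "T \<le> X" "a n \<le> X" "1 / a 0 \<le> X" by (auto simp: X_def)
  have a0: "0 < a 0" and an: "0 < a n" using pos by auto
  have X0: "0 < X" "0 < 1 / X" using X(1) T by auto
  have X1: "1 / X \<le> a 0" "1 / X \<le> 1 / T" using X X0 a0 T by (auto simp: field_simps)
  have npX: "\<not> is_pole (fs m) (\<i> * of_real X)" "\<not> is_pole (fs m) (\<i> * of_real (1 / X))"
    by (rule axis_no_pole_right[OF m X(1)], rule axis_no_pole_left[OF m X0(2) X1(2)])
  have npT': "\<not> is_pole (fs m) (\<i> * of_real T)" "\<not> is_pole (fs m) (\<i> * of_real (1 / T))"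
    by (rule axis_no_pole_right[OF m order_refl], rule axis_no_pole_left[OF m T_inverse(1) order_refl])
  have npr: "\<not> is_pole (fs m) (\<i> * of_real t)" if "a n \<le> t" for t
  proof
    assume "is_pole (fs m) (\<i> * of_real t)"
    from admissible_splitting_no_pole(2)[OF adm _ this] that an show False by simp
  qed
  have npl: "\<not> is_pole (fs m) (\<i> * of_real t)" if "0 < t" "t \<le> a 0" for t
  proof
    assume "is_pole (fs m) (\<i> * of_real t)"
    from admissible_splitting_no_pole(1)[OF adm that(1) this] that show False by simp
  qed
  define Z where "Z = (\<lambda>s. \<Sum>l\<le>p - m. axis_coeff m l * tail_term (m + l) (of_int (k - 2 * int m - int l) - s))"
  define Y0 where "Y0 = (\<lambda>s. axis_pv (fs m) (1 / X) (a 0) s - axis_pv (fs m) (1 / X) (1 / T) s + Z s)"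
  define Y1 where "Y1 = (\<lambda>s. axis_pv (fs m) (a n) X s - axis_pv (fs m) T X s + tail_term m s)"
  define M where "M = (\<lambda>j. axis_pv (fs m) (a j) (a (Suc j)))"
  have T0: "0 < T" using T by simp
  note mer0 = axis_pv_meromorphic[OF m X0(2) X1(1) npX(2) npl[OF a0 order_refl]] axis_pv_meromorphic[OF m X0(2) X1(2) npX(2) npT'(2)]
  note mer1 = axis_pv_meromorphic[OF m an X(2) npr[OF order_refl] npX(1)] axis_pv_meromorphic[OF m T0 X(1) npT'(1) npX(1)]
  have Y0: "Y0 meromorphic_on UNIV" unfolding Y0_def Z_def
    by (intro meromorphic_on_add meromorphic_on_diff mer0 tail_sum_meromorphic m)
  have Y1: "Y1 meromorphic_on UNIV" unfolding Y1_def
    by (intro meromorphic_on_add meromorphic_on_diff mer1 tail_term_meromorphic m)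
  note zero = reg_integral_zero_axis[OF m a0 X(3,1) npl, folded Z_def, folded Y0_def]
  note inf = reg_integral_inf_axis[OF m an X(2,1) npr, folded Y1_def]
  show "\<exists>I0 Iinf M.
           meromorphically_extends I0 (\<lambda>s. has_reg_integral_zero \<sigma> (mellin_integrand (fs m) s) (a 0)) \<and>
           (\<exists>C. \<forall>s. Re s > C \<longrightarrow> (\<exists>v. has_reg_integral_zero \<sigma> (mellin_integrand (fs m) s) (a 0) v)) \<and>
           meromorphically_extends Iinf (\<lambda>s. has_reg_integral_inf \<sigma> (mellin_integrand (fs m) s) (a n)) \<and>
           (\<exists>C. \<forall>s. Re s < C \<longrightarrow> (\<exists>v. has_reg_integral_inf \<sigma> (mellin_integrand (fs m) s) (a n) v)) \<and>
           (\<forall>j<n. \<forall>s. has_reg_integral_pole (mellin_integrand (fs m) s) (a j) (a (Suc j)) (c j) (M j s)) \<and>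
           remove_sings (axis_Lambda m) = remove_sings (\<lambda>s. I0 s + (\<Sum>j<n. M j s) + Iinf s)"
  proof (rule exI[of _ "remove_sings Y0"], rule exI[of _ "remove_sings Y1"], rule exI[of _ M], intro conjI)
    show "meromorphically_extends (remove_sings Y0) (\<lambda>s. has_reg_integral_zero \<sigma> (mellin_integrand (fs m) s) (a 0))"
    proof (rule meromorphically_extends_remove_sings[OF Y0])
      fix s v assume "has_reg_integral_zero \<sigma> (mellin_integrand (fs m) s) (a 0) v"
      note v = zero(2)[OF _ _ this]
      have "Z analytic_on {s}" unfolding Z_def
        by (rule tail_sum_analytic[OF m]) (use v in simp)
      then have "Y0 analytic_on {s}" unfolding Y0_def by (intro analytic_intros mer0)
      moreover have "v = Y0 s" unfolding Y0_def Z_def by (rule conjunct1[OF v])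
      ultimately show "v = Y0 s \<and> Y0 analytic_on {s}" by simp
    qed
    show "meromorphically_extends (remove_sings Y1) (\<lambda>s. has_reg_integral_inf \<sigma> (mellin_integrand (fs m) s) (a n))"
    proof (rule meromorphically_extends_remove_sings[OF Y1])
      fix s v assume "has_reg_integral_inf \<sigma> (mellin_integrand (fs m) s) (a n) v"
      note v = inf(2)[OF _ this]
      have "tail_term m analytic_on {s}" by (rule tail_term_analytic[OF m]) (use v in simp)
      then have "Y1 analytic_on {s}" unfolding Y1_def by (intro analytic_intros mer1)
      moreover have "v = Y1 s" unfolding Y1_def by (rule conjunct1[OF v])
      ultimately show "v = Y1 s \<and> Y1 analytic_on {s}" by simp
    qed
    show "\<exists>C. \<forall>s. Re s > C \<longrightarrow> (\<exists>v. has_reg_integral_zero \<sigma> (mellin_integrand (fs m) s) (a 0) v)"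
    \<comment> \<open>The exponents k - 2 m - l decrease in l, so l = 0 gives the strongest
      condition.\<close>
    proof (rule exI[of _ "of_int (k - 2 * int m)"], intro allI impI)
      fix s assume s: "Re s > of_int (k - 2 * int m)"
      have "has_reg_integral_zero \<sigma> (mellin_integrand (fs m) s) (a 0) (Y0 s)"
        unfolding Y0_def Z_def by (rule zero(1)) (use s in auto)
      then show "\<exists>v. has_reg_integral_zero \<sigma> (mellin_integrand (fs m) s) (a 0) v" by (rule exI)
    qed
    show "\<exists>C. \<forall>s. Re s < C \<longrightarrow> (\<exists>v. has_reg_integral_inf \<sigma> (mellin_integrand (fs m) s) (a n) v)"
    proof (rule exI[of _ 0], intro allI impI)
      fix s assume s: "Re s < 0"
      have "has_reg_integral_inf \<sigma> (mellin_integrand (fs m) s) (a n) (Y1 s)"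
        unfolding Y1_def by (rule inf(1)) (use s in auto)
      then show "\<exists>v. has_reg_integral_inf \<sigma> (mellin_integrand (fs m) s) (a n) v" by (rule exI)
    qed
    show "\<forall>j<n. \<forall>s. has_reg_integral_pole (mellin_integrand (fs m) s) (a j) (a (Suc j)) (c j) (M j s)"
    proof (intro allI impI)
      fix j s assume j: "j < n"
      have c: "a j < c j" "c j < a (Suc j)" using adm j unfolding admissible_splitting_def by auto
      have "c j \<in> {t. 0 < t \<and> is_pole (fs m) (\<i> * of_real t)}" using adm j unfolding admissible_splitting_def by blast
      then have pole: "is_pole (fs m) (\<i> * of_real (c j))" by simp
      have aj: "0 < a j" using pos[of j] j by simp
      show "has_reg_integral_pole (mellin_integrand (fs m) s) (a j) (a (Suc j)) (c j) (M j s)"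
        unfolding M_def
      proof (rule axis_pv_pole[OF m aj c pole])
        fix t assume t: "a j \<le> t" "t \<le> a (Suc j)" "t \<noteq> c j"
        show "\<not> is_pole (fs m) (\<i> * of_real t)"
          using admissible_splitting_no_pole(4)[OF adm, of t j] aj t j by force
      qed
    qed
    show "remove_sings (axis_Lambda m) = remove_sings (\<lambda>s. remove_sings Y0 s + (\<Sum>j<n. M j s) + remove_sings Y1 s)"
    proof (rule ext, rule remove_sings_cong[OF _ refl])
      fix z
      have eq: "axis_Lambda m s = Y0 s + (\<Sum>j<n. M j s) + Y1 s" for s
      proof -
        have 1: "axis_pv (fs m) (1 / X) (a n) s = axis_pv (fs m) (1 / X) (a 0) s + (\<Sum>j<n. M j s)"
          unfolding M_def by (rule axis_pv_telescope[OF m adm X0(2) X1(1) npX(2) order_refl])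
        have "1 / X \<le> a n" using X1(1) admissible_splitting_mono(1)[OF adm, of 0 n] by simp
        then have 2: "axis_pv (fs m) (1 / X) X s = axis_pv (fs m) (1 / X) (a n) s + axis_pv (fs m) (a n) X s"
          by (intro axis_pv_combine m X0(2) X(2) npX npr) auto
        have 3: "axis_pv (fs m) (1 / X) X s = axis_pv (fs m) (1 / X) T s + axis_pv (fs m) T X s"
          by (intro axis_pv_combine m X0(2) X(1) npX npT') (use X1(2) T_inverse in linarith)
        have 4: "axis_pv (fs m) (1 / X) T s = axis_pv (fs m) (1 / X) (1 / T) s + axis_pv (fs m) (1 / T) T s"
          by (intro axis_pv_combine m X0(2) X1(2) T_inverse npX npT')
        show ?thesis unfolding axis_Lambda_def Y0_def Y1_def Z_def using 1 2 3 4 by (simp add: algebra_simps)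
      qed
      show "\<forall>\<^sub>F s in at z. axis_Lambda m s = remove_sings Y0 s + (\<Sum>j<n. M j s) + remove_sings Y1 s"
        using eventually_remove_sings_meromorphic[OF Y0, of z] eventually_remove_sings_meromorphic[OF Y1, of z]
        by eventually_elim (simp add: eq)
    qed
  qed
qed

text \<open>The interval from ln (1 / T) to ln T is symmetric, so \<open>has_pv_reflect\<close>
  applies. After reflection \<open>axis_transform\<close> rewrites the integrand, and its powers of
  exp x turn the parameter - s into k - 2 m - l - s.\<close>

lemma axis_pv_reflect:
  assumes m: "m \<le> p"
  shows "axis_pv (fs m) (1 / T) T s = (\<Sum>l\<le>p - m. axis_coeff m l * axis_pv (fs (m + l)) (1 / T) T (of_int (k - 2 * int m - int l) - s))"
    (is "_ = ?V")
proof (rule axis_pv_eqI)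
  let ?e = "\<lambda>l. k - 2 * int m - int l" and ?A = "ln (1 / T)" and ?B = "ln T"
  let ?g = "\<lambda>x. fs m (\<i> * exp x) * exp (s * x)"
  have pv: "has_pv (\<lambda>x. axis_coeff m l * (fs (m + l) (\<i> * exp x) * exp ((of_int (?e l) - s) * x))) ?A ?B
      (axis_coeff m l * axis_pv (fs (m + l)) (1 / T) T (of_int (?e l) - s))" if "l \<in> {..p - m}" for l
    by (rule has_pv_cmult, rule axis_pv_entire(1)[OF _ T_inverse axis_no_pole_left[OF _ T_inverse(1)] axis_no_pole_right])
       (use that m in auto)
  have sum: "has_pv (\<lambda>x. \<Sum>l\<le>p - m. axis_coeff m l * (fs (m + l) (\<i> * exp x) * exp ((of_int (?e l) - s) * x))) ?A ?B ?V"
    by (rule has_pv_sum[OF finite_atMost pv])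
  let ?P = "\<lambda>r \<delta>. \<delta> > 0 \<and> \<delta> \<le> 1 \<and> (\<forall>z. ?A \<le> Re z \<longrightarrow> Re z \<le> ?B \<longrightarrow> \<bar>Im z\<bar> \<le> \<delta> \<longrightarrow> Im z \<noteq> 0 \<longrightarrow> \<not> is_pole (fs r) (\<i> * exp z))"
  have "\<exists>\<delta>. ?P r \<delta>" if "r \<le> p" for r by (rule component_pole_free_strip[OF qm that])
  then have "\<forall>r\<in>{..p}. \<exists>\<delta>. ?P r \<delta>" by simp
  from bchoice[OF this] obtain D where D: "\<forall>r\<in>{..p}. ?P r (D r)" by (elim exE)
  \<comment> \<open>The transformation of one component needs all components to be free of poles, so
    the strip must suit all of them at once.\<close>
  define \<delta> where "\<delta> = Min (D ` {..p})"
  have \<delta>: "\<delta> > 0" "\<delta> \<le> D r" if "r \<le> p" for r unfolding \<delta>_def using D that by auto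
  have \<delta>1: "\<delta> \<le> 1" using \<delta>(2)[of 0] D by force
  have "has_pv (\<lambda>x. ?g (- x)) ?A ?B ?V"
  proof (rule has_pv_cong[OF sum])
    show "\<delta> > 0" using \<delta>(1)[of 0] by simp
    fix x \<eta> assume x: "?A \<le> x" "x \<le> ?B" "\<eta> \<noteq> 0" "\<bar>\<eta>\<bar> < \<delta>"
    define z where "z = Complex x \<eta>"
    have np: "\<not> is_pole (fs r) (\<i> * exp z)" if "r \<le> p" for r
    proof -
      have "?P r (D r)" using D that by blast
      then show ?thesis using x \<delta>(2)[OF that] unfolding z_def by force
    qed
    have "Re (exp z) > 0" using x \<delta>1 by (intro exp_box_Re_pos) (simp add: z_def)
    from axis_transform[OF m this np]
    have tr: "fs m (\<i> / exp z) = (\<Sum>l\<le>p - m. axis_coeff m l * exp z powi ?e l * fs (m + l) (\<i> * exp z))" .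
    have "?g (- z) = (\<Sum>l\<le>p - m. axis_coeff m l * exp z powi ?e l * fs (m + l) (\<i> * exp z)) * exp (- (s * z))"
      unfolding tr[symmetric] by (simp add: exp_minus field_simps)
    also have "\<dots> = (\<Sum>l\<le>p - m. axis_coeff m l * (fs (m + l) (\<i> * exp z) * exp ((of_int (?e l) - s) * z)))"
      unfolding sum_distrib_right
    proof (rule sum.cong[OF refl])
      fix l
      have "exp z powi ?e l * exp (- (s * z)) = exp ((of_int (?e l) - s) * z)"
        unfolding exp_power_int exp_add[symmetric] by (simp add: algebra_simps)
      then show "axis_coeff m l * exp z powi ?e l * fs (m + l) (\<i> * exp z) * exp (- (s * z)) =
          axis_coeff m l * (fs (m + l) (\<i> * exp z) * exp ((of_int (?e l) - s) * z))"
        by (simp only: mult.assoc mult.left_commute[of "exp z powi _"])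
    qed
    finally show "(\<Sum>l\<le>p - m. axis_coeff m l * (fs (m + l) (\<i> * exp (Complex x \<eta>)) * exp ((of_int (?e l) - s) * Complex x \<eta>))) = ?g (- Complex x \<eta>)"
      unfolding z_def by (rule sym)
  qed
  then have "has_pv (\<lambda>x. ?g (- (- x))) (- ?B) (- ?A) ?V" by (rule has_pv_reflect)
  then show "has_pv ?g ?A ?B ?V" using T by (simp add: ln_div)
qed

text \<open>Applying the transformation under \<open>S\<close> twice gives the identity.\<close>
lemma axis_coeff_inversion:
  "(\<Sum>l\<le>j. axis_coeff m l * axis_coeff (m + l) (j - l)) = (if j = 0 then 1 else 0)"
proof -
  have ev: "even k" by (rule weight_even[OF qm])
  \<comment> \<open>The exponents add up to 2 k - 4 m - 2 l - j. Here i^(2 k) = (- 1)^k is 1 because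
    the weight is even, so only the alternating sign and a factor independent of l remain.\<close>
  have pow: "\<i> powi (k - 2 * int m - int l) * \<i> powi (k - 2 * int (m + l) - int (j - l)) = (- 1) ^ l * \<i> powi (- int j)" if "l \<le> j" for l
  proof -
    obtain k' where k': "k = 2 * k'" using ev by (rule evenE)
    have add3: "\<i> powi (a + b + c) = \<i> powi a * \<i> powi b * \<i> powi c" for a b c by (simp add: power_int_add)
    have even2: "\<i> powi (2 * n) = (- 1) powi n" for n by (simp add: power_int_mult)
    have "\<i> powi (k - 2 * int m - int l) * \<i> powi (k - 2 * int (m + l) - int (j - l)) = \<i> powi (2 * (2 * (k' - int m)) + 2 * - int l + - int j)"
      using that by (simp add: power_int_add[symmetric] k' algebra_simps of_nat_diff)
    also have "\<dots> = \<i> powi (2 * (2 * (k' - int m))) * \<i> powi (2 * - int l) * \<i> powi (- int j)"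
      by (rule add3)
    also have "\<i> powi (2 * (2 * (k' - int m))) = (1 :: complex)" unfolding even2 by (simp add: power_int_mult)
    also have "\<i> powi (2 * - int l) = ((- 1) ^ l :: complex)" unfolding even2 by (simp add: power_int_minus power_inverse[symmetric])
    finally show ?thesis by simp
  qed
  \<comment> \<open>Both sides count the ways to split m + j objects into classes of sizes m, l and
    j - l.\<close>
  have choose: "((m + l) choose l) * ((m + j) choose (j - l)) = ((m + j) choose m) * (j choose l)" if "l \<le> j" for l
  proof -
    have "((m + j) choose (m + l)) * ((m + l) choose m) = ((m + j) choose m) * (j choose l)"
      using choose_mult[of m "m + l" "m + j"] that by simp
    moreover have "(m + l) choose m = (m + l) choose l" using binomial_symmetric[of m "m + l"] by simp
    moreover have "(m + j) choose (m + l) = (m + j) choose (j - l)" using binomial_symmetric[of "m + l" "m + j"] that by simp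
    ultimately show ?thesis by (simp add: mult.commute)
  qed
  have "axis_coeff m l * axis_coeff (m + l) (j - l) = of_nat ((m + j) choose m) * \<i> powi (- int j) * ((- 1) ^ l * of_nat (j choose l))" if "l \<in> {..j}" for l
  proof -
    have l: "l \<le> j" using that by simp
    then have ml: "m + l + (j - l) = m + j" by simp
    have "axis_coeff m l * axis_coeff (m + l) (j - l) = of_nat (((m + l) choose l) * ((m + j) choose (j - l))) *
       (\<i> powi (k - 2 * int m - int l) * \<i> powi (k - 2 * int (m + l) - int (j - l)))"
      unfolding axis_coeff_def ml of_nat_mult by (simp only: mult_ac)
    then show ?thesis unfolding pow[OF l] choose[OF l] by (simp add: mult_ac)
  qed
  then have "(\<Sum>l\<le>j. axis_coeff m l * axis_coeff (m + l) (j - l)) = of_nat ((m + j) choose m) * \<i> powi (- int j) * (\<Sum>l\<le>j. (- 1) ^ l * of_nat (j choose l))"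
    unfolding sum_distrib_left by (rule sum.cong[OF refl])
  also have "\<dots> = (if j = 0 then 1 else 0)" using choose_alternating_sum[of j, where 'a = complex] by (cases "j = 0") auto
  finally show ?thesis .
qed

lemma axis_Lambda_functional_equation:
  assumes m: "m \<le> p"
  shows "axis_Lambda m s = (\<Sum>l\<le>p - m. axis_coeff m l * axis_Lambda (m + l) (of_int (k - 2 * int m - int l) - s))"
proof -
  let ?e = "\<lambda>m l. k - 2 * int m - int l"
  \<comment> \<open>On the right-hand side the tails at infinity are literally the tails at 0 of the
    left-hand side. The remaining double sum of tails at 0 has arguments s - (l + i); collected by j
    = l + i, it collapses to j = 0 by \<open>axis_coeff_inversion\<close>.\<close>
  have "(\<Sum>l\<le>p - m. axis_coeff m l * (\<Sum>i\<le>p - (m + l). axis_coeff (m + l) i * tail_term (m + l + i) (of_int (?e (m + l) i) - (of_int (?e m l) - s)))) =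
     (\<Sum>l\<le>p - m. \<Sum>i\<le>p - m - l. axis_coeff m l * axis_coeff (m + l) i * tail_term (m + (l + i)) (s - of_nat (l + i)))"
    unfolding sum_distrib_left by (intro sum.cong) (auto simp: algebra_simps)
  also have "\<dots> = (\<Sum>(l, i)\<in>{(l, i). l + i \<le> p - m}. axis_coeff m l * axis_coeff (m + l) i * tail_term (m + (l + i)) (s - of_nat (l + i)))"
    by (subst sum.Sigma) (auto intro!: sum.cong)
  also have "\<dots> = (\<Sum>j\<le>p - m. \<Sum>l\<le>j. axis_coeff m l * axis_coeff (m + l) (j - l) * tail_term (m + (l + (j - l))) (s - of_nat (l + (j - l))))"
    by (rule sum.triangle_reindex_eq)
  also have "\<dots> = (\<Sum>j\<le>p - m. (\<Sum>l\<le>j. axis_coeff m l * axis_coeff (m + l) (j - l)) * tail_term (m + j) (s - of_nat j))"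
    unfolding sum_distrib_right by (intro sum.cong) auto
  also have "\<dots> = tail_term m s"
    unfolding axis_coeff_inversion by (simp add: if_distrib[of "\<lambda>x. x * _"] sum.delta cong: if_cong)
  finally have tail: "(\<Sum>l\<le>p - m. axis_coeff m l * (\<Sum>i\<le>p - (m + l). axis_coeff (m + l) i * tail_term (m + l + i) (of_int (?e (m + l) i) - (of_int (?e m l) - s)))) = tail_term m s" .
  show ?thesis
    unfolding axis_Lambda_def axis_pv_reflect[OF m, of s] distrib_left sum.distrib tail by simp
qed

lemma complete_L_component: "m \<le> p \<Longrightarrow> complete_L \<sigma> (fs m) = remove_sings (axis_Lambda m)"
  by (rule complete_L_eqI[OF is_complete_L_axis_Lambda])

text \<open>\<open>axis_Lambda\<close> takes default values at its singularities, so its functional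
  equation is used on a punctured neighbourhood of s. Continuity carries it to s, which is what the
  assumptions on poles provide.\<close>

lemma complete_L_functional_equation:
  assumes m: "m \<le> p" and np: "\<not> is_pole (complete_L \<sigma> (fs m)) s"
    and np': "\<And>l. l \<le> p - m \<Longrightarrow> \<not> is_pole (complete_L \<sigma> (fs (m + l))) (of_int (k - 2 * int m - int l) - s)"
  shows "complete_L \<sigma> (fs m) s = (\<Sum>l\<le>p - m. axis_coeff m l * complete_L \<sigma> (fs (m + l)) (of_int (k - 2 * int m - int l) - s))"
proof -
  let ?e = "\<lambda>l. of_int (k - 2 * int m - int l) :: complex"
  let ?G = "\<lambda>s. \<Sum>l\<le>p - m. axis_coeff m l * complete_L \<sigma> (fs (m + l)) (?e l - s)"
  have nice: "complete_L \<sigma> (fs r) nicely_meromorphic_on UNIV" if "r \<le> p" for r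
    unfolding complete_L_component[OF that] by (rule remove_sings_nicely_meromorphic[OF axis_Lambda_meromorphic[OF that]])
  have raw: "\<forall>\<^sub>F w in at z. complete_L \<sigma> (fs r) w = axis_Lambda r w" if "r \<le> p" for r z
    unfolding complete_L_component[OF that] by (rule eventually_remove_sings_meromorphic[OF axis_Lambda_meromorphic[OF that]])
  have "isCont (complete_L \<sigma> (fs m)) s" by (rule nicely_meromorphic_isCont[OF nice[OF m] _ np]) simp
  then have limF: "(complete_L \<sigma> (fs m) \<longlongrightarrow> complete_L \<sigma> (fs m) s) (at s)" by (simp add: isCont_def)
  have "isCont (\<lambda>s. complete_L \<sigma> (fs (m + l)) (?e l - s)) s" if l: "l \<le> p - m" for l
  proof (rule isCont_o2[where g = "complete_L \<sigma> (fs (m + l))"])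
    show "isCont (complete_L \<sigma> (fs (m + l))) (?e l - s)"
      by (rule nicely_meromorphic_isCont[OF nice _ np'[OF l]]) (use l m in auto)
  qed (intro continuous_intros)
  then have "isCont ?G s" by (intro continuous_intros) auto
  then have limG: "(?G \<longlongrightarrow> ?G s) (at s)" by (simp add: isCont_def)
  have "\<forall>\<^sub>F w in at s. complete_L \<sigma> (fs (m + l)) (?e l - w) = axis_Lambda (m + l) (?e l - w)" if "l \<in> {..p - m}" for l
  proof (rule eventually_compose_filterlim[OF raw])
    show "m + l \<le> p" using that m by simp
    show "filterlim (\<lambda>w. ?e l - w) (at (?e l - s)) (at s)"
      by (auto simp: filterlim_at eventually_at_filter intro!: tendsto_intros)
  qed
  then have "\<forall>\<^sub>F w in at s. \<forall>l\<in>{..p - m}. complete_L \<sigma> (fs (m + l)) (?e l - w) = axis_Lambda (m + l) (?e l - w)"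
    by (subst eventually_ball_finite_distrib) auto
  with raw[OF m, of s] have "\<forall>\<^sub>F w in at s. ?G w = complete_L \<sigma> (fs m) w"
  proof eventually_elim
    case (elim w)
    then have "?G w = (\<Sum>l\<le>p - m. axis_coeff m l * axis_Lambda (m + l) (?e l - w))" by (intro sum.cong) auto
    then show ?case using elim(1) axis_Lambda_functional_equation[OF m, of w] by simp
  qed
  from Lim_transform_eventually[OF limG this] limF show ?thesis
    by (intro tendsto_unique[OF at_neq_bot])
qed

text \<open>The tail at infinity contributes - a_0 / s. At the other end the tail with index l is
  taken at k - l - s, which reverses the sign and gives i^(k - l) a_l / (s - (k - l)). Both kinds
  meet at s = 0 if 0 lies in {k - p..k}; therefore \<rho> is a sum.\<close>

lemma axis_Lambda_0_poles:
  defines "N \<equiv> insert 0 {k - int p..k}"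
    and "\<rho> \<equiv> \<lambda>n. (if n = 0 then - fourier_coeff (fs 0) 0 else 0) + (if n \<in> {k - int p..k} then \<i> powi n * fourier_coeff (fs (nat (k - n))) 0 else 0)"
  shows "\<exists>E. E holomorphic_on UNIV \<and> (\<forall>s. s \<notin> of_int ` N \<longrightarrow> axis_Lambda 0 s = E s + (\<Sum>n\<in>N. \<rho> n / (s - of_int n)))"
proof -
  let ?A = "\<lambda>r. fourier_coeff (fs r) 0"
  \<comment> \<open>The entire function (T^s - 1) / s: it separates T^s / s into an entire part and
    the pole 1 / s.\<close>
  define Q where "Q = (\<lambda>s. if s = 0 then deriv (\<lambda>s. complex_of_real T powr s) 0 else (of_real T powr s - of_real T powr 0) / (s - 0))"
  have "(\<lambda>s. complex_of_real T powr s) holomorphic_on UNIV" using T by (intro holomorphic_intros) auto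
  then have Q: "Q holomorphic_on UNIV" unfolding Q_def by (rule pole_lemma_open) simp
  define H where "H = (\<lambda>r s. J r s - ?A r * Q s)"
  have H: "H r holomorphic_on B" if "r \<le> p" for r B
    unfolding H_def by (intro holomorphic_intros J_holomorphic that holomorphic_on_subset[OF Q]) auto
  have tail: "tail_term r s = H r s - ?A r / s" if "s \<noteq> 0" for r s
    using that T unfolding tail_term_def H_def Q_def by (simp add: field_simps)
  define E where "E = (\<lambda>s. axis_pv (fs 0) (1 / T) T s + H 0 s + (\<Sum>l\<le>p. axis_coeff 0 l * H l (of_int (k - int l) - s)))"
  have comp: "(\<lambda>s. H l (of_int (k - int l) - s)) holomorphic_on UNIV" if "l \<le> p" for l
    using holomorphic_on_compose_gen[of "\<lambda>s. of_int (k - int l) - s" UNIV "H l" UNIV] H[OF that, of UNIV]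
    by (simp add: o_def holomorphic_intros)
  have "E holomorphic_on UNIV"
    unfolding E_def by (intro holomorphic_intros axis_pv_T_entire H comp) auto
  moreover have "axis_Lambda 0 s = E s + (\<Sum>n\<in>N. \<rho> n / (s - of_int n))" if s: "s \<notin> of_int ` N" for s
  proof -
    have s0: "s \<noteq> 0" using s unfolding N_def by auto
    have sl: "of_int (k - int l) - s \<noteq> 0" if "l \<le> p" for l
    proof
      assume "of_int (k - int l) - s = 0"
      then have "s = of_int (k - int l)" by simp
      moreover have "k - int l \<in> N" using that unfolding N_def by auto
      ultimately show False using s by blast
    qed
    have fN: "finite N" unfolding N_def by simp
    have "(\<Sum>l\<le>p. axis_coeff 0 l * tail_term l (of_int (k - int l) - s)) =
        (\<Sum>l\<le>p. axis_coeff 0 l * H l (of_int (k - int l) - s) + \<i> powi (k - int l) * ?A l / (s - of_int (k - int l)))"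
    proof (rule sum.cong[OF refl])
      fix l assume "l \<in> {..p}"
      then have nz: "of_int (k - int l) - s \<noteq> 0" using sl by simp
      have "- (?A l / (of_int (k - int l) - s)) = ?A l / (s - of_int (k - int l))"
        by (metis minus_diff_eq minus_divide_right)
      then have t: "tail_term l (of_int (k - int l) - s) = H l (of_int (k - int l) - s) + ?A l / (s - of_int (k - int l))"
        unfolding tail[OF nz] by simp
      have c: "axis_coeff 0 l = \<i> powi (k - int l)" by (simp add: axis_coeff_def)
      show "axis_coeff 0 l * tail_term l (of_int (k - int l) - s) = axis_coeff 0 l * H l (of_int (k - int l) - s) + \<i> powi (k - int l) * ?A l / (s - of_int (k - int l))"
        unfolding t by (simp add: distrib_left c)
    qed
    also have "\<dots> = (\<Sum>l\<le>p. axis_coeff 0 l * H l (of_int (k - int l) - s)) + (\<Sum>l\<le>p. \<i> powi (k - int l) * ?A l / (s - of_int (k - int l)))"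
      by (rule sum.distrib)
    also have "(\<Sum>l\<le>p. \<i> powi (k - int l) * ?A l / (s - of_int (k - int l))) =
        (\<Sum>n\<in>{k - int p..k}. \<i> powi n * ?A (nat (k - n)) / (s - of_int n))"
      by (rule sum.reindex_bij_witness[where j = "\<lambda>l. k - int l" and i = "\<lambda>n. nat (k - n)"]) auto
    also have "\<dots> = (\<Sum>n\<in>N. (if n \<in> {k - int p..k} then \<i> powi n * ?A (nat (k - n)) else 0) / (s - of_int n))"
      by (rule sum.mono_neutral_cong_left[OF fN]) (auto simp: N_def)
    finally have 1: "(\<Sum>l\<le>p. axis_coeff 0 l * tail_term l (of_int (k - int l) - s)) =
      (\<Sum>l\<le>p. axis_coeff 0 l * H l (of_int (k - int l) - s)) + \<dots>" .
    have "(\<Sum>n\<in>N. (if n = 0 then - ?A 0 else 0) / (s - of_int n)) = (\<Sum>n\<in>{0 :: int}. - ?A 0 / s)"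
      by (rule sum.mono_neutral_cong_right[OF fN]) (auto simp: N_def)
    then have 2: "tail_term 0 s = H 0 s + (\<Sum>n\<in>N. (if n = 0 then - ?A 0 else 0) / (s - of_int n))"
      using tail[OF s0, of 0] by simp
    have 3: "axis_Lambda 0 s = axis_pv (fs 0) (1 / T) T s + tail_term 0 s + (\<Sum>l\<le>p. axis_coeff 0 l * tail_term l (of_int (k - int l) - s))"
      unfolding axis_Lambda_def by simp
    show ?thesis unfolding 3 1 2 E_def \<rho>_def add_divide_distrib sum.distrib by (simp only: add_ac)
  qed
  ultimately show ?thesis by blast
qed

end

end

theorem theorem1p3:
  fixes k :: int and p :: nat and f :: "complex \<Rightarrow> complex"
    and fs :: "nat \<Rightarrow> complex \<Rightarrow> complex" and \<sigma> :: real
  assumes "mero_quasi_modular k p f fs"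
    and "\<sigma> = 1 \<or> \<sigma> = -1"
  shows
    "(is_complete_L \<sigma> f (complete_L \<sigma> f) \<and>
      (\<forall>r\<le>p. is_complete_L \<sigma> (fs r) (complete_L \<sigma> (fs r))) \<and>
      (\<forall>s. \<not> is_pole (complete_L \<sigma> f) s \<longrightarrow>
         (\<forall>r\<le>p. \<not> is_pole (complete_L \<sigma> (fs r)) (of_int k - of_nat r - s)) \<longrightarrow>
         complete_L \<sigma> f s =
           (\<Sum>r=0..p. \<i> powi (k - int r) * complete_L \<sigma> (fs r) (of_int k - of_nat r - s))))
     \<and>
     ((\<forall>s. is_pole (complete_L \<sigma> f) s \<longrightarrow>
         zorder (complete_L \<sigma> f) s = -1 \<and>
         (s = 0 \<or> (\<exists>n::int. s = of_int n \<and> k - int p \<le> n \<and> n \<le> k))) \<and>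
      residue (complete_L \<sigma> f) 0 = - fourier_coeff f 0 + fourier_coeff (component p fs k) 0 \<and>
      (\<forall>n::int. n \<noteq> 0 \<longrightarrow> k - int p \<le> n \<longrightarrow> n \<le> k \<longrightarrow>
         residue (complete_L \<sigma> f) (of_int n) =
           \<i> powi n * fourier_coeff (component p fs (k - n)) 0))
     \<and>
     (\<forall>m\<le>p. \<forall>s. \<not> is_pole (complete_L \<sigma> (fs m)) s \<longrightarrow>
        (\<forall>r\<le>p - m. \<not> is_pole (complete_L \<sigma> (fs (m + r)))
                       (of_int k - 2 * of_nat m - of_nat r - s)) \<longrightarrow>
        complete_L \<sigma> (fs m) s =
          (\<Sum>r=0..p - m. \<i> powi (k - 2 * int m - int r) * of_nat ((m + r) choose r) *
             complete_L \<sigma> (fs (m + r)) (of_int k - 2 * of_nat m - of_nat r - s)))"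
proof -
  note qm = assms(1) and \<sigma> = assms(2)
  from component_threshold[OF qm \<sigma>] obtain T J where T: "1 < T"
    and J': "\<forall>r\<le>p. laplace_limit \<sigma> T (\<lambda>t. fs r (\<i> * of_real t)) (fourier_coeff (fs r) 0) (J r)"
    and np': "\<forall>r\<le>p. \<forall>z. Re z \<ge> T \<longrightarrow> \<not> is_pole (fs r) (\<i> * z)" by (elim exE conjE)
  have J: "laplace_limit \<sigma> T (\<lambda>t. fs r (\<i> * of_real t)) (fourier_coeff (fs r) 0) (J r)" if "r \<le> p" for r
    by (rule J'[rule_format, OF that])
  have npT: "\<not> is_pole (fs r) (\<i> * z)" if "r \<le> p" "Re z \<ge> T" for r z
    by (rule np'[rule_format, OF that])
  note ctx = qm \<sigma> T J npT
  let ?\<Lambda> = "axis_Lambda k p fs T J"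
  have comp: "is_complete_L \<sigma> (fs r) (complete_L \<sigma> (fs r))" if "r \<le> p" for r
    using is_complete_L_axis_Lambda[OF ctx that] complete_L_component[OF ctx that] by simp
  have f0: "f \<tau> = fs 0 \<tau>" if "Im \<tau> > 0" for \<tau> by (rule component_0[OF qm that])
  have compf: "is_complete_L \<sigma> f (complete_L \<sigma> (fs 0))"
    using is_complete_L_cong[OF f0] comp[of 0] by simp
  have Lf: "complete_L \<sigma> f = complete_L \<sigma> (fs 0)" by (rule complete_L_eqI[OF compf])
  have af: "fourier_coeff f 0 = fourier_coeff (fs 0) 0"
  proof -
    have "has_fourier_expansion f = has_fourier_expansion (fs 0)"
      by (rule ext, rule has_fourier_expansion_cong, rule f0)
    then show ?thesis unfolding fourier_coeff_def by simp
  qed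
  have iii: "complete_L \<sigma> (fs m) s = (\<Sum>r=0..p - m. \<i> powi (k - 2 * int m - int r) * of_nat ((m + r) choose r) *
             complete_L \<sigma> (fs (m + r)) (of_int k - 2 * of_nat m - of_nat r - s))"
    if m: "m \<le> p" and np: "\<not> is_pole (complete_L \<sigma> (fs m)) s"
      "\<forall>r\<le>p - m. \<not> is_pole (complete_L \<sigma> (fs (m + r))) (of_int k - 2 * of_nat m - of_nat r - s)" for m s
  proof -
    have e: "of_int (k - 2 * int m - int r) = (of_int k - 2 * of_nat m - of_nat r :: complex)" for r by simp
    have "complete_L \<sigma> (fs m) s = (\<Sum>l\<le>p - m. axis_coeff k m l * complete_L \<sigma> (fs (m + l)) (of_int (k - 2 * int m - int l) - s))"
      by (rule complete_L_functional_equation[OF ctx m np(1)]) (use np(2) in \<open>simp_all add: e\<close>)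
    then show ?thesis unfolding e axis_coeff_def[OF qm] by (simp add: atLeast0AtMost mult_ac)
  qed
  define N where "N = insert 0 {k - int p..k}"
  define \<rho> where "\<rho> = (\<lambda>n. (if n = 0 then - fourier_coeff (fs 0) 0 else 0) + (if n \<in> {k - int p..k} then \<i> powi n * fourier_coeff (fs (nat (k - n))) 0 else 0))"
  have "\<exists>E. E holomorphic_on UNIV \<and> (\<forall>s. s \<notin> of_int ` N \<longrightarrow> ?\<Lambda> 0 s = E s + (\<Sum>n\<in>N. \<rho> n / (s - of_int n)))"
    unfolding N_def \<rho>_def by (rule axis_Lambda_0_poles[OF ctx])
  then obtain E where E: "E holomorphic_on UNIV"
    and eq: "\<forall>s. s \<notin> of_int ` N \<longrightarrow> ?\<Lambda> 0 s = E s + (\<Sum>n\<in>N. \<rho> n / (s - of_int n))" by (elim exE conjE)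
  note eq = eq[rule_format]
  have fN: "finite N" unfolding N_def by simp
  have L: "complete_L \<sigma> f = remove_sings (?\<Lambda> 0)" unfolding Lf by (rule complete_L_component[OF ctx]) simp_all
  have iso: "isolated_singularity_at (?\<Lambda> 0) s" for s
    by (rule meromorphic_on_isolated_singularity[OF meromorphic_on_subset[OF axis_Lambda_meromorphic[OF ctx]]]) auto
  \<comment> \<open>Residue and order depend on punctured neighbourhoods only, so they may be read
    off from the raw formula before singularities are removed.\<close>
  have res: "residue (complete_L \<sigma> f) (of_int n) = \<rho> n" if "n \<in> N" for n
    unfolding L residue_remove_sings[OF iso] by (rule simple_pole_sum(2)[OF fN E eq that])
  have poles: "zorder (complete_L \<sigma> f) s = -1 \<and> (s = 0 \<or> (\<exists>n::int. s = of_int n \<and> k - int p \<le> n \<and> n \<le> k))"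
    if "is_pole (complete_L \<sigma> f) s" for s
  proof -
    have "is_pole (?\<Lambda> 0) s" using that iso unfolding L by simp
    from simple_pole_sum(1)[OF fN E eq this] have "zorder (?\<Lambda> 0) s = -1" "\<exists>n\<in>N. s = of_int n" by simp_all
    then show ?thesis using iso unfolding L N_def by auto
  qed
  have comp0: "fourier_coeff (component p fs j) 0 = (if 0 \<le> j \<and> j \<le> int p then fourier_coeff (fs (nat j)) 0 else 0)" for j
    by (simp add: component_def)
  show ?thesis
  proof (intro conjI allI impI)
    show "is_complete_L \<sigma> f (complete_L \<sigma> f)" unfolding Lf by (rule compf)
    show "is_complete_L \<sigma> (fs r) (complete_L \<sigma> (fs r))" if "r \<le> p" for r by (rule comp[OF that])
    show "complete_L \<sigma> f s = (\<Sum>r=0..p. \<i> powi (k - int r) * complete_L \<sigma> (fs r) (of_int k - of_nat r - s))"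
      if "\<not> is_pole (complete_L \<sigma> f) s" "\<forall>r\<le>p. \<not> is_pole (complete_L \<sigma> (fs r)) (of_int k - of_nat r - s)" for s
    proof -
      have e: "(\<Sum>r=0..p - 0. \<i> powi (k - 2 * int 0 - int r) * of_nat ((0 + r) choose r) *
             complete_L \<sigma> (fs (0 + r)) (of_int k - 2 * of_nat 0 - of_nat r - s)) =
          (\<Sum>r=0..p. \<i> powi (k - int r) * complete_L \<sigma> (fs r) (of_int k - of_nat r - s))" by simp
      show ?thesis unfolding Lf by (rule trans[OF iii e]) (use that[unfolded Lf] in simp_all)
    qed
    show "zorder (complete_L \<sigma> f) s = -1" if "is_pole (complete_L \<sigma> f) s" for s
      by (rule conjunct1[OF poles[OF that]])
    show "s = 0 \<or> (\<exists>n::int. s = of_int n \<and> k - int p \<le> n \<and> n \<le> k)" if "is_pole (complete_L \<sigma> f) s" for s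
      by (rule conjunct2[OF poles[OF that]])
    have mem: "0 \<in> {k - int p..k} \<longleftrightarrow> 0 \<le> k \<and> k \<le> int p" by auto
    have "residue (complete_L \<sigma> f) (of_int 0) = \<rho> 0" by (rule res) (simp add: N_def)
    also have "\<rho> 0 = - fourier_coeff f 0 + fourier_coeff (component p fs k) 0"
      unfolding \<rho>_def comp0 af mem by simp
    finally show "residue (complete_L \<sigma> f) 0 = - fourier_coeff f 0 + fourier_coeff (component p fs k) 0" by simp
    show "residue (complete_L \<sigma> f) (of_int n) = \<i> powi n * fourier_coeff (component p fs (k - n)) 0"
      if n: "n \<noteq> 0" "k - int p \<le> n" "n \<le> k" for n
    proof -
      have "residue (complete_L \<sigma> f) (of_int n) = \<rho> n" by (rule res) (use n in \<open>simp add: N_def\<close>)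
      also have "\<rho> n = \<i> powi n * fourier_coeff (component p fs (k - n)) 0"
        unfolding \<rho>_def comp0 using n by simp
      finally show ?thesis .
    qed
    show "complete_L \<sigma> (fs m) s = (\<Sum>r=0..p - m. \<i> powi (k - 2 * int m - int r) * of_nat ((m + r) choose r) *
             complete_L \<sigma> (fs (m + r)) (of_int k - 2 * of_nat m - of_nat r - s))"
      if "m \<le> p" "\<not> is_pole (complete_L \<sigma> (fs m)) s"
      "\<forall>r\<le>p - m. \<not> is_pole (complete_L \<sigma> (fs (m + r))) (of_int k - 2 * of_nat m - of_nat r - s)" for m s
      by (rule iii[OF that])
  qed
qed

end
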